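(* Let $\Omega$ be the unit ball of $\mathbb R^3$ centered at the origin. Let $g:\mathbb R\to\mathbb R$ be a continuous function and assume that there exist $a_1,a_2,b\in\mathbb R$ and $2<p\le6$ such that for all $s,t\in\mathbb R$ $$|g(s)|\le a_1+b|s|^{p-1},\qquad g(-s)=-g(s),$$ $$(g(s)-g(t))(s-t)\ge-(a_2+b|s|^{p-2}+b|t|^{p-2})(s-t)^2 .$$ Let $G(s)=\int_0^s g(t)\,dt$ and let $f:H^1_0(\Omega)\to\mathbb R$ be the $C^1$ functional $f(u)=\frac12\int_\Omega|Du|^2-\int_\Omega G(u)$. Assume that $f$ is bounded from below and admits a bounded minimizing sequence. Then $f$ has a minimizing sequence $(u_h)\subset H^1_0(\Omega)$ and there is a sequence $(\psi_h)\subset H^{-1}(\Omega)$ such that $$\lim_h\|u_h-u_h^*\|_{L^2(\Omega)\cap L^{2^*}(\Omega)}=0,$$ $$\int_\Omega Du_h\cdot D\varphi=\int_\Omega g(u_h)\varphi+\langle\psi_h,\varphi\rangle\quad\forall\varphi\in H^1_0(\Omega),\qquad \lim_h\|\psi_h\|_{H^{-1}}=0,$$ $$\liminf_h\Big[\int_\Omega|Dw|^2-\int_\Omega\underline D_s g(u_h)w^2\Big]\ge0\qquad\forall w\in H^1_0(\Omega).$$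
   Context: For $s\in\mathbb R$, $$\underline D_s g(s):=\liminf_{(t,\tau)\to(0,0),\ t,\tau\in\mathbb Q}\frac{g(s+t)-g(s+\tau)}{t-\tau}$$ (with $t\ne\tau$), which is a measurable function of $s$, possibly taking the value $+\infty$; integrals are understood in the extended sense. Here $2^*=6$, and $L^2\cap L^{2^*}$ carries the norm $\|\cdot\|_{L^2}+\|\cdot\|_{L^{2^*}}$. For $u\in H^1_0(\Omega)$, $u^*:=|u|^*$ denotes the Schwarz symmetrization of $|u|$, i.e. the function on $\Omega$ such that for all $t\ge 0$ the set $\{u^*>t\}$ is the open ball centered at the origin with the same Lebesgue measure as $\{|u|>t\}$. *)

theory Defs
  imports "HOL-Analysis.Analysis"
begin

text \<open>
  A function on \<open>\<Omega>\<close> is represented by a total function, whose values outside \<open>\<Omega>\<close> never matter;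
  elements of Lebesgue and Sobolev spaces are representatives, not classes modulo equality almost
  everywhere.
\<close>

definition Lp :: "real \<Rightarrow> 'a::euclidean_space set \<Rightarrow> ('a \<Rightarrow> 'b::euclidean_space) set" where
  "Lp p \<Omega> = {u \<in> borel_measurable (lebesgue_on \<Omega>).
     integrable (lebesgue_on \<Omega>) (\<lambda>x. norm (u x) powr p)}"

definition Lp_norm :: "real \<Rightarrow> 'a::euclidean_space set \<Rightarrow> ('a \<Rightarrow> 'b::euclidean_space) \<Rightarrow> real" where
  "Lp_norm p \<Omega> u = (\<integral>x. norm (u x) powr p \<partial>lebesgue_on \<Omega>) powr (1 / p)"

definition partial_deriv :: "'n \<Rightarrow> (real^'n \<Rightarrow> real) \<Rightarrow> (real^'n \<Rightarrow> real)" where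
  "partial_deriv i f = (\<lambda>x. frechet_derivative f (at x) (axis i 1))"

text \<open>
  All iterated partial derivatives exist and are Frechet differentiable, hence continuous; this is
  the class of infinitely differentiable functions.
\<close>

definition smooth :: "(real^'n \<Rightarrow> real) \<Rightarrow> bool" where
  "smooth f \<longleftrightarrow> (\<forall>is. fold partial_deriv is f differentiable_on UNIV)"

definition test_functions :: "(real^'n) set \<Rightarrow> (real^'n \<Rightarrow> real) set" where
  "test_functions \<Omega> = {\<phi>. smooth \<phi> \<and> compact (closure {x. \<phi> x \<noteq> 0}) \<and> closure {x. \<phi> x \<noteq> 0} \<subseteq> \<Omega>}"

definition is_weak_gradient ::
    "(real^'n) set \<Rightarrow> (real^'n \<Rightarrow> real) \<Rightarrow> (real^'n \<Rightarrow> real^'n) \<Rightarrow> bool" where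
  "is_weak_gradient \<Omega> u V \<longleftrightarrow> (\<forall>\<phi>\<in>test_functions \<Omega>. \<forall>i.
     (\<integral>x. u x * partial_deriv i \<phi> x \<partial>lebesgue_on \<Omega>) = - (\<integral>x. V x $ i * \<phi> x \<partial>lebesgue_on \<Omega>))"

definition H1 :: "(real^'n) set \<Rightarrow> (real^'n \<Rightarrow> real) set" where
  "H1 \<Omega> = {u \<in> Lp 2 \<Omega>. \<exists>V\<in>Lp 2 \<Omega>. is_weak_gradient \<Omega> u V}"

text \<open>The weak gradient is unique up to null sets, so the choice does not affect integrals.\<close>

definition weak_gradient :: "(real^'n) set \<Rightarrow> (real^'n \<Rightarrow> real) \<Rightarrow> (real^'n \<Rightarrow> real^'n)" where
  "weak_gradient \<Omega> u = (SOME V. V \<in> Lp 2 \<Omega> \<and> is_weak_gradient \<Omega> u V)"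

definition H1_norm :: "(real^'n) set \<Rightarrow> (real^'n \<Rightarrow> real) \<Rightarrow> real" where
  "H1_norm \<Omega> u = sqrt ((Lp_norm 2 \<Omega> u)\<^sup>2 + (Lp_norm 2 \<Omega> (weak_gradient \<Omega> u))\<^sup>2)"

definition H10 :: "(real^'n) set \<Rightarrow> (real^'n \<Rightarrow> real) set" where
  "H10 \<Omega> = {u \<in> H1 \<Omega>. \<forall>\<epsilon>>0. \<exists>\<phi>\<in>test_functions \<Omega>. H1_norm \<Omega> (\<lambda>x. u x - \<phi> x) < \<epsilon>}"

text \<open>
  The dual of \<^term>\<open>H10 \<Omega>\<close>. Boundedness forces a functional to agree on representatives of the same
  class. Values of a functional outside \<^term>\<open>H10 \<Omega>\<close> are irrelevant.
\<close>

definition H_minus1 :: "(real^'n) set \<Rightarrow> ((real^'n \<Rightarrow> real) \<Rightarrow> real) set" where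
  "H_minus1 \<Omega> = {\<psi>.
     (\<forall>u\<in>H10 \<Omega>. \<forall>v\<in>H10 \<Omega>. \<psi> (\<lambda>x. u x + v x) = \<psi> u + \<psi> v) \<and>
     (\<forall>c. \<forall>u\<in>H10 \<Omega>. \<psi> (\<lambda>x. c * u x) = c * \<psi> u) \<and>
     (\<exists>C. \<forall>u\<in>H10 \<Omega>. \<bar>\<psi> u\<bar> \<le> C * H1_norm \<Omega> u)}"

definition H_minus1_norm :: "(real^'n) set \<Rightarrow> ((real^'n \<Rightarrow> real) \<Rightarrow> real) \<Rightarrow> real" where
  "H_minus1_norm \<Omega> \<psi> = (SUP u\<in>{u \<in> H10 \<Omega>. H1_norm \<Omega> u \<le> 1}. \<bar>\<psi> u\<bar>)"

text \<open>
  If \<open>u\<close> is essentially unbounded, every superlevel set of its symmetrization contains the origin,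
  so the symmetrization takes the value \<open>\<infinity>\<close> there; this is the only point where it can.
\<close>

definition is_schwarz_symm ::
    "'a::euclidean_space set \<Rightarrow> ('a \<Rightarrow> real) \<Rightarrow> ('a \<Rightarrow> ennreal) \<Rightarrow> bool" where
  "is_schwarz_symm \<Omega> u v \<longleftrightarrow>
     (\<forall>t\<ge>0. \<exists>r\<ge>0. {x\<in>\<Omega>. v x > ennreal t} = ball 0 r \<and>
        emeasure lebesgue (ball 0 r :: 'a set) = emeasure lebesgue {x\<in>\<Omega>. \<bar>u x\<bar> > t}) \<and>
     (\<forall>x. x \<notin> \<Omega> \<longrightarrow> v x = 0)"

definition schwarz_symm :: "'a::euclidean_space set \<Rightarrow> ('a \<Rightarrow> real) \<Rightarrow> 'a \<Rightarrow> real" where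
  "schwarz_symm \<Omega> u x = enn2real ((THE v. is_schwarz_symm \<Omega> u v) x)"

text \<open>The definite description in \<^const>\<open>schwarz_symm\<close> is well defined on balls.\<close>

lemma ball_0_eq_of_emeasure_eq:
  fixes r s :: real
  assumes "r \<ge> 0" "s \<ge> 0"
    and "emeasure lebesgue (ball 0 r :: 'a::euclidean_space set) = emeasure lebesgue (ball 0 s :: 'a set)"
  shows "r = s"
proof -
  have "measure lebesgue (ball 0 r :: 'a set) = measure lebesgue (ball 0 s :: 'a set)"
    using assms(3) by (simp only: measure_def)
  then have "r ^ DIM('a) = s ^ DIM('a)"
    using assms less_imp_neq[OF unit_ball_vol_pos[of "real DIM('a)"]] by (simp add: content_ball)
  then show ?thesis using assms by (simp add: power_eq_iff_eq_base)
qed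

lemma is_schwarz_symm_unique:
  fixes u :: "'a::euclidean_space \<Rightarrow> real"
  assumes v: "is_schwarz_symm \<Omega> u v" and w: "is_schwarz_symm \<Omega> u w"
  shows "v = w"
proof -
  have levels: "ennreal t < v x \<longleftrightarrow> ennreal t < w x" if t: "t \<ge> 0" and x: "x \<in> \<Omega>" for t x
  proof -
    obtain r where r: "r \<ge> 0" "{x\<in>\<Omega>. v x > ennreal t} = ball 0 r"
      "emeasure lebesgue (ball 0 r :: 'a set) = emeasure lebesgue {x\<in>\<Omega>. \<bar>u x\<bar> > t}"
      using v t unfolding is_schwarz_symm_def by metis
    obtain s where s: "s \<ge> 0" "{x\<in>\<Omega>. w x > ennreal t} = ball 0 s"
      "emeasure lebesgue (ball 0 s :: 'a set) = emeasure lebesgue {x\<in>\<Omega>. \<bar>u x\<bar> > t}"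
      using w t unfolding is_schwarz_symm_def by metis
    have "r = s"
      by (rule ball_0_eq_of_emeasure_eq[OF r(1) s(1) trans[OF r(3) s(3)[symmetric]]])
    then have "{x\<in>\<Omega>. v x > ennreal t} = {x\<in>\<Omega>. w x > ennreal t}" using r s by simp
    then show ?thesis using x by blast
  qed
  have eq: "a = b" if "\<And>t. t \<ge> 0 \<Longrightarrow> ennreal t < a \<longleftrightarrow> ennreal t < b" for a b :: ennreal
  proof (rule ccontr)
    assume "a \<noteq> b"
    then consider z where "a < z" "z < b" | z where "b < z" "z < a"
      using dense by (metis neqE)
    then show False
    proof cases
      case (1 z)
      then obtain t where "t \<ge> 0" "z = ennreal t" by (cases z) auto
      then show False using 1 that by (metis not_less_iff_gr_or_eq)
    next
      case (2 z)
      then obtain t where "t \<ge> 0" "z = ennreal t" by (cases z) auto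
      then show False using 2 that by (metis not_less_iff_gr_or_eq)
    qed
  qed
  show ?thesis
  proof
    fix x show "v x = w x"
    proof (cases "x \<in> \<Omega>")
      case True then show ?thesis using levels eq by blast
    next
      case False then show ?thesis using v w by (simp add: is_schwarz_symm_def)
    qed
  qed
qed

lemma is_schwarz_symm_exists:
  fixes u :: "'a::euclidean_space \<Rightarrow> real"
  assumes R: "R \<ge> 0" and u: "u \<in> borel_measurable (lebesgue_on (ball 0 R))"
  shows "\<exists>v. is_schwarz_symm (ball 0 R) u v"
proof -
  define S where "S t = {x\<in>ball 0 R. \<bar>u x\<bar> > t}" for t
  define c where "c = unit_ball_vol DIM('a)"
  have c: "c > 0" by (simp add: c_def)
  define M where "M t = measure lebesgue (S t)" for t
  define r where "r t = root DIM('a) (M t / c)" for t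
  define v where "v x = (if x \<in> ball 0 R then (SUP t\<in>{t. t \<ge> 0 \<and> norm x < r t}. ennreal t) else 0)" for x :: 'a
  have Sm: "S t \<in> lmeasurable" for t
  proof -
    have "{x \<in> space (lebesgue_on (ball 0 R)). \<bar>u x\<bar> > t} \<in> sets (lebesgue_on (ball 0 R))"
      using u by measurable
    then have "S t \<in> sets lebesgue"
      by (simp add: S_def sets_restrict_space_iff)
    moreover have "S t \<subseteq> ball 0 R" by (auto simp: S_def)
    ultimately show ?thesis by (meson fmeasurableI2 lmeasurable_ball)
  qed
  have anti: "M t \<le> M s" if "s \<le> t" for s t
    unfolding M_def by (rule measure_mono_fmeasurable) (use that Sm in \<open>auto simp: S_def fmeasurableD\<close>)
  have M0: "M t \<ge> 0" for t by (simp add: M_def)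
  have MR: "M t \<le> c * R ^ DIM('a)" for t
  proof -
    have "M t \<le> measure lebesgue (ball 0 R :: 'a set)"
      unfolding M_def by (rule measure_mono_fmeasurable) (use Sm in \<open>auto simp: S_def fmeasurableD\<close>)
    then show ?thesis using R by (simp add: content_ball c_def)
  qed
  have r0: "r t \<ge> 0" for t using M0 c by (simp add: r_def)
  have rpow: "r t ^ DIM('a) = M t / c" for t using M0 c by (simp add: r_def)
  have less_r: "y < r t \<longleftrightarrow> c * y ^ DIM('a) < M t" if "y \<ge> 0" for y t
  proof -
    have "y < r t \<longleftrightarrow> y ^ DIM('a) < r t ^ DIM('a)"
      using that r0[of t] by (simp add: power_mono_iff flip: not_le)
    then show ?thesis using c by (simp add: rpow field_simps)
  qed
  have right: "\<exists>s>t. y < M s" if "y < M t" for y t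
  proof -
    have "(\<lambda>n. measure lebesgue (S (t + 1 / real (Suc n)))) \<longlonglongrightarrow> measure lebesgue (\<Union>n. S (t + 1 / real (Suc n)))"
    proof (rule Lim_measure_incseq)
      show "range (\<lambda>n. S (t + 1 / real (Suc n))) \<subseteq> sets lebesgue" using Sm by (auto simp: fmeasurableD)
      have "1 / real (Suc n) \<le> 1 / real (Suc m)" if "m \<le> n" for m n
        using that by (simp add: frac_le)
      then show "incseq (\<lambda>n. S (t + 1 / real (Suc n)))"
        unfolding incseq_def S_def by (force dest: order.strict_trans1)
      have "(\<Union>n. S (t + 1 / real (Suc n))) \<subseteq> ball 0 R" by (auto simp: S_def)
      then have "(\<Union>n. S (t + 1 / real (Suc n))) \<in> lmeasurable"
        using Sm by (intro fmeasurableI2[OF lmeasurable_ball[of 0 R]]) (auto simp: fmeasurableD)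
      then show "emeasure lebesgue (\<Union>n. S (t + 1 / real (Suc n))) \<noteq> \<infinity>"
        by (auto simp: fmeasurable_def)
    qed
    moreover have "(\<Union>n. S (t + 1 / real (Suc n))) = S t"
    proof
      show "(\<Union>n. S (t + 1 / real (Suc n))) \<subseteq> S t"
        unfolding S_def by (auto intro: order.strict_trans1[rotated] simp: add_increasing2)
      show "S t \<subseteq> (\<Union>n. S (t + 1 / real (Suc n)))"
      proof
        fix x assume x: "x \<in> S t"
        then have "0 < \<bar>u x\<bar> - t" by (simp add: S_def)
        then obtain n where "1 / real (Suc n) < \<bar>u x\<bar> - t"
          using nat_approx_posE by blast
        then show "x \<in> (\<Union>n. S (t + 1 / real (Suc n)))"
          using x by (auto simp: S_def intro!: exI[of _ n])
      qed
    qed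
    ultimately have "(\<lambda>n. M (t + 1 / real (Suc n))) \<longlonglongrightarrow> M t" by (simp add: M_def)
    then have "\<forall>\<^sub>F n in sequentially. y < M (t + 1 / real (Suc n))"
      using that by (rule order_tendstoD)
    then obtain n where "y < M (t + 1 / real (Suc n))"
      by (auto simp: eventually_sequentially)
    then show ?thesis by (intro exI[of _ "t + 1 / real (Suc n)"]) auto
  qed
  have "is_schwarz_symm (ball 0 R) u v"
    unfolding is_schwarz_symm_def
  proof (intro conjI allI impI)
    fix t :: real assume t: "0 \<le> t"
    have "{x\<in>ball 0 R. v x > ennreal t} = ball 0 (r t)"
    proof (intro equalityI subsetI)
      fix x :: 'a assume "x \<in> {x\<in>ball 0 R. v x > ennreal t}"
      then obtain s where s: "s \<ge> 0" "norm x < r s" "ennreal t < ennreal s"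
        by (auto simp: v_def less_SUP_iff)
      then have "t < s" using t by (simp add: ennreal_less_iff)
      then show "x \<in> ball 0 (r t)"
        using s anti[of t s] less_r[of "norm x" s] less_r[of "norm x" t] by simp
    next
      fix x :: 'a assume x: "x \<in> ball 0 (r t)"
      then have "c * norm x ^ DIM('a) < M t" by (simp add: less_r)
      then obtain s where s: "s > t" "c * norm x ^ DIM('a) < M s" using right by blast
      have "c * norm x ^ DIM('a) < c * R ^ DIM('a)" using s MR[of s] by simp
      then have "norm x < R" using c R by (metis mult_less_cancel_left_pos power_less_imp_less_base)
      moreover have "norm x < r s" using s by (simp add: less_r)
      ultimately show "x \<in> {x\<in>ball 0 R. v x > ennreal t}"
        using s t by (auto simp: v_def less_SUP_iff ennreal_less_iff intro!: exI[of _ s])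
    qed
    moreover have "emeasure lebesgue (ball 0 (r t) :: 'a set) = emeasure lebesgue {x\<in>ball 0 R. \<bar>u x\<bar> > t}"
    proof -
      have "measure lebesgue (ball 0 (r t) :: 'a set) = M t"
        using r0 c by (simp add: content_ball rpow flip: c_def)
      moreover have "emeasure lebesgue (ball 0 (r t) :: 'a set) = ennreal (measure lebesgue (ball 0 (r t) :: 'a set))"
        using emeasure_eq_measure2[OF lmeasurable_ball] by blast
      moreover have "emeasure lebesgue (S t) = ennreal (M t)"
        unfolding M_def using emeasure_eq_measure2[OF Sm] by blast
      ultimately show ?thesis by (simp add: S_def)
    qed
    ultimately show "\<exists>r\<ge>0. {x\<in>ball 0 R. v x > ennreal t} = ball 0 r \<and>
        emeasure lebesgue (ball 0 r :: 'a set) = emeasure lebesgue {x\<in>ball 0 R. \<bar>u x\<bar> > t}"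
      using r0 by blast
  next
    fix x :: 'a assume "x \<notin> ball 0 R" then show "v x = 0" unfolding v_def by (rule if_not_P)
  qed
  then show ?thesis by blast
qed

lemma is_schwarz_symm_The:
  assumes "R \<ge> 0" and "u \<in> borel_measurable (lebesgue_on (ball 0 R))"
  shows "is_schwarz_symm (ball 0 R) u (THE v. is_schwarz_symm (ball 0 R) u v)"
  using is_schwarz_symm_exists[OF assms] is_schwarz_symm_unique by (metis theI)

text \<open>The interval integral is oriented: \<^term>\<open>primitive g s\<close> is minus the integral over \<open>[s, 0]\<close> if \<open>s < 0\<close>.\<close>

definition primitive :: "(real \<Rightarrow> real) \<Rightarrow> real \<Rightarrow> real" where
  "primitive g s = interval_lebesgue_integral lborel (ereal 0) (ereal s) g"

definition energy :: "(real^'n) set \<Rightarrow> (real \<Rightarrow> real) \<Rightarrow> (real^'n \<Rightarrow> real) \<Rightarrow> real" where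
  "energy \<Omega> g u = 1/2 * (\<integral>x. (norm (weak_gradient \<Omega> u x))\<^sup>2 \<partial>lebesgue_on \<Omega>)
     - (\<integral>x. primitive g (u x) \<partial>lebesgue_on \<Omega>)"

definition minimizing_sequence :: "('v \<Rightarrow> real) \<Rightarrow> 'v set \<Rightarrow> (nat \<Rightarrow> 'v) \<Rightarrow> bool" where
  "minimizing_sequence f X u \<longleftrightarrow> (\<forall>h. u h \<in> X) \<and> (\<lambda>h. f (u h)) \<longlonglongrightarrow> (INF v\<in>X. f v)"

definition lower_deriv :: "(real \<Rightarrow> real) \<Rightarrow> real \<Rightarrow> ereal" where
  "lower_deriv g s = Liminf (at (0, 0) within {(t, \<tau>). t \<in> \<rat> \<and> \<tau> \<in> \<rat> \<and> t \<noteq> \<tau>})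
     (\<lambda>(t, \<tau>). ereal ((g (s + t) - g (s + \<tau>)) / (t - \<tau>)))"

text \<open>
  Positive part minus negative part (\<^const>\<open>e2ennreal\<close> truncates negative values to \<open>0\<close>);
  meaningful as soon as one of the two is finite.
\<close>

definition ext_integral :: "'a measure \<Rightarrow> ('a \<Rightarrow> ereal) \<Rightarrow> ereal" where
  "ext_integral M F =
     enn2ereal (\<integral>\<^sup>+x. e2ennreal (F x) \<partial>M) - enn2ereal (\<integral>\<^sup>+x. e2ennreal (- F x) \<partial>M)"

end

theory Submission
  imports Defs "HOL-Complex_Analysis.Great_Picard" "HOL-Library.Diagonal_Subsequence"
begin

text \<open>
  The minimizing sequence can be taken constant, equal to a suitable minimizer. If \<open>f\<close> is bounded
  below, scaling a concentrated plateau function shows \<open>G s \<le> \<epsilon> s^6 + K\<close> for every \<open>\<epsilon> > 0\<close>, so \<open>\<integral> G(u)\<close>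
  is weakly upper semicontinuous along bounded sequences and \<open>f\<close> attains its infimum. Among the
  minimizers in a fixed ball of \<open>H\<^sup>1\<^sub>0\<close> choose one, \<open>u\<close>, maximizing \<open>\<integral> |u(x)| (4 - |x|\<^sup>2) dx\<close>; as \<open>g\<close> is odd,
  \<open>u \<ge> 0\<close> may be assumed. Polarization with respect to a half-space containing the origin does not
  increase \<open>\<integral> |Du|\<^sup>2\<close>, which is a limit of nonlocal energies for which this is a pointwise rearrangement
  inequality; it preserves \<open>\<integral> G(u)\<close> and increases the moment unless it fixes \<open>u\<close>. Hence \<open>u\<close> is invariant under all
  these polarizations, thus radially decreasing, and so equal to its Schwarz symmetrization. The first
  variation gives the equation with \<open>\<psi> = 0\<close>, and Fatou's lemma applied to second differences of \<open>G\<close> the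
  inequality for the second derivative.
\<close>

section \<open>Test functions\<close>

text \<open>At the critical power 6 the Sobolev embedding is not compact, so
  \<open>\<integral> G(u)\<close> need not be continuous along bounded sequences; boundedness from
  below is what rules out a loss in the wrong direction. Limits are taken in \<open>L2\<close> only,
  never weakly: the gradient of a limit is constructed by completeness. Competitors are restricted
  to gradient norm at most that of the given bounded sequence. The full set of minimizers might be
  unbounded, but this part of it is compact, so the moment has a maximizer, and polarization does
  not leave it because it does not increase the gradient norm. A polarized test function is no
  longer smooth. Nonlocal energies need no derivatives and do not grow under mollification, so the
  Dirichlet integral is only ever compared between two smooth functions. Invariance under a
  polarization holds up to a null set that depends on the half-space, and there are uncountably many
  half-spaces. Comparing mollified values turns these statements into pointwise monotonicity before
  the limit is taken.\<close>

definition bump :: "nat \<Rightarrow> real \<Rightarrow> real" where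
  "bump k t = (if t > 0 then exp (- 1 / t) / t ^ k else 0)"

lemma bump_nonneg: "bump k t \<ge> 0"
  by (simp add: bump_def)

lemma bump_pos: "t > 0 \<Longrightarrow> bump k t > 0"
  by (simp add: bump_def)

lemma bump_0_less_1: "bump 0 t < 1"
  by (simp add: bump_def)

lemma tendsto_bump_right_0: "(bump k \<longlongrightarrow> 0) (at_right 0)"
proof -
  have "((\<lambda>s::real. s ^ k / exp s) \<longlongrightarrow> 0) at_top" by (rule tendsto_power_div_exp_0)
  then have "((\<lambda>t::real. inverse t ^ k / exp (inverse t)) \<longlongrightarrow> 0) (at_right 0)"
    by (rule filterlim_compose[OF _ filterlim_inverse_at_top_right])
  then show ?thesis
    by (rule Lim_transform_eventually)
       (auto simp: eventually_at_filter bump_def exp_minus field_simps)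
qed

text \<open>The powers of \<open>t\<close> in the denominator make the family \<open>bump k\<close>
  closed under differentiation up to linear combinations. At 0 the difference quotient is
  \<open>bump (k + 1)\<close> from the right and 0 from the left, and both tend to 0.\<close>

lemma bump_has_real_derivative:
  "(bump k has_real_derivative bump (k + 2) t - real k * bump (k + 1) t) (at t)"
proof -
  consider "t > 0" | "t < 0" | "t = 0" by linarith
  then show ?thesis
  proof cases
    case 1
    have "((\<lambda>t. exp (- 1 / t) * inverse t ^ k) has_real_derivative bump (k + 2) t - real k * bump (k + 1) t) (at t)"
    proof (cases k)
      case (Suc n)
      have e: "((\<lambda>t. exp (- 1 / t)) has_real_derivative exp (- 1 / t) * (1 / t\<^sup>2)) (at t)"
        using 1 by (auto intro!: derivative_eq_intros simp: power2_eq_square)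
      have i: "(inverse has_real_derivative - (inverse t ^ Suc (Suc 0))) (at t)"
        using 1 by (intro DERIV_inverse) simp
      show ?thesis unfolding Suc
        by (rule DERIV_cong[OF DERIV_mult[OF e DERIV_power_Suc[OF i]]])
           (use 1 in \<open>auto simp: bump_def power2_eq_square field_simps\<close>)
    qed (use 1 in \<open>auto intro!: derivative_eq_intros simp: bump_def field_simps power2_eq_square\<close>)
    then show ?thesis
      by (rule has_field_derivative_transform_within[of _ _ _ _ t]) (use 1 in \<open>auto simp: bump_def dist_real_def field_simps\<close>)
  next
    case 2
    have "((\<lambda>t. 0) has_real_derivative bump (k + 2) t - real k * bump (k + 1) t) (at t)"
      using 2 by (auto simp: bump_def)
    then show ?thesis
      by (rule has_field_derivative_transform_within[of _ _ _ _ "- t"]) (use 2 in \<open>auto simp: bump_def dist_real_def\<close>)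
  next
    case 3
    have "((\<lambda>h. (bump k (0 + h) - bump k 0) / h) \<longlongrightarrow> 0) (at 0)"
    proof (rule filterlim_split_at)
      show "((\<lambda>h. (bump k (0 + h) - bump k 0) / h) \<longlongrightarrow> 0) (at_right 0)"
        by (rule Lim_transform_eventually[OF tendsto_bump_right_0[of "Suc k"]])
           (auto simp: eventually_at_filter bump_def field_simps)
      show "((\<lambda>h. (bump k (0 + h) - bump k 0) / h) \<longlongrightarrow> 0) (at_left 0)"
        by (rule Lim_transform_eventually[OF tendsto_const[of 0]])
           (auto simp: eventually_at_filter bump_def)
    qed
    then show ?thesis unfolding 3 DERIV_def by (simp add: bump_def)
  qed
qed

lemma partial_deriv_eq: "(f has_derivative f') (at x) \<Longrightarrow> partial_deriv i f x = f' (axis i 1)"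
  by (simp add: partial_deriv_def frechet_derivative_at[symmetric])

definition grad :: "(real^'n \<Rightarrow> real) \<Rightarrow> real^'n \<Rightarrow> real^'n" where
  "grad f x = (\<chi> i. partial_deriv i f x)"

lemma grad_nth [simp]: "grad f x $ i = partial_deriv i f x"
  by (simp add: grad_def)

lemma grad_eqI:
  assumes "(f has_derivative (\<lambda>h. v \<bullet> h)) (at x)" shows "grad f x = v"
  by (simp add: vec_eq_iff partial_deriv_eq[OF assms] inner_axis)

lemma has_derivative_grad:
  assumes "f differentiable at x" shows "(f has_derivative (\<lambda>h. grad f x \<bullet> h)) (at x)"
proof -
  obtain f' where f': "(f has_derivative f') (at x)" using assms by (auto simp: differentiable_def)
  then interpret bounded_linear f' by (rule has_derivative_bounded_linear)
  have "f' h = grad f x \<bullet> h" for h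
  proof -
    have "f' h = f' (\<Sum>i\<in>UNIV. h $ i *\<^sub>R axis i 1)"
      using basis_expansion[of h] by (simp add: scalar_mult_eq_scaleR)
    also have "\<dots> = (\<Sum>i\<in>UNIV. h $ i * f' (axis i 1))"
      by (simp add: sum scaleR)
    also have "\<dots> = grad f x \<bullet> h"
      by (simp add: inner_vec_def partial_deriv_eq[OF f'] mult.commute)
    finally show ?thesis .
  qed
  then show ?thesis using f' by presburger
qed

text \<open>Membership is preserved by \<open>partial_deriv\<close>, which is what
  \<open>smooth\<close> asks for, since it quantifies over all iterated partial derivatives. The
  explicit cut-offs and the mollifier kernel below are built inside this class.\<close>

inductive_set elem_smooth :: "(real^'n \<Rightarrow> real) set" where
  const: "(\<lambda>x. c) \<in> elem_smooth"
| coord: "(\<lambda>x. x $ i) \<in> elem_smooth"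
| add: "f \<in> elem_smooth \<Longrightarrow> g \<in> elem_smooth \<Longrightarrow> (\<lambda>x. f x + g x) \<in> elem_smooth"
| mult: "f \<in> elem_smooth \<Longrightarrow> g \<in> elem_smooth \<Longrightarrow> (\<lambda>x. f x * g x) \<in> elem_smooth"
| bump: "f \<in> elem_smooth \<Longrightarrow> (\<lambda>x. bump k (f x)) \<in> elem_smooth"

lemma elem_smooth_partial_deriv:
  fixes f :: "real^'n \<Rightarrow> real"
  shows "f \<in> elem_smooth \<Longrightarrow> (\<forall>x. f differentiable at x) \<and> (\<forall>i. partial_deriv i f \<in> elem_smooth)"
proof (induction rule: elem_smooth.induct)
  case (const c)
  have *: "((\<lambda>x. c) has_derivative (\<lambda>h. 0)) (at x)" for x :: "real^'n" by simp
  have "partial_deriv i (\<lambda>x::real^'n. c) = (\<lambda>x. 0)" for i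
    using partial_deriv_eq[OF *] by auto
  then show ?case using elem_smooth.const[of 0] by simp
next
  case (coord j)
  have *: "((\<lambda>x. x $ j) has_derivative (\<lambda>h. h $ j)) (at x)" for x :: "real^'n"
    by (intro bounded_linear_imp_has_derivative bounded_linear_vec_nth)
  have "partial_deriv i (\<lambda>x::real^'n. x $ j) = (\<lambda>x. axis i 1 $ j)" for i
    using partial_deriv_eq[OF *] by auto
  then show ?case using * elem_smooth.const by (auto intro: differentiableI)
next
  case (add f g)
  define f' g' where "f' x h = grad f x \<bullet> h" and "g' x h = grad g x \<bullet> h" for x h
  have f': "(f has_derivative f' x) (at x)" and g': "(g has_derivative g' x) (at x)" for x
    using add.IH by (auto simp: f'_def[abs_def] g'_def[abs_def] intro: has_derivative_grad)
  note d = has_derivative_add[OF f' g']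
  have "partial_deriv i (\<lambda>x. f x + g x) = (\<lambda>x. partial_deriv i f x + partial_deriv i g x)" for i
    by (rule ext) (simp add: partial_deriv_eq[OF d] partial_deriv_eq[OF f'] partial_deriv_eq[OF g'])
  then show ?case using d add by (auto intro!: elem_smooth.add intro: differentiableI)
next
  case (mult f g)
  define f' g' where "f' x h = grad f x \<bullet> h" and "g' x h = grad g x \<bullet> h" for x h
  have f': "(f has_derivative f' x) (at x)" and g': "(g has_derivative g' x) (at x)" for x
    using mult.IH by (auto simp: f'_def[abs_def] g'_def[abs_def] intro: has_derivative_grad)
  note d = has_derivative_mult[OF f' g']
  have "partial_deriv i (\<lambda>x. f x * g x) = (\<lambda>x. f x * partial_deriv i g x + partial_deriv i f x * g x)" for i
    by (rule ext) (simp add: partial_deriv_eq[OF d] partial_deriv_eq[OF f'] partial_deriv_eq[OF g'])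
  then show ?case
    using d mult by (auto intro!: elem_smooth.add elem_smooth.mult intro: differentiableI)
next
  case (bump f k)
  define f' where "f' x h = grad f x \<bullet> h" for x h
  have f': "(f has_derivative f' x) (at x)" for x
    using bump.IH by (auto simp: f'_def[abs_def] intro: has_derivative_grad)
  have d: "((\<lambda>x. bump k (f x)) has_derivative (\<lambda>h. f' x h * (bump (k + 2) (f x) - real k * bump (k + 1) (f x)))) (at x)" for x
    by (rule has_derivative_compose[OF f' bump_has_real_derivative[unfolded has_field_derivative_def], THEN has_derivative_eq_rhs])
       (auto simp: mult.commute)
  have "partial_deriv i (\<lambda>x. bump k (f x)) =
      (\<lambda>x. partial_deriv i f x * (bump (k + 2) (f x) + (- real k) * bump (k + 1) (f x)))" for i
    by (rule ext) (simp add: partial_deriv_eq[OF d] partial_deriv_eq[OF f'])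
  moreover have "(\<lambda>x. partial_deriv i f x * (bump (k + 2) (f x) + (- real k) * bump (k + 1) (f x))) \<in> elem_smooth" for i
    using bump by (intro elem_smooth.intros) auto
  ultimately show ?case using d by (auto intro: differentiableI)
qed

lemma elem_smooth_imp_smooth:
  assumes "f \<in> elem_smooth" shows "smooth f"
proof -
  have "fold partial_deriv is f \<in> elem_smooth" for "is"
    using assms by (induction "is" arbitrary: f) (auto dest: elem_smooth_partial_deriv)
  then show ?thesis
    unfolding smooth_def differentiable_on_def
    using elem_smooth_partial_deriv differentiable_at_withinI by blast
qed

lemma smooth_partial_deriv: "smooth f \<Longrightarrow> smooth (partial_deriv i f)"
  unfolding smooth_def
proof
  fix "is" assume "\<forall>is. fold partial_deriv is f differentiable_on UNIV"
  then show "fold partial_deriv is (partial_deriv i f) differentiable_on UNIV"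
    by (auto dest: spec[of _ "i # is"])
qed

lemma smooth_differentiable: "smooth f \<Longrightarrow> f differentiable at x"
  by (auto simp: smooth_def differentiable_on_def dest: spec[of _ "[]"])

lemma smooth_has_derivative: "smooth f \<Longrightarrow> (f has_derivative (\<lambda>h. grad f x \<bullet> h)) (at x)"
  by (intro has_derivative_grad smooth_differentiable)

lemma smooth_continuous_on: "smooth f \<Longrightarrow> continuous_on A f"
  by (intro continuous_at_imp_continuous_on ballI differentiable_imp_continuous_within smooth_differentiable)

lemma smooth_continuous_on_grad: "smooth f \<Longrightarrow> continuous_on A (grad f)"
  unfolding grad_def by (intro continuous_on_vec_lambda smooth_continuous_on smooth_partial_deriv)

lemma smooth_linear_comb:
  fixes f g :: "real^'n \<Rightarrow> real"
  assumes "smooth f" "smooth g"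
  shows "smooth (\<lambda>x. a * f x + b * g x)"
    and partial_deriv_linear_comb: "partial_deriv i (\<lambda>x. a * f x + b * g x) = (\<lambda>x. a * partial_deriv i f x + b * partial_deriv i g x)"
proof -
  have d: "((\<lambda>x. a * f x + b * g x) has_derivative (\<lambda>h. (a *\<^sub>R grad f x + b *\<^sub>R grad g x) \<bullet> h)) (at x)"
    if "smooth f" "smooth g" for f g x
    using that by (auto intro!: derivative_eq_intros smooth_has_derivative simp: inner_add_left)
  have p: "partial_deriv i (\<lambda>x. a * f x + b * g x) = (\<lambda>x. a * partial_deriv i f x + b * partial_deriv i g x)"
    if "smooth f" "smooth g" for f g i
    by (rule ext) (simp add: partial_deriv_eq[OF d[OF that]] inner_add_left inner_axis)
  have "fold partial_deriv is (\<lambda>x. a * f x + b * g x) = (\<lambda>x. a * fold partial_deriv is f x + b * fold partial_deriv is g x)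
     \<and> smooth (fold partial_deriv is f) \<and> smooth (fold partial_deriv is g)" for "is"
    using assms
  proof (induction "is" arbitrary: f g)
    case (Cons i "is")
    show ?case using Cons.IH[OF smooth_partial_deriv[OF Cons.prems(1), of i] smooth_partial_deriv[OF Cons.prems(2), of i]]
      by (simp add: p[OF Cons.prems])
  qed auto
  then show "smooth (\<lambda>x. a * f x + b * g x)"
    unfolding smooth_def[of "\<lambda>x. a * f x + b * g x"] differentiable_on_def
    by (auto intro!: differentiableI d)
  show "partial_deriv i (\<lambda>x. a * f x + b * g x) = (\<lambda>x. a * partial_deriv i f x + b * partial_deriv i g x)"
    by (rule p[OF assms])
qed

lemma smooth_scaleR:
  fixes f :: "real^'n \<Rightarrow> real"
  assumes "smooth f" shows "smooth (\<lambda>x. f (c *\<^sub>R x))"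
    and grad_scaleR: "grad (\<lambda>x. f (c *\<^sub>R x)) x = c *\<^sub>R grad f (c *\<^sub>R x)"
proof -
  have d: "((\<lambda>x. k * f (c *\<^sub>R x)) has_derivative (\<lambda>h. (k *\<^sub>R c *\<^sub>R grad f (c *\<^sub>R x)) \<bullet> h)) (at x)"
    if "smooth f" for f k x
  proof -
    have "((\<lambda>x. f (c *\<^sub>R x)) has_derivative (\<lambda>h. grad f (c *\<^sub>R x) \<bullet> (c *\<^sub>R h))) (at x)"
      by (rule has_derivative_compose[OF _ smooth_has_derivative[OF that]])
         (auto intro!: derivative_eq_intros)
    then show ?thesis by (auto intro!: derivative_eq_intros)
  qed
  \<comment> \<open>Each differentiation produces a factor \<open>c\<close>, so the induction runs
    over arbitrary multiples \<open>k'\<close> of the dilated function; only \<open>k' = 1\<close>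
    is used afterwards.\<close>
  have "\<exists>k. fold partial_deriv is (\<lambda>x. k' * f (c *\<^sub>R x)) = (\<lambda>x. k * fold partial_deriv is f (c *\<^sub>R x))
      \<and> smooth (fold partial_deriv is f)" for "is" k'
    using assms
  proof (induction "is" arbitrary: f k')
    case (Cons i "is")
    have "partial_deriv i (\<lambda>x. k' * f (c *\<^sub>R x)) = (\<lambda>x. (k' * c) * partial_deriv i f (c *\<^sub>R x))"
      by (rule ext) (simp add: partial_deriv_eq[OF d[OF Cons.prems]] inner_axis)
    then show ?case using Cons.IH[OF smooth_partial_deriv[OF Cons.prems, of i]] by auto
  qed auto
  note fold_eq = this[of _ 1]
  show "smooth (\<lambda>x. f (c *\<^sub>R x))"
    unfolding smooth_def[of "\<lambda>x. f (c *\<^sub>R x)"] differentiable_on_def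
  proof (intro allI ballI)
    fix "is" and x :: "real^'n"
    obtain k where eq: "fold partial_deriv is (\<lambda>x. f (c *\<^sub>R x)) = (\<lambda>x. k * fold partial_deriv is f (c *\<^sub>R x))"
      and sm: "smooth (fold partial_deriv is f)" using fold_eq[of "is"] by auto
    show "fold partial_deriv is (\<lambda>x. f (c *\<^sub>R x)) differentiable at x"
      unfolding eq by (rule differentiableI[OF d[OF sm]])
  qed
  show "grad (\<lambda>x. f (c *\<^sub>R x)) x = c *\<^sub>R grad f (c *\<^sub>R x)"
    using d[OF assms, of 1 x] by (intro grad_eqI) simp
qed

lemma test_functions_smooth: "\<phi> \<in> test_functions \<Omega> \<Longrightarrow> smooth \<phi>"
  by (simp add: test_functions_def)

lemma test_functionsI:
  fixes \<phi> :: "real^'n \<Rightarrow> real"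
  assumes "smooth \<phi>" "compact K" "K \<subseteq> \<Omega>" "\<And>x. x \<notin> K \<Longrightarrow> \<phi> x = 0"
  shows "\<phi> \<in> test_functions \<Omega>"
proof -
  have "closure {x. \<phi> x \<noteq> 0} \<subseteq> K"
    using assms by (intro closure_minimal compact_imp_closed) auto
  moreover have "compact (closure {x. \<phi> x \<noteq> 0})"
    using bounded_subset[OF compact_imp_bounded[OF assms(2)] calculation]
    by (simp add: compact_eq_bounded_closed)
  ultimately show ?thesis using assms by (auto simp: test_functions_def)
qed

lemma grad_eq_0:
  assumes "open U" "x \<in> U" "\<And>y. y \<in> U \<Longrightarrow> f y = 0" shows "grad f x = 0"
proof (rule grad_eqI)
  have "((\<lambda>x. 0) has_derivative (\<lambda>h. 0 \<bullet> h)) (at x)" by simp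
  then show "(f has_derivative (\<lambda>h. 0 \<bullet> h)) (at x)"
    by (rule has_derivative_transform_within_open[OF _ assms(1,2)]) (simp add: assms(3))
qed

lemma test_functionsE:
  assumes "\<phi> \<in> test_functions \<Omega>"
  obtains K where "compact K" "K \<subseteq> \<Omega>" "\<And>x. x \<notin> K \<Longrightarrow> \<phi> x = 0" "\<And>x. x \<notin> K \<Longrightarrow> grad \<phi> x = 0"
proof
  define K where "K = closure {x. \<phi> x \<noteq> 0}"
  show "compact K" "K \<subseteq> \<Omega>" using assms by (auto simp: K_def test_functions_def)
  show z: "\<phi> x = 0" if "x \<notin> K" for x
    using closure_subset[of "{x. \<phi> x \<noteq> 0}"] that unfolding K_def by blast
  have "open (- K)" unfolding K_def by (rule open_Compl[OF closed_closure])
  then show "grad \<phi> x = 0" if "x \<notin> K" for x by (rule grad_eq_0) (use that z in auto)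
qed

lemma test_functions_partial_deriv:
  assumes "\<phi> \<in> test_functions \<Omega>" shows "partial_deriv i \<phi> \<in> test_functions \<Omega>"
proof -
  obtain K where "compact K" "K \<subseteq> \<Omega>" "\<And>x. x \<notin> K \<Longrightarrow> grad \<phi> x = 0"
    using test_functionsE[OF assms] by metis
  then show ?thesis using assms
    by (intro test_functionsI[of _ K] smooth_partial_deriv) (auto simp: test_functions_def vec_eq_iff)
qed

lemma test_functions_linear_comb:
  assumes "f \<in> test_functions \<Omega>" "g \<in> test_functions \<Omega>"
  shows "(\<lambda>x. a * f x + b * g x) \<in> test_functions \<Omega>"
    and grad_linear_comb: "grad (\<lambda>x. a * f x + b * g x) x = a *\<^sub>R grad f x + b *\<^sub>R grad g x"
proof -
  obtain K where K: "compact K" "K \<subseteq> \<Omega>" "\<And>x. x \<notin> K \<Longrightarrow> f x = 0"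
    using test_functionsE[OF assms(1)] by metis
  obtain L where L: "compact L" "L \<subseteq> \<Omega>" "\<And>x. x \<notin> L \<Longrightarrow> g x = 0"
    using test_functionsE[OF assms(2)] by metis
  show "(\<lambda>x. a * f x + b * g x) \<in> test_functions \<Omega>"
    using K L assms
    by (intro test_functionsI[of _ "K \<union> L"] smooth_linear_comb(1)) (auto simp: test_functions_def)
  show "grad (\<lambda>x. a * f x + b * g x) x = a *\<^sub>R grad f x + b *\<^sub>R grad g x"
    using assms by (simp add: vec_eq_iff partial_deriv_linear_comb test_functions_def)
qed

lemma zero_test_function: "(\<lambda>x. 0) \<in> test_functions \<Omega>"
  by (intro test_functionsI[of _ "{}"] elem_smooth_imp_smooth elem_smooth.const) auto

lemma grad_zero [simp]: "grad (\<lambda>x. 0) x = 0"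
  by (rule grad_eq_0[of UNIV]) auto

section \<open>Continuous functions of compact support\<close>

lemma
  fixes f :: "'a::euclidean_space \<Rightarrow> 'b::euclidean_space"
  assumes c: "continuous_on UNIV f" and K: "compact K" "\<And>x. x \<notin> K \<Longrightarrow> f x = 0"
  shows integrable_compact_support: "integrable lborel f"
    and bounded_compact_support: "bounded (range f)"
    and uniformly_continuous_compact_support: "uniformly_continuous_on UNIV f"
proof -
  have "integrable lborel (\<lambda>x. indicator K x *\<^sub>R f x)"
    using borel_integrable_compact[OF K(1), of f] continuous_on_subset[OF c] by (simp add: set_integrable_def)
  moreover have "(\<lambda>x. indicator K x *\<^sub>R f x) = f" using K by (auto simp: indicator_def)
  ultimately show "integrable lborel f" by simp
  have "bounded (f ` K)"
    using compact_continuous_image[OF continuous_on_subset[OF c] K(1)] compact_imp_bounded by blast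
  then have "bounded (insert 0 (f ` K))" by simp
  then show "bounded (range f)" by (rule bounded_subset) (use K in auto)
  obtain r where r: "K \<subseteq> cball 0 r"
    using bounded_subset_ballD[OF compact_imp_bounded[OF K(1)], of 0] ball_subset_cball by blast
  \<comment> \<open>The radius leaves a margin of 1: two points at distance less than 1 either both
    lie in this larger ball, where Heine-Cantor applies, or both lie outside \<open>K\<close>, where
    \<open>f\<close> vanishes.\<close>
  have u: "uniformly_continuous_on (cball 0 (r + 1)) f"
    by (intro compact_uniformly_continuous continuous_on_subset[OF c]) auto
  show "uniformly_continuous_on UNIV f"
    unfolding uniformly_continuous_on_def
  proof (intro allI impI)
    fix e :: real assume "e > 0"
    then obtain d where d: "d > 0" "\<And>x y. x \<in> cball 0 (r + 1) \<Longrightarrow> y \<in> cball 0 (r + 1) \<Longrightarrow> dist y x < d \<Longrightarrow> dist (f y) (f x) < e"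
      using u unfolding uniformly_continuous_on_def by metis
    show "\<exists>d>0. \<forall>x\<in>UNIV. \<forall>x'\<in>UNIV. dist x' x < d \<longrightarrow> dist (f x') (f x) < e"
    proof (intro exI[of _ "min d 1"] conjI ballI impI)
      fix x y :: 'a assume xy: "dist y x < min d 1"
      have "norm x \<le> norm y + dist y x" "norm y \<le> norm x + dist y x"
        by (metis add.commute dist_norm norm_triangle_sub dist_commute)+
      then consider "x \<in> cball 0 (r + 1)" "y \<in> cball 0 (r + 1)" | "x \<notin> cball 0 r" "y \<notin> cball 0 r"
        using xy by fastforce
      then show "dist (f y) (f x) < e"
      proof cases
        case 2
        then have "x \<notin> K" "y \<notin> K" using r by auto
        then have "f x = 0" "f y = 0" using K(2) by auto
        then show ?thesis using \<open>e > 0\<close> by simp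
      qed (use xy d(2) in simp)
    qed (use d in simp)
  qed
qed

section \<open>Square-integrable functions\<close>

text \<open>The space \<open>Lp 2\<close> over an arbitrary measure, with an integer power instead
  of \<open>powr\<close>. The analysis takes place on \<open>lborel\<close> over the whole space and
  is translated to \<open>Lp\<close> and \<open>lebesgue_on\<close> at the end.\<close>

definition square_integrable :: "'a measure \<Rightarrow> ('a \<Rightarrow> 'b::euclidean_space) \<Rightarrow> bool" where
  "square_integrable M f \<longleftrightarrow> f \<in> borel_measurable M \<and> integrable M (\<lambda>x. (norm (f x))\<^sup>2)"

definition l2norm :: "'a measure \<Rightarrow> ('a \<Rightarrow> 'b::euclidean_space) \<Rightarrow> real" where
  "l2norm M f = sqrt (\<integral>x. (norm (f x))\<^sup>2 \<partial>M)"

lemma square_integrable_measurable [measurable_dest]: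
  "square_integrable M f \<Longrightarrow> f \<in> borel_measurable M"
  by (simp add: square_integrable_def)

lemma square_integrable_norm2: "square_integrable M f \<Longrightarrow> integrable M (\<lambda>x. (norm (f x))\<^sup>2)"
  by (simp add: square_integrable_def)

lemma l2norm_nonneg [simp]: "0 \<le> l2norm M f"
  by (simp add: l2norm_def)

lemma l2norm_power2: "(l2norm M f)\<^sup>2 = (\<integral>x. (norm (f x))\<^sup>2 \<partial>M)"
  by (simp add: l2norm_def)

lemma nn_integral_l2norm:
  "square_integrable M f \<Longrightarrow> (\<integral>\<^sup>+x. ennreal ((norm (f x))\<^sup>2) \<partial>M) = ennreal ((l2norm M f)\<^sup>2)"
  unfolding l2norm_power2 by (rule nn_integral_eq_integral) (auto simp: square_integrable_norm2)

text \<open>Estimates are made with nonnegative extended integrals, where Tonelli and Fatou need no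
  integrability; this converts them into bounds for real norms.\<close>

lemma square_integrableI_nn:
  assumes "f \<in> borel_measurable M" "(\<integral>\<^sup>+x. ennreal ((norm (f x))\<^sup>2) \<partial>M) \<le> ennreal A" "0 \<le> A"
  shows "square_integrable M f" "(l2norm M f)\<^sup>2 \<le> A"
proof -
  show s: "square_integrable M f"
    unfolding square_integrable_def
    using assms by (auto simp: integrable_iff_bounded intro: le_less_trans)
  show "(l2norm M f)\<^sup>2 \<le> A"
    using assms(2,3) unfolding nn_integral_l2norm[OF s] by simp
qed

lemma square_integrable_bound:
  fixes f :: "'a \<Rightarrow> 'b::euclidean_space" and g :: "'a \<Rightarrow> 'c::euclidean_space"
  assumes "square_integrable M f" "g \<in> borel_measurable M" "AE x in M. norm (g x) \<le> norm (f x)"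
  shows "square_integrable M g" "l2norm M g \<le> l2norm M f"
proof -
  have le: "AE x in M. (norm (g x))\<^sup>2 \<le> (norm (f x))\<^sup>2"
    using assms(3) by (auto intro: power_mono elim: AE_mp)
  show s: "square_integrable M g"
    unfolding square_integrable_def
    using assms(2) le by (auto intro!: Bochner_Integration.integrable_bound[OF square_integrable_norm2[OF assms(1)]])
  show "l2norm M g \<le> l2norm M f"
    unfolding l2norm_def using s assms(1) le
    by (intro real_sqrt_le_mono integral_mono_AE) (auto simp: square_integrable_norm2)
qed

lemma square_integrable_cong_AE:
  assumes "square_integrable M f" "g \<in> borel_measurable M" "AE x in M. f x = g x"
  shows "square_integrable M g" "l2norm M g = l2norm M f"
proof -
  show s: "square_integrable M g"
    by (rule square_integrable_bound[OF assms(1,2)]) (use assms(3) in auto)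
  show "l2norm M g = l2norm M f"
    unfolding l2norm_def using assms s
    by (intro arg_cong[where f=sqrt] integral_cong_AE) (auto dest: square_integrable_measurable)
qed

lemma square_integrable_inner:
  assumes "square_integrable M f" "square_integrable M g"
  shows "integrable M (\<lambda>x. f x \<bullet> g x)"
proof (rule Bochner_Integration.integrable_bound)
  show "integrable M (\<lambda>x. (norm (f x))\<^sup>2 + (norm (g x))\<^sup>2)"
    using assms by (intro Bochner_Integration.integrable_add square_integrable_norm2)
  show "(\<lambda>x. f x \<bullet> g x) \<in> borel_measurable M" using assms by measurable
  have "\<bar>a \<bullet> b\<bar> \<le> (norm a)\<^sup>2 + (norm b)\<^sup>2" for a b :: 'b
  proof -
    have "0 \<le> norm a * norm b" by simp
    then show ?thesis
      using Cauchy_Schwarz_ineq2[of a b] sum_squares_bound[of "norm a" "norm b"] by linarith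
  qed
  then show "AE x in M. norm (f x \<bullet> g x) \<le> norm ((norm (f x))\<^sup>2 + (norm (g x))\<^sup>2)" by simp
qed

lemma square_integrable_mult:
  fixes f g :: "'a \<Rightarrow> real"
  shows "square_integrable M f \<Longrightarrow> square_integrable M g \<Longrightarrow> integrable M (\<lambda>x. f x * g x)"
  using square_integrable_inner[of M f g] by simp

lemma square_integrable_zero [simp]: "square_integrable M (\<lambda>x. 0)" "l2norm M (\<lambda>x. 0) = 0"
  by (auto simp: square_integrable_def l2norm_def)

lemma square_integrable_scaleR:
  assumes "square_integrable M f"
  shows "square_integrable M (\<lambda>x. c *\<^sub>R f x)" "l2norm M (\<lambda>x. c *\<^sub>R f x) = \<bar>c\<bar> * l2norm M f"
  using assms by (auto simp: square_integrable_def l2norm_def power_mult_distrib real_sqrt_mult)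

lemma square_integrable_add:
  assumes "square_integrable M f" "square_integrable M g"
  shows "square_integrable M (\<lambda>x. f x + g x)"
    and l2norm_add_power2: "(l2norm M (\<lambda>x. f x + g x))\<^sup>2
      = (l2norm M f)\<^sup>2 + 2 * (\<integral>x. f x \<bullet> g x \<partial>M) + (l2norm M g)\<^sup>2"
proof -
  have eq: "(norm (f x + g x))\<^sup>2 = (norm (f x))\<^sup>2 + 2 * (f x \<bullet> g x) + (norm (g x))\<^sup>2" for x
    by (simp add: power2_norm_eq_inner inner_add_left inner_add_right inner_commute)
  have i: "integrable M (\<lambda>x. 2 * (f x \<bullet> g x))"
    using square_integrable_inner[OF assms] by simp
  note n = square_integrable_norm2[OF assms(1)] square_integrable_norm2[OF assms(2)]
  show "square_integrable M (\<lambda>x. f x + g x)"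
    unfolding square_integrable_def eq using assms i n by (auto dest: square_integrable_measurable)
  show "(l2norm M (\<lambda>x. f x + g x))\<^sup>2 = (l2norm M f)\<^sup>2 + 2 * (\<integral>x. f x \<bullet> g x \<partial>M) + (l2norm M g)\<^sup>2"
    unfolding l2norm_power2 eq using i n square_integrable_inner[OF assms] by simp
qed

lemma square_integrable_diff:
  assumes "square_integrable M f" "square_integrable M g"
  shows "square_integrable M (\<lambda>x. f x - g x)"
    and l2norm_diff_power2: "(l2norm M (\<lambda>x. f x - g x))\<^sup>2
      = (l2norm M f)\<^sup>2 - 2 * (\<integral>x. f x \<bullet> g x \<partial>M) + (l2norm M g)\<^sup>2"
  using square_integrable_add[OF assms(1) square_integrable_scaleR(1)[OF assms(2), of "-1"]]
    l2norm_add_power2[OF assms(1) square_integrable_scaleR(1)[OF assms(2), of "-1"]]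
    square_integrable_scaleR(2)[OF assms(2), of "-1"]
  by simp_all

lemma l2norm_minus_commute: "l2norm M (\<lambda>x. f x - g x) = l2norm M (\<lambda>x. g x - f x)"
  by (simp add: l2norm_def norm_minus_commute)

lemma l2norm_Cauchy_Schwarz:
  assumes "square_integrable M f" "square_integrable M g"
  shows "\<bar>\<integral>x. f x \<bullet> g x \<partial>M\<bar> \<le> l2norm M f * l2norm M g"
proof -
  define A B C where "A = (l2norm M f)\<^sup>2" and "B = (\<integral>x. f x \<bullet> g x \<partial>M)" and "C = (l2norm M g)\<^sup>2"
  \<comment> \<open>The squared norm of \<open>f + t g\<close>. Its value at the minimum point
    \<open>t = - B / C\<close> is the inequality; if \<open>C = 0\<close> it is affine in
    \<open>t\<close>, and the argument \<open>- (A + 1) / (2 * B)\<close> would give the value -1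
    unless \<open>B = 0\<close>.\<close>
  have quad: "0 \<le> A + 2 * t * B + t\<^sup>2 * C" for t
  proof -
    have "(l2norm M (\<lambda>x. f x + t *\<^sub>R g x))\<^sup>2 = A + 2 * t * B + t\<^sup>2 * C"
      using l2norm_add_power2[OF assms(1) square_integrable_scaleR(1)[OF assms(2), of t]]
        square_integrable_scaleR(2)[OF assms(2), of t]
      by (simp add: A_def B_def C_def power_mult_distrib)
    then show ?thesis by (metis zero_le_power2)
  qed
  have "B\<^sup>2 \<le> A * C"
  proof (cases "C = 0")
    case True
    have "B = 0"
    proof (rule ccontr)
      assume "B \<noteq> 0"
      then show False using quad[of "- (A + 1) / (2 * B)"] by (simp add: True field_simps)
    qed
    then show ?thesis by (simp add: True)
  next
    case False
    then have "C > 0" by (simp add: C_def)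
    then show ?thesis using quad[of "- B / C"]
      by (simp add: power2_eq_square field_simps)
  qed
  then have "\<bar>B\<bar> \<le> sqrt (A * C)" by (simp add: real_le_rsqrt)
  also have "sqrt (A * C) = l2norm M f * l2norm M g"
    by (simp add: A_def C_def real_sqrt_mult)
  finally show ?thesis by (simp add: B_def)
qed

lemma l2norm_triangle:
  assumes "square_integrable M f" "square_integrable M g"
  shows "l2norm M (\<lambda>x. f x + g x) \<le> l2norm M f + l2norm M g"
proof (rule power2_le_imp_le)
  show "(l2norm M (\<lambda>x. f x + g x))\<^sup>2 \<le> (l2norm M f + l2norm M g)\<^sup>2"
    using l2norm_Cauchy_Schwarz[OF assms] by (simp add: l2norm_add_power2[OF assms] power2_sum)
qed simp

lemma l2norm_triangle_diff:
  assumes "square_integrable M f" "square_integrable M g" "square_integrable M h"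
  shows "l2norm M (\<lambda>x. f x - h x) \<le> l2norm M (\<lambda>x. f x - g x) + l2norm M (\<lambda>x. g x - h x)"
  using l2norm_triangle[OF square_integrable_diff(1)[OF assms(1,2)] square_integrable_diff(1)[OF assms(2,3)]]
  by simp

lemma l2norm_triangle_abs:
  assumes "square_integrable M f" "square_integrable M g"
  shows "\<bar>l2norm M f - l2norm M g\<bar> \<le> l2norm M (\<lambda>x. f x - g x)"
  using l2norm_triangle_diff[OF assms square_integrable_zero(1)]
    l2norm_triangle_diff[OF assms(2,1) square_integrable_zero(1)]
  by (simp add: l2norm_minus_commute[of M g f])

lemma l2norm_tendsto:
  assumes "\<And>n. square_integrable M (F n)" "square_integrable M f"
    and "(\<lambda>n. l2norm M (\<lambda>x. F n x - f x)) \<longlonglongrightarrow> 0"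
  shows "(\<lambda>n. l2norm M (F n)) \<longlonglongrightarrow> l2norm M f"
proof -
  have "(\<lambda>n. l2norm M (F n) - l2norm M f) \<longlonglongrightarrow> 0"
    by (rule Lim_null_comparison[OF _ assms(3)])
       (auto intro!: always_eventually l2norm_triangle_abs assms)
  then show ?thesis by (simp add: LIM_zero_iff)
qed

text \<open>Four times an inner product is the difference of the squared norms of the sum and of the
  difference, so \<open>l2norm_tendsto\<close> suffices.\<close>

lemma integral_inner_tendsto:
  assumes F: "\<And>n. square_integrable M (F n)" "square_integrable M f"
    and G: "\<And>n. square_integrable M (G n)" "square_integrable M g"
    and lim: "(\<lambda>n. l2norm M (\<lambda>x. F n x - f x)) \<longlonglongrightarrow> 0" "(\<lambda>n. l2norm M (\<lambda>x. G n x - g x)) \<longlonglongrightarrow> 0"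
  shows "(\<lambda>n. \<integral>x. F n x \<bullet> G n x \<partial>M) \<longlonglongrightarrow> (\<integral>x. f x \<bullet> g x \<partial>M)"
proof -
  have eq: "(\<integral>x. u x \<bullet> v x \<partial>M) = ((l2norm M (\<lambda>x. u x + v x))\<^sup>2 - (l2norm M (\<lambda>x. u x - v x))\<^sup>2) / 4"
    if "square_integrable M u" "square_integrable M v" for u v :: "'a \<Rightarrow> 'b"
    by (simp add: l2norm_add_power2[OF that] l2norm_diff_power2[OF that])
  have p: "(\<lambda>n. l2norm M (\<lambda>x. F n x + G n x)) \<longlonglongrightarrow> l2norm M (\<lambda>x. f x + g x)"
  proof (rule l2norm_tendsto)
    show "(\<lambda>n. l2norm M (\<lambda>x. F n x + G n x - (f x + g x))) \<longlonglongrightarrow> 0"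
    proof (rule Lim_null_comparison)
      show "(\<lambda>n. l2norm M (\<lambda>x. F n x - f x) + l2norm M (\<lambda>x. G n x - g x)) \<longlonglongrightarrow> 0"
        using tendsto_add[OF lim] by simp
      have "l2norm M (\<lambda>x. F n x + G n x - (f x + g x)) \<le> l2norm M (\<lambda>x. F n x - f x) + l2norm M (\<lambda>x. G n x - g x)" for n
        using l2norm_triangle[OF square_integrable_diff(1)[OF F(1) F(2)] square_integrable_diff(1)[OF G(1) G(2)], of n n]
        by (simp add: algebra_simps)
      then show "\<forall>\<^sub>F n in sequentially. norm (l2norm M (\<lambda>x. F n x + G n x - (f x + g x)))
          \<le> l2norm M (\<lambda>x. F n x - f x) + l2norm M (\<lambda>x. G n x - g x)" by simp
    qed
  qed (use F G in \<open>auto intro: square_integrable_add\<close>)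
  have m: "(\<lambda>n. l2norm M (\<lambda>x. F n x - G n x)) \<longlonglongrightarrow> l2norm M (\<lambda>x. f x - g x)"
  proof (rule l2norm_tendsto)
    show "(\<lambda>n. l2norm M (\<lambda>x. F n x - G n x - (f x - g x))) \<longlonglongrightarrow> 0"
    proof (rule Lim_null_comparison)
      show "(\<lambda>n. l2norm M (\<lambda>x. F n x - f x) + l2norm M (\<lambda>x. G n x - g x)) \<longlonglongrightarrow> 0"
        using tendsto_add[OF lim] by simp
      have "l2norm M (\<lambda>x. F n x - G n x - (f x - g x)) \<le> l2norm M (\<lambda>x. F n x - f x) + l2norm M (\<lambda>x. G n x - g x)" for n
        using l2norm_triangle[OF square_integrable_diff(1)[OF F(1) F(2)] square_integrable_diff(1)[OF G(2) G(1)], of n n]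
        by (simp add: algebra_simps l2norm_minus_commute[of M g])
      then show "\<forall>\<^sub>F n in sequentially. norm (l2norm M (\<lambda>x. F n x - G n x - (f x - g x)))
          \<le> l2norm M (\<lambda>x. F n x - f x) + l2norm M (\<lambda>x. G n x - g x)" by simp
    qed
  qed (use F G in \<open>auto intro: square_integrable_diff\<close>)
  have "(\<lambda>n. ((l2norm M (\<lambda>x. F n x + G n x))\<^sup>2 - (l2norm M (\<lambda>x. F n x - G n x))\<^sup>2) / 4)
      \<longlonglongrightarrow> ((l2norm M (\<lambda>x. f x + g x))\<^sup>2 - (l2norm M (\<lambda>x. f x - g x))\<^sup>2) / 4"
    by (intro tendsto_intros p m) auto
  then show ?thesis by (simp only: eq[OF F(1) G(1)] eq[OF F(2) G(2)])
qed

lemma l2_AE_subseq: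
  assumes "\<And>n. square_integrable M (F n)" "square_integrable M f"
    and "(\<lambda>n. l2norm M (\<lambda>x. F n x - f x)) \<longlonglongrightarrow> 0"
  obtains r :: "nat \<Rightarrow> nat" where "strict_mono r" "AE x in M. (\<lambda>n. F (r n) x) \<longlonglongrightarrow> f x"
proof -
  have "(\<lambda>n. (l2norm M (\<lambda>x. F n x - f x))\<^sup>2) \<longlonglongrightarrow> 0"
    using tendsto_power[OF assms(3), of 2] by simp
  then have "(\<lambda>n. \<integral>x. norm ((norm (F n x - f x))\<^sup>2) \<partial>M) \<longlonglongrightarrow> 0"
    by (simp add: l2norm_power2)
  then obtain r :: "nat \<Rightarrow> nat" where r: "strict_mono r" "AE x in M. (\<lambda>n. (norm (F (r n) x - f x))\<^sup>2) \<longlonglongrightarrow> 0"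
    using tendsto_L1_AE_subseq[of M "\<lambda>n x. (norm (F n x - f x))\<^sup>2"]
      square_integrable_norm2[OF square_integrable_diff(1)[OF assms(1,2)]] by blast
  have conv: "(\<lambda>n. F (r n) x) \<longlonglongrightarrow> f x" if "(\<lambda>n. (norm (F (r n) x - f x))\<^sup>2) \<longlonglongrightarrow> 0" for x
  proof -
    have "(\<lambda>n. sqrt ((norm (F (r n) x - f x))\<^sup>2)) \<longlonglongrightarrow> sqrt 0"
      using that by (rule tendsto_real_sqrt)
    then show ?thesis by (simp add: tendsto_norm_zero_iff LIM_zero_iff)
  qed
  show thesis by (rule that[OF r(1)]) (use r(2) in eventually_elim, rule conv)
qed

text \<open>Riesz--Fischer. Along a subsequence with increments of norm at most \<open>4\<^sup>-\<^sup>k\<close> the sum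
  of \<open>2\<^sup>k\<close> times the squared increments is integrable, which makes the increments almost
  everywhere summable.\<close>

lemma l2_complete:
  fixes F :: "nat \<Rightarrow> 'a \<Rightarrow> 'b::euclidean_space"
  assumes sq: "\<And>n. square_integrable M (F n)"
    and cauchy: "\<And>e. e > 0 \<Longrightarrow> \<exists>N. \<forall>m\<ge>N. \<forall>n\<ge>N. l2norm M (\<lambda>x. F m x - F n x) < e"
  obtains f where "square_integrable M f" "(\<lambda>n. l2norm M (\<lambda>x. F n x - f x)) \<longlonglongrightarrow> 0"
proof -
  have [measurable]: "F n \<in> borel_measurable M" for n using sq by measurable
  have "\<forall>k. \<exists>N. \<forall>m\<ge>N. \<forall>n\<ge>N. l2norm M (\<lambda>x. F m x - F n x) < (1/4) ^ k"
    using cauchy by simp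
  then obtain N where N: "\<And>k m n. m \<ge> N k \<Longrightarrow> n \<ge> N k \<Longrightarrow> l2norm M (\<lambda>x. F m x - F n x) < (1/4) ^ k"
    by metis
  \<comment> \<open>The partial sum dominates every \<open>N j\<close> with
    \<open>j \<le> k\<close>, so all indices from \<open>r k\<close> on satisfy the
    \<open>k\<close>-th Cauchy bound; the summand \<open>k\<close> gives
    \<open>r k \<ge> k\<close>.\<close>
  define r where "r k = (\<Sum>j\<le>k. N j) + k" for k
  have rN: "r j \<ge> N k" if "j \<ge> k" for j k
    unfolding r_def using member_le_sum[of k "{..j}" N] that by simp
  define d where "d k x = F (r (Suc k)) x - F (r k) x" for k x
  have [measurable]: "d k \<in> borel_measurable M" for k
    unfolding d_def[abs_def] by measurable
  have dsq: "square_integrable M (d k)" for k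
    unfolding d_def[abs_def] by (intro square_integrable_diff sq)
  have dn: "l2norm M (d k) \<le> (1/4) ^ k" for k
    unfolding d_def[abs_def] by (intro less_imp_le[OF N] rN) auto
  have "(\<integral>\<^sup>+x. (\<Sum>k. ennreal (2 ^ k * (norm (d k x))\<^sup>2)) \<partial>M) = (\<Sum>k. \<integral>\<^sup>+x. ennreal (2 ^ k * (norm (d k x))\<^sup>2) \<partial>M)"
    unfolding d_def by (intro nn_integral_suminf) measurable
  also have "\<dots> \<le> (\<Sum>k. ennreal ((1/2) ^ k))"
  proof (intro suminf_le summableI)
    fix k
    have "(\<integral>\<^sup>+x. ennreal (2 ^ k * (norm (d k x))\<^sup>2) \<partial>M) = ennreal (2 ^ k) * ennreal ((l2norm M (d k))\<^sup>2)"
      unfolding nn_integral_l2norm[OF dsq, symmetric]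
      by (subst nn_integral_cmult[symmetric]) (auto simp: d_def ennreal_mult)
    also have "\<dots> \<le> ennreal (2 ^ k * ((1/4) ^ k)\<^sup>2)"
      by (subst ennreal_mult[symmetric]) (auto intro!: ennreal_leI mult_left_mono power_mono dn)
    also have "\<dots> \<le> ennreal ((1/2) ^ k)"
    proof (rule ennreal_leI)
      have "((1/4::real) ^ k)\<^sup>2 = (1/16) ^ k"
        by (simp add: power2_eq_square flip: power_mult_distrib)
      then have "(2::real) ^ k * ((1/4) ^ k)\<^sup>2 = (2 * (1/16)) ^ k"
        by (simp only: power_mult_distrib)
      also have "\<dots> = (1/8) ^ k" by simp
      also have "\<dots> \<le> (1/2) ^ k" by (intro power_mono) auto
      finally show "(2::real) ^ k * ((1/4) ^ k)\<^sup>2 \<le> (1/2) ^ k" .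
    qed
    finally show "(\<integral>\<^sup>+x. ennreal (2 ^ k * (norm (d k x))\<^sup>2) \<partial>M) \<le> ennreal ((1/2) ^ k)" .
  qed
  also have "\<dots> < \<infinity>"
    by (subst suminf_ennreal_eq[OF _ geometric_sums]) auto
  finally have fin: "(\<integral>\<^sup>+x. (\<Sum>k. ennreal (2 ^ k * (norm (d k x))\<^sup>2)) \<partial>M) \<noteq> \<infinity>"
    by (rule less_imp_neq)
  have "AE x in M. (\<Sum>k. ennreal (2 ^ k * (norm (d k x))\<^sup>2)) \<noteq> \<infinity>"
    by (rule nn_integral_PInf_AE[OF _ fin]) measurable
  then have conv: "AE x in M. convergent (\<lambda>k. F (r k) x)"
  proof (rule eventually_mono)
    fix x assume fin: "(\<Sum>k. ennreal (2 ^ k * (norm (d k x))\<^sup>2)) \<noteq> \<infinity>"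
    obtain C where C: "C \<ge> 0" "(\<Sum>k. ennreal (2 ^ k * (norm (d k x))\<^sup>2)) = ennreal C"
      using that[OF enn2real_nonneg ennreal_enn2real[symmetric]] fin
      unfolding top.not_eq_extremum infinity_ennreal_def .
    have dle: "norm (d k x) \<le> sqrt C * (1 / sqrt 2) ^ k" for k
    proof -
      have "ennreal (2 ^ k * (norm (d k x))\<^sup>2) = (\<Sum>j\<in>{k}. ennreal (2 ^ j * (norm (d j x))\<^sup>2))" by simp
      also have "\<dots> \<le> ennreal C" unfolding C(2)[symmetric] by (rule sum_le_suminf) auto
      finally have "2 ^ k * (norm (d k x))\<^sup>2 \<le> C" using C(1) by simp
      then have "(norm (d k x))\<^sup>2 \<le> C * (1/2) ^ k" by (simp add: field_simps power_divide)
      also have "\<dots> = (sqrt C * (1 / sqrt 2) ^ k)\<^sup>2"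
      proof -
        have "((1 / sqrt 2) ^ k)\<^sup>2 = (1/2) ^ k"
          by (simp add: power2_eq_square flip: power_mult_distrib)
        then show ?thesis using C(1) by (simp add: power_mult_distrib)
      qed
      finally show ?thesis by (rule power2_le_imp_le) (use C in simp)
    qed
    have "norm (1 / sqrt 2) < 1" by simp
    then have "summable (\<lambda>k. sqrt C * (1 / sqrt 2) ^ k)"
      by (intro summable_mult summable_geometric)
    then have "summable (\<lambda>k. d k x)"
      by (rule summable_comparison_test'[where N=0]) (rule dle)
    then have "(\<lambda>n. \<Sum>k<n. d k x) \<longlonglongrightarrow> (\<Sum>k. d k x)" by (rule summable_LIMSEQ)
    then have "(\<lambda>n. F (r n) x - F (r 0) x) \<longlonglongrightarrow> (\<Sum>k. d k x)"
      unfolding d_def sum_lessThan_telescope[of "\<lambda>k. F (r k) x"] .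
    then have "(\<lambda>n. (F (r n) x - F (r 0) x) + F (r 0) x) \<longlonglongrightarrow> (\<Sum>k. d k x) + F (r 0) x"
      by (intro tendsto_intros)
    then show "convergent (\<lambda>k. F (r k) x)" by (auto simp: convergent_def)
  qed
  define f where "f x = lim (\<lambda>k. F (r k) x)" for x
  have fm [measurable]: "f \<in> borel_measurable M" unfolding f_def[abs_def] by measurable
  have flim: "AE x in M. (\<lambda>k. F (r k) x) \<longlonglongrightarrow> f x"
    using conv by (auto simp: f_def convergent_LIMSEQ_iff)
  \<comment> \<open>Fatou's lemma carries the Cauchy estimate over to the pointwise limit. It yields
    both \<open>f \<in> L2\<close>, from \<open>e = 1\<close>, and the convergence.\<close>
  have est: "(\<integral>\<^sup>+x. ennreal ((norm (F n x - f x))\<^sup>2) \<partial>M) \<le> ennreal (e\<^sup>2)"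
    if e: "e > 0" and n: "\<And>j. j \<ge> K \<Longrightarrow> l2norm M (\<lambda>x. F n x - F j x) < e" for n e K
  proof -
    have "(\<integral>\<^sup>+x. ennreal ((norm (F n x - f x))\<^sup>2) \<partial>M) = (\<integral>\<^sup>+x. liminf (\<lambda>k. ennreal ((norm (F n x - F (r k) x))\<^sup>2)) \<partial>M)"
    proof (rule nn_integral_cong_AE)
      show "AE x in M. ennreal ((norm (F n x - f x))\<^sup>2) = liminf (\<lambda>k. ennreal ((norm (F n x - F (r k) x))\<^sup>2))"
        using flim
        by eventually_elim (auto intro!: lim_imp_Liminf[symmetric] tendsto_ennrealI tendsto_intros)
    qed
    also have "\<dots> \<le> liminf (\<lambda>k. \<integral>\<^sup>+x. ennreal ((norm (F n x - F (r k) x))\<^sup>2) \<partial>M)"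
      by (intro nn_integral_liminf) measurable
    also have "\<dots> = liminf (\<lambda>k. ennreal ((l2norm M (\<lambda>x. F n x - F (r k) x))\<^sup>2))"
      by (subst nn_integral_l2norm) (auto intro: square_integrable_diff sq)
    also have "\<dots> \<le> liminf (\<lambda>k. ennreal (e\<^sup>2))"
    proof (intro Liminf_mono eventually_sequentiallyI[of K] ennreal_leI power_mono)
      fix k assume "K \<le> k"
      then show "l2norm M (\<lambda>x. F n x - F (r k) x) \<le> e"
        by (intro less_imp_le[OF n]) (simp add: r_def)
    qed auto
    also have "\<dots> = ennreal (e\<^sup>2)" by (rule Liminf_const) simp
    finally show ?thesis .
  qed
  obtain K where K: "\<forall>m\<ge>K. \<forall>n\<ge>K. l2norm M (\<lambda>x. F m x - F n x) < 1" using cauchy[of 1] by auto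
  have "square_integrable M (\<lambda>x. F K x - f x)"
  proof (rule square_integrableI_nn(1)[OF _ est])
    show "l2norm M (\<lambda>x. F K x - F j x) < 1" if "K \<le> j" for j using K that by blast
  qed (simp_all, measurable)
  then have fsq: "square_integrable M f"
    using square_integrable_diff(1)[OF sq[of K], of "\<lambda>x. F K x - f x"] by simp
  have "(\<lambda>n. l2norm M (\<lambda>x. F n x - f x)) \<longlonglongrightarrow> 0"
  proof (rule LIMSEQ_I)
    fix e :: real assume e: "e > 0"
    obtain K where K: "\<forall>m\<ge>K. \<forall>n\<ge>K. l2norm M (\<lambda>x. F m x - F n x) < e / 2" using cauchy[of "e / 2"] e by auto
    have "l2norm M (\<lambda>x. F n x - f x) < e" if "n \<ge> K" for n
    proof -
      have "(l2norm M (\<lambda>x. F n x - f x))\<^sup>2 \<le> (e / 2)\<^sup>2"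
      proof (rule square_integrableI_nn(2)[OF _ est])
        show "l2norm M (\<lambda>x. F n x - F j x) < e / 2" if "K \<le> j" for j using K that \<open>n \<ge> K\<close> by blast
      qed (use e in \<open>simp_all, measurable\<close>)
      then have "l2norm M (\<lambda>x. F n x - f x) \<le> e / 2" by (rule power2_le_imp_le) (use e in simp)
      then show ?thesis using e by linarith
    qed
    then show "\<exists>no. \<forall>n\<ge>no. norm (l2norm M (\<lambda>x. F n x - f x) - 0) < e" by auto
  qed
  then show thesis by (rule that[OF fsq])
qed

section \<open>Invariance of the Lebesgue measure\<close>

lemma nn_integral_lborel_translate:
  fixes f :: "'a::euclidean_space \<Rightarrow> ennreal"
  assumes [measurable]: "f \<in> borel_measurable borel"
  shows "(\<integral>\<^sup>+x. f (x + c) \<partial>lborel) = (\<integral>\<^sup>+x. f x \<partial>lborel)"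
proof -
  have "(\<integral>\<^sup>+x. f x \<partial>lborel) = (\<integral>\<^sup>+x. f x \<partial>distr lborel borel ((+) c))" by (simp add: lborel_distr_plus)
  also have "\<dots> = (\<integral>\<^sup>+x. f (c + x) \<partial>lborel)" by (rule nn_integral_distr) auto
  finally show ?thesis by (simp add: add.commute)
qed

lemma
  fixes f :: "'a::euclidean_space \<Rightarrow> 'b::euclidean_space"
  assumes [measurable]: "f \<in> borel_measurable borel"
  shows integral_lborel_translate: "(\<integral>x. f (x + c) \<partial>lborel) = (\<integral>x. f x \<partial>lborel)"
    and integrable_lborel_translate: "integrable lborel (\<lambda>x. f (x + c)) \<longleftrightarrow> integrable lborel f"
proof -
  have "(\<integral>x. f x \<partial>lborel) = (\<integral>x. f x \<partial>distr lborel borel ((+) c))" by (simp add: lborel_distr_plus)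
  also have "\<dots> = (\<integral>x. f (c + x) \<partial>lborel)" by (rule integral_distr) auto
  finally show "(\<integral>x. f (x + c) \<partial>lborel) = (\<integral>x. f x \<partial>lborel)" by (simp add: add.commute)
  have "integrable lborel f \<longleftrightarrow> integrable (distr lborel borel ((+) c)) f" by (simp add: lborel_distr_plus)
  also have "\<dots> \<longleftrightarrow> integrable lborel (\<lambda>x. f (c + x))" by (rule integrable_distr_eq) auto
  finally show "integrable lborel (\<lambda>x. f (x + c)) \<longleftrightarrow> integrable lborel f" by (simp add: add.commute)
qed

text \<open>\<open>lborel\<close> is characterized by its values on boxes, and the preimage of a box
  under \<open>T\<close> is its image under \<open>inv T\<close>, which is again orthogonal and so
  preserves measure.\<close>

lemma lborel_distr_orthogonal:
  fixes T :: "real^'n::{finite,wellorder} \<Rightarrow> real^'n::_"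
  assumes T: "orthogonal_transformation T"
  shows "distr lborel borel T = lborel"
proof -
  have lin: "linear (inv T)" and bij: "bij T" and oinv: "orthogonal_transformation (inv T)"
    using orthogonal_transformation_inv[OF T] orthogonal_transformation_linear orthogonal_transformation_bij[OF T] by auto
  have Tm [measurable]: "T \<in> borel_measurable borel"
    using orthogonal_transformation_linear[OF T]
    by (intro borel_measurable_continuous_onI linear_continuous_on linear_conv_bounded_linear[THEN iffD1])
  have "lborel = distr lborel borel T"
  proof (rule lborel_eqI)
    fix l u :: "real^'n::_" assume le: "\<And>b. b \<in> Basis \<Longrightarrow> l \<bullet> b \<le> u \<bullet> b"
    have "T -` box l u = inv T ` box l u" using bij by (simp add: bij_vimage_eq_inv_image)
    then have "emeasure (distr lborel borel T) (box l u) = emeasure lebesgue (inv T ` box l u)"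
      using measurable_sets_borel[OF Tm, of "box l u"] by (simp add: emeasure_distr)
    also have "\<dots> = ennreal (measure lebesgue (inv T ` box l u))"
      using measurable_orthogonal_image[OF oinv lmeasurable_box] by (rule emeasure_eq_measure2)
    also have "\<dots> = emeasure lebesgue (box l u)"
      using measure_orthogonal_image[OF oinv lmeasurable_box, of l u] emeasure_eq_measure2[OF lmeasurable_box, of l u] by simp
    also have "\<dots> = (\<Prod>b\<in>Basis. (u - l) \<bullet> b)" using le by simp
    finally show "emeasure (distr lborel borel T) (box l u) = (\<Prod>b\<in>Basis. (u - l) \<bullet> b)" .
  qed simp
  then show ?thesis by simp
qed

section \<open>Integration by parts and the fundamental lemma\<close>

lemma has_derivative_inner_bound:
  fixes f :: "'a::real_inner \<Rightarrow> real"
  assumes "\<And>x. (f has_derivative (\<lambda>h. G x \<bullet> h)) (at x)" "\<And>x. norm (G x) \<le> B"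
  shows "\<bar>f x - f y\<bar> \<le> B * norm (x - y)"
proof -
  have B: "0 \<le> B" using assms(2)[of undefined] norm_ge_zero order_trans by blast
  have "\<bar>G x \<bullet> h\<bar> \<le> B * norm h" for x h
    using Cauchy_Schwarz_ineq2[of "G x" h] mult_right_mono[OF assms(2)[of x] norm_ge_zero[of h]] by linarith
  then have "onorm (\<lambda>h. G x \<bullet> h) \<le> B" for x
    by (intro onorm_bound B) simp
  then have "norm (f x - f y) \<le> B * norm (x - y)"
    by (intro differentiable_bound[of UNIV f "\<lambda>x h. G x \<bullet> h"]) (auto intro: assms)
  then show ?thesis by simp
qed

text \<open>The difference quotients have integral 0 by translation invariance. With steps at most 1
  they vanish outside one fixed ball and are bounded by the Lipschitz constant, so dominated
  convergence applies.\<close>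

lemma integral_directional_derivative_0:
  fixes f :: "real^'n \<Rightarrow> real"
  assumes d: "\<And>x. (f has_derivative (\<lambda>h. G x \<bullet> h)) (at x)" and G: "continuous_on UNIV G"
    and K: "compact K" "\<And>x. x \<notin> K \<Longrightarrow> f x = 0"
  shows "(\<integral>x. G x \<bullet> e \<partial>lborel) = 0"
proof -
  have fc: "continuous_on UNIV f"
    using d has_derivative_continuous by (blast intro: continuous_at_imp_continuous_on)
  have [measurable]: "f \<in> borel_measurable borel" "G \<in> borel_measurable borel"
    using fc G by (auto intro: borel_measurable_continuous_onI)
  have "open (- K)" using K(1) by (simp add: compact_imp_closed open_Compl)
  then have G0: "G x = 0" if "x \<notin> K" for x
    using grad_eq_0[of "- K" x f] grad_eqI[OF d, of x] that K(2) by auto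
  obtain B where B: "\<And>x. norm (G x) \<le> B"
    using bounded_compact_support[OF G K(1) G0] by (auto simp: bounded_iff)
  obtain r where r: "K \<subseteq> ball 0 r"
    using bounded_subset_ballD[OF compact_imp_bounded[OF K(1)], of 0] by blast
  define t where "t n = 1 / real (Suc n)" for n
  have t: "0 < t n" "t n \<le> 1" for n by (auto simp: t_def)
  define D where "D n x = (f (x + t n *\<^sub>R e) - f x) / t n" for n x
  have fi: "integrable lborel f" by (rule integrable_compact_support[OF fc K])
  have D0: "(\<integral>x. D n x \<partial>lborel) = 0" for n
    unfolding D_def using fi by (simp add: integral_lborel_translate integrable_lborel_translate)
  have "(\<lambda>n. \<integral>x. D n x \<partial>lborel) \<longlonglongrightarrow> (\<integral>x. G x \<bullet> e \<partial>lborel)"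
  proof (rule integral_dominated_convergence[where w="\<lambda>x. indicator (cball 0 (r + norm e)) x * (B * norm e)"])
    show "integrable lborel (\<lambda>x::real^'n. indicator (cball 0 (r + norm e)) x * (B * norm e))"
      using emeasure_lborel_cball_finite[of "0::real^'n" "r + norm e"] by simp
    show "AE x in lborel. (\<lambda>n. D n x) \<longlonglongrightarrow> G x \<bullet> e"
    proof (rule AE_I2)
      fix x
      have "((\<lambda>s. f (x + s *\<^sub>R e)) has_derivative (\<lambda>s. G (x + 0 *\<^sub>R e) \<bullet> (s *\<^sub>R e))) (at 0)"
        by (rule has_derivative_compose[OF _ d]) (auto intro!: derivative_eq_intros)
      then have "((\<lambda>s. f (x + s *\<^sub>R e)) has_real_derivative G x \<bullet> e) (at 0)"
        by (simp add: has_field_derivative_def mult_commute_abs)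
      then have "((\<lambda>s. (f (x + s *\<^sub>R e) - f x) / s) \<longlongrightarrow> G x \<bullet> e) (at 0)"
        by (simp add: DERIV_def)
      moreover have "t \<longlonglongrightarrow> 0"
        using LIMSEQ_inverse_real_of_nat unfolding t_def[abs_def] inverse_eq_divide .
      then have "filterlim t (at 0) sequentially"
        unfolding filterlim_at using less_imp_neq[OF t(1)] by auto
      ultimately show "(\<lambda>n. D n x) \<longlonglongrightarrow> G x \<bullet> e"
        unfolding D_def by (rule filterlim_compose)
    qed
    show "AE x in lborel. norm (D n x) \<le> indicator (cball 0 (r + norm e)) x * (B * norm e)" for n
    proof (rule AE_I2)
      fix x
      have "norm (t n *\<^sub>R e) \<le> norm e" using t[of n] by (simp add: mult_left_le_one_le)
      then have x: "norm x \<le> norm (x + t n *\<^sub>R e) + norm e"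
        using norm_triangle_ineq4[of "x + t n *\<^sub>R e" "t n *\<^sub>R e"] by simp
      show "norm (D n x) \<le> indicator (cball 0 (r + norm e)) x * (B * norm e)"
      proof (cases "norm x \<le> r + norm e")
        case True
        have "\<bar>f (x + t n *\<^sub>R e) - f x\<bar> \<le> B * (t n * norm e)"
          using has_derivative_inner_bound[of f G B "x + t n *\<^sub>R e" x] d B t[of n] by simp
        then show ?thesis using True t[of n] by (simp add: D_def field_simps)
      next
        case False
        then have "x \<notin> ball 0 r" "x + t n *\<^sub>R e \<notin> ball 0 r"
          using x norm_ge_zero[of e] unfolding mem_ball_0 by linarith+
        then have "x \<notin> K" "x + t n *\<^sub>R e \<notin> K" using r by blast+
        then show ?thesis by (simp add: D_def K False)
      qed
    qed
  qed (simp_all add: D_def)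
  then show ?thesis by (simp add: D0 LIMSEQ_const_iff)
qed

lemma test_function_integrals:
  assumes "\<phi> \<in> test_functions \<Omega>"
  shows test_function_measurable: "\<phi> \<in> borel_measurable borel" "grad \<phi> \<in> borel_measurable borel"
    and test_function_square_integrable: "square_integrable lborel \<phi>" "square_integrable lborel (grad \<phi>)"
    and test_function_bounded: "\<exists>B. \<forall>x. \<bar>\<phi> x\<bar> \<le> B" "\<exists>B. \<forall>x. norm (grad \<phi> x) \<le> B"
    and test_function_integrable: "integrable lborel \<phi>"
proof -
  obtain K where K: "compact K" "\<And>x. x \<notin> K \<Longrightarrow> \<phi> x = 0" "\<And>x. x \<notin> K \<Longrightarrow> grad \<phi> x = 0"
    using test_functionsE[OF assms] by metis
  note s = test_functions_smooth[OF assms]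
  note c = smooth_continuous_on[OF s, of UNIV] smooth_continuous_on_grad[OF s, of UNIV]
  show m: "\<phi> \<in> borel_measurable borel" "grad \<phi> \<in> borel_measurable borel"
    using c by (auto intro: borel_measurable_continuous_onI)
  show "integrable lborel \<phi>" by (rule integrable_compact_support[OF c(1) K(1,2)])
  show "\<exists>B. \<forall>x. \<bar>\<phi> x\<bar> \<le> B" "\<exists>B. \<forall>x. norm (grad \<phi> x) \<le> B"
    using bounded_compact_support[OF c(1) K(1,2)] bounded_compact_support[OF c(2) K(1,3)] by (auto simp: bounded_iff)
  have "integrable lborel (\<lambda>x. (norm (\<phi> x))\<^sup>2)" "integrable lborel (\<lambda>x. (norm (grad \<phi> x))\<^sup>2)"
    by (rule integrable_compact_support[OF _ K(1)]; use K c in \<open>auto intro!: continuous_intros\<close>)+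
  then show "square_integrable lborel \<phi>" "square_integrable lborel (grad \<phi>)"
    using m by (auto simp: square_integrable_def)
qed

text \<open>The product \<open>\<psi> \<phi>\<close> has compact support although
  \<open>\<psi>\<close> need not, so the integral of its partial derivative is 0.\<close>

lemma test_function_by_parts:
  assumes "\<phi> \<in> test_functions \<Omega>" "smooth \<psi>"
  shows "(\<integral>x. \<psi> x * partial_deriv i \<phi> x \<partial>lborel) = - (\<integral>x. partial_deriv i \<psi> x * \<phi> x \<partial>lborel)"
proof -
  obtain K where K: "compact K" "\<And>x. x \<notin> K \<Longrightarrow> \<phi> x = 0" "\<And>x. x \<notin> K \<Longrightarrow> grad \<phi> x = 0"
    using test_functionsE[OF assms(1)] by metis
  note s = test_functions_smooth[OF assms(1)]
  note c = smooth_continuous_on[OF s, of UNIV] smooth_continuous_on_grad[OF s, of UNIV]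
    smooth_continuous_on[OF assms(2), of UNIV] smooth_continuous_on_grad[OF assms(2), of UNIV]
  have "(\<integral>x. (\<psi> x *\<^sub>R grad \<phi> x + \<phi> x *\<^sub>R grad \<psi> x) \<bullet> axis i 1 \<partial>lborel) = 0"
  proof (rule integral_directional_derivative_0[where f="\<lambda>x. \<psi> x * \<phi> x", OF _ _ K(1)])
    show "((\<lambda>x. \<psi> x * \<phi> x) has_derivative (\<lambda>h. (\<psi> x *\<^sub>R grad \<phi> x + \<phi> x *\<^sub>R grad \<psi> x) \<bullet> h)) (at x)" for x
      by (rule has_derivative_eq_rhs[OF has_derivative_mult[OF smooth_has_derivative[OF assms(2)] smooth_has_derivative[OF s]]])
         (auto simp: inner_add_left algebra_simps)
  qed (use c K in \<open>auto intro!: continuous_intros\<close>)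
  then have "(\<integral>x. \<psi> x * partial_deriv i \<phi> x + partial_deriv i \<psi> x * \<phi> x \<partial>lborel) = 0"
    by (simp add: inner_add_left inner_axis mult.commute)
  moreover have "integrable lborel (\<lambda>x. \<psi> x * partial_deriv i \<phi> x)"
  proof (rule integrable_compact_support[OF _ K(1)])
    show "\<psi> x * partial_deriv i \<phi> x = 0" if "x \<notin> K" for x
      using K(3)[OF that] by (metis grad_nth zero_index mult_zero_right)
  qed (intro continuous_on_mult smooth_continuous_on smooth_partial_deriv assms s)
  moreover have "integrable lborel (\<lambda>x. partial_deriv i \<psi> x * \<phi> x)"
  proof (rule integrable_compact_support[OF _ K(1)])
    show "partial_deriv i \<psi> x * \<phi> x = 0" if "x \<notin> K" for x by (simp add: K(2)[OF that])
  qed (intro continuous_on_mult smooth_continuous_on smooth_partial_deriv assms s)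
  ultimately show ?thesis by simp
qed

section \<open>Cut-off functions and the fundamental lemma of the calculus of variations\<close>

lemma elem_smooth_prod:
  assumes "finite I" "\<And>i. i \<in> I \<Longrightarrow> f i \<in> elem_smooth"
  shows "(\<lambda>x. \<Prod>i\<in>I. f i x) \<in> elem_smooth"
  using assms by (induction I rule: finite_induct) (auto intro: elem_smooth.intros)

lemma elem_smooth_sum:
  assumes "finite I" "\<And>i. i \<in> I \<Longrightarrow> f i \<in> elem_smooth"
  shows "(\<lambda>x. \<Sum>i\<in>I. f i x) \<in> elem_smooth"
  using assms by (induction I rule: finite_induct) (auto intro: elem_smooth.intros)

lemma elem_smooth_power: "f \<in> elem_smooth \<Longrightarrow> (\<lambda>x. f x ^ n) \<in> elem_smooth"
  by (induction n) (auto intro: elem_smooth.intros)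

lemma elem_smooth_diff:
  assumes "f \<in> elem_smooth" "g \<in> elem_smooth" shows "(\<lambda>x. f x - g x) \<in> elem_smooth"
  using elem_smooth.add[OF assms(1) elem_smooth.mult[OF elem_smooth.const[of "-1"] assms(2)]] by simp

lemma elem_smooth_norm2: "(\<lambda>x. (norm x)\<^sup>2) \<in> elem_smooth"
proof -
  have "(\<lambda>x::real^'a. \<Sum>i\<in>UNIV. x $ i * x $ i) \<in> elem_smooth"
    by (intro elem_smooth_sum elem_smooth.intros) auto
  then show ?thesis by (simp add: power2_norm_eq_inner inner_vec_def)
qed

text \<open>If \<open>0 \<le> \<psi> < 1\<close>, then \<open>1 - (1 - \<psi>)\<^sup>n\<close> tends to the indicator of \<open>{\<psi> > 0}\<close>; being a polynomial in \<open>\<psi>\<close>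
  without constant term, it is a test function.\<close>

lemma plateau_test_functions:
  assumes "\<psi> \<in> elem_smooth" "\<And>x. 0 \<le> \<psi> x" "\<And>x. \<psi> x < 1" and K: "compact K" "K \<subseteq> \<Omega>" "\<And>x. x \<notin> K \<Longrightarrow> \<psi> x = 0"
  shows "(\<lambda>x. 1 - (1 - \<psi> x) ^ n) \<in> test_functions \<Omega>"
    and "0 \<le> 1 - (1 - \<psi> x) ^ n" "1 - (1 - \<psi> x) ^ n \<le> 1"
    and "(\<lambda>n. 1 - (1 - \<psi> x) ^ n) \<longlonglongrightarrow> indicator {x. 0 < \<psi> x} x"
proof -
  show "(\<lambda>x. 1 - (1 - \<psi> x) ^ n) \<in> test_functions \<Omega>"
    using assms
    by (intro test_functionsI[of _ K] elem_smooth_imp_smooth elem_smooth_diff elem_smooth_power elem_smooth.const) auto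
  show "0 \<le> 1 - (1 - \<psi> x) ^ n" "1 - (1 - \<psi> x) ^ n \<le> 1"
    using assms(2)[of x] assms(3)[of x] by (auto simp: power_le_one)
  show "(\<lambda>n. 1 - (1 - \<psi> x) ^ n) \<longlonglongrightarrow> indicator {x. 0 < \<psi> x} x"
  proof (cases "\<psi> x > 0")
    case True
    then have "(\<lambda>n. 1 - (1 - \<psi> x) ^ n) \<longlonglongrightarrow> 1 - 0"
      using assms(3)[of x] by (intro tendsto_intros LIMSEQ_power_zero) auto
    then show ?thesis using True by simp
  next
    case False
    then have "\<psi> x = 0" using assms(2)[of x] by simp
    then show ?thesis by simp
  qed
qed

text \<open>The finite measures with densities the positive and the negative part of
  \<open>f\<close> agree on boxes, a generator closed under intersection. Hence they are equal and
  so are their densities almost everywhere, which forces \<open>f = 0\<close>.\<close>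

lemma AE_eq_0_if_integral_boxes_0:
  fixes f :: "'a::euclidean_space \<Rightarrow> real"
  assumes fi: "integrable lborel f" and box0: "\<And>a b. (\<integral>x. indicator (box a b) x * f x \<partial>lborel) = 0"
  shows "AE x in lborel. f x = 0"
proof -
  have [measurable]: "f \<in> borel_measurable borel" using borel_measurable_integrable[OF fi] by simp
  have fin: "(\<integral>\<^sup>+x. ennreal (f x) \<partial>lborel) < \<infinity>" "(\<integral>\<^sup>+x. ennreal (- f x) \<partial>lborel) < \<infinity>"
    using fi real_integrable_def[of lborel f] by (auto simp: top.not_eq_extremum)
  define E where "E = range (\<lambda>(a, b). box a b::'a set)"
  have "density lborel (\<lambda>x. ennreal (f x)) = density lborel (\<lambda>x. ennreal (- f x))" (is "?N1 = ?N2")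
  proof (rule measure_eqI_generator_eq)
    show "Int_stable E" by (auto simp: E_def Int_stable_def box_Int_box)
    show "E \<subseteq> Pow UNIV" "sets ?N1 = sigma_sets UNIV E" "sets ?N2 = sigma_sets UNIV E"
      by (simp_all add: borel_eq_box E_def)
    let ?A = "\<lambda>n::nat. box (- (real n *\<^sub>R One)) (real n *\<^sub>R One) :: 'a set"
    show "range ?A \<subseteq> E" "(\<Union>i. ?A i) = UNIV" unfolding E_def UN_box_eq_UNIV by auto
    have le: "emeasure ?N1 X \<le> (\<integral>\<^sup>+x. ennreal (f x) \<partial>lborel)" if "X \<in> sets borel" for X
      using that by (auto simp: emeasure_density intro!: nn_integral_mono split: split_indicator)
    show "emeasure ?N1 (?A i) \<noteq> \<infinity>" for i
      using le[of "?A i"] fin(1) by (auto simp: top_unique)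
    show "emeasure ?N1 X = emeasure ?N2 X" if XE: "X \<in> E" for X
    proof -
      obtain a b where X: "X = box a b" using XE by (auto simp: E_def)
      define h where "h x = indicator X x * f x" for x
      have hi: "integrable lborel h"
        using integrable_real_mult_indicator[of X lborel f] fi by (simp add: X h_def[abs_def] mult.commute)
      have "emeasure ?N1 X = (\<integral>\<^sup>+x. ennreal (h x) \<partial>lborel)"
        by (auto simp: emeasure_density X h_def intro!: nn_integral_cong split: split_indicator)
      moreover have "emeasure ?N2 X = (\<integral>\<^sup>+x. ennreal (- h x) \<partial>lborel)"
        by (auto simp: emeasure_density X h_def intro!: nn_integral_cong split: split_indicator)
      moreover have "enn2real (\<integral>\<^sup>+x. ennreal (h x) \<partial>lborel) = enn2real (\<integral>\<^sup>+x. ennreal (- h x) \<partial>lborel)"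
        using real_lebesgue_integral_def[OF hi] box0[of a b] by (simp add: h_def[abs_def] X)
      moreover have "(\<integral>\<^sup>+x. ennreal (h x) \<partial>lborel) < top" "(\<integral>\<^sup>+x. ennreal (- h x) \<partial>lborel) < top"
        using hi real_integrable_def[of lborel h] by (auto simp: top.not_eq_extremum)
      ultimately show ?thesis by (metis ennreal_enn2real)
    qed
  qed
  then have "AE x in lborel. ennreal (f x) = ennreal (- f x)"
    by (subst (asm) sigma_finite_measure.density_unique_iff[OF sigma_finite_lborel]) auto
  then show ?thesis
  proof eventually_elim
    case (elim x)
    then show ?case
      by (metis enn2real_ennreal ennreal_neg linorder_le_cases neg_0_le_iff_le neg_le_0_iff_le order_antisym enn2real_0)
  qed
qed

text \<open>A product of one-dimensional bumps is positive exactly on a given open box, so its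
  plateau functions converge to the indicator of the box, and \<open>f\<close> has integral 0 over
  every box whose closure lies in \<open>\<Omega>\<close>. An open set is a countable union of
  closed boxes.\<close>

lemma fundamental_lemma:
  fixes f :: "real^'n \<Rightarrow> real"
  assumes "open \<Omega>" and fm [measurable]: "f \<in> borel_measurable borel"
    and fi: "integrable lborel (\<lambda>x. indicator \<Omega> x * f x)"
    and zero: "\<And>\<phi>. \<phi> \<in> test_functions \<Omega> \<Longrightarrow> (\<integral>x. f x * \<phi> x \<partial>lborel) = 0"
  shows "AE x in lborel. x \<in> \<Omega> \<longrightarrow> f x = 0"
proof -
  have box0: "(\<integral>x. indicator (box a b) x * f x \<partial>lborel) = 0" if ab: "cbox a b \<subseteq> \<Omega>" for a b
  proof -
    define \<psi> where "\<psi> x = (\<Prod>i\<in>UNIV. bump 0 (x $ i - a $ i) * bump 0 (b $ i - x $ i))" for x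
    have \<psi>s: "\<psi> \<in> elem_smooth"
      unfolding \<psi>_def[abs_def]
      by (intro elem_smooth_prod elem_smooth.mult elem_smooth.bump elem_smooth_diff elem_smooth.coord elem_smooth.const finite)
    have lt: "bump 0 s * bump 0 t < 1" for s t
      using mult_strict_mono'[of "bump 0 s" 1 "bump 0 t" 1] by (simp add: bump_nonneg bump_0_less_1)
    have \<psi>01: "0 \<le> \<psi> x" "\<psi> x < 1" for x
    proof -
      show "0 \<le> \<psi> x" by (auto simp: \<psi>_def intro!: prod_nonneg mult_nonneg_nonneg bump_nonneg)
      have "\<psi> x < (\<Prod>i\<in>(UNIV::'n set). 1)"
        unfolding \<psi>_def by (rule prod_mono_strict) (auto simp: bump_nonneg lt intro: less_imp_le)
      then show "\<psi> x < 1" by simp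
    qed
    have \<psi>pos: "\<psi> x > 0 \<longleftrightarrow> x \<in> box a b" for x
    proof -
      have "bump 0 t > 0 \<longleftrightarrow> t > 0" for t by (simp add: bump_def)
      moreover have "\<psi> x > 0 \<longleftrightarrow> (\<forall>i. bump 0 (x $ i - a $ i) > 0 \<and> bump 0 (b $ i - x $ i) > 0)"
        using \<psi>01(1)[of x] bump_nonneg unfolding \<psi>_def
        by (auto simp: less_le zero_less_mult_iff)
      ultimately show ?thesis by (auto simp: mem_box_cart)
    qed
    have K: "compact (cbox a b)" "\<And>x. x \<notin> cbox a b \<Longrightarrow> \<psi> x = 0"
      using \<psi>pos \<psi>01(1) box_subset_cbox[of a b] by (auto simp: less_le)
    note pl = plateau_test_functions[OF \<psi>s \<psi>01 K(1) ab K(2)]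
    have "(\<lambda>n. \<integral>x. f x * (1 - (1 - \<psi> x) ^ n) \<partial>lborel) \<longlonglongrightarrow> (\<integral>x. f x * indicator {x. 0 < \<psi> x} x \<partial>lborel)"
    proof (rule integral_dominated_convergence[where w="\<lambda>x. \<bar>indicator \<Omega> x * f x\<bar>"])
      have [measurable]: "\<psi> \<in> borel_measurable borel"
        using smooth_continuous_on[OF elem_smooth_imp_smooth[OF \<psi>s]] by (rule borel_measurable_continuous_onI)
      show "(\<lambda>x. f x * indicator {x. 0 < \<psi> x} x) \<in> borel_measurable lborel"
        "(\<lambda>x. f x * (1 - (1 - \<psi> x) ^ n)) \<in> borel_measurable lborel" for n by measurable
      show "integrable lborel (\<lambda>x. \<bar>indicator \<Omega> x * f x\<bar>)" using fi by (rule integrable_abs)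
      show "AE x in lborel. (\<lambda>n. f x * (1 - (1 - \<psi> x) ^ n)) \<longlonglongrightarrow> f x * indicator {x. 0 < \<psi> x} x"
        by (intro AE_I2 tendsto_intros pl(4))
      show "AE x in lborel. norm (f x * (1 - (1 - \<psi> x) ^ n)) \<le> \<bar>indicator \<Omega> x * f x\<bar>" for n
      proof (rule AE_I2)
        fix x
        show "norm (f x * (1 - (1 - \<psi> x) ^ n)) \<le> \<bar>indicator \<Omega> x * f x\<bar>"
        proof (cases "x \<in> cbox a b")
          case True
          then have "x \<in> \<Omega>" using ab by auto
          then show ?thesis using pl(2,3)[where x=x and n=n] by (auto simp: abs_mult mult_left_le)
        qed (simp add: K(2))
      qed
    qed
    then have "(\<integral>x. f x * indicator {x. 0 < \<psi> x} x \<partial>lborel) = 0"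
      by (simp add: zero[OF pl(1)] LIMSEQ_const_iff)
    then show ?thesis by (simp add: \<psi>pos mult.commute)
  qed
  have cb: "AE x in lborel. x \<in> cbox a b \<longrightarrow> f x = 0" if ab: "cbox a b \<subseteq> \<Omega>" for a b
  proof -
    have "integrable lborel (\<lambda>x. indicator (box a b) x * (indicator \<Omega> x * f x))"
      using integrable_real_mult_indicator[OF _ fi, of "box a b"] by (simp add: mult.commute)
    moreover have "(\<lambda>x. indicator (box a b) x * (indicator \<Omega> x * f x)) = (\<lambda>x. indicator (box a b) x * f x)"
      using ab box_subset_cbox[of a b] by (auto simp: indicator_def fun_eq_iff)
    ultimately have "integrable lborel (\<lambda>x. indicator (box a b) x * f x)" by simp
    moreover have "(\<integral>x. indicator (box c d) x * (indicator (box a b) x * f x) \<partial>lborel) = 0" for c d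
    proof -
      obtain l u where lu: "box c d \<inter> box a b = box l u" using box_Int_box by blast
      \<comment> \<open>If the intersection is empty, the corners \<open>l\<close> and
        \<open>u\<close> are unconstrained and \<open>cbox l u\<close> may leave
        \<open>cbox a b\<close>. They are then replaced by corners for which the open and the closed
        box are both empty.\<close>
      define l' u' where "l' = (if box l u = {} then One else l)" and "u' = (if box l u = {} then 0 else u)"
      have lu': "box l u = box l' u'" and "cbox l' u' \<subseteq> cbox a b"
      proof -
        have e: "cbox One (0::real^'n) = {}" "box One (0::real^'n) = {}"
          by (simp_all add: box_eq_empty ex_in_conv)
        show "box l u = box l' u'" by (simp add: l'_def u'_def e)
        show "cbox l' u' \<subseteq> cbox a b"
        proof (cases "box l u = {}")
          case False
          then have "cbox l u = closure (box l u)" by (simp add: closure_box)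
          also have "\<dots> \<subseteq> cbox a b"
            using lu box_subset_cbox[of a b] by (intro closure_minimal) auto
          finally show ?thesis using False by (simp add: l'_def u'_def)
        qed (simp add: l'_def u'_def e)
      qed
      then have "(\<integral>x. indicator (box l u) x * f x \<partial>lborel) = 0" using box0[of l' u'] ab by auto
      moreover have "(\<lambda>x. indicator (box c d) x * (indicator (box a b) x * f x)) = (\<lambda>x. indicator (box l u) x * f x)"
        unfolding lu[symmetric] by (auto simp: indicator_def)
      ultimately show ?thesis by (simp only:)
    qed
    ultimately have "AE x in lborel. indicator (box a b) x * f x = 0" by (rule AE_eq_0_if_integral_boxes_0)
    moreover have "AE x in lborel. x \<notin> cbox a b - box a b"
      using null_sets_cbox_Diff_box[of a b] by (rule AE_not_in)
    ultimately show ?thesis by eventually_elim (auto simp: indicator_def split: if_splits)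
  qed
  obtain D where D: "countable D" "D \<subseteq> Pow \<Omega>" "\<And>X. X \<in> D \<Longrightarrow> \<exists>a b. X = cbox a b" "\<Union>D = \<Omega>"
    using open_countable_Union_open_cbox[OF assms(1)] by metis
  have "\<forall>X\<in>D. AE x in lborel. x \<in> X \<longrightarrow> f x = 0" using D cb by (metis Pow_iff subsetD)
  then have "AE x in lborel. \<forall>X\<in>D. x \<in> X \<longrightarrow> f x = 0" 
    using AE_ball_countable[OF D(1), of "\<lambda>x X. x \<in> X \<longrightarrow> f x = 0" lborel] by blast
  then show ?thesis by eventually_elim (use D(4) in blast)
qed

section \<open>Mollification\<close>

lemma jensen_square:
  assumes P: "emeasure P (space P) \<le> 1" and f [measurable]: "f \<in> borel_measurable P"
  shows "ennreal ((\<integral>y. f y \<partial>P)\<^sup>2) \<le> (\<integral>\<^sup>+y. ennreal ((f y)\<^sup>2) \<partial>P)"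
proof (cases "integrable P f")
  case True
  have "ennreal ((\<integral>y. f y \<partial>P)\<^sup>2) = (ennreal \<bar>\<integral>y. f y \<partial>P\<bar>)\<^sup>2"
    by (simp add: ennreal_power)
  also have "\<dots> \<le> (\<integral>\<^sup>+y. ennreal \<bar>f y\<bar> \<partial>P)\<^sup>2"
    using integral_norm_bound_ennreal[OF True] by (intro power_mono) auto
  also have "\<dots> \<le> (\<integral>\<^sup>+y. (ennreal \<bar>f y\<bar>)\<^sup>2 \<partial>P) * emeasure P (space P)"
    using Cauchy_Schwarz_nn_integral[of "\<lambda>y. ennreal \<bar>f y\<bar>" P "\<lambda>_. 1"] by simp
  also have "\<dots> \<le> (\<integral>\<^sup>+y. (ennreal \<bar>f y\<bar>)\<^sup>2 \<partial>P) * 1" by (intro mult_left_mono P) simp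
  finally show ?thesis by (simp add: ennreal_power)
\<comment> \<open>For non-integrable \<open>f\<close> the Bochner integral is 0 by convention, so
  the left-hand side vanishes.\<close>
qed (simp add: not_integrable_integral_eq)

text \<open>An average of functions has at most the averaged squared norm. The translation estimate
  averages along a segment, the two mollification estimates over a small ball.\<close>

lemma nn_integral_jensen_square:
  assumes "sigma_finite_measure M" and P: "emeasure P (space P) \<le> 1"
    and f [measurable]: "(\<lambda>(x, y). f x y) \<in> borel_measurable (M \<Otimes>\<^sub>M P)"
  shows "(\<integral>\<^sup>+x. ennreal ((\<integral>y. f x y \<partial>P)\<^sup>2) \<partial>M) \<le> (\<integral>\<^sup>+y. \<integral>\<^sup>+x. ennreal ((f x y)\<^sup>2) \<partial>M \<partial>P)"
proof -
  interpret M: sigma_finite_measure M by fact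
  interpret P: finite_measure P using P by (intro finite_measureI) (auto simp: top_unique)
  interpret pair_sigma_finite M P ..
  have "(\<integral>\<^sup>+x. ennreal ((\<integral>y. f x y \<partial>P)\<^sup>2) \<partial>M) \<le> (\<integral>\<^sup>+x. \<integral>\<^sup>+y. ennreal ((f x y)\<^sup>2) \<partial>P \<partial>M)"
    by (intro nn_integral_mono jensen_square P) measurable
  also have "\<dots> = (\<integral>\<^sup>+y. \<integral>\<^sup>+x. ennreal ((f x y)\<^sup>2) \<partial>M \<partial>P)"
    by (rule Fubini'[symmetric]) measurable
  finally show ?thesis .
qed

text \<open>The increment is the average of \<open>G \<bullet> z\<close> along the segment from
  \<open>x\<close> to \<open>x + z\<close>, with \<open>P\<close> the uniform distribution on the
  unit interval; after Jensen each translate of \<open>G\<close> contributes the same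
  integral.\<close>

lemma translation_estimate:
  fixes f :: "real^'n \<Rightarrow> real"
  assumes d: "\<And>x. (f has_derivative (\<lambda>h. G x \<bullet> h)) (at x)" and G: "continuous_on UNIV G"
  shows "(\<integral>\<^sup>+x. ennreal ((f (x + z) - f x)\<^sup>2) \<partial>lborel) \<le> (\<integral>\<^sup>+x. ennreal ((G x \<bullet> z)\<^sup>2) \<partial>lborel)"
proof -
  define P where "P = density lborel (\<lambda>t. ennreal (indicator {0..1::real} t))"
  have [measurable]: "G \<in> borel_measurable borel" using G by (rule borel_measurable_continuous_onI)
  have sP [measurable_cong]: "sets P = sets borel" by (simp add: P_def)
  have P1: "emeasure P (space P) \<le> 1" by (simp add: P_def emeasure_density ennreal_indicator)
  have eq: "f (x + z) - f x = (\<integral>t. G (x + t *\<^sub>R z) \<bullet> z \<partial>P)" for x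
  proof -
    have "(\<integral>t. indicator {0..1} t *\<^sub>R (G (x + t *\<^sub>R z) \<bullet> z) \<partial>lborel) = f (x + 1 *\<^sub>R z) - f (x + 0 *\<^sub>R z)"
    proof (rule integral_FTC_atLeastAtMost)
      show "((\<lambda>t. f (x + t *\<^sub>R z)) has_vector_derivative G (x + t *\<^sub>R z) \<bullet> z) (at t within {0..1})" for t
      proof -
        have "((\<lambda>s. f (x + s *\<^sub>R z)) has_derivative (\<lambda>s. G (x + t *\<^sub>R z) \<bullet> (s *\<^sub>R z))) (at t)"
          by (rule has_derivative_compose[OF _ d]) (auto intro!: derivative_eq_intros)
        then have "((\<lambda>s. f (x + s *\<^sub>R z)) has_derivative (\<lambda>s. s *\<^sub>R (G (x + t *\<^sub>R z) \<bullet> z))) (at t)"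
          by (simp only: inner_scaleR_right real_scaleR_def)
        then show ?thesis unfolding has_vector_derivative_def by (rule has_derivative_at_withinI)
      qed
      show "continuous_on {0..1} (\<lambda>t. G (x + t *\<^sub>R z) \<bullet> z)"
        by (rule continuous_on_inner[OF continuous_on_compose2[OF G]]) (auto intro!: continuous_intros)
    qed simp
    moreover have "(\<integral>t. G (x + t *\<^sub>R z) \<bullet> z \<partial>P) = (\<integral>t. indicator {0..1} t *\<^sub>R (G (x + t *\<^sub>R z) \<bullet> z) \<partial>lborel)"
      unfolding P_def by (rule integral_density) auto
    ultimately show ?thesis by simp
  qed
  have "(\<integral>\<^sup>+x. ennreal ((f (x + z) - f x)\<^sup>2) \<partial>lborel)
      \<le> (\<integral>\<^sup>+t. \<integral>\<^sup>+x. ennreal ((G (x + t *\<^sub>R z) \<bullet> z)\<^sup>2) \<partial>lborel \<partial>P)"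
    unfolding eq
  proof (rule nn_integral_jensen_square[OF sigma_finite_lborel P1])
    show "(\<lambda>(x, t). G (x + t *\<^sub>R z) \<bullet> z) \<in> borel_measurable (lborel \<Otimes>\<^sub>M P)" by measurable
  qed
  also have "\<dots> = (\<integral>\<^sup>+t. \<integral>\<^sup>+x. ennreal ((G x \<bullet> z)\<^sup>2) \<partial>lborel \<partial>P)"
    by (intro nn_integral_cong nn_integral_lborel_translate[where f="\<lambda>x. ennreal ((G x \<bullet> z)\<^sup>2)"]) measurable
  also have "\<dots> = (\<integral>\<^sup>+x. ennreal ((G x \<bullet> z)\<^sup>2) \<partial>lborel) * emeasure P (space P)" by simp
  also have "\<dots> \<le> (\<integral>\<^sup>+x. ennreal ((G x \<bullet> z)\<^sup>2) \<partial>lborel) * 1" by (intro mult_left_mono P1) simp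
  finally show ?thesis by simp
qed

section \<open>Convolution with a test function\<close>

definition conv :: "('a::euclidean_space \<Rightarrow> real) \<Rightarrow> ('a \<Rightarrow> real) \<Rightarrow> 'a \<Rightarrow> real" where
  "conv R u x = (\<integral>y. R (x - y) * u y \<partial>lborel)"

lemma integrable_conv:
  assumes R: "R \<in> test_functions \<Omega>" and u: "integrable lborel u"
  shows "integrable lborel (\<lambda>y. R (x - y) * u y)"
proof -
  have [measurable]: "R \<in> borel_measurable borel" by (rule test_function_measurable[OF R])
  have [measurable]: "u \<in> borel_measurable borel" using borel_measurable_integrable[OF u] by simp
  obtain B where B: "\<And>x. \<bar>R x\<bar> \<le> B" using test_function_bounded(1)[OF R] by auto
  show ?thesis
  proof (rule Bochner_Integration.integrable_bound)
    show "integrable lborel (\<lambda>y. B * u y)" using u by simp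
    have "\<bar>R (x - y)\<bar> * \<bar>u y\<bar> \<le> \<bar>B\<bar> * \<bar>u y\<bar>" for y
      using B[of "x - y"] by (intro mult_right_mono) auto
    then show "AE y in lborel. norm (R (x - y) * u y) \<le> norm (B * u y)" by (simp add: abs_mult)
  qed measurable
qed

text \<open>Uniform continuity of \<open>grad R\<close> bounds the first-order remainder of
  \<open>R\<close> by \<open>e' * norm h\<close> uniformly in the base point, and this survives
  integration against \<open>u\<close>. Dividing by \<open>I + 1\<close> rather than
  \<open>I\<close> covers \<open>u = 0\<close>.\<close>

lemma has_derivative_conv:
  fixes R :: "real^'n \<Rightarrow> real"
  assumes R: "R \<in> test_functions \<Omega>" and u: "integrable lborel u"
  shows "(conv R u has_derivative (\<lambda>h. (\<chi> i. conv (partial_deriv i R) u x) \<bullet> h)) (at x)"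
proof -
  note s = test_functions_smooth[OF R]
  obtain K where K: "compact K" "\<And>x. x \<notin> K \<Longrightarrow> grad R x = 0" using test_functionsE[OF R] by metis
  have uc: "uniformly_continuous_on UNIV (grad R)"
    by (rule uniformly_continuous_compact_support[OF smooth_continuous_on_grad[OF s] K])
  have gi: "integrable lborel (\<lambda>y. (grad R (x - y) \<bullet> h) * u y)" for x h
  proof -
    have "integrable lborel (\<lambda>y. \<Sum>i\<in>UNIV. h $ i * (partial_deriv i R (x - y) * u y))"
      by (intro Bochner_Integration.integrable_sum integrable_mult_right integrable_conv[OF test_functions_partial_deriv[OF R] u])
    then show ?thesis
      by (simp add: inner_vec_def sum_distrib_left sum_distrib_right mult.commute mult.left_commute)
  qed
  have lin: "(\<chi> i. conv (partial_deriv i R) u x) \<bullet> h = (\<integral>y. (grad R (x - y) \<bullet> h) * u y \<partial>lborel)" for x h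
  proof -
    have "(\<integral>y. (grad R (x - y) \<bullet> h) * u y \<partial>lborel) = (\<integral>y. (\<Sum>i\<in>UNIV. h $ i * (partial_deriv i R (x - y) * u y)) \<partial>lborel)"
      by (intro Bochner_Integration.integral_cong)
         (simp_all add: inner_vec_def sum_distrib_left sum_distrib_right mult.commute mult.left_commute)
    also have "\<dots> = (\<Sum>i\<in>UNIV. h $ i * conv (partial_deriv i R) u x)"
      unfolding conv_def
      by (subst Bochner_Integration.integral_sum)
         (auto intro!: integrable_mult_right integrable_conv[OF test_functions_partial_deriv[OF R] u])
    finally show ?thesis by (simp add: inner_vec_def mult.commute)
  qed
  show ?thesis
    unfolding has_derivative_at_alt
  proof (intro conjI allI impI)
    show "bounded_linear (\<lambda>h. (\<chi> i. conv (partial_deriv i R) u x) \<bullet> h)" by (rule bounded_linear_inner_right)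
    fix e :: real assume e: "e > 0"
    define I where "I = (\<integral>y. \<bar>u y\<bar> \<partial>lborel)"
    have I: "I \<ge> 0" by (simp add: I_def)
    define e' where "e' = e / (I + 1)"
    have e': "e' > 0" using e I by (simp add: e'_def)
    obtain d where d: "d > 0" "\<And>y z. dist z y < d \<Longrightarrow> dist (grad R z) (grad R y) < e'"
      using uc e' unfolding uniformly_continuous_on_def by (metis UNIV_I)
    have lip: "\<bar>R (z + h) - R z - grad R z \<bullet> h\<bar> \<le> e' * norm h" if h: "norm h < d" for z h
    proof -
      have "norm (R (z + h) - R z - grad R z \<bullet> ((z + h) - z)) \<le> norm ((z + h) - z) * e'"
      proof (rule differentiable_bound_linearization[where S="ball z d" and f'="\<lambda>x h. grad R x \<bullet> h"])
        fix t :: real assume "t \<in> {0..1}"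
        then have "\<bar>t\<bar> * norm h \<le> 1 * norm h" by (intro mult_right_mono) auto
        then show "z + t *\<^sub>R (z + h - z) \<in> ball z d" using h by (simp add: dist_norm)
      next
        fix w assume w: "w \<in> ball z d"
        show "(R has_derivative (\<lambda>h. grad R w \<bullet> h)) (at w within ball z d)"
          by (rule has_derivative_at_withinI[OF smooth_has_derivative[OF s]])
        have le: "norm (grad R w - grad R z) \<le> e'"
          using d(2)[of w z] w by (simp add: dist_commute dist_norm less_imp_le)
        have ik: "\<bar>(grad R w - grad R z) \<bullet> k\<bar> \<le> e' * norm k" for k
          using Cauchy_Schwarz_ineq2[of "grad R w - grad R z" k] mult_right_mono[OF le norm_ge_zero[of k]] by linarith
        show "onorm ((\<lambda>h. grad R w \<bullet> h) - (\<lambda>h. grad R z \<bullet> h)) \<le> e'"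
        proof (rule onorm_bound)
          show "norm (((\<lambda>h. grad R w \<bullet> h) - (\<lambda>h. grad R z \<bullet> h)) k) \<le> e' * norm k" for k
            using ik[of k] by (simp add: inner_diff_left)
        qed (use e' in simp)
      qed (use d in simp)
      then show ?thesis by (simp add: mult.commute)
    qed
    show "\<exists>d>0. \<forall>y. norm (y - x) < d \<longrightarrow>
        norm (conv R u y - conv R u x - (\<chi> i. conv (partial_deriv i R) u x) \<bullet> (y - x)) \<le> e * norm (y - x)"
    proof (intro exI[of _ d] conjI allI impI d)
      fix y assume y: "norm (y - x) < d"
      define h where "h = y - x"
      note i = integrable_conv[OF R u, of y] integrable_conv[OF R u, of x] gi[of x h]
      have split: "R (y - w) * u w - R (x - w) * u w - (grad R (x - w) \<bullet> h) * u w
          = (R (x - w + h) - R (x - w) - grad R (x - w) \<bullet> h) * u w" for w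
      proof -
        have "y - w = x - w + h" by (simp add: h_def)
        then show ?thesis by (simp only: left_diff_distrib)
      qed
      have ii: "integrable lborel (\<lambda>w. R (y - w) * u w - R (x - w) * u w - (grad R (x - w) \<bullet> h) * u w)"
        using i by (intro Bochner_Integration.integrable_diff)
      have "conv R u y - conv R u x - (\<chi> i. conv (partial_deriv i R) u x) \<bullet> h
          = (\<integral>w. R (y - w) * u w - R (x - w) * u w - (grad R (x - w) \<bullet> h) * u w \<partial>lborel)"
        unfolding lin unfolding conv_def
        by (simp only: Bochner_Integration.integral_diff[OF Bochner_Integration.integrable_diff[OF i(1,2)] i(3)]
            Bochner_Integration.integral_diff[OF i(1,2)])
      also have "\<dots> = (\<integral>w. (R (x - w + h) - R (x - w) - grad R (x - w) \<bullet> h) * u w \<partial>lborel)"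
        by (simp only: split)
      also have "\<bar>\<dots>\<bar> \<le> (\<integral>w. (e' * norm h) * \<bar>u w\<bar> \<partial>lborel)"
      proof (rule integral_abs_bound_integral)
        show "integrable lborel (\<lambda>w. (R (x - w + h) - R (x - w) - grad R (x - w) \<bullet> h) * u w)"
          using ii by (simp only: split)
        show "integrable lborel (\<lambda>w. (e' * norm h) * \<bar>u w\<bar>)" using u by simp
        show "\<bar>(R (x - w + h) - R (x - w) - grad R (x - w) \<bullet> h) * u w\<bar> \<le> (e' * norm h) * \<bar>u w\<bar>" for w
          using lip[of h "x - w"] y by (auto simp: abs_mult h_def intro: mult_right_mono)
      qed
      also have "\<dots> = e' * I * norm h" by (simp add: I_def)
      also have "e' * I \<le> e" using e I by (simp add: e'_def field_simps)
      then have "e' * I * norm h \<le> e * norm h" by (rule mult_right_mono) simp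
      finally show "norm (conv R u y - conv R u x - (\<chi> i. conv (partial_deriv i R) u x) \<bullet> (y - x)) \<le> e * norm (y - x)"
        by (simp add: h_def)
    qed
  qed
qed

lemma smooth_conv:
  fixes R :: "real^'n \<Rightarrow> real"
  assumes R: "R \<in> test_functions \<Omega>" and u: "integrable lborel u"
  shows "smooth (conv R u)"
proof -
  have "fold partial_deriv is (conv R u) = conv (fold partial_deriv is R) u \<and> fold partial_deriv is R \<in> test_functions \<Omega>" for "is"
    using R
  proof (induction "is" arbitrary: R)
    case (Cons i "is")
    have "partial_deriv i (conv R u) = conv (partial_deriv i R) u"
      by (rule ext) (simp add: partial_deriv_eq[OF has_derivative_conv[OF Cons.prems u]] inner_axis)
    then show ?case using Cons.IH[OF test_functions_partial_deriv[OF Cons.prems, of i]] by simp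
  qed simp
  then show ?thesis
    unfolding smooth_def differentiable_on_def
    by (metis differentiableI differentiable_at_withinI has_derivative_conv u)
qed

text \<open>The standard mollifier. It depends on \<open>norm x\<close> only, so mollification
  commutes with reflections, which is needed to exploit polarization.\<close>

definition rho :: "real \<Rightarrow> real^'n \<Rightarrow> real" where
  "rho \<delta> x = bump 0 (\<delta>\<^sup>2 - (norm x)\<^sup>2) / (\<integral>y. bump 0 (\<delta>\<^sup>2 - (norm (y::real^'n))\<^sup>2) \<partial>lborel)"

lemma
  assumes \<delta>: "\<delta> > 0"
  shows rho_test: "(rho \<delta> :: real^'n \<Rightarrow> real) \<in> test_functions UNIV"
    and rho_nonneg: "0 \<le> rho \<delta> (x::real^'n)"
    and rho_eq_0: "\<delta> \<le> norm x \<Longrightarrow> rho \<delta> x = 0"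
    and rho_integral: "(\<integral>x. rho \<delta> (x::real^'n) \<partial>lborel) = 1"
proof -
  define b where "b y = bump 0 (\<delta>\<^sup>2 - (norm y)\<^sup>2)" for y :: "real^'n"
  define c where "c = (\<integral>y. b y \<partial>lborel)"
  have b: "b \<in> elem_smooth"
    unfolding b_def[abs_def] by (intro elem_smooth.bump elem_smooth_diff elem_smooth_norm2 elem_smooth.const)
  have b0: "b y = 0" if "\<delta> \<le> norm y" for y
    using power_mono[OF that, of 2] \<delta> by (simp add: b_def bump_def not_less)
  have bpos: "b y > 0" if "norm y < \<delta>" for y
    using power_strict_mono[OF that, of 2] by (simp add: b_def bump_pos)
  have bnn: "b y \<ge> 0" for y by (simp add: b_def bump_nonneg)
  have bt: "b \<in> test_functions UNIV"
    by (rule test_functionsI[of _ "cball 0 \<delta>"]) (use b b0 in \<open>auto intro: elem_smooth_imp_smooth\<close>)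
  note bi = test_function_integrable[OF bt]
  have "c \<noteq> 0"
  proof
    assume "c = 0"
    then have "AE y in lborel. b y = 0"
      using integral_nonneg_eq_0_iff_AE[OF bi] bnn by (simp add: c_def)
    then have "AE y in lborel. (y::real^'n) \<notin> ball 0 \<delta>"
      by eventually_elim (use bpos in force)
    then have "ball (0::real^'n) \<delta> \<in> null_sets lborel" by (subst AE_iff_null_sets) auto
    then have "emeasure lborel (ball (0::real^'n) \<delta>) = 0" by auto
    then show False using \<delta> unit_ball_vol_pos[of "real CARD('n)"] by (simp add: emeasure_ball)
  qed
  moreover have "c \<ge> 0" unfolding c_def using bnn by simp
  ultimately have c: "c > 0" by simp
  have req: "rho \<delta> y = b y / c" for y by (simp add: rho_def b_def c_def)
  show "0 \<le> rho \<delta> x" using bnn c by (simp add: req)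
  show "\<delta> \<le> norm x \<Longrightarrow> rho \<delta> x = 0" by (simp add: req b0)
  show "(\<integral>x. rho \<delta> (x::real^'n) \<partial>lborel) = 1" using c by (simp add: req c_def)
  have "(\<lambda>y. inverse c * b y) \<in> test_functions UNIV"
    using test_functions_linear_comb(1)[OF bt bt, of "inverse c" 0] by simp
  then show "(rho \<delta> :: real^'n \<Rightarrow> real) \<in> test_functions UNIV"
    by (simp add: req[abs_def] divide_inverse mult.commute)
qed

lemma rho_norm_cong:
  fixes x y :: "real^'n"
  shows "norm x = norm y \<Longrightarrow> rho \<delta> x = rho \<delta> y"
  by (simp add: rho_def)

text \<open>Seen as a probability measure on increments \<open>z\<close>, the kernel turns a
  mollification into the average of the translates \<open>u (x + z)\<close>, the form required by
  Jensen's inequality.\<close>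

definition moll :: "real \<Rightarrow> (real^'n) measure" where
  "moll \<delta> = density lborel (\<lambda>z. ennreal (rho \<delta> z))"

lemma sets_moll [simp, measurable_cong]: "sets (moll \<delta>) = sets borel"
  by (simp add: moll_def)

lemma space_moll [simp]: "space (moll \<delta>) = UNIV"
  by (simp add: moll_def)

lemma
  assumes \<delta>: "\<delta> > 0"
  shows emeasure_moll: "emeasure (moll \<delta> :: (real^'n) measure) UNIV = 1"
    and AE_moll: "AE z in (moll \<delta> :: (real^'n) measure). norm z < \<delta>"
proof -
  have [measurable]: "(rho \<delta> :: real^'n \<Rightarrow> real) \<in> borel_measurable borel"
    by (rule test_function_measurable(1)[OF rho_test[OF \<delta>]])
  have "(\<integral>\<^sup>+z. ennreal (rho \<delta> (z::real^'n)) \<partial>lborel) = 1"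
    using nn_integral_eq_integral[OF test_function_integrable[OF rho_test[OF \<delta>]]]
    by (simp add: rho_nonneg[OF \<delta>] rho_integral[OF \<delta>])
  then show "emeasure (moll \<delta> :: (real^'n) measure) UNIV = 1"
    unfolding moll_def by (subst emeasure_density) auto
  have pos: "norm z < \<delta>" if "0 < rho \<delta> z" for z :: "real^'n"
    using rho_eq_0[OF \<delta>, of z] that by (cases "\<delta> \<le> norm z") auto
  show "AE z in (moll \<delta> :: (real^'n) measure). norm z < \<delta>"
    unfolding moll_def using pos by (subst AE_density) auto
qed

abbreviation mollify :: "real \<Rightarrow> (real^'n \<Rightarrow> real) \<Rightarrow> real^'n \<Rightarrow> real" where
  "mollify \<delta> \<equiv> conv (rho \<delta>)"

lemma
  fixes u :: "real^'n \<Rightarrow> real"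
  assumes \<delta>: "\<delta> > 0" and u: "integrable lborel u"
  shows mollify_eq: "mollify \<delta> u x = (\<integral>z. u (x + z) \<partial>moll \<delta>)"
    and integrable_moll: "integrable (moll \<delta>) (\<lambda>z. u (x + z))"
proof -
  have [measurable]: "u \<in> borel_measurable borel" using borel_measurable_integrable[OF u] by simp
  have [measurable]: "(rho \<delta> :: real^'n \<Rightarrow> real) \<in> borel_measurable borel"
    by (rule test_function_measurable(1)[OF rho_test[OF \<delta>]])
  have m: "rho \<delta> (- z) = rho \<delta> z" for z :: "real^'n" by (rule rho_norm_cong) simp
  have "mollify \<delta> u x = (\<integral>z. rho \<delta> z * u (x + z) \<partial>lborel)"
    using integral_lborel_translate[of "\<lambda>y. rho \<delta> (x - y) * u y" x]
    by (simp add: conv_def m add.commute)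
  also have "\<dots> = (\<integral>z. u (x + z) \<partial>moll \<delta>)"
    unfolding moll_def by (subst integral_density) (auto simp: rho_nonneg[OF \<delta>])
  finally show "mollify \<delta> u x = (\<integral>z. u (x + z) \<partial>moll \<delta>)" .
  have "integrable lborel (\<lambda>z. rho \<delta> z * u (x + z))"
    using integrable_lborel_translate[of "\<lambda>y. rho \<delta> (x - y) * u y" x] integrable_conv[OF rho_test[OF \<delta>] u, of x]
    by (simp add: m add.commute)
  then show "integrable (moll \<delta>) (\<lambda>z. u (x + z))"
    unfolding moll_def by (subst integrable_density) (auto simp: rho_nonneg[OF \<delta>])
qed

lemma mollify_measurable:
  fixes u :: "real^'n \<Rightarrow> real"
  assumes "\<delta> > 0" "integrable lborel u" shows "mollify \<delta> u \<in> borel_measurable borel"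
  using smooth_continuous_on[OF smooth_conv[OF rho_test assms(2)]] assms(1)
  by (blast intro: borel_measurable_continuous_onI)

text \<open>Mollification commutes with translations and averages over them. Integrated over small
  \<open>h\<close> this says that it does not increase the energy \<open>nonlocal\<close>.\<close>

lemma mollify_translation:
  fixes u :: "real^'n \<Rightarrow> real"
  assumes \<delta>: "\<delta> > 0" and u: "integrable lborel u"
  shows "(\<integral>\<^sup>+x. ennreal ((mollify \<delta> u (x + h) - mollify \<delta> u x)\<^sup>2) \<partial>lborel)
    \<le> (\<integral>\<^sup>+x. ennreal ((u (x + h) - u x)\<^sup>2) \<partial>lborel)"
proof -
  have [measurable]: "u \<in> borel_measurable borel" using borel_measurable_integrable[OF u] by simp
  have "(\<integral>\<^sup>+x. ennreal ((mollify \<delta> u (x + h) - mollify \<delta> u x)\<^sup>2) \<partial>lborel)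
      = (\<integral>\<^sup>+x. ennreal ((\<integral>z. u (x + h + z) - u (x + z) \<partial>moll \<delta>)\<^sup>2) \<partial>lborel)"
    by (simp add: mollify_eq[OF \<delta> u] integrable_moll[OF \<delta> u])
  also have "\<dots> \<le> (\<integral>\<^sup>+z. \<integral>\<^sup>+x. ennreal ((u (x + h + z) - u (x + z))\<^sup>2) \<partial>lborel \<partial>moll \<delta>)"
  proof (rule nn_integral_jensen_square[OF sigma_finite_lborel])
    show "emeasure (moll \<delta>) (space (moll \<delta> :: (real^'n) measure)) \<le> 1" by (simp add: emeasure_moll[OF \<delta>])
    show "(\<lambda>(x, z). u (x + h + z) - u (x + z)) \<in> borel_measurable (lborel \<Otimes>\<^sub>M moll \<delta>)" by measurable
  qed
  also have "\<dots> = (\<integral>\<^sup>+(z::real^'n). \<integral>\<^sup>+x. ennreal ((u (x + h) - u x)\<^sup>2) \<partial>lborel \<partial>moll \<delta>)"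
  proof (rule nn_integral_cong)
    fix z :: "real^'n"
    show "(\<integral>\<^sup>+x. ennreal ((u (x + h + z) - u (x + z))\<^sup>2) \<partial>lborel) = (\<integral>\<^sup>+x. ennreal ((u (x + h) - u x)\<^sup>2) \<partial>lborel)"
      using nn_integral_lborel_translate[of "\<lambda>x. ennreal ((u (x + h) - u x)\<^sup>2)" z]
      by (simp add: add.assoc add.commute[of h z])
  qed
  also have "\<dots> = (\<integral>\<^sup>+x. ennreal ((u (x + h) - u x)\<^sup>2) \<partial>lborel)"
    using emeasure_moll[OF \<delta>, where ?'n='n] by simp
  finally show ?thesis .
qed

text \<open>The error \<open>mollify \<delta> u x - u x\<close> is an average of increments
  \<open>u (x + z) - u x\<close>, since \<open>moll\<close> has total mass 1.\<close>

lemma mollify_close: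
  fixes u :: "real^'n \<Rightarrow> real"
  assumes \<delta>: "\<delta> > 0" and u: "integrable lborel u"
    and C: "\<And>z. norm z < \<delta> \<Longrightarrow> (\<integral>\<^sup>+x. ennreal ((u (x + z) - u x)\<^sup>2) \<partial>lborel) \<le> C"
  shows "(\<integral>\<^sup>+x. ennreal ((mollify \<delta> u x - u x)\<^sup>2) \<partial>lborel) \<le> C"
proof -
  have [measurable]: "u \<in> borel_measurable borel" using borel_measurable_integrable[OF u] by simp
  interpret prob_space_moll: finite_measure "moll \<delta> :: (real^'n) measure"
    by (rule finite_measureI) (simp add: emeasure_moll[OF \<delta>])
  have m1: "measure (moll \<delta> :: (real^'n) measure) UNIV = 1" by (simp add: measure_def emeasure_moll[OF \<delta>])
  have "(\<integral>\<^sup>+x. ennreal ((mollify \<delta> u x - u x)\<^sup>2) \<partial>lborel)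
      = (\<integral>\<^sup>+x. ennreal ((\<integral>z. u (x + z) - u x \<partial>moll \<delta>)\<^sup>2) \<partial>lborel)"
    by (simp add: mollify_eq[OF \<delta> u] integrable_moll[OF \<delta> u] m1)
  also have "\<dots> \<le> (\<integral>\<^sup>+z. \<integral>\<^sup>+x. ennreal ((u (x + z) - u x)\<^sup>2) \<partial>lborel \<partial>moll \<delta>)"
  proof (rule nn_integral_jensen_square[OF sigma_finite_lborel])
    show "emeasure (moll \<delta>) (space (moll \<delta> :: (real^'n) measure)) \<le> 1" by (simp add: emeasure_moll[OF \<delta>])
    show "(\<lambda>(x, z). u (x + z) - u x) \<in> borel_measurable (lborel \<Otimes>\<^sub>M moll \<delta>)" by measurable
  qed
  also have "\<dots> \<le> (\<integral>\<^sup>+(z::real^'n). C \<partial>moll \<delta>)"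
  proof (rule nn_integral_mono_AE)
    show "AE z in (moll \<delta> :: (real^'n) measure). (\<integral>\<^sup>+x. ennreal ((u (x + z) - u x)\<^sup>2) \<partial>lborel) \<le> C"
      using AE_moll[OF \<delta>] by eventually_elim (rule C)
  qed
  also have "\<dots> = C" using emeasure_moll[OF \<delta>, where ?'n='n] by simp
  finally show ?thesis .
qed

lemma mollify_eq_0:
  fixes u :: "real^'n \<Rightarrow> real"
  assumes \<delta>: "\<delta> > 0" and u0: "\<And>x. r < norm x \<Longrightarrow> u x = 0" and x: "r + \<delta> < norm x"
  shows "mollify \<delta> u x = 0"
proof -
  have z: "rho \<delta> (x - y) * u y = 0" for y
  proof (cases "r < norm y")
    case False
    then have "\<delta> \<le> norm (x - y)" using x norm_triangle_ineq2[of x y] by linarith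
    then show ?thesis by (simp add: rho_eq_0[OF \<delta>])
  qed (simp add: u0)
  then show ?thesis unfolding conv_def z by simp
qed

lemma mollify_test_function:
  fixes u :: "real^'n \<Rightarrow> real"
  assumes "\<delta> > 0" "integrable lborel u" "\<And>x. r < norm x \<Longrightarrow> u x = 0" "cball 0 (r + \<delta>) \<subseteq> \<Omega>"
  shows "mollify \<delta> u \<in> test_functions \<Omega>"
  using assms smooth_conv[OF rho_test[OF assms(1)] assms(2)]
  by (intro test_functionsI[of _ "cball 0 (r + \<delta>)"]) (auto intro: mollify_eq_0[OF assms(1,3)])

lemma ball_borel [measurable]: "ball x r \<in> sets borel"
  by simp

section \<open>The Dirichlet integral as a limit of nonlocal energies\<close>

text \<open>A Gagliardo-type energy whose kernel is the indicator of a ball. It makes sense without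
  derivatives and involves \<open>u\<close> only through pairs of values, which a polarization
  rearranges. It is not normalized; the factor is \<open>kappa\<close>.\<close>

definition nonlocal :: "real \<Rightarrow> (real^'n \<Rightarrow> real) \<Rightarrow> ennreal" where
  "nonlocal \<epsilon> u = (\<integral>\<^sup>+z. indicator (ball 0 \<epsilon>) z * (\<integral>\<^sup>+x. ennreal ((u (x + z) - u x)\<^sup>2) \<partial>lborel) \<partial>lborel)"

text \<open>The second moment of the ball in one direction. \<open>axis undefined 1\<close> is just
  some unit vector; by rotation invariance the choice is immaterial.\<close>

definition kappa :: "'n::finite itself \<Rightarrow> real \<Rightarrow> ennreal" where
  "kappa _ \<epsilon> = (\<integral>\<^sup>+z. indicator (ball (0::real^'n) \<epsilon>) z * ennreal ((axis undefined 1 \<bullet> z)\<^sup>2) \<partial>lborel)"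

lemma nn_integral_ball_inner:
  fixes a :: "real^'n::{finite,wellorder}"
  shows "(\<integral>\<^sup>+z. indicator (ball 0 \<epsilon>) z * ennreal ((a \<bullet> z)\<^sup>2) \<partial>lborel) = ennreal ((norm a)\<^sup>2) * kappa TYPE('n) \<epsilon>"
proof -
  define e where "e = (axis undefined 1 :: real^'n::_)"
  obtain T where T: "orthogonal_transformation T" "T (norm a *\<^sub>R e) = a"
    using orthogonal_transformation_exists[of "norm a *\<^sub>R e" a] by (auto simp: e_def norm_axis_1)
  have lin: "linear T" and nrm: "norm (T z) = norm z" and inn: "T y \<bullet> T z = y \<bullet> z" for y z
    using T(1) by (auto simp: orthogonal_transformation_linear orthogonal_transformation_norm orthogonal_transformation_def)
  have [measurable]: "T \<in> borel_measurable borel"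
    using lin by (intro borel_measurable_continuous_onI linear_continuous_on linear_conv_bounded_linear[THEN iffD1])
  have "(\<integral>\<^sup>+z. indicator (ball 0 \<epsilon>) z * ennreal ((a \<bullet> z)\<^sup>2) \<partial>lborel)
      = (\<integral>\<^sup>+z. indicator (ball 0 \<epsilon>) z * ennreal ((a \<bullet> z)\<^sup>2) \<partial>distr lborel borel T)"
    by (simp add: lborel_distr_orthogonal[OF T(1)])
  also have "\<dots> = (\<integral>\<^sup>+z. indicator (ball 0 \<epsilon>) (T z) * ennreal ((a \<bullet> T z)\<^sup>2) \<partial>lborel)"
    by (rule nn_integral_distr) auto
  also have "\<dots> = (\<integral>\<^sup>+z. ennreal ((norm a)\<^sup>2) * (indicator (ball 0 \<epsilon>) z * ennreal ((e \<bullet> z)\<^sup>2)) \<partial>lborel)"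
  proof (rule nn_integral_cong)
    fix z
    have "a \<bullet> T z = norm a * (e \<bullet> z)" using inn[of "norm a *\<^sub>R e" z] T(2) by simp
    then show "indicator (ball 0 \<epsilon>) (T z) * ennreal ((a \<bullet> T z)\<^sup>2) = ennreal ((norm a)\<^sup>2) * (indicator (ball 0 \<epsilon>) z * ennreal ((e \<bullet> z)\<^sup>2))"
      by (simp add: indicator_def nrm power_mult_distrib ennreal_mult)
  qed
  also have "\<dots> = ennreal ((norm a)\<^sup>2) * kappa TYPE('n) \<epsilon>"
    unfolding kappa_def e_def by (rule nn_integral_cmult) measurable
  finally show ?thesis .
qed

lemma nn_integral_lborel_scale:
  fixes f :: "'a::euclidean_space \<Rightarrow> ennreal"
  assumes [measurable]: "f \<in> borel_measurable borel" and c: "c > 0"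
  shows "(\<integral>\<^sup>+x. f x \<partial>lborel) = ennreal (c ^ DIM('a)) * (\<integral>\<^sup>+x. f (c *\<^sub>R x) \<partial>lborel)"
  by (subst lborel_affine[of c 0]) (use c in \<open>auto simp: nn_integral_density nn_integral_distr nn_integral_cmult\<close>)

lemma kappa_scale: "\<epsilon> > 0 \<Longrightarrow> kappa TYPE('n) \<epsilon> = ennreal (\<epsilon> ^ CARD('n)) * (ennreal (\<epsilon>\<^sup>2) * kappa TYPE('n::finite) 1)"
proof -
  assume e: "\<epsilon> > 0"
  have meas: "(\<lambda>z. indicator (ball (0::real^'n) \<epsilon>) z * ennreal ((axis undefined 1 \<bullet> z)\<^sup>2)) \<in> borel_measurable borel"
    by measurable
  have "kappa TYPE('n) \<epsilon> = ennreal (\<epsilon> ^ CARD('n)) *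
      (\<integral>\<^sup>+z. indicator (ball (0::real^'n) \<epsilon>) (\<epsilon> *\<^sub>R z) * ennreal ((axis undefined 1 \<bullet> (\<epsilon> *\<^sub>R z))\<^sup>2) \<partial>lborel)"
    unfolding kappa_def using nn_integral_lborel_scale[OF meas e] by simp
  also have "(\<integral>\<^sup>+z. indicator (ball (0::real^'n) \<epsilon>) (\<epsilon> *\<^sub>R z) * ennreal ((axis undefined 1 \<bullet> (\<epsilon> *\<^sub>R z))\<^sup>2) \<partial>lborel)
      = (\<integral>\<^sup>+z. ennreal (\<epsilon>\<^sup>2) * (indicator (ball (0::real^'n) 1) z * ennreal ((axis undefined 1 \<bullet> z)\<^sup>2)) \<partial>lborel)"
    using e by (intro nn_integral_cong) (auto simp: indicator_def power_mult_distrib ennreal_mult)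
  also have "\<dots> = ennreal (\<epsilon>\<^sup>2) * kappa TYPE('n) 1"
    unfolding kappa_def by (rule nn_integral_cmult) measurable
  finally show ?thesis .
qed

lemma kappa_1: "kappa TYPE('n::finite) 1 \<noteq> 0" "kappa TYPE('n) 1 \<noteq> top"
proof -
  let ?e = "axis undefined 1 :: real^'n"
  have "kappa TYPE('n) 1 \<le> (\<integral>\<^sup>+z. indicator (ball (0::real^'n) 1) z \<partial>lborel)"
    unfolding kappa_def
  proof (rule nn_integral_mono)
    fix z :: "real^'n"
    have "(?e \<bullet> z)\<^sup>2 \<le> 1" if "norm z < 1"
      using Cauchy_Schwarz_ineq2[of ?e z] that by (simp add: norm_axis_1 abs_square_le_1)
    then show "indicator (ball 0 1) z * ennreal ((?e \<bullet> z)\<^sup>2) \<le> indicator (ball 0 1) z"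
      by (auto simp: indicator_def)
  qed
  then show "kappa TYPE('n) 1 \<noteq> top"
    using emeasure_lborel_ball_finite[of "0::real^'n" 1] by (auto simp: top_unique)
  show "kappa TYPE('n) 1 \<noteq> 0"
  proof
    assume "kappa TYPE('n) 1 = 0"
    then have "AE z in lborel. indicator (ball (0::real^'n) 1) z * ennreal ((?e \<bullet> z)\<^sup>2) = 0"
      unfolding kappa_def by (subst (asm) nn_integral_0_iff_AE) auto
    \<comment> \<open>This ball lies in the unit ball and in the half-space where the inner product
      with the axis vector is positive; it has positive measure.\<close>
    then have "AE z in lborel. z \<notin> ball ((1/2) *\<^sub>R ?e) (1/2)"
    proof eventually_elim
      case (elim z)
      show ?case
      proof
        assume z: "z \<in> ball ((1/2) *\<^sub>R ?e) (1/2)"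
        then have d: "norm (z - (1/2) *\<^sub>R ?e) < 1/2" by (simp add: dist_norm norm_minus_commute)
        have "norm z \<le> norm (z - (1/2) *\<^sub>R ?e) + norm ((1/2) *\<^sub>R ?e)" using norm_triangle_ineq[of "z - (1/2) *\<^sub>R ?e" "(1/2) *\<^sub>R ?e"] by simp
        then have z1: "norm z < 1" using d by (simp add: norm_axis_1)
        have "\<bar>?e \<bullet> (z - (1/2) *\<^sub>R ?e)\<bar> < 1/2"
          using Cauchy_Schwarz_ineq2[of ?e "z - (1/2) *\<^sub>R ?e"] d by (simp add: norm_axis_1)
        moreover have "?e \<bullet> (z - (1/2) *\<^sub>R ?e) = ?e \<bullet> z - 1/2"
          by (simp add: inner_diff_right inner_axis_axis)
        ultimately have "?e \<bullet> z > 0" by linarith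
        with z1 show False using elim by (simp add: indicator_def)
      qed
    qed
    then have "ball ((1/2) *\<^sub>R ?e) (1/2) \<in> null_sets lborel" by (subst AE_iff_null_sets) auto
    then have "emeasure lborel (ball ((1/2) *\<^sub>R ?e) (1/2)) = 0" by auto
    then show False using unit_ball_vol_pos[of "real CARD('n)"] by (simp add: emeasure_ball)
  qed
qed

lemma nonlocal_le:
  fixes \<phi> :: "real^'n::{finite,wellorder} \<Rightarrow> real"
  assumes "\<phi> \<in> test_functions \<Omega>"
  shows "nonlocal \<epsilon> \<phi> \<le> kappa TYPE('n) \<epsilon> * (\<integral>\<^sup>+x. ennreal ((norm (grad \<phi> x))\<^sup>2) \<partial>lborel)"
proof -
  note s = test_functions_smooth[OF assms]
  have [measurable]: "grad \<phi> \<in> borel_measurable borel" by (rule test_function_measurable[OF assms])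
  have "nonlocal \<epsilon> \<phi> \<le> (\<integral>\<^sup>+z. indicator (ball 0 \<epsilon>) z * (\<integral>\<^sup>+x. ennreal ((grad \<phi> x \<bullet> z)\<^sup>2) \<partial>lborel) \<partial>lborel)"
    unfolding nonlocal_def
    by (intro nn_integral_mono mult_left_mono translation_estimate smooth_has_derivative s smooth_continuous_on_grad) auto
  also have "\<dots> = (\<integral>\<^sup>+z. \<integral>\<^sup>+x. indicator (ball 0 \<epsilon>) z * ennreal ((grad \<phi> x \<bullet> z)\<^sup>2) \<partial>lborel \<partial>lborel)"
    by (intro nn_integral_cong nn_integral_cmult[symmetric]) measurable
  also have "\<dots> = (\<integral>\<^sup>+x. \<integral>\<^sup>+z. indicator (ball 0 \<epsilon>) z * ennreal ((grad \<phi> x \<bullet> z)\<^sup>2) \<partial>lborel \<partial>lborel)"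
    by (rule lborel_pair.Fubini') measurable
  also have "\<dots> = (\<integral>\<^sup>+x. kappa TYPE('n) \<epsilon> * ennreal ((norm (grad \<phi> x))\<^sup>2) \<partial>lborel)"
    by (simp add: nn_integral_ball_inner mult.commute)
  also have "\<dots> = kappa TYPE('n) \<epsilon> * (\<integral>\<^sup>+x. ennreal ((norm (grad \<phi> x))\<^sup>2) \<partial>lborel)"
    by (rule nn_integral_cmult) measurable
  finally show ?thesis .
qed

text \<open>Converse of \<open>nonlocal_le\<close>: the difference quotients of the smooth
  \<open>\<psi>\<close> tend pointwise to \<open>grad \<psi> x \<bullet> z\<close>, and Fatou's
  lemma is applied first in \<open>x\<close>, then in \<open>z\<close>.\<close>

lemma dirichlet_le_nonlocal:
  fixes \<psi> :: "real^'n::{finite,wellorder} \<Rightarrow> real"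
  assumes "\<psi> \<in> test_functions \<Omega>" and le: "\<And>\<epsilon>. \<epsilon> > 0 \<Longrightarrow> nonlocal \<epsilon> \<psi> \<le> kappa TYPE('n) \<epsilon> * A"
  shows "(\<integral>\<^sup>+x. ennreal ((norm (grad \<psi> x))\<^sup>2) \<partial>lborel) \<le> A"
proof -
  note s = test_functions_smooth[OF assms(1)]
  have [measurable]: "\<psi> \<in> borel_measurable borel" "grad \<psi> \<in> borel_measurable borel"
    by (rule test_function_measurable[OF assms(1)])+
  define t where "t n = 1 / real (Suc n)" for n
  have t: "0 < t n" for n by (simp add: t_def)
  have t0: "t \<longlonglongrightarrow> 0" using LIMSEQ_inverse_real_of_nat unfolding t_def[abs_def] inverse_eq_divide .
  have lim: "(\<lambda>n. (\<psi> (x + t n *\<^sub>R z) - \<psi> x) / t n) \<longlonglongrightarrow> grad \<psi> x \<bullet> z" for x z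
  proof -
    have "((\<lambda>s. \<psi> (x + s *\<^sub>R z)) has_derivative (\<lambda>s. grad \<psi> (x + 0 *\<^sub>R z) \<bullet> (s *\<^sub>R z))) (at 0)"
      by (rule has_derivative_compose[OF _ smooth_has_derivative[OF s]]) (auto intro!: derivative_eq_intros)
    then have "((\<lambda>s. \<psi> (x + s *\<^sub>R z)) has_real_derivative grad \<psi> x \<bullet> z) (at 0)"
      by (simp add: has_field_derivative_def mult_commute_abs)
    then have "((\<lambda>s. (\<psi> (x + s *\<^sub>R z) - \<psi> x) / s) \<longlongrightarrow> grad \<psi> x \<bullet> z) (at 0)"
      by (simp add: DERIV_def)
    moreover have "filterlim t (at 0) sequentially"
      unfolding filterlim_at using less_imp_neq[OF t] t0 by auto
    ultimately show ?thesis by (rule filterlim_compose)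
  qed
  define Q where "Q n z x = ennreal (((\<psi> (x + t n *\<^sub>R z) - \<psi> x) / t n)\<^sup>2)" for n x z
  have [measurable]: "case_prod (Q n) \<in> borel_measurable (borel \<Otimes>\<^sub>M borel)" for n unfolding Q_def by measurable
  have Qlim: "ennreal ((grad \<psi> x \<bullet> z)\<^sup>2) = liminf (\<lambda>n. Q n z x)" for x z
    unfolding Q_def by (intro lim_imp_Liminf[symmetric] tendsto_ennrealI tendsto_power lim) simp
  \<comment> \<open>Substituting \<open>t n *\<^sub>R z\<close> for \<open>z\<close> yields the
    Jacobian \<open>t n ^ CARD('n)\<close> and the square of \<open>t n\<close> from the quotient.
    By \<open>kappa_scale\<close> the same factor stands on the right and cancels.\<close>
  have bound: "(\<integral>\<^sup>+z. indicator (ball 0 1) z * (\<integral>\<^sup>+x. Q n z x \<partial>lborel) \<partial>lborel) \<le> kappa TYPE('n) 1 * A" for n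
  proof -
    let ?c = "ennreal (t n ^ CARD('n)) * ennreal ((t n)\<^sup>2)"
    have inner: "(\<integral>\<^sup>+x. ennreal ((\<psi> (x + t n *\<^sub>R z) - \<psi> x)\<^sup>2) \<partial>lborel) = ennreal ((t n)\<^sup>2) * (\<integral>\<^sup>+x. Q n z x \<partial>lborel)" for z
      unfolding Q_def using t[of n]
      by (subst nn_integral_cmult[symmetric]) (auto simp: power_divide intro!: nn_integral_cong simp flip: ennreal_mult)
    have meas: "(\<lambda>z. indicator (ball 0 (t n)) z * (\<integral>\<^sup>+x. ennreal ((\<psi> (x + z) - \<psi> x)\<^sup>2) \<partial>lborel)) \<in> borel_measurable borel"
      by measurable
    have "nonlocal (t n) \<psi> = ennreal (t n ^ CARD('n)) *
        (\<integral>\<^sup>+z. indicator (ball 0 (t n)) (t n *\<^sub>R z) * (\<integral>\<^sup>+x. ennreal ((\<psi> (x + t n *\<^sub>R z) - \<psi> x)\<^sup>2) \<partial>lborel) \<partial>lborel)"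
      unfolding nonlocal_def using nn_integral_lborel_scale[OF meas t[of n]] by simp
    also have "(\<integral>\<^sup>+z. indicator (ball 0 (t n)) (t n *\<^sub>R z) * (\<integral>\<^sup>+x. ennreal ((\<psi> (x + t n *\<^sub>R z) - \<psi> x)\<^sup>2) \<partial>lborel) \<partial>lborel)
        = (\<integral>\<^sup>+z. ennreal ((t n)\<^sup>2) * (indicator (ball 0 1) z * (\<integral>\<^sup>+x. Q n z x \<partial>lborel)) \<partial>lborel)"
      unfolding inner using t[of n] by (intro nn_integral_cong) (auto simp: indicator_def)
    also have "\<dots> = ennreal ((t n)\<^sup>2) * (\<integral>\<^sup>+z. indicator (ball 0 1) z * (\<integral>\<^sup>+x. Q n z x \<partial>lborel) \<partial>lborel)"
      by (rule nn_integral_cmult) measurable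
    finally have "?c * (\<integral>\<^sup>+z. indicator (ball 0 1) z * (\<integral>\<^sup>+x. Q n z x \<partial>lborel) \<partial>lborel) = nonlocal (t n) \<psi>"
      by (simp add: mult.assoc)
    also have "\<dots> \<le> ?c * (kappa TYPE('n) 1 * A)"
      using le[OF t[of n]] kappa_scale[OF t[of n], where ?'n='n] by (simp add: mult.assoc)
    finally show ?thesis
      using t[of n] by (subst (asm) ennreal_mult_le_mult_iff) (auto simp: ennreal_mult_eq_top_iff)
  qed
  have "kappa TYPE('n) 1 * (\<integral>\<^sup>+x. ennreal ((norm (grad \<psi> x))\<^sup>2) \<partial>lborel) = (\<integral>\<^sup>+x. kappa TYPE('n) 1 * ennreal ((norm (grad \<psi> x))\<^sup>2) \<partial>lborel)"
    by (rule nn_integral_cmult[symmetric]) measurable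
  also have "\<dots> = (\<integral>\<^sup>+x. \<integral>\<^sup>+z. indicator (ball 0 1) z * ennreal ((grad \<psi> x \<bullet> z)\<^sup>2) \<partial>lborel \<partial>lborel)"
    by (simp add: nn_integral_ball_inner mult.commute)
  also have "\<dots> = (\<integral>\<^sup>+z. \<integral>\<^sup>+x. indicator (ball 0 1) z * ennreal ((grad \<psi> x \<bullet> z)\<^sup>2) \<partial>lborel \<partial>lborel)"
    by (rule lborel_pair.Fubini') measurable
  also have "\<dots> = (\<integral>\<^sup>+z. indicator (ball 0 1) z * (\<integral>\<^sup>+x. liminf (\<lambda>n. Q n z x) \<partial>lborel) \<partial>lborel)"
    unfolding Qlim[symmetric] by (intro nn_integral_cong nn_integral_cmult) measurable
  also have "\<dots> \<le> (\<integral>\<^sup>+z. liminf (\<lambda>n. indicator (ball 0 1) z * (\<integral>\<^sup>+x. Q n z x \<partial>lborel)) \<partial>lborel)"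
  proof (rule nn_integral_mono)
    fix z :: "real^'n::_"
    have "(\<integral>\<^sup>+x. liminf (\<lambda>n. Q n z x) \<partial>lborel) \<le> liminf (\<lambda>n. \<integral>\<^sup>+x. Q n z x \<partial>lborel)"
      by (rule nn_integral_liminf) measurable
    then show "indicator (ball 0 1) z * (\<integral>\<^sup>+x. liminf (\<lambda>n. Q n z x) \<partial>lborel) \<le> liminf (\<lambda>n. indicator (ball 0 1) z * (\<integral>\<^sup>+x. Q n z x \<partial>lborel))"
      by (cases "z \<in> ball 0 1") auto
  qed
  also have "\<dots> \<le> liminf (\<lambda>n. \<integral>\<^sup>+z. indicator (ball 0 1) z * (\<integral>\<^sup>+x. Q n z x \<partial>lborel) \<partial>lborel)"
    by (rule nn_integral_liminf) measurable
  also have "\<dots> \<le> liminf (\<lambda>n. kappa TYPE('n) 1 * A)"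
    by (intro Liminf_mono always_eventually allI bound)
  also have "\<dots> = kappa TYPE('n) 1 * A" by (rule Liminf_const) simp
  finally show ?thesis
    using kappa_1[where ?'n='n] by (subst (asm) ennreal_mult_le_mult_iff) auto
qed

section \<open>The closure of the test functions in the Dirichlet norm\<close>

text \<open>The closure in \<open>L2\<close> times \<open>L2\<close> of the graph of
  \<open>grad\<close> on test functions. Functions live on the whole space, so extension by zero is
  built in, and carrying \<open>V\<close> along avoids the choice made in
  \<open>weak_gradient\<close>.\<close>

definition h0_pair :: "(real^'n) set \<Rightarrow> (real^'n \<Rightarrow> real) \<Rightarrow> (real^'n \<Rightarrow> real^'n) \<Rightarrow> bool" where
  "h0_pair \<Omega> u V \<longleftrightarrow> square_integrable lborel u \<and> square_integrable lborel V \<and>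
    (\<forall>e>0. \<exists>\<phi>\<in>test_functions \<Omega>. l2norm lborel (\<lambda>x. \<phi> x - u x) < e \<and> l2norm lborel (\<lambda>x. grad \<phi> x - V x) < e)"

lemma h0_pairD:
  assumes "h0_pair \<Omega> u V"
  shows "square_integrable lborel u" "square_integrable lborel V"
    and "u \<in> borel_measurable borel" "V \<in> borel_measurable borel"
  using assms square_integrable_measurable[of lborel u] square_integrable_measurable[of lborel V]
  by (auto simp: h0_pair_def)

lemma tendsto_0_inverse_Suc:
  assumes "\<And>n. 0 \<le> f n" "\<And>n. f n < 1 / real (Suc n)" shows "f \<longlonglongrightarrow> 0"
  by (rule Lim_null_comparison[OF _ LIMSEQ_inverse_real_of_nat])
     (use assms less_imp_le[OF assms(2)] in \<open>auto simp: inverse_eq_divide\<close>)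

lemma h0_pair_sequence:
  assumes "h0_pair \<Omega> u V"
  obtains \<phi> where "\<And>n. \<phi> n \<in> test_functions \<Omega>" "(\<lambda>n. l2norm lborel (\<lambda>x. \<phi> n x - u x)) \<longlonglongrightarrow> 0"
    "(\<lambda>n. l2norm lborel (\<lambda>x. grad (\<phi> n) x - V x)) \<longlonglongrightarrow> 0"
proof -
  define P where "P n \<phi> \<longleftrightarrow> \<phi> \<in> test_functions \<Omega> \<and> l2norm lborel (\<lambda>x. \<phi> x - u x) < 1 / real (Suc n)
      \<and> l2norm lborel (\<lambda>x. grad \<phi> x - V x) < 1 / real (Suc n)" for n \<phi>
  have "\<exists>\<phi>. P n \<phi>" for n
  proof -
    have "0 < 1 / real (Suc n)" by simp
    then show ?thesis using assms unfolding h0_pair_def P_def by blast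
  qed
  then obtain \<phi> where "\<And>n. P n (\<phi> n)" by metis
  then have \<phi>: "\<And>n. \<phi> n \<in> test_functions \<Omega>" "\<And>n. l2norm lborel (\<lambda>x. \<phi> n x - u x) < 1 / real (Suc n)"
    "\<And>n. l2norm lborel (\<lambda>x. grad (\<phi> n) x - V x) < 1 / real (Suc n)" by (simp_all only: P_def)
  show thesis
    by (rule that[OF \<phi>(1)]) (rule tendsto_0_inverse_Suc[OF l2norm_nonneg \<phi>(2)], rule tendsto_0_inverse_Suc[OF l2norm_nonneg \<phi>(3)])
qed

lemma h0_pairI:
  assumes "square_integrable lborel u" "square_integrable lborel V" "\<And>n. \<phi> n \<in> test_functions \<Omega>"
    and lim: "(\<lambda>n. l2norm lborel (\<lambda>x. \<phi> n x - u x)) \<longlonglongrightarrow> 0" "(\<lambda>n. l2norm lborel (\<lambda>x. grad (\<phi> n) x - V x)) \<longlonglongrightarrow> 0"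
  shows "h0_pair \<Omega> u V"
  unfolding h0_pair_def
proof (intro conjI assms allI impI)
  fix e :: real assume "e > 0"
  then have "\<forall>\<^sub>F n in sequentially. l2norm lborel (\<lambda>x. \<phi> n x - u x) < e \<and> l2norm lborel (\<lambda>x. grad (\<phi> n) x - V x) < e"
    using order_tendstoD(2)[OF lim(1)] order_tendstoD(2)[OF lim(2)] by (intro eventually_conj) auto
  then obtain n where "l2norm lborel (\<lambda>x. \<phi> n x - u x) < e \<and> l2norm lborel (\<lambda>x. grad (\<phi> n) x - V x) < e"
    by (auto simp: eventually_sequentially)
  then show "\<exists>\<phi>\<in>test_functions \<Omega>. l2norm lborel (\<lambda>x. \<phi> x - u x) < e \<and> l2norm lborel (\<lambda>x. grad \<phi> x - V x) < e"
    using assms(3) by blast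
qed

lemma h0_pair_test_function: "\<phi> \<in> test_functions \<Omega> \<Longrightarrow> h0_pair \<Omega> \<phi> (grad \<phi>)"
  by (rule h0_pairI[of _ _ "\<lambda>_. \<phi>"]) (auto intro: test_function_square_integrable)

lemma h0_pair_zero: "h0_pair \<Omega> (\<lambda>x. 0) (\<lambda>x. 0)"
proof -
  have "grad (\<lambda>x::real^'a. 0) = (\<lambda>x. 0)" by (rule ext) simp
  then show ?thesis using h0_pair_test_function[OF zero_test_function, of \<Omega>] by simp
qed

lemma h0_pair_linear_comb:
  assumes "h0_pair \<Omega> u U" "h0_pair \<Omega> v V"
  shows "h0_pair \<Omega> (\<lambda>x. a * u x + b * v x) (\<lambda>x. a *\<^sub>R U x + b *\<^sub>R V x)"
proof -
  obtain \<phi> where \<phi>: "\<And>n. \<phi> n \<in> test_functions \<Omega>" "(\<lambda>n. l2norm lborel (\<lambda>x. \<phi> n x - u x)) \<longlonglongrightarrow> 0"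
    "(\<lambda>n. l2norm lborel (\<lambda>x. grad (\<phi> n) x - U x)) \<longlonglongrightarrow> 0" by (rule h0_pair_sequence[OF assms(1)]) (rule that)
  obtain \<psi> where \<psi>: "\<And>n. \<psi> n \<in> test_functions \<Omega>" "(\<lambda>n. l2norm lborel (\<lambda>x. \<psi> n x - v x)) \<longlonglongrightarrow> 0"
    "(\<lambda>n. l2norm lborel (\<lambda>x. grad (\<psi> n) x - V x)) \<longlonglongrightarrow> 0" by (rule h0_pair_sequence[OF assms(2)]) (rule that)
  note sq = h0_pairD(1,2)[OF assms(1)] h0_pairD(1,2)[OF assms(2)]
  have lim: "(\<lambda>n. l2norm lborel (\<lambda>x. (a *\<^sub>R F n x + b *\<^sub>R G n x) - (a *\<^sub>R f x + b *\<^sub>R g x))) \<longlonglongrightarrow> 0"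
    if "\<And>n. square_integrable lborel (F n)" "\<And>n. square_integrable lborel (G n)"
      "square_integrable lborel f" "square_integrable lborel g"
      "(\<lambda>n. l2norm lborel (\<lambda>x. F n x - f x)) \<longlonglongrightarrow> 0" "(\<lambda>n. l2norm lborel (\<lambda>x. G n x - g x)) \<longlonglongrightarrow> 0"
    for F G :: "nat \<Rightarrow> real^'a \<Rightarrow> 'b::euclidean_space" and f g
  proof (rule Lim_null_comparison)
    show "(\<lambda>n. \<bar>a\<bar> * l2norm lborel (\<lambda>x. F n x - f x) + \<bar>b\<bar> * l2norm lborel (\<lambda>x. G n x - g x)) \<longlonglongrightarrow> 0"
      using tendsto_add[OF tendsto_mult_right[OF that(5), of "\<bar>a\<bar>"] tendsto_mult_right[OF that(6), of "\<bar>b\<bar>"]] by (simp add: mult.commute)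
    have "l2norm lborel (\<lambda>x. (a *\<^sub>R F n x + b *\<^sub>R G n x) - (a *\<^sub>R f x + b *\<^sub>R g x))
        \<le> \<bar>a\<bar> * l2norm lborel (\<lambda>x. F n x - f x) + \<bar>b\<bar> * l2norm lborel (\<lambda>x. G n x - g x)" for n
      using l2norm_triangle[OF square_integrable_scaleR(1)[OF square_integrable_diff(1)[OF that(1,3)], of a n]
          square_integrable_scaleR(1)[OF square_integrable_diff(1)[OF that(2,4)], of b n]]
        square_integrable_scaleR(2)[OF square_integrable_diff(1)[OF that(1,3)], of a n]
        square_integrable_scaleR(2)[OF square_integrable_diff(1)[OF that(2,4)], of b n]
      by (simp add: algebra_simps)
    then show "\<forall>\<^sub>F n in sequentially. norm (l2norm lborel (\<lambda>x. (a *\<^sub>R F n x + b *\<^sub>R G n x) - (a *\<^sub>R f x + b *\<^sub>R g x)))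
        \<le> \<bar>a\<bar> * l2norm lborel (\<lambda>x. F n x - f x) + \<bar>b\<bar> * l2norm lborel (\<lambda>x. G n x - g x)" by simp
  qed
  show ?thesis
  proof (rule h0_pairI[where \<phi>="\<lambda>n x. a * \<phi> n x + b * \<psi> n x"])
    show "square_integrable lborel (\<lambda>x. a * u x + b * v x)" "square_integrable lborel (\<lambda>x. a *\<^sub>R U x + b *\<^sub>R V x)"
      using square_integrable_add(1)[OF square_integrable_scaleR(1)[OF sq(1), of a] square_integrable_scaleR(1)[OF sq(3), of b]]
        square_integrable_add(1)[OF square_integrable_scaleR(1)[OF sq(2), of a] square_integrable_scaleR(1)[OF sq(4), of b]]
      by simp_all
    show "(\<lambda>x. a * \<phi> n x + b * \<psi> n x) \<in> test_functions \<Omega>" for n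
      by (rule test_functions_linear_comb(1)[OF \<phi>(1) \<psi>(1)])
    show "(\<lambda>n. l2norm lborel (\<lambda>x. (a * \<phi> n x + b * \<psi> n x) - (a * u x + b * v x))) \<longlonglongrightarrow> 0"
      using lim[OF test_function_square_integrable(1)[OF \<phi>(1)] test_function_square_integrable(1)[OF \<psi>(1)] sq(1,3) \<phi>(2) \<psi>(2)] by simp
    show "(\<lambda>n. l2norm lborel (\<lambda>x. grad (\<lambda>x. a * \<phi> n x + b * \<psi> n x) x - (a *\<^sub>R U x + b *\<^sub>R V x))) \<longlonglongrightarrow> 0"
      unfolding grad_linear_comb[OF \<phi>(1) \<psi>(1)]
      by (rule lim[OF test_function_square_integrable(2)[OF \<phi>(1)] test_function_square_integrable(2)[OF \<psi>(1)] sq(2,4) \<phi>(3) \<psi>(3)])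
  qed
qed

lemma h0_pair_cong_AE:
  assumes "h0_pair \<Omega> u V" "u' \<in> borel_measurable borel" "V' \<in> borel_measurable borel"
    and ae: "AE x in lborel. u x = u' x" "AE x in lborel. V x = V' x"
  shows "h0_pair \<Omega> u' V'"
proof -
  obtain \<phi> where \<phi>: "\<And>n. \<phi> n \<in> test_functions \<Omega>" "(\<lambda>n. l2norm lborel (\<lambda>x. \<phi> n x - u x)) \<longlonglongrightarrow> 0"
    "(\<lambda>n. l2norm lborel (\<lambda>x. grad (\<phi> n) x - V x)) \<longlonglongrightarrow> 0" by (rule h0_pair_sequence[OF assms(1)]) (rule that)
  note sq = h0_pairD(1,2)[OF assms(1)]
  have sq': "square_integrable lborel u'" "square_integrable lborel V'"
    using square_integrable_cong_AE(1)[OF sq(1) _ ae(1)] square_integrable_cong_AE(1)[OF sq(2) _ ae(2)] assms(2,3) by auto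
  have "l2norm lborel (\<lambda>x. \<phi> n x - u' x) = l2norm lborel (\<lambda>x. \<phi> n x - u x)" for n
  proof (rule square_integrable_cong_AE(2)[OF square_integrable_diff(1)[OF test_function_square_integrable(1)[OF \<phi>(1)] sq(1)]])
    show "AE x in lborel. \<phi> n x - u x = \<phi> n x - u' x" using ae(1) by eventually_elim simp
    show "(\<lambda>x. \<phi> n x - u' x) \<in> borel_measurable lborel"
      using test_function_measurable(1)[OF \<phi>(1)] assms(2) by simp
  qed
  moreover have "l2norm lborel (\<lambda>x. grad (\<phi> n) x - V' x) = l2norm lborel (\<lambda>x. grad (\<phi> n) x - V x)" for n
  proof (rule square_integrable_cong_AE(2)[OF square_integrable_diff(1)[OF test_function_square_integrable(2)[OF \<phi>(1)] sq(2)]])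
    show "AE x in lborel. grad (\<phi> n) x - V x = grad (\<phi> n) x - V' x" using ae(2) by eventually_elim simp
    show "(\<lambda>x. grad (\<phi> n) x - V' x) \<in> borel_measurable lborel"
      using test_function_measurable(2)[OF \<phi>(1)] assms(3) by simp
  qed
  ultimately show ?thesis
    using h0_pairI[OF sq' \<phi>(1)] \<phi>(2,3) by simp
qed

lemma h0_pair_AE_outside:
  assumes "h0_pair \<Omega> u V" shows "AE x in lborel. x \<notin> \<Omega> \<longrightarrow> u x = 0 \<and> V x = 0"
proof -
  obtain \<phi> where \<phi>: "\<And>n. \<phi> n \<in> test_functions \<Omega>" "(\<lambda>n. l2norm lborel (\<lambda>x. \<phi> n x - u x)) \<longlonglongrightarrow> 0"
    "(\<lambda>n. l2norm lborel (\<lambda>x. grad (\<phi> n) x - V x)) \<longlonglongrightarrow> 0" by (rule h0_pair_sequence[OF assms(1)]) (rule that)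
  have z: "\<phi> n x = 0" "grad (\<phi> n) x = 0" if "x \<notin> \<Omega>" for n x
    using test_functionsE[OF \<phi>(1)[of n]] that by (metis subsetD)+
  obtain r where "strict_mono r" and r: "AE x in lborel. (\<lambda>n. \<phi> (r n) x) \<longlonglongrightarrow> u x"
    by (rule l2_AE_subseq[OF test_function_square_integrable(1)[OF \<phi>(1)] h0_pairD(1)[OF assms] \<phi>(2)])
  obtain s where "strict_mono s" and s: "AE x in lborel. (\<lambda>n. grad (\<phi> (s n)) x) \<longlonglongrightarrow> V x"
    by (rule l2_AE_subseq[OF test_function_square_integrable(2)[OF \<phi>(1)] h0_pairD(2)[OF assms] \<phi>(3)])
  show ?thesis using r s
  proof eventually_elim
    case (elim x)
    show ?case
    proof
      assume "x \<notin> \<Omega>"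
      then have "(\<lambda>n. 0) \<longlonglongrightarrow> u x" "(\<lambda>n. 0) \<longlonglongrightarrow> V x" using elim z by simp_all
      then show "u x = 0 \<and> V x = 0" by (simp add: LIMSEQ_const_iff)
    qed
  qed
qed

lemma h0_pair_by_parts:
  assumes "h0_pair \<Omega> u V" "\<psi> \<in> test_functions \<Omega>'"
  shows "(\<integral>x. u x * partial_deriv i \<psi> x \<partial>lborel) = - (\<integral>x. V x $ i * \<psi> x \<partial>lborel)"
proof -
  obtain \<phi> where \<phi>: "\<And>n. \<phi> n \<in> test_functions \<Omega>" "(\<lambda>n. l2norm lborel (\<lambda>x. \<phi> n x - u x)) \<longlonglongrightarrow> 0"
    "(\<lambda>n. l2norm lborel (\<lambda>x. grad (\<phi> n) x - V x)) \<longlonglongrightarrow> 0" by (rule h0_pair_sequence[OF assms(1)]) (rule that)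
  note sq = h0_pairD(1,2)[OF assms(1)]
  note t = test_function_square_integrable
  note d\<psi> = t(1)[OF test_functions_partial_deriv[OF assms(2), of i]]
  have e\<psi>: "square_integrable lborel (\<lambda>x. \<psi> x *\<^sub>R axis i (1::real))"
    using t(1)[OF assms(2)] test_function_measurable(1)[OF assms(2)]
    by (auto simp: square_integrable_def norm_axis_1)
  have l1: "(\<lambda>n. \<integral>x. \<phi> n x \<bullet> partial_deriv i \<psi> x \<partial>lborel) \<longlonglongrightarrow> (\<integral>x. u x \<bullet> partial_deriv i \<psi> x \<partial>lborel)"
    by (rule integral_inner_tendsto[OF t(1)[OF \<phi>(1)] sq(1) d\<psi> d\<psi> \<phi>(2)]) simp
  have l2: "(\<lambda>n. \<integral>x. grad (\<phi> n) x \<bullet> (\<psi> x *\<^sub>R axis i 1) \<partial>lborel) \<longlonglongrightarrow> (\<integral>x. V x \<bullet> (\<psi> x *\<^sub>R axis i 1) \<partial>lborel)"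
    by (rule integral_inner_tendsto[OF t(2)[OF \<phi>(1)] sq(2) e\<psi> e\<psi> \<phi>(3)]) simp
  have eq: "(\<integral>x. \<phi> n x \<bullet> partial_deriv i \<psi> x \<partial>lborel) = - (\<integral>x. grad (\<phi> n) x \<bullet> (\<psi> x *\<^sub>R axis i 1) \<partial>lborel)" for n
    using test_function_by_parts[OF assms(2) test_functions_smooth[OF \<phi>(1)], of n i]
    by (simp add: inner_axis mult.commute)
  have "(\<integral>x. u x \<bullet> partial_deriv i \<psi> x \<partial>lborel) = - (\<integral>x. V x \<bullet> (\<psi> x *\<^sub>R axis i 1) \<partial>lborel)"
    by (rule LIMSEQ_unique[OF l1]) (unfold eq, rule tendsto_minus[OF l2])
  then show ?thesis by (simp add: inner_axis mult.commute)
qed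

lemma l2norm_translate:
  fixes f :: "'a::euclidean_space \<Rightarrow> 'b::euclidean_space"
  assumes "square_integrable lborel f"
  shows "square_integrable lborel (\<lambda>x. f (x + z))" "l2norm lborel (\<lambda>x. f (x + z)) = l2norm lborel f"
proof -
  have [measurable]: "f \<in> borel_measurable borel" using square_integrable_measurable[OF assms] by simp
  show "square_integrable lborel (\<lambda>x. f (x + z))"
    using assms integrable_lborel_translate[of "\<lambda>x. (norm (f x))\<^sup>2" z] by (auto simp: square_integrable_def)
  show "l2norm lborel (\<lambda>x. f (x + z)) = l2norm lborel f"
    unfolding l2norm_def using integral_lborel_translate[of "\<lambda>x. (norm (f x))\<^sup>2" z] by simp
qed

text \<open>The estimate for test functions passes to the limit. It is the source of the Poincare
  inequality, of the mollification rate and of the equicontinuity used for compactness.\<close>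

lemma h0_pair_translation:
  assumes "h0_pair \<Omega> u V"
  shows "l2norm lborel (\<lambda>x. u (x + z) - u x) \<le> norm z * l2norm lborel V"
proof -
  obtain \<phi> where \<phi>: "\<And>n. \<phi> n \<in> test_functions \<Omega>" "(\<lambda>n. l2norm lborel (\<lambda>x. \<phi> n x - u x)) \<longlonglongrightarrow> 0"
    "(\<lambda>n. l2norm lborel (\<lambda>x. grad (\<phi> n) x - V x)) \<longlonglongrightarrow> 0" by (rule h0_pair_sequence[OF assms(1)]) (rule that)
  note sq = h0_pairD(1,2)[OF assms(1)]
  note t = test_function_square_integrable
  have est: "l2norm lborel (\<lambda>x. \<phi> n (x + z) - \<phi> n x) \<le> norm z * l2norm lborel (grad (\<phi> n))" for n
  proof -
    have [measurable]: "\<phi> n \<in> borel_measurable borel" "grad (\<phi> n) \<in> borel_measurable borel"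
      by (rule test_function_measurable[OF \<phi>(1)])+
    have "(\<integral>\<^sup>+x. ennreal ((norm (\<phi> n (x + z) - \<phi> n x))\<^sup>2) \<partial>lborel) \<le> (\<integral>\<^sup>+x. ennreal ((grad (\<phi> n) x \<bullet> z)\<^sup>2) \<partial>lborel)"
      using translation_estimate[OF smooth_has_derivative[OF test_functions_smooth[OF \<phi>(1)]] smooth_continuous_on_grad[OF test_functions_smooth[OF \<phi>(1)]], of n z]
      by simp
    also have "\<dots> \<le> (\<integral>\<^sup>+x. ennreal ((norm z)\<^sup>2) * ennreal ((norm (grad (\<phi> n) x))\<^sup>2) \<partial>lborel)"
    proof (rule nn_integral_mono)
      fix x
      have "\<bar>grad (\<phi> n) x \<bullet> z\<bar>\<^sup>2 \<le> (norm (grad (\<phi> n) x) * norm z)\<^sup>2"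
        by (intro power_mono Cauchy_Schwarz_ineq2) simp
      then show "ennreal ((grad (\<phi> n) x \<bullet> z)\<^sup>2) \<le> ennreal ((norm z)\<^sup>2) * ennreal ((norm (grad (\<phi> n) x))\<^sup>2)"
        by (simp add: power_mult_distrib mult.commute flip: ennreal_mult)
    qed
    also have "\<dots> = ennreal ((norm z)\<^sup>2) * (\<integral>\<^sup>+x. ennreal ((norm (grad (\<phi> n) x))\<^sup>2) \<partial>lborel)"
      by (rule nn_integral_cmult) measurable
    also have "\<dots> = ennreal ((norm z * l2norm lborel (grad (\<phi> n)))\<^sup>2)"
      unfolding nn_integral_l2norm[OF t(2)[OF \<phi>(1)]] by (simp add: power_mult_distrib ennreal_mult)
    finally have "(l2norm lborel (\<lambda>x. \<phi> n (x + z) - \<phi> n x))\<^sup>2 \<le> (norm z * l2norm lborel (grad (\<phi> n)))\<^sup>2"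
      by (intro square_integrableI_nn(2)) auto
    then show ?thesis by (rule power2_le_imp_le) simp
  qed
  have tr: "(\<lambda>n. l2norm lborel (\<lambda>x. \<phi> n (x + z) - u (x + z))) \<longlonglongrightarrow> 0"
    using \<phi>(2) l2norm_translate(2)[OF square_integrable_diff(1)[OF t(1)[OF \<phi>(1)] sq(1)]] by simp
  have "(\<lambda>n. l2norm lborel (\<lambda>x. \<phi> n (x + z) - \<phi> n x)) \<longlonglongrightarrow> l2norm lborel (\<lambda>x. u (x + z) - u x)"
  proof (rule l2norm_tendsto)
    show "square_integrable lborel (\<lambda>x. \<phi> n (x + z) - \<phi> n x)" for n
      by (intro square_integrable_diff(1) l2norm_translate(1) t(1)[OF \<phi>(1)])
    show "square_integrable lborel (\<lambda>x. u (x + z) - u x)"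
      by (intro square_integrable_diff(1) l2norm_translate(1) sq)
    show "(\<lambda>n. l2norm lborel (\<lambda>x. (\<phi> n (x + z) - \<phi> n x) - (u (x + z) - u x))) \<longlonglongrightarrow> 0"
    proof (rule Lim_null_comparison)
      show "(\<lambda>n. l2norm lborel (\<lambda>x. \<phi> n (x + z) - u (x + z)) + l2norm lborel (\<lambda>x. \<phi> n x - u x)) \<longlonglongrightarrow> 0"
        using tendsto_add[OF tr \<phi>(2)] by simp
      have "l2norm lborel (\<lambda>x. (\<phi> n (x + z) - \<phi> n x) - (u (x + z) - u x))
          \<le> l2norm lborel (\<lambda>x. \<phi> n (x + z) - u (x + z)) + l2norm lborel (\<lambda>x. \<phi> n x - u x)" for n
        using l2norm_triangle[OF l2norm_translate(1)[OF square_integrable_diff(1)[OF t(1)[OF \<phi>(1)] sq(1)]]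
            square_integrable_diff(1)[OF sq(1) t(1)[OF \<phi>(1)]], of n z n]
        by (simp add: algebra_simps l2norm_minus_commute[of lborel u])
      then show "\<forall>\<^sub>F n in sequentially. norm (l2norm lborel (\<lambda>x. (\<phi> n (x + z) - \<phi> n x) - (u (x + z) - u x)))
          \<le> l2norm lborel (\<lambda>x. \<phi> n (x + z) - u (x + z)) + l2norm lborel (\<lambda>x. \<phi> n x - u x)" by simp
    qed
  qed
  moreover have "(\<lambda>n. norm z * l2norm lborel (grad (\<phi> n))) \<longlonglongrightarrow> norm z * l2norm lborel V"
    by (intro tendsto_mult_left l2norm_tendsto[OF t(2)[OF \<phi>(1)] sq(2) \<phi>(3)])
  ultimately show ?thesis by (rule LIMSEQ_le) (use est in auto)
qed

text \<open>Near-minimizers of the Dirichlet norm among the test functions within distance \<open>1 / n\<close> of \<open>v\<close>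
  form a Cauchy sequence by the parallelogram identity.\<close>

lemma h0_pair_lsc:
  assumes v: "square_integrable lborel v" and A: "0 \<le> A"
    and approx: "\<And>e. e > 0 \<Longrightarrow> \<exists>\<phi>\<in>test_functions \<Omega>. l2norm lborel (\<lambda>x. \<phi> x - v x) < e \<and> (l2norm lborel (grad \<phi>))\<^sup>2 < A + e"
  obtains V where "h0_pair \<Omega> v V" "(l2norm lborel V)\<^sup>2 \<le> A"
proof -
  define D where "D \<phi> = (l2norm lborel (grad \<phi>))\<^sup>2" for \<phi> :: "real^'a \<Rightarrow> real"
  define C where "C n = {\<phi>\<in>test_functions \<Omega>. l2norm lborel (\<lambda>x. \<phi> x - v x) < 1 / real (Suc n)}" for n
  define m where "m n = Inf (D ` C n)" for n
  note t = test_function_square_integrable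
  have bdd: "bdd_below (D ` C n)" for n by (auto simp: D_def intro!: bdd_belowI[of _ 0])
  have small: "\<exists>\<phi>\<in>C n. D \<phi> < A + e" if "e > 0" for e n
  proof -
    obtain \<phi> where "\<phi> \<in> test_functions \<Omega>" "l2norm lborel (\<lambda>x. \<phi> x - v x) < min e (1 / real (Suc n))" "D \<phi> < A + min e (1 / real (Suc n))"
      using approx[of "min e (1 / real (Suc n))"] \<open>e > 0\<close> by (auto simp: D_def)
    then show ?thesis by (auto simp: C_def intro!: bexI[of _ \<phi>])
  qed
  have ne: "C n \<noteq> {}" for n using small[of 1 n] by auto
  have mle: "m n \<le> D \<phi>" if "\<phi> \<in> C n" for n \<phi> unfolding m_def by (intro cInf_lower imageI that bdd)
  have mA: "m n \<le> A" for n
  proof (rule field_le_epsilon)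
    fix e :: real assume "e > 0"
    then show "m n \<le> A + e" using small[of e n] mle by (meson less_imp_le order_trans)
  qed
  have Csub: "C k \<subseteq> C n" if "n \<le> k" for n k
  proof -
    have "1 / real (Suc k) \<le> 1 / real (Suc n)" using that by (simp add: frac_le)
    then show ?thesis by (auto simp: C_def)
  qed
  \<comment> \<open>The admissible sets shrink with \<open>n\<close>, so the infima increase; they
    stay below \<open>A\<close> and therefore converge, which makes \<open>m k - m n\<close> small
    in the next estimate.\<close>
  have "incseq m"
    unfolding incseq_def m_def using Csub ne bdd by (intro allI impI cInf_superset_mono image_mono) auto
  then obtain L where "m \<longlonglongrightarrow> L"
    using incseq_convergent[of m A] mA by blast
  then have conv: "convergent m" by (rule convergentI)
  have "\<exists>\<phi>\<in>C n. D \<phi> < m n + 1 / real (Suc n)" for n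
  proof -
    have "Inf (D ` C n) < m n + 1 / real (Suc n)" by (simp add: m_def)
    then show ?thesis using ne[of n] by (subst (asm) cInf_less_iff[OF _ bdd]) auto
  qed
  then obtain w where w: "\<And>n. w n \<in> C n" "\<And>n. D (w n) < m n + 1 / real (Suc n)" by metis
  have wt: "w n \<in> test_functions \<Omega>" for n using w(1)[of n] by (simp add: C_def)
  have wv: "l2norm lborel (\<lambda>x. w n x - v x) < 1 / real (Suc n)" for n using w(1)[of n] by (simp add: C_def)
  \<comment> \<open>The midpoint of \<open>w n\<close> and \<open>w k\<close> is still admissible
    for \<open>n\<close>, so \<open>4 * m n\<close> bounds from below the squared norm of the sum of
    the two gradients.\<close>
  have diff: "(l2norm lborel (\<lambda>x. grad (w n) x - grad (w k) x))\<^sup>2 \<le> 2 * (m k - m n) + 4 / real (Suc n)" if nk: "n \<le> k" for n k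
  proof -
    let ?a = "grad (w n)" and ?b = "grad (w k)"
    define z where "z x = (1/2) * w n x + (1/2) * w k x" for x
    have zt: "z \<in> test_functions \<Omega>" unfolding z_def[abs_def] by (rule test_functions_linear_comb(1)[OF wt wt])
    have wkn: "w k \<in> C n" using Csub[OF nk] w(1) by auto
    have zz: "(\<lambda>x. z x - v x) = (\<lambda>x. (1/2) *\<^sub>R (w n x - v x) + (1/2) *\<^sub>R (w k x - v x))"
      by (auto simp: z_def field_simps)
    have "l2norm lborel (\<lambda>x. z x - v x) \<le> 1/2 * l2norm lborel (\<lambda>x. w n x - v x) + 1/2 * l2norm lborel (\<lambda>x. w k x - v x)"
      unfolding zz
      using l2norm_triangle[OF square_integrable_scaleR(1)[OF square_integrable_diff(1)[OF t(1)[OF wt] v], of "1/2" n]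
          square_integrable_scaleR(1)[OF square_integrable_diff(1)[OF t(1)[OF wt] v], of "1/2" k]]
      unfolding square_integrable_scaleR(2)[OF square_integrable_diff(1)[OF t(1)[OF wt] v]] by simp
    also have "\<dots> < 1 / real (Suc n)" using wv[of n] wkn by (simp add: C_def)
    finally have "z \<in> C n" using zt by (simp add: C_def)
    then have "m n \<le> D z" by (rule mle)
    moreover have gz: "grad z = (\<lambda>x. (1/2) *\<^sub>R (?a x + ?b x))"
      unfolding z_def[abs_def] using grad_linear_comb[OF wt wt, of "1/2" n "1/2" k] by (auto simp: scaleR_add_right)
    have "D z = 1/4 * (l2norm lborel (\<lambda>x. ?a x + ?b x))\<^sup>2"
      unfolding D_def gz square_integrable_scaleR(2)[OF square_integrable_add(1)[OF t(2)[OF wt] t(2)[OF wt]]]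
      by (simp add: power2_eq_square)
    ultimately have f1: "4 * m n \<le> D (w n) + 2 * (\<integral>x. ?a x \<bullet> ?b x \<partial>lborel) + D (w k)"
      by (simp add: l2norm_add_power2[OF t(2)[OF wt] t(2)[OF wt]] D_def)
    have f2: "(l2norm lborel (\<lambda>x. ?a x - ?b x))\<^sup>2 = D (w n) - 2 * (\<integral>x. ?a x \<bullet> ?b x \<partial>lborel) + D (w k)"
      by (simp add: l2norm_diff_power2[OF t(2)[OF wt] t(2)[OF wt]] D_def)
    have f3: "1 / real (Suc k) \<le> 1 / real (Suc n)" using nk by (simp add: frac_le)
    have arith: "X \<le> 2 * (m' - m) + 4 * a"
      if "4 * m \<le> p + 2 * i + q" "X = p - 2 * i + q" "b \<le> a" "p < m + a" "q < m' + b"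
      for m m' p i q X a b :: real using that by (simp add: algebra_simps)
    show ?thesis using arith[OF f1 f2 f3 w(2) w(2)] by simp
  qed
  obtain V where V: "square_integrable lborel V" "(\<lambda>n. l2norm lborel (\<lambda>x. grad (w n) x - V x)) \<longlonglongrightarrow> 0"
  proof (rule l2_complete[OF t(2)[OF wt]])
    fix e :: real assume e: "e > 0"
    have e2: "e\<^sup>2 / 8 > 0" using e by simp
    obtain N1 where N1: "\<And>k n. k \<ge> N1 \<Longrightarrow> n \<ge> N1 \<Longrightarrow> \<bar>m k - m n\<bar> < e\<^sup>2 / 8"
      using convergent_Cauchy[OF conv] e2 unfolding Cauchy_def dist_real_def by metis
    obtain N2 where N2: "1 / real (Suc N2) < e\<^sup>2 / 8" using nat_approx_posE[OF e2] by auto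
    have le: "l2norm lborel (\<lambda>x. grad (w n) x - grad (w k) x) < e" if "max N1 N2 \<le> n" "n \<le> k" for n k
    proof (rule power2_less_imp_less)
      have "1 / real (Suc n) \<le> 1 / real (Suc N2)" using that by (intro frac_le) auto
      then have "1 / real (Suc n) < e\<^sup>2 / 8" using N2 by (rule le_less_trans)
      then have "4 * (1 / real (Suc n)) < 4 * (e\<^sup>2 / 8)" by (rule mult_strict_left_mono) simp
      then have "4 / real (Suc n) < e\<^sup>2 / 2" by simp
      moreover have "\<bar>m k - m n\<bar> < e\<^sup>2 / 8" using N1 that by simp
      then have "m k - m n < e\<^sup>2 / 8" by (rule le_less_trans[OF abs_ge_self])
      then have "2 * (m k - m n) < 2 * (e\<^sup>2 / 8)" by (rule mult_strict_left_mono) simp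
      then have "2 * (m k - m n) < e\<^sup>2 / 4" by simp
      ultimately show "(l2norm lborel (\<lambda>x. grad (w n) x - grad (w k) x))\<^sup>2 < e\<^sup>2"
        using diff[OF that(2)] zero_less_power[OF e, of 2] by argo
    qed (use e in simp)
    show "\<exists>N. \<forall>k\<ge>N. \<forall>n\<ge>N. l2norm lborel (\<lambda>x. grad (w k) x - grad (w n) x) < e"
    proof (intro exI[of _ "max N1 N2"] allI impI)
      fix k n assume "max N1 N2 \<le> k" "max N1 N2 \<le> n"
      then show "l2norm lborel (\<lambda>x. grad (w k) x - grad (w n) x) < e"
        using le[of k n] le[of n k] by (cases "k \<le> n") (auto simp: l2norm_minus_commute[of lborel "grad (w k)"])
    qed
  qed (rule that)
  have "h0_pair \<Omega> v V"
    by (rule h0_pairI[OF v V(1) wt tendsto_0_inverse_Suc[OF l2norm_nonneg wv] V(2)])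
  moreover have "(l2norm lborel V)\<^sup>2 \<le> A"
  proof (rule LIMSEQ_le)
    show "(\<lambda>n. (l2norm lborel (grad (w n)))\<^sup>2) \<longlonglongrightarrow> (l2norm lborel V)\<^sup>2"
      by (intro tendsto_power l2norm_tendsto[OF t(2)[OF wt] V])
    show "(\<lambda>n. A + 1 / real (Suc n)) \<longlonglongrightarrow> A"
      using tendsto_add[OF tendsto_const[of A] LIMSEQ_inverse_real_of_nat] by (simp add: inverse_eq_divide)
    have "(l2norm lborel (grad (w n)))\<^sup>2 \<le> A + 1 / real (Suc n)" for n
      using w(2)[of n] mA[of n] by (simp add: D_def)
    then show "\<exists>N. \<forall>n\<ge>N. (l2norm lborel (grad (w n)))\<^sup>2 \<le> A + 1 / real (Suc n)" by blast
  qed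
  ultimately show thesis by (rule that)
qed

section \<open>Polarization\<close>

text \<open>For a unit vector \<open>n\<close> this is the reflection in the hyperplane
  \<open>n \<bullet> x = c\<close>.\<close>

definition reflect :: "'a::euclidean_space \<Rightarrow> real \<Rightarrow> 'a \<Rightarrow> 'a" where
  "reflect n c x = x - (2 * (n \<bullet> x - c)) *\<^sub>R n"

text \<open>Two-point rearrangement: of the values at two mirror points the larger one goes to the
  side \<open>n \<bullet> x \<le> c\<close>, which contains the origin if \<open>c \<ge> 0\<close>.
  All uses below have \<open>c \<ge> 0\<close>, so mass moves towards the origin.\<close>

definition polar :: "'a::euclidean_space \<Rightarrow> real \<Rightarrow> ('a \<Rightarrow> real) \<Rightarrow> 'a \<Rightarrow> real" where
  "polar n c u x = (if n \<bullet> x \<le> c then max (u x) (u (reflect n c x)) else min (u x) (u (reflect n c x)))"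

lemma
  assumes n: "norm n = 1"
  shows inner_reflect: "n \<bullet> reflect n c x = 2 * c - n \<bullet> x"
    and reflect_reflect [simp]: "reflect n c (reflect n c x) = x"
    and reflect_fixed: "n \<bullet> x = c \<Longrightarrow> reflect n c x = x"
    and norm_reflect: "(norm (reflect n c x))\<^sup>2 = (norm x)\<^sup>2 - 4 * c * (n \<bullet> x - c)"
    and norm_reflect_diff: "norm (reflect n c x - reflect n c y) = norm (x - y)"
    and norm_diff_reflect: "(norm (x - reflect n c y))\<^sup>2 = (norm (x - y))\<^sup>2 + 4 * (n \<bullet> x - c) * (n \<bullet> y - c)"
proof -
  have nn: "n \<bullet> n = 1" using n by (simp add: norm_eq_1)
  show i: "n \<bullet> reflect n c x = 2 * c - n \<bullet> x" for x
    by (simp add: reflect_def inner_diff_right nn algebra_simps)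
  show "reflect n c (reflect n c x) = x"
    unfolding reflect_def[of n c "reflect n c x"] i by (simp add: reflect_def algebra_simps)
  show "n \<bullet> x = c \<Longrightarrow> reflect n c x = x" by (simp add: reflect_def)
  have sq: "(norm (x - t *\<^sub>R n))\<^sup>2 = (norm x)\<^sup>2 - 2 * t * (n \<bullet> x) + t\<^sup>2" for x t
  proof -
    have "(norm (x - t *\<^sub>R n))\<^sup>2 = x \<bullet> x - t * (n \<bullet> x) - t * (x \<bullet> n) + t * t * (n \<bullet> n)"
      unfolding power2_norm_eq_inner by (simp add: inner_diff_left inner_diff_right algebra_simps)
    then show ?thesis by (simp add: nn inner_commute[of x n] dot_square_norm n flip: power2_eq_square)
  qed
  have "reflect n c x - reflect n c y = (x - y) - (2 * (n \<bullet> (x - y))) *\<^sub>R n"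
    by (simp add: reflect_def inner_diff_right algebra_simps)
  then have "(norm (reflect n c x - reflect n c y))\<^sup>2 = (norm (x - y))\<^sup>2"
    by (simp only: sq) (simp add: power2_eq_square)
  then show "norm (reflect n c x - reflect n c y) = norm (x - y)"
    by (rule power2_eq_imp_eq) simp_all
  show "(norm (reflect n c x))\<^sup>2 = (norm x)\<^sup>2 - 4 * c * (n \<bullet> x - c)"
    unfolding reflect_def sq by (simp add: power2_eq_square algebra_simps)
  have "x - reflect n c y = (x - y) - (- 2 * (n \<bullet> y - c)) *\<^sub>R n"
    by (simp add: reflect_def algebra_simps)
  then show "(norm (x - reflect n c y))\<^sup>2 = (norm (x - y))\<^sup>2 + 4 * (n \<bullet> x - c) * (n \<bullet> y - c)"
    by (simp only: sq) (simp add: power2_eq_square inner_diff_right algebra_simps)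
qed

lemma reflect_continuous [continuous_intros]: "continuous_on A (reflect n c)"
  unfolding reflect_def[abs_def] by (intro continuous_intros)

lemma reflect_measurable [measurable]: "reflect n c \<in> borel_measurable borel"
  by (intro borel_measurable_continuous_onI reflect_continuous)

lemma polar_measurable [measurable]:
  assumes [measurable]: "u \<in> borel_measurable borel" shows "polar n c u \<in> borel_measurable borel"
  unfolding polar_def[abs_def] by measurable

text \<open>The reflection is the orthogonal reflection in the parallel hyperplane through the
  origin followed by the translation by \<open>(2 * c) *\<^sub>R n\<close>.\<close>

lemma lborel_distr_reflect:
  fixes n :: "real^'n::{finite,wellorder}"
  assumes n: "norm n = 1"
  shows "distr lborel borel (reflect n c) = lborel"
proof -
  have r0: "reflect n 0 x = x - (2 * (n \<bullet> x)) *\<^sub>R n" for x by (simp add: reflect_def)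
  have "linear (reflect n 0)"
    by (rule linearI) (simp_all add: r0 inner_add_right algebra_simps)
  moreover have "norm (reflect n 0 x) = norm x" for x
    using norm_reflect[OF n, of 0 x] by (metis diff_zero mult_zero_left mult_zero_right norm_ge_zero power2_eq_imp_eq)
  ultimately have "orthogonal_transformation (reflect n 0)" by (simp add: orthogonal_transformation)
  then have "distr lborel borel (reflect n 0) = lborel" by (rule lborel_distr_orthogonal)
  then have "distr lborel borel (reflect n c) = distr (distr lborel borel (reflect n 0)) borel ((+) ((2 * c) *\<^sub>R n))"
    using lborel_distr_plus[of "(2 * c) *\<^sub>R n"]
    by (subst distr_distr) (auto simp: comp_def reflect_def algebra_simps intro!: arg_cong[where f="distr lborel borel"])
  also have "\<dots> = lborel" using \<open>distr lborel borel (reflect n 0) = lborel\<close> lborel_distr_plus by simp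
  finally show ?thesis .
qed

lemma nn_integral_reflect:
  fixes n :: "real^'n::{finite,wellorder}"
  assumes "norm n = 1" and [measurable]: "f \<in> borel_measurable borel"
  shows "(\<integral>\<^sup>+x. f (reflect n c x) \<partial>lborel) = (\<integral>\<^sup>+x. f x \<partial>lborel)"
  using nn_integral_distr[of "reflect n c" lborel borel f] lborel_distr_reflect[OF assms(1), of c] by simp

lemma
  fixes n :: "real^'n::{finite,wellorder}" and f :: "real^'n::{finite,wellorder} \<Rightarrow> real"
  assumes "norm n = 1" and [measurable]: "f \<in> borel_measurable borel"
  shows integral_reflect: "(\<integral>x. f (reflect n c x) \<partial>lborel) = (\<integral>x. f x \<partial>lborel)"
    and integrable_reflect: "integrable lborel (\<lambda>x. f (reflect n c x)) \<longleftrightarrow> integrable lborel f"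
  using integral_distr[of "reflect n c" lborel borel f] integrable_distr_eq[of "reflect n c" lborel borel f]
    lborel_distr_reflect[OF assms(1), of c] by simp_all

lemma polar_cases:
  fixes n x :: "'a::euclidean_space" and u :: "'a \<Rightarrow> real"
  assumes n: "norm n = 1"
  shows "n \<bullet> x \<le> c \<Longrightarrow> polar n c u x = max (u x) (u (reflect n c x)) \<and> polar n c u (reflect n c x) = min (u x) (u (reflect n c x))"
    and "c \<le> n \<bullet> x \<Longrightarrow> polar n c u x = min (u x) (u (reflect n c x)) \<and> polar n c u (reflect n c x) = max (u x) (u (reflect n c x))"
proof -
  have *: "n \<bullet> x = c \<Longrightarrow> reflect n c x = x" by (rule reflect_fixed[OF n])
  show "n \<bullet> x \<le> c \<Longrightarrow> polar n c u x = max (u x) (u (reflect n c x)) \<and> polar n c u (reflect n c x) = min (u x) (u (reflect n c x))"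
    using * by (cases "n \<bullet> x = c") (auto simp: polar_def inner_reflect[OF n] reflect_reflect[OF n] max_def min_def)
  show "c \<le> n \<bullet> x \<Longrightarrow> polar n c u x = min (u x) (u (reflect n c x)) \<and> polar n c u (reflect n c x) = max (u x) (u (reflect n c x))"
    using * by (cases "n \<bullet> x = c") (auto simp: polar_def inner_reflect[OF n] reflect_reflect[OF n] max_def min_def)
qed

lemma polar_swap:
  fixes n x :: "'a::euclidean_space" and u :: "'a \<Rightarrow> real"
  assumes n: "norm n = 1"
  shows "(polar n c u x = u x \<and> polar n c u (reflect n c x) = u (reflect n c x)) \<or>
    (polar n c u x = u (reflect n c x) \<and> polar n c u (reflect n c x) = u x)"
  using polar_cases[OF n, where x=x and c=c and u=u] by (cases "n \<bullet> x \<le> c") (auto simp: max_def min_def split: if_splits)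

text \<open>If both pairs are ordered alike this is an equality; if they are ordered oppositely, the
  right-hand side exceeds the left by twice a product of two nonnegative differences.\<close>

lemma rearrange_sq:
  fixes a a' b b' :: real
  shows "(max a a' - max b b')\<^sup>2 + (min a a' - min b b')\<^sup>2 \<le> (a - b)\<^sup>2 + (a' - b')\<^sup>2"
proof -
  consider "a \<le> a'" "b \<le> b'" | "a' \<le> a" "b' \<le> b" | "a \<le> a'" "b' \<le> b" | "a' \<le> a" "b \<le> b'" by linarith
  then show ?thesis
  proof cases
    case 3
    then have "0 \<le> (a' - a) * (b - b')" by (intro mult_nonneg_nonneg) auto
    moreover have "(a - b)\<^sup>2 + (a' - b')\<^sup>2 = (a' - b)\<^sup>2 + (a - b')\<^sup>2 + 2 * ((a' - a) * (b - b'))"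
      by (simp add: power2_eq_square algebra_simps)
    ultimately have "(a' - b)\<^sup>2 + (a - b')\<^sup>2 \<le> (a - b)\<^sup>2 + (a' - b')\<^sup>2" by simp
    then show ?thesis using 3 by (simp add: max_absorb1 max_absorb2 min_absorb1 min_absorb2 add.commute)
  next
    case 4
    then have "0 \<le> (a - a') * (b' - b)" by (intro mult_nonneg_nonneg) auto
    moreover have "(a - b)\<^sup>2 + (a' - b')\<^sup>2 = (a' - b)\<^sup>2 + (a - b')\<^sup>2 + 2 * ((a - a') * (b' - b))"
      by (simp add: power2_eq_square algebra_simps)
    ultimately have "(a' - b)\<^sup>2 + (a - b')\<^sup>2 \<le> (a - b)\<^sup>2 + (a' - b')\<^sup>2" by simp
    then show ?thesis using 4 by (simp add: max_absorb1 max_absorb2 min_absorb1 min_absorb2 add.commute)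
  qed (simp_all add: max_absorb1 max_absorb2 min_absorb1 min_absorb2)
qed

lemma polar_contraction:
  fixes u v :: "'a::euclidean_space \<Rightarrow> real"
  assumes n: "norm n = 1"
  shows "(polar n c u x - polar n c v x)\<^sup>2 + (polar n c u (reflect n c x) - polar n c v (reflect n c x))\<^sup>2
    \<le> (u x - v x)\<^sup>2 + (u (reflect n c x) - v (reflect n c x))\<^sup>2"
  using polar_cases[OF n, where x=x and c=c and u=u] polar_cases[OF n, where x=x and c=c and u=v]
    rearrange_sq[of "u x" "u (reflect n c x)" "v x" "v (reflect n c x)"]
  by (cases "n \<bullet> x \<le> c") auto

text \<open>Tonelli and the shift \<open>y = x + z\<close>. In this form the energy is visibly
  invariant when both variables are reflected.\<close>

lemma nonlocal_kernel:
  fixes u :: "real^'n \<Rightarrow> real"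
  assumes [measurable]: "u \<in> borel_measurable borel"
  shows "nonlocal \<epsilon> u = (\<integral>\<^sup>+x. \<integral>\<^sup>+y. indicator {t. t < \<epsilon>} (norm (x - y)) * ennreal ((u x - u y)\<^sup>2) \<partial>lborel \<partial>lborel)"
proof -
  have "nonlocal \<epsilon> u = (\<integral>\<^sup>+z. \<integral>\<^sup>+x. indicator (ball 0 \<epsilon>) z * ennreal ((u (x + z) - u x)\<^sup>2) \<partial>lborel \<partial>lborel)"
    unfolding nonlocal_def by (intro nn_integral_cong nn_integral_cmult[symmetric]) measurable
  also have "\<dots> = (\<integral>\<^sup>+x. \<integral>\<^sup>+z. indicator (ball 0 \<epsilon>) z * ennreal ((u (x + z) - u x)\<^sup>2) \<partial>lborel \<partial>lborel)"
    by (rule lborel_pair.Fubini') measurable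
  also have "\<dots> = (\<integral>\<^sup>+x. \<integral>\<^sup>+y. indicator {t. t < \<epsilon>} (norm (x - y)) * ennreal ((u x - u y)\<^sup>2) \<partial>lborel \<partial>lborel)"
  proof (rule nn_integral_cong)
    fix x
    have [measurable]: "(\<lambda>y. indicator {t. t < \<epsilon>} (norm (x - y)) * ennreal ((u x - u y)\<^sup>2)) \<in> borel_measurable borel"
      by measurable
    show "(\<integral>\<^sup>+z. indicator (ball 0 \<epsilon>) z * ennreal ((u (x + z) - u x)\<^sup>2) \<partial>lborel)
        = (\<integral>\<^sup>+y. indicator {t. t < \<epsilon>} (norm (x - y)) * ennreal ((u x - u y)\<^sup>2) \<partial>lborel)"
      using nn_integral_lborel_translate[of "\<lambda>y. indicator {t. t < \<epsilon>} (norm (x - y)) * ennreal ((u x - u y)\<^sup>2)" x]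
      by (simp add: add.commute indicator_def power2_commute[of "u x"])
  qed
  finally show ?thesis .
qed

text \<open>Averaging the integrand over the four pairs formed from \<open>x\<close>,
  \<open>y\<close> and their mirror points leaves the energy unchanged, up to the factor 4, and
  reduces the claim to a pointwise inequality for four values. Only two kernel values occur,
  \<open>k x y\<close> and \<open>k x (reflect n c y)\<close>.\<close>

lemma nonlocal_polar_le:
  fixes u :: "real^'n::{finite,wellorder} \<Rightarrow> real"
  assumes n: "norm n = 1" and [measurable]: "u \<in> borel_measurable borel"
  shows "nonlocal \<epsilon> (polar n c u) \<le> nonlocal \<epsilon> u"
proof -
  define k :: "real^'n::_ \<Rightarrow> real^'n::_ \<Rightarrow> ennreal" where "k x y = indicator {t. t < \<epsilon>} (norm (x - y))" for x y
  define F where "F v x y = k x y * ennreal ((v x - v y)\<^sup>2)" for v x y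
  define S where "S v x y = F v x y + F v (reflect n c x) (reflect n c y) + (F v (reflect n c x) y + F v x (reflect n c y))" for v x y
  have [measurable]: "case_prod k \<in> borel_measurable (borel \<Otimes>\<^sub>M borel)" unfolding k_def by measurable
  have sym: "(\<integral>\<^sup>+x. \<integral>\<^sup>+y. S v x y \<partial>lborel \<partial>lborel) = 4 * nonlocal \<epsilon> v" if [measurable]: "v \<in> borel_measurable borel" for v
  proof -
    have [measurable]: "case_prod (F v) \<in> borel_measurable (borel \<Otimes>\<^sub>M borel)" unfolding F_def by measurable
    define I where "I = (\<integral>\<^sup>+x. \<integral>\<^sup>+y. F v x y \<partial>lborel \<partial>lborel)"
    have y: "(\<integral>\<^sup>+y. F v x (reflect n c y) \<partial>lborel) = (\<integral>\<^sup>+y. F v x y \<partial>lborel)" for x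
      by (rule nn_integral_reflect[OF n]) measurable
    have x: "(\<integral>\<^sup>+x. \<integral>\<^sup>+y. F v (reflect n c x) y \<partial>lborel \<partial>lborel) = I"
      unfolding I_def by (rule nn_integral_reflect[OF n, of "\<lambda>x. \<integral>\<^sup>+y. F v x y \<partial>lborel"]) measurable
    have "(\<integral>\<^sup>+x. \<integral>\<^sup>+y. S v x y \<partial>lborel \<partial>lborel)
        = (\<integral>\<^sup>+x. (\<integral>\<^sup>+y. F v x y \<partial>lborel) + (\<integral>\<^sup>+y. F v (reflect n c x) (reflect n c y) \<partial>lborel) +
            ((\<integral>\<^sup>+y. F v (reflect n c x) y \<partial>lborel) + (\<integral>\<^sup>+y. F v x (reflect n c y) \<partial>lborel)) \<partial>lborel)"
      unfolding S_def by (intro nn_integral_cong) (simp add: nn_integral_add)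
    also have "\<dots> = I + I + (I + I)"
      unfolding y x[symmetric] by (simp add: nn_integral_add x) (simp add: I_def)
    also have "\<dots> = 4 * I" 
    proof -
      have "(4::ennreal) = 1 + 1 + (1 + 1)" by simp
      then show ?thesis by (simp only: distrib_right mult_1)
    qed
    finally show ?thesis unfolding nonlocal_kernel[OF that] I_def F_def k_def .
  qed
  have le: "S (polar n c u) x y \<le> S u x y" for x y
  proof -
    let ?r = "reflect n c"
    define a a' b b' where "a = u x" "a' = u (?r x)" "b = u y" "b' = u (?r y)"
    define A A' B B' where "A = polar n c u x" "A' = polar n c u (?r x)" "B = polar n c u y" "B' = polar n c u (?r y)"
    note defs = a_a'_b_b'_def A_A'_B_B'_def
    have k1: "k (?r x) (?r y) = k x y" by (simp add: k_def norm_reflect_diff[OF n])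
    have k2: "k (?r x) y = k x (?r y)"
      using norm_reflect_diff[OF n, of c x "?r y"] by (simp add: k_def reflect_reflect[OF n])
    have Su: "S u x y = k x y * ennreal ((a - b)\<^sup>2 + (a' - b')\<^sup>2) + k x (?r y) * ennreal ((a' - b)\<^sup>2 + (a - b')\<^sup>2)"
      unfolding S_def F_def k1 k2 defs by (simp add: distrib_left)
    have SP: "S (polar n c u) x y = k x y * ennreal ((A - B)\<^sup>2 + (A' - B')\<^sup>2) + k x (?r y) * ennreal ((A' - B)\<^sup>2 + (A - B')\<^sup>2)"
      unfolding S_def F_def k1 k2 defs by (simp add: distrib_left)
    \<comment> \<open>Polarization at most swaps the two values over \<open>x\<close> and the two
      over \<open>y\<close>, and the sum over all four combinations is invariant under swaps. This
      settles the case of equal kernel values.\<close>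
    have sums: "(A - B)\<^sup>2 + (A' - B')\<^sup>2 + ((A' - B)\<^sup>2 + (A - B')\<^sup>2) = (a - b)\<^sup>2 + (a' - b')\<^sup>2 + ((a' - b)\<^sup>2 + (a - b')\<^sup>2)"
      using polar_swap[OF n, where x=x and c=c and u=u] polar_swap[OF n, where x=y and c=c and u=u] unfolding defs by auto
    have kk: "(k x y = 0 \<or> k x y = 1) \<and> (k x (?r y) = 0 \<or> k x (?r y) = 1)" by (simp add: k_def indicator_def)
    have ar: "a < a + 4 * t \<Longrightarrow> 0 < t" "a + 4 * t < a \<Longrightarrow> t < 0" for a t :: real by simp_all
    consider "k x y = k x (?r y)" | "k x y = 1" "k x (?r y) = 0" | "k x y = 0" "k x (?r y) = 1" using kk by metis
    then show ?thesis
    proof cases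
      case 1
      have e: "S v x y = k x y * ennreal ((v x - v y)\<^sup>2 + (v (?r x) - v (?r y))\<^sup>2 + ((v (?r x) - v y)\<^sup>2 + (v x - v (?r y))\<^sup>2))" for v
        unfolding S_def F_def k1 k2 1[symmetric] by (simp add: distrib_left)
      have "S (polar n c u) x y = S u x y" unfolding e using sums unfolding defs by (simp only:)
      then show ?thesis by simp
    next
      case 2
      \<comment> \<open>A point is closer to \<open>y\<close> than to its mirror image exactly when
        it lies strictly on the side of \<open>y\<close>. Hence \<open>x\<close> and
        \<open>y\<close> lie on the same side and their pairs of polarized values are ordered alike,
        as \<open>rearrange_sq\<close> needs. In the remaining case they lie on opposite sides and
        the roles of \<open>a\<close> and \<open>a'\<close> are exchanged.\<close>
      then have "norm (x - y) < norm (x - ?r y)" by (auto simp: k_def indicator_def split: if_splits)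
      then have "(norm (x - y))\<^sup>2 < (norm (x - ?r y))\<^sup>2" by (intro power_strict_mono) auto
      then have "0 < (n \<bullet> x - c) * (n \<bullet> y - c)"
        unfolding norm_diff_reflect[OF n] mult.assoc by (rule ar)
      then have "n \<bullet> x \<le> c \<and> n \<bullet> y \<le> c \<or> c \<le> n \<bullet> x \<and> c \<le> n \<bullet> y" by (auto simp: zero_less_mult_iff)
      then have "(A - B)\<^sup>2 + (A' - B')\<^sup>2 \<le> (a - b)\<^sup>2 + (a' - b')\<^sup>2"
        using polar_cases[OF n, where x=x and c=c and u=u] polar_cases[OF n, where x=y and c=c and u=u] rearrange_sq[of a a' b b'] unfolding defs by auto
      then show ?thesis unfolding Su SP 2 by (simp add: ennreal_leI del: ennreal_plus)
    next
      case 3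
      then have "norm (x - ?r y) < norm (x - y)" by (auto simp: k_def indicator_def split: if_splits)
      then have "(norm (x - ?r y))\<^sup>2 < (norm (x - y))\<^sup>2" by (intro power_strict_mono) auto
      then have "(n \<bullet> x - c) * (n \<bullet> y - c) < 0"
        unfolding norm_diff_reflect[OF n] mult.assoc by (rule ar)
      then have "n \<bullet> x \<le> c \<and> c \<le> n \<bullet> y \<or> c \<le> n \<bullet> x \<and> n \<bullet> y \<le> c" by (auto simp: mult_less_0_iff)
      then have "(A' - B)\<^sup>2 + (A - B')\<^sup>2 \<le> (a' - b)\<^sup>2 + (a - b')\<^sup>2"
        using polar_cases[OF n, where x=x and c=c and u=u] polar_cases[OF n, where x=y and c=c and u=u] rearrange_sq[of a' a b b'] unfolding defs
        by (auto simp: max.commute min.commute)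
      then show ?thesis unfolding Su SP 3 by (simp add: ennreal_leI del: ennreal_plus)
    qed
  qed
  have "4 * nonlocal \<epsilon> (polar n c u) \<le> 4 * nonlocal \<epsilon> u"
    unfolding sym[OF assms(2), symmetric] sym[OF polar_measurable[OF assms(2)], symmetric]
    by (intro nn_integral_mono le)
  then show ?thesis by (subst (asm) ennreal_mult_le_mult_iff) auto
qed

lemma nonlocal_abs_le: "nonlocal \<epsilon> (\<lambda>x. \<bar>u x\<bar>) \<le> nonlocal \<epsilon> u"
proof -
  have "(\<bar>a\<bar> - \<bar>b\<bar>)\<^sup>2 \<le> (a - b)\<^sup>2" for a b :: real
    by (rule abs_le_square_iff[THEN iffD1]) (rule abs_triangle_ineq3)
  then show ?thesis
    unfolding nonlocal_def by (intro nn_integral_mono mult_left_mono ennreal_leI) auto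
qed

text \<open>Contraction holds for the sum over a point and its mirror image, not pointwise;
  integrating that sum doubles the squared norm by reflection invariance.\<close>

lemma l2norm_polar_abs_diff:
  fixes u v :: "real^'n::{finite,wellorder} \<Rightarrow> real"
  assumes n: "norm n = 1" and u: "square_integrable lborel u" and v: "square_integrable lborel v"
  shows "square_integrable lborel (\<lambda>x. polar n c (\<lambda>x. \<bar>u x\<bar>) x - polar n c (\<lambda>x. \<bar>v x\<bar>) x)"
    and "l2norm lborel (\<lambda>x. polar n c (\<lambda>x. \<bar>u x\<bar>) x - polar n c (\<lambda>x. \<bar>v x\<bar>) x) \<le> l2norm lborel (\<lambda>x. u x - v x)"
proof -
  have [measurable]: "u \<in> borel_measurable borel" "v \<in> borel_measurable borel"
    using square_integrable_measurable[OF u] square_integrable_measurable[OF v] by simp_all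
  define P Q where "P x = polar n c (\<lambda>x. \<bar>u x\<bar>) x - polar n c (\<lambda>x. \<bar>v x\<bar>) x" and "Q x = u x - v x" for x
  have [measurable]: "P \<in> borel_measurable borel" "Q \<in> borel_measurable borel"
    unfolding P_def[abs_def] Q_def[abs_def] by measurable
  have dbl: "(\<integral>\<^sup>+x. ennreal ((f x)\<^sup>2 + (f (reflect n c x))\<^sup>2) \<partial>lborel) = 2 * (\<integral>\<^sup>+x. ennreal ((f x)\<^sup>2) \<partial>lborel)"
    if [measurable]: "f \<in> borel_measurable borel" for f
    using nn_integral_reflect[OF n, of "\<lambda>x. ennreal ((f x)\<^sup>2)" c] by (simp add: nn_integral_add mult_2)
  have "2 * (\<integral>\<^sup>+x. ennreal ((P x)\<^sup>2) \<partial>lborel) \<le> 2 * (\<integral>\<^sup>+x. ennreal ((Q x)\<^sup>2) \<partial>lborel)"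
    unfolding dbl[symmetric, OF \<open>P \<in> _\<close>] dbl[symmetric, OF \<open>Q \<in> _\<close>]
  proof (intro nn_integral_mono ennreal_leI)
    fix x
    have "(\<bar>a\<bar> - \<bar>b\<bar>)\<^sup>2 \<le> (a - b)\<^sup>2" for a b :: real
      by (rule abs_le_square_iff[THEN iffD1]) (rule abs_triangle_ineq3)
    from add_mono[OF this this] show "(P x)\<^sup>2 + (P (reflect n c x))\<^sup>2 \<le> (Q x)\<^sup>2 + (Q (reflect n c x))\<^sup>2"
      using polar_contraction[OF n, of c "\<lambda>x. \<bar>u x\<bar>" x "\<lambda>x. \<bar>v x\<bar>"] order_trans unfolding P_def Q_def by blast
  qed
  then have "(\<integral>\<^sup>+x. ennreal ((P x)\<^sup>2) \<partial>lborel) \<le> (\<integral>\<^sup>+x. ennreal ((Q x)\<^sup>2) \<partial>lborel)"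
    by (subst (asm) ennreal_mult_le_mult_iff) auto
  also have "\<dots> = ennreal ((l2norm lborel Q)\<^sup>2)"
    using nn_integral_l2norm[OF square_integrable_diff(1)[OF u v]] by (simp add: Q_def[abs_def])
  finally have *: "(\<integral>\<^sup>+x. ennreal ((norm (P x))\<^sup>2) \<partial>lborel) \<le> ennreal ((l2norm lborel Q)\<^sup>2)" by simp
  have "square_integrable lborel P" by (rule square_integrableI_nn(1)[OF _ *]) auto
  then show "square_integrable lborel (\<lambda>x. polar n c (\<lambda>x. \<bar>u x\<bar>) x - polar n c (\<lambda>x. \<bar>v x\<bar>) x)"
    unfolding P_def[abs_def] .
  have "(l2norm lborel P)\<^sup>2 \<le> (l2norm lborel Q)\<^sup>2" by (rule square_integrableI_nn(2)[OF _ *]) auto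
  then have "l2norm lborel P \<le> l2norm lborel Q" by (rule power2_le_imp_le) simp
  then show "l2norm lborel (\<lambda>x. polar n c (\<lambda>x. \<bar>u x\<bar>) x - polar n c (\<lambda>x. \<bar>v x\<bar>) x) \<le> l2norm lborel (\<lambda>x. u x - v x)"
    unfolding P_def[abs_def] Q_def[abs_def] .
qed

lemma polar_continuous:
  assumes n: "norm n = 1" and u: "continuous_on UNIV u"
  shows "continuous_on UNIV (polar n c u)"
proof -
  have ur: "continuous_on A (\<lambda>x. u (reflect n c x))" for A
    by (rule continuous_on_compose2[OF u reflect_continuous]) simp
  have "continuous_on ({x. n \<bullet> x \<le> c} \<union> {x. c \<le> n \<bullet> x})
      (\<lambda>x. if n \<bullet> x \<le> c then max (u x) (u (reflect n c x)) else min (u x) (u (reflect n c x)))"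
  proof (rule continuous_on_cases)
    show "closed {x. n \<bullet> x \<le> c}" "closed {x. c \<le> n \<bullet> x}"
      by (auto intro: closed_halfspace_le closed_halfspace_ge)
    show "continuous_on {x. n \<bullet> x \<le> c} (\<lambda>x. max (u x) (u (reflect n c x)))"
      "continuous_on {x. c \<le> n \<bullet> x} (\<lambda>x. min (u x) (u (reflect n c x)))"
      by (intro continuous_on_max continuous_on_min ur continuous_on_subset[OF u] subset_UNIV)+
    show "\<forall>x. x \<in> {x. n \<bullet> x \<le> c} \<and> \<not> n \<bullet> x \<le> c \<or> x \<in> {x. c \<le> n \<bullet> x} \<and> n \<bullet> x \<le> c
        \<longrightarrow> max (u x) (u (reflect n c x)) = min (u x) (u (reflect n c x))"
      using reflect_fixed[OF n] by auto
  qed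
  moreover have "{x. n \<bullet> x \<le> c} \<union> {x. c \<le> n \<bullet> x} = UNIV" by auto
  ultimately show ?thesis by (simp add: polar_def[abs_def])
qed

text \<open>For \<open>c \<ge> 0\<close> reflecting a point of the half-space containing the origin
  does not bring it closer to the origin. On the other side the minimum of 0 and a nonnegative value
  is 0.\<close>

lemma polar_eq_0:
  assumes n: "norm n = 1" and c: "0 \<le> c" and u: "\<And>x. 0 \<le> u x" "\<And>x. r < norm x \<Longrightarrow> u x = 0" and x: "r < norm x"
  shows "polar n c u x = 0"
proof (cases "n \<bullet> x \<le> c")
  case True
  then have "(norm x)\<^sup>2 \<le> (norm (reflect n c x))\<^sup>2"
    using norm_reflect[OF n, of c x] c by (simp add: mult_nonneg_nonpos)
  then have "norm x \<le> norm (reflect n c x)" by (rule power2_le_imp_le) simp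
  then show ?thesis using True u(2) x by (simp add: polar_def)
qed (use u x in \<open>simp add: polar_def min_def\<close>)

text \<open>Approximate \<open>u\<close> by a test function \<open>f\<close>, polarize its modulus
  to get a continuous \<open>w\<close>, and mollify \<open>w\<close> to a test function
  \<open>\<psi>\<close>. At each scale the nonlocal energies decrease from \<open>f\<close> to
  \<open>\<psi>\<close>, so the Dirichlet integral of \<open>\<psi>\<close> is at most that of
  \<open>f\<close>, and \<open>h0_pair_lsc\<close> produces the gradient \<open>V'\<close>.\<close>

theorem polar_h0_pair:
  fixes n :: "real^'n::{finite,wellorder}"
  assumes u: "h0_pair (ball 0 1) u V" and n: "norm n = 1" and c: "0 \<le> c"
  obtains V' where "h0_pair (ball 0 1) (polar n c (\<lambda>x. \<bar>u x\<bar>)) V'" "(l2norm lborel V')\<^sup>2 \<le> (l2norm lborel V)\<^sup>2"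
proof -
  let ?T = "\<lambda>u. polar n c (\<lambda>x. \<bar>u x\<bar>)"
  note sq = h0_pairD(1,2)[OF u]
  note t = test_function_square_integrable
  obtain \<phi> where \<phi>: "\<And>n. \<phi> n \<in> test_functions (ball 0 1)" "(\<lambda>n. l2norm lborel (\<lambda>x. \<phi> n x - u x)) \<longlonglongrightarrow> 0"
    "(\<lambda>n. l2norm lborel (\<lambda>x. grad (\<phi> n) x - V x)) \<longlonglongrightarrow> 0" by (rule h0_pair_sequence[OF u]) (rule that)
  have T0: "polar n c (\<lambda>x. 0) = (\<lambda>x. 0)" by (auto simp: polar_def)
  have Tsq: "square_integrable lborel (?T v)" if "square_integrable lborel v" for v
    using l2norm_polar_abs_diff(1)[OF n that square_integrable_zero(1), of c] by (simp add: T0)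
  show thesis
  proof (rule h0_pair_lsc[OF Tsq[OF sq(1)] zero_le_power2[of "l2norm lborel V"]])
    fix e :: real assume e: "e > 0"
    have "(\<lambda>k. (l2norm lborel (grad (\<phi> k)))\<^sup>2) \<longlonglongrightarrow> (l2norm lborel V)\<^sup>2"
      by (intro tendsto_power l2norm_tendsto[OF t(2)[OF \<phi>(1)] sq(2) \<phi>(3)])
    then have "\<forall>\<^sub>F k in sequentially. (l2norm lborel (grad (\<phi> k)))\<^sup>2 < (l2norm lborel V)\<^sup>2 + e"
      using e by (intro order_tendstoD(2)) auto
    moreover have "\<forall>\<^sub>F k in sequentially. l2norm lborel (\<lambda>x. \<phi> k x - u x) < e / 2"
      using e by (intro order_tendstoD(2)[OF \<phi>(2)]) auto
    ultimately have "\<forall>\<^sub>F k in sequentially. (l2norm lborel (grad (\<phi> k)))\<^sup>2 < (l2norm lborel V)\<^sup>2 + e \<and> l2norm lborel (\<lambda>x. \<phi> k x - u x) < e / 2"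
      by (rule eventually_conj)
    then obtain k where k: "(l2norm lborel (grad (\<phi> k)))\<^sup>2 < (l2norm lborel V)\<^sup>2 + e" "l2norm lborel (\<lambda>x. \<phi> k x - u x) < e / 2"
      unfolding eventually_sequentially by blast
    define f where "f = \<phi> k"
    have ft: "f \<in> test_functions (ball 0 1)" using \<phi>(1) by (simp add: f_def)
    obtain K where K: "compact K" "K \<subseteq> ball 0 1" "\<And>x. x \<notin> K \<Longrightarrow> f x = 0" using test_functionsE[OF ft] by metis
    \<comment> \<open>A radius strictly below 1 leaves room to mollify inside the unit ball.\<close>
    obtain r where r: "0 < r" "r < 1" "\<And>x. r < norm x \<Longrightarrow> f x = 0"
    proof (cases "K = {}")
      case True
      then show ?thesis using K(3) by (intro that[of "1/2"]) auto
    next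
      case False
      then obtain y where y: "y \<in> K" "\<And>x. x \<in> K \<Longrightarrow> norm x \<le> norm y"
        using continuous_attains_sup[OF K(1) False continuous_on_norm_id] by auto
      have "norm y < 1" using y(1) K(2) by auto
      define r where "r = (norm y + 1) / 2"
      have r: "0 < r" "r < 1" "norm y < r" using \<open>norm y < 1\<close> norm_ge_zero[of y] by (auto simp: r_def add_nonneg_pos)
      have "f x = 0" if "r < norm x" for x
        using y(2)[of x] K(3)[of x] that r(3) by fastforce
      with r(1,2) show ?thesis by (rule that)
    qed
    define w where "w = ?T f"
    have fc: "continuous_on UNIV f" using ft by (intro smooth_continuous_on test_functions_smooth)
    have wc: "continuous_on UNIV w" unfolding w_def by (intro polar_continuous n continuous_intros fc)
    have w0: "w x = 0" if "r < norm x" for x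
      unfolding w_def by (rule polar_eq_0[OF n c _ _ that]) (auto simp: r(3))
    have [measurable]: "f \<in> borel_measurable borel" "w \<in> borel_measurable borel"
      using fc wc by (auto intro: borel_measurable_continuous_onI)
    have w0K: "w x = 0" if "x \<notin> cball 0 r" for x using that by (intro w0) auto
    note wi = integrable_compact_support[OF wc compact_cball w0K]
    note wuc = uniformly_continuous_compact_support[OF wc compact_cball w0K]
    have wsq: "square_integrable lborel w" unfolding w_def by (intro Tsq t(1)[OF ft])
    define M where "M = measure lborel (cball (0::real^'n::_) 2)"
    have M: "0 \<le> M" by (simp add: M_def)
    \<comment> \<open>A uniform error \<open>\<eta>\<close> on a ball of measure \<open>M\<close>
      costs at most \<open>\<eta> * (M + 1) = e / 3\<close> in \<open>L2\<close>. Together with the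
      distance below \<open>e / 2\<close> between \<open>f\<close> and \<open>u\<close>, which
      polarization does not enlarge, this stays below \<open>e\<close>.\<close>
    define \<eta> where "\<eta> = e / (3 * (M + 1))"
    have \<eta>: "\<eta> > 0" using e M by (simp add: \<eta>_def)
    define \<theta> where "\<theta> = min \<eta> (e / 3)"
    obtain d where d: "d > 0" "\<And>x y. dist y x < d \<Longrightarrow> dist (w y) (w x) < \<eta>"
      using wuc \<eta> unfolding uniformly_continuous_on_def by (metis UNIV_I)
    \<comment> \<open>The first bound serves the uniform continuity of \<open>w\<close>, the second
      keeps the support of the mollification in the unit ball.\<close>
    define \<delta> where "\<delta> = min d (1 - r)"
    have \<delta>: "\<delta> > 0" "\<delta> \<le> d" "\<delta> \<le> 1 - r" using d r by (auto simp: \<delta>_def)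
    define \<psi> where "\<psi> = mollify (\<delta>/2) w"
    have \<delta>2: "\<delta> / 2 > 0" using \<delta> by simp
    have \<psi>t: "\<psi> \<in> test_functions (ball 0 1)"
      unfolding \<psi>_def
    proof (rule mollify_test_function[OF \<delta>2 wi w0])
      show "cball 0 (r + \<delta> / 2) \<subseteq> ball (0::real^'n::_) 1" using \<delta> by auto
    qed
    have close: "(\<integral>\<^sup>+x. ennreal ((\<psi> x - w x)\<^sup>2) \<partial>lborel) \<le> ennreal (\<eta>\<^sup>2 * M)"
      unfolding \<psi>_def
    proof (rule mollify_close[OF \<delta>2 wi])
      fix z :: "real^'n::_" assume z: "norm z < \<delta> / 2"
      have "(\<integral>\<^sup>+x. ennreal ((w (x + z) - w x)\<^sup>2) \<partial>lborel) \<le> (\<integral>\<^sup>+x. ennreal (\<eta>\<^sup>2) * indicator (cball (0::real^'n::_) 2) x \<partial>lborel)"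
      proof (rule nn_integral_mono)
        fix x :: "real^'n::_"
        show "ennreal ((w (x + z) - w x)\<^sup>2) \<le> ennreal (\<eta>\<^sup>2) * indicator (cball 0 2) x"
        proof (cases "norm x \<le> 2")
          case True
          have "dist (w (x + z)) (w x) < \<eta>" using z \<delta> by (intro d) (simp add: dist_norm)
          then have "\<bar>w (x + z) - w x\<bar>\<^sup>2 \<le> \<eta>\<^sup>2" by (intro power_mono) (auto simp: dist_real_def)
          then show ?thesis using True by (simp add: ennreal_leI)
        next
          case False
          then have "r < norm x" using r by simp
          moreover have "norm x \<le> norm (x + z) + norm z" using norm_triangle_ineq4[of "x + z" z] by simp
          then have "r < norm (x + z)" using False z \<delta> r by linarith
          ultimately show ?thesis by (simp add: w0)
        qed
      qed
      also have "\<dots> = ennreal (\<eta>\<^sup>2) * emeasure lborel (cball (0::real^'n::_) 2)"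
        by (rule nn_integral_cmult_indicator) simp
      also have "\<dots> = ennreal (\<eta>\<^sup>2 * M)"
        using emeasure_lborel_cball_finite[of "0::real^'n::_" 2]
        by (simp add: M_def emeasure_eq_ennreal_measure ennreal_mult)
      finally show "(\<integral>\<^sup>+x. ennreal ((w (x + z) - w x)\<^sup>2) \<partial>lborel) \<le> ennreal (\<eta>\<^sup>2 * M)" .
    qed
    have "(l2norm lborel (\<lambda>x. \<psi> x - w x))\<^sup>2 \<le> \<eta>\<^sup>2 * M"
      using close M test_function_measurable(1)[OF \<psi>t] by (intro square_integrableI_nn(2)) auto
    also have "\<dots> \<le> (\<eta> * (M + 1))\<^sup>2"
    proof -
      have "M \<le> (M + 1)\<^sup>2" using M by (simp add: power2_sum)
      then show ?thesis by (simp add: power_mult_distrib mult_left_mono)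
    qed
    also have "\<eta> * (M + 1) = e / 3" using M by (simp add: \<eta>_def field_simps)
    finally have "l2norm lborel (\<lambda>x. \<psi> x - w x) \<le> e / 3" by (rule power2_le_imp_le) (use e in simp)
    moreover have "l2norm lborel (\<lambda>x. w x - ?T u x) \<le> l2norm lborel (\<lambda>x. f x - u x)"
      unfolding w_def by (rule l2norm_polar_abs_diff(2)[OF n t(1)[OF ft] sq(1)])
    moreover have "l2norm lborel (\<lambda>x. \<psi> x - ?T u x) \<le> l2norm lborel (\<lambda>x. \<psi> x - w x) + l2norm lborel (\<lambda>x. w x - ?T u x)"
      by (rule l2norm_triangle_diff[OF t(1)[OF \<psi>t] wsq Tsq[OF sq(1)]])
    ultimately have small: "l2norm lborel (\<lambda>x. \<psi> x - ?T u x) < e" using k(2) e by (simp add: f_def)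
    have "(\<integral>\<^sup>+x. ennreal ((norm (grad \<psi> x))\<^sup>2) \<partial>lborel) \<le> (\<integral>\<^sup>+x. ennreal ((norm (grad f x))\<^sup>2) \<partial>lborel)"
    proof (rule dirichlet_le_nonlocal[OF \<psi>t])
      fix \<epsilon> :: real
      have "nonlocal \<epsilon> \<psi> \<le> nonlocal \<epsilon> w"
        unfolding nonlocal_def \<psi>_def
        by (rule nn_integral_mono[OF mult_left_mono[OF mollify_translation[OF \<delta>2 wi] zero_le]])
      also have "\<dots> \<le> nonlocal \<epsilon> (\<lambda>x. \<bar>f x\<bar>)" unfolding w_def by (rule nonlocal_polar_le[OF n]) measurable
      also have "\<dots> \<le> nonlocal \<epsilon> f" by (rule nonlocal_abs_le)
      also have "\<dots> \<le> kappa TYPE('n) \<epsilon> * (\<integral>\<^sup>+x. ennreal ((norm (grad f x))\<^sup>2) \<partial>lborel)" by (rule nonlocal_le[OF ft])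
      finally show "nonlocal \<epsilon> \<psi> \<le> kappa TYPE('n) \<epsilon> * (\<integral>\<^sup>+x. ennreal ((norm (grad f x))\<^sup>2) \<partial>lborel)" .
    qed
    then have gle: "(l2norm lborel (grad \<psi>))\<^sup>2 \<le> (l2norm lborel (grad f))\<^sup>2"
      unfolding nn_integral_l2norm[OF t(2)[OF ft]] nn_integral_l2norm[OF t(2)[OF \<psi>t]] by simp
    then show "\<exists>\<psi>\<in>test_functions (ball 0 1). l2norm lborel (\<lambda>x. \<psi> x - ?T u x) < e \<and> (l2norm lborel (grad \<psi>))\<^sup>2 < (l2norm lborel V)\<^sup>2 + e"
      using \<psi>t small le_less_trans[OF gle k(1)[folded f_def]] by blast
  qed (rule that)
qed

section \<open>The Sobolev inequality in dimension three\<close>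

lemma ennreal_abs_integral_le: "ennreal \<bar>\<integral>x. f x \<partial>M\<bar> \<le> (\<integral>\<^sup>+x. ennreal \<bar>f x\<bar> \<partial>M)" for f :: "'a \<Rightarrow> real"
proof (cases "integrable M f")
  case True then show ?thesis using integral_norm_bound_ennreal[OF True] by simp
qed (simp add: not_integrable_integral_eq)

text \<open>The fundamental theorem of calculus for the \<open>m\<close>-th power of
  \<open>\<phi>\<close> along a coordinate line, started at the parameter \<open>a\<close>, where
  the line is outside the support; the integral is then extended to the whole line.\<close>

lemma power_le_line_integral:
  fixes \<phi> :: "real^'n \<Rightarrow> real"
  assumes \<phi>: "\<phi> \<in> test_functions \<Omega>" and m: "0 < m"
  shows "ennreal (\<bar>\<phi> c\<bar> ^ m) \<le> (\<integral>\<^sup>+s. ennreal (real m * \<bar>\<phi> (c + s *\<^sub>R axis i 1)\<bar> ^ (m - 1) * \<bar>partial_deriv i \<phi> (c + s *\<^sub>R axis i 1)\<bar>) \<partial>lborel)"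
proof -
  let ?e = "axis i 1 :: real^'n"
  note s = test_functions_smooth[OF \<phi>]
  obtain K where K: "compact K" "\<And>x. x \<notin> K \<Longrightarrow> \<phi> x = 0" using test_functionsE[OF \<phi>] by metis
  obtain r where r: "K \<subseteq> ball 0 r" "r > 0" using bounded_subset_ballD[OF compact_imp_bounded[OF K(1)], of 0] by blast
  define a where "a = - (r + norm c)"
  define h' where "h' t = real m * \<phi> (c + t *\<^sub>R ?e) ^ (m - 1) * partial_deriv i \<phi> (c + t *\<^sub>R ?e)" for t
  have "norm (a *\<^sub>R ?e) \<le> norm (c + a *\<^sub>R ?e) + norm c" using norm_triangle_ineq4[of "c + a *\<^sub>R ?e" c] by simp
  then have "r \<le> norm (c + a *\<^sub>R ?e)" using r(2) by (simp add: norm_axis_1 a_def)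
  then have a0: "\<phi> (c + a *\<^sub>R ?e) = 0" using r(1) by (intro K(2)) auto
  have der: "((\<lambda>t. \<phi> (c + t *\<^sub>R ?e) ^ m) has_vector_derivative h' t) (at t within {a..0})" for t
  proof -
    have "((\<lambda>t. \<phi> (c + t *\<^sub>R ?e)) has_derivative (\<lambda>k. grad \<phi> (c + t *\<^sub>R ?e) \<bullet> (k *\<^sub>R ?e))) (at t)"
      by (rule has_derivative_compose[OF _ smooth_has_derivative[OF s]]) (auto intro!: derivative_eq_intros)
    then have "((\<lambda>t. \<phi> (c + t *\<^sub>R ?e)) has_real_derivative partial_deriv i \<phi> (c + t *\<^sub>R ?e)) (at t)"
      by (simp add: has_field_derivative_def inner_axis mult_commute_abs)
    from DERIV_power[OF this, of m] have "((\<lambda>t. \<phi> (c + t *\<^sub>R ?e) ^ m) has_real_derivative h' t) (at t)"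
      by (rule DERIV_cong) (simp add: h'_def mult.commute mult.left_commute)
    then show ?thesis
      by (simp add: has_real_derivative_iff_has_vector_derivative has_vector_derivative_at_within)
  qed
  have cont: "continuous_on {a..0} h'"
    unfolding h'_def
    by (intro continuous_intros continuous_on_compose2[OF smooth_continuous_on[OF s, of UNIV]]
        continuous_on_compose2[OF smooth_continuous_on[OF smooth_partial_deriv[OF s], of UNIV]]) auto
  have "a \<le> 0" unfolding a_def using r(2) norm_ge_zero[of c] by linarith
  from integral_FTC_atLeastAtMost[OF this der cont]
  have "\<phi> c ^ m = (\<integral>t. indicator {a..0} t *\<^sub>R h' t \<partial>lborel)" using a0 m by simp
  then have "ennreal (\<bar>\<phi> c\<bar> ^ m) = ennreal \<bar>\<integral>t. indicator {a..0} t *\<^sub>R h' t \<partial>lborel\<bar>" by (simp flip: power_abs)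
  also have "\<dots> \<le> (\<integral>\<^sup>+t. ennreal \<bar>indicator {a..0} t *\<^sub>R h' t\<bar> \<partial>lborel)" by (rule ennreal_abs_integral_le)
  also have "\<dots> \<le> (\<integral>\<^sup>+t. ennreal (real m * \<bar>\<phi> (c + t *\<^sub>R ?e)\<bar> ^ (m - 1) * \<bar>partial_deriv i \<phi> (c + t *\<^sub>R ?e)\<bar>) \<partial>lborel)"
    by (intro nn_integral_mono ennreal_leI) (auto simp: h'_def abs_mult power_abs indicator_def)
  finally show ?thesis .
qed

definition vec3 :: "real \<Rightarrow> real \<Rightarrow> real \<Rightarrow> real^3" where
  "vec3 x y z = vector [x, y, z]"

lemma vec3_nth [simp]: "vec3 x y z $ 1 = x" "vec3 x y z $ 2 = y" "vec3 x y z $ 3 = z"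
  by (simp_all add: vec3_def)

lemma vec3_add: "vec3 x y z + s *\<^sub>R axis 1 1 = vec3 (s + x) y z"
  "vec3 x y z + s *\<^sub>R axis 2 1 = vec3 x (s + y) z" "vec3 x y z + s *\<^sub>R axis 3 1 = vec3 x y (s + z)"
  by (simp_all add: vec_eq_iff forall_3 axis_def)

lemma Basis_3: "(Basis :: (real^3) set) = {axis 1 1, axis 2 1, axis 3 1}"
  by (auto simp: Basis_vec_def UNIV_3)

lemma vec3_measurable [measurable (raw)]:
  assumes [measurable]: "f \<in> borel_measurable M" "g \<in> borel_measurable M" "h \<in> borel_measurable M"
  shows "(\<lambda>x. vec3 (f x) (g x) (h x)) \<in> borel_measurable M"
  by (subst borel_measurable_euclidean_space) (auto simp: Basis_3 inner_axis)

text \<open>The third coordinate is outermost, matching the slicing by \<open>z\<close> in the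
  Sobolev inequality.\<close>

lemma nn_integral_vec3:
  assumes [measurable]: "f \<in> borel_measurable borel"
  shows "(\<integral>\<^sup>+v. f v \<partial>lborel) = (\<integral>\<^sup>+z. \<integral>\<^sup>+p. f (vec3 (fst p) (snd p) z) \<partial>(lborel \<Otimes>\<^sub>M lborel) \<partial>lborel)"
proof -
  let ?P = "(lborel :: real measure) \<Otimes>\<^sub>M ((lborel :: real measure) \<Otimes>\<^sub>M (lborel :: real measure))"
  let ?f = "\<lambda>q. vec3 (fst (snd q)) (snd (snd q)) (fst q)"
  interpret P: pair_sigma_finite "lborel :: real measure" "(lborel :: real measure) \<Otimes>\<^sub>M (lborel :: real measure)"
    by (intro pair_sigma_finite.intro sigma_finite_lborel lborel_pair.sigma_finite_measure_axioms)
  have axis_ne: "axis 1 1 \<noteq> (axis 2 1 :: real^3)" "axis 1 1 \<noteq> (axis 3 1 :: real^3)" "axis 2 1 \<noteq> (axis 3 1 :: real^3)"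
    by (simp_all add: axis_eq_axis)
  have "lborel = distr ?P borel ?f"
  proof (rule lborel_eqI)
    fix l u :: "real^3" assume le: "\<And>b. b \<in> Basis \<Longrightarrow> l \<bullet> b \<le> u \<bullet> b"
    have le3: "l $ 1 \<le> u $ 1" "l $ 2 \<le> u $ 2" "l $ 3 \<le> u $ 3"
      using le[of "axis 1 1"] le[of "axis 2 1"] le[of "axis 3 1"] by (simp_all add: Basis_3 inner_axis)
    have "?f -` box l u \<inter> space ?P = {l $ 3 <..< u $ 3} \<times> ({l $ 1 <..< u $ 1} \<times> {l $ 2 <..< u $ 2})"
      by (auto simp: mem_box Basis_3 inner_axis space_pair_measure)
    then have "emeasure (distr ?P borel ?f) (box l u) = emeasure ?P ({l $ 3 <..< u $ 3} \<times> ({l $ 1 <..< u $ 1} \<times> {l $ 2 <..< u $ 2}))"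
      by (subst emeasure_distr) auto
    also have "\<dots> = emeasure lborel {l $ 3 <..< u $ 3} * (emeasure lborel {l $ 1 <..< u $ 1} * emeasure lborel {l $ 2 <..< u $ 2})"
      by (simp add: sigma_finite_measure.emeasure_pair_measure_Times[OF lborel_pair.sigma_finite_measure_axioms] lborel.emeasure_pair_measure_Times)
    also have "\<dots> = (\<Prod>b\<in>Basis. (u - l) \<bullet> b)"
      using le3 axis_ne by (simp add: Basis_3 inner_axis mult.assoc mult.commute mult.left_commute flip: ennreal_mult)
    finally show "emeasure (distr ?P borel ?f) (box l u) = (\<Prod>b\<in>Basis. (u - l) \<bullet> b)" .
  qed simp
  then have "(\<integral>\<^sup>+v. f v \<partial>lborel) = (\<integral>\<^sup>+v. f v \<partial>distr ?P borel ?f)" by simp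
  also have "\<dots> = (\<integral>\<^sup>+q. f (?f q) \<partial>?P)" by (rule nn_integral_distr) auto
  also have "\<dots> = (\<integral>\<^sup>+z. \<integral>\<^sup>+p. f (vec3 (fst p) (snd p) z) \<partial>(lborel \<Otimes>\<^sub>M lborel) \<partial>lborel)"
    by (subst sigma_finite_measure.nn_integral_fst[OF lborel_pair.sigma_finite_measure_axioms, symmetric]) auto
  finally show ?thesis .
qed

lemma power2_ennreal: "0 \<le> a \<Longrightarrow> (ennreal a)\<^sup>2 = ennreal (a\<^sup>2)"
  by (simp add: ennreal_power)

text \<open>On each slice \<open>z = const\<close> apply the two-dimensional Gagliardo--Nirenberg inequality to \<open>u\<^sup>3\<close>;
  the factor \<open>\<integral> u\<^sup>4\<close> over the slice that appears is bounded by integrating \<open>\<partial>\<^sub>3 u\<^sup>4\<close> in the third direction.\<close>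

lemma sobolev_test_function:
  fixes \<phi> :: "real^3 \<Rightarrow> real"
  assumes \<phi>: "\<phi> \<in> test_functions \<Omega>"
  shows "(\<integral>\<^sup>+x. ennreal (\<bar>\<phi> x\<bar> ^ 6) \<partial>lborel) \<le> 1296 * (\<integral>\<^sup>+x. ennreal ((norm (grad \<phi> x))\<^sup>2) \<partial>lborel) ^ 3"
proof -
  define d where "d i v = \<bar>partial_deriv i \<phi> v\<bar>" for i v
  define u where "u v = \<bar>\<phi> v\<bar>" for v
  have nn [simp]: "0 \<le> d i v" "0 \<le> u v" for i v by (simp_all add: d_def u_def)
  have [measurable]: "d i \<in> borel_measurable borel" "u \<in> borel_measurable borel" for i
    using test_function_measurable(1)[OF \<phi>] test_function_measurable(1)[OF test_functions_partial_deriv[OF \<phi>]]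
    unfolding d_def[abs_def] u_def[abs_def] by measurable
  let ?L2 = "(lborel :: real measure) \<Otimes>\<^sub>M (lborel :: real measure)"
  define X where "X = (\<integral>\<^sup>+v. ennreal (u v ^ 6) \<partial>lborel)"
  define N where "N i = (\<integral>\<^sup>+v. ennreal ((d i v)\<^sup>2) \<partial>lborel)" for i
  define F where "F i v = ennreal (3 * (u v)\<^sup>2 * d i v)" for i v
  have [measurable]: "F i \<in> borel_measurable borel" for i unfolding F_def by measurable
  define R where "R z = (\<integral>\<^sup>+p. ennreal (u (vec3 (fst p) (snd p) z) ^ 4) \<partial>?L2)" for z
  define D where "D i z = (\<integral>\<^sup>+p. ennreal ((d i (vec3 (fst p) (snd p) z))\<^sup>2) \<partial>?L2)" for i z
  define P where "P i z = (\<integral>\<^sup>+p. F i (vec3 (fst p) (snd p) z) \<partial>?L2)" for i z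
  \<comment> \<open>The full integral of the third partial derivative of the fourth power of
    \<open>u\<close>: it bounds the slice integrals \<open>R z\<close> uniformly in
    \<open>z\<close>.\<close>
  define K where "K = (\<integral>\<^sup>+v. ennreal (4 * u v ^ 3 * d 3 v) \<partial>lborel)"
  have [measurable]: "R \<in> borel_measurable borel" "D i \<in> borel_measurable borel" "P i \<in> borel_measurable borel" for i
    unfolding R_def D_def P_def by measurable
  have N_eq: "N i = (\<integral>\<^sup>+z. D i z \<partial>lborel)" for i unfolding N_def D_def by (rule nn_integral_vec3) measurable
  have K2: "K\<^sup>2 \<le> 16 * X * N 3"
  proof -
    have "K = (\<integral>\<^sup>+v. ennreal (4 * u v ^ 3) * ennreal (d 3 v) \<partial>lborel)"
      unfolding K_def by (simp add: ennreal_mult)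
    then have "K\<^sup>2 \<le> (\<integral>\<^sup>+v. (ennreal (4 * u v ^ 3))\<^sup>2 \<partial>lborel) * (\<integral>\<^sup>+v. (ennreal (d 3 v))\<^sup>2 \<partial>lborel)"
      by (simp only:) (rule Cauchy_Schwarz_nn_integral; measurable)
    also have "(\<integral>\<^sup>+v. (ennreal (4 * u v ^ 3))\<^sup>2 \<partial>lborel) = (\<integral>\<^sup>+v. 16 * ennreal (u v ^ 6) \<partial>lborel)"
    proof (rule nn_integral_cong)
      fix v
      have "(4 * u v ^ 3)\<^sup>2 = 16 * u v ^ 6" by (simp add: power_mult_distrib flip: power_mult)
      then show "(ennreal (4 * u v ^ 3))\<^sup>2 = 16 * ennreal (u v ^ 6)" by (simp add: power2_ennreal ennreal_mult)
    qed
    also have "\<dots> = 16 * X" unfolding X_def by (rule nn_integral_cmult) measurable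
    finally show ?thesis by (simp add: N_def power2_ennreal)
  qed
  have RK: "R z \<le> K" for z
  proof -
    have "R z \<le> (\<integral>\<^sup>+p. \<integral>\<^sup>+s. ennreal (4 * u (vec3 (fst p) (snd p) s) ^ 3 * d 3 (vec3 (fst p) (snd p) s)) \<partial>lborel \<partial>?L2)"
      unfolding R_def
    proof (rule nn_integral_mono)
      fix p :: "real \<times> real"
      have "ennreal (u (vec3 (fst p) (snd p) z) ^ 4) \<le> (\<integral>\<^sup>+s. ennreal (4 * u (vec3 (fst p) (snd p) (s + z)) ^ 3 * d 3 (vec3 (fst p) (snd p) (s + z))) \<partial>lborel)"
        using power_le_line_integral[OF \<phi>, of 4 "vec3 (fst p) (snd p) z" 3] by (simp add: u_def d_def vec3_add)
      also have "\<dots> = (\<integral>\<^sup>+s. ennreal (4 * u (vec3 (fst p) (snd p) s) ^ 3 * d 3 (vec3 (fst p) (snd p) s)) \<partial>lborel)"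
        by (rule nn_integral_lborel_translate) measurable
      finally show "ennreal (u (vec3 (fst p) (snd p) z) ^ 4) \<le> (\<integral>\<^sup>+s. ennreal (4 * u (vec3 (fst p) (snd p) s) ^ 3 * d 3 (vec3 (fst p) (snd p) s)) \<partial>lborel)" .
    qed
    also have "\<dots> = (\<integral>\<^sup>+s. \<integral>\<^sup>+p. ennreal (4 * u (vec3 (fst p) (snd p) s) ^ 3 * d 3 (vec3 (fst p) (snd p) s)) \<partial>?L2 \<partial>lborel)"
    proof -
      interpret Q: pair_sigma_finite ?L2 "lborel :: real measure"
        by (intro pair_sigma_finite.intro sigma_finite_lborel lborel_pair.sigma_finite_measure_axioms)
      show ?thesis by (rule Q.Fubini'[symmetric]) measurable
    qed
    also have "\<dots> = K" unfolding K_def by (rule nn_integral_vec3[symmetric]) measurable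
    finally show ?thesis .
  qed
  have P2: "(P i z)\<^sup>2 \<le> 9 * K * D i z" for i z
  proof -
    have "P i z = (\<integral>\<^sup>+p. ennreal (3 * (u (vec3 (fst p) (snd p) z))\<^sup>2) * ennreal (d i (vec3 (fst p) (snd p) z)) \<partial>?L2)"
      unfolding P_def F_def by (simp add: ennreal_mult)
    then have "(P i z)\<^sup>2 \<le> (\<integral>\<^sup>+p. (ennreal (3 * (u (vec3 (fst p) (snd p) z))\<^sup>2))\<^sup>2 \<partial>?L2) * (\<integral>\<^sup>+p. (ennreal (d i (vec3 (fst p) (snd p) z)))\<^sup>2 \<partial>?L2)"
      by (simp only:) (rule Cauchy_Schwarz_nn_integral; measurable)
    also have "(\<integral>\<^sup>+p. (ennreal (3 * (u (vec3 (fst p) (snd p) z))\<^sup>2))\<^sup>2 \<partial>?L2) = (\<integral>\<^sup>+p. 9 * ennreal (u (vec3 (fst p) (snd p) z) ^ 4) \<partial>?L2)"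
    proof (rule nn_integral_cong)
      fix p :: "real \<times> real"
      have "(3 * (u v)\<^sup>2)\<^sup>2 = 9 * u v ^ 4" for v by (simp add: power_mult_distrib flip: power_mult)
      then show "(ennreal (3 * (u (vec3 (fst p) (snd p) z))\<^sup>2))\<^sup>2 = 9 * ennreal (u (vec3 (fst p) (snd p) z) ^ 4)"
        by (simp add: power2_ennreal ennreal_mult)
    qed
    also have "\<dots> = 9 * R z" unfolding R_def by (rule nn_integral_cmult) measurable
    also have "9 * R z * (\<integral>\<^sup>+p. (ennreal (d i (vec3 (fst p) (snd p) z)))\<^sup>2 \<partial>?L2) = 9 * R z * D i z"
      by (simp add: D_def power2_ennreal)
    also have "\<dots> \<le> 9 * K * D i z" by (intro mult_mono RK) auto
    finally show ?thesis .
  qed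
  \<comment> \<open>The sixth power is the product of two cubes. One is bounded by a line integral
    in the first direction, which depends on \<open>y\<close> only, the other by one in the second
    direction, which depends on \<open>x\<close> only, so the double integral factorizes.\<close>
  have slice: "(\<integral>\<^sup>+p. ennreal (u (vec3 (fst p) (snd p) z) ^ 6) \<partial>?L2) \<le> P 1 z * P 2 z" for z
  proof -
    define A where "A y = (\<integral>\<^sup>+s. F 1 (vec3 s y z) \<partial>lborel)" for y
    define B where "B x = (\<integral>\<^sup>+s. F 2 (vec3 x s z) \<partial>lborel)" for x
    have [measurable]: "A \<in> borel_measurable borel" "B \<in> borel_measurable borel"
      unfolding A_def B_def by measurable
    have "(\<integral>\<^sup>+p. ennreal (u (vec3 (fst p) (snd p) z) ^ 6) \<partial>?L2) \<le> (\<integral>\<^sup>+p. B (fst p) * A (snd p) \<partial>?L2)"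
    proof (rule nn_integral_mono)
      fix p :: "real \<times> real"
      let ?v = "vec3 (fst p) (snd p) z"
      have "ennreal (u ?v ^ 3) \<le> (\<integral>\<^sup>+s. F 1 (vec3 (s + fst p) (snd p) z) \<partial>lborel)"
        using power_le_line_integral[OF \<phi>, of 3 ?v 1] by (simp add: u_def d_def F_def vec3_add)
      also have "\<dots> = A (snd p)" unfolding A_def by (rule nn_integral_lborel_translate) measurable
      finally have a: "ennreal (u ?v ^ 3) \<le> A (snd p)" .
      have "ennreal (u ?v ^ 3) \<le> (\<integral>\<^sup>+s. F 2 (vec3 (fst p) (s + snd p) z) \<partial>lborel)"
        using power_le_line_integral[OF \<phi>, of 3 ?v 2] by (simp add: u_def d_def F_def vec3_add)
      also have "\<dots> = B (fst p)" unfolding B_def by (rule nn_integral_lborel_translate) measurable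
      finally have b: "ennreal (u ?v ^ 3) \<le> B (fst p)" .
      have e: "u ?v ^ 6 = u ?v ^ 3 * u ?v ^ 3" by (simp flip: power_add)
      have "ennreal (u ?v ^ 6) = ennreal (u ?v ^ 3) * ennreal (u ?v ^ 3)"
        unfolding e by (rule ennreal_mult) simp_all
      also have "\<dots> \<le> B (fst p) * A (snd p)" by (intro mult_mono a b) auto
      finally show "ennreal (u ?v ^ 6) \<le> B (fst p) * A (snd p)" .
    qed
    also have "\<dots> = (\<integral>\<^sup>+x. \<integral>\<^sup>+y. B x * A y \<partial>lborel \<partial>lborel)"
      by (subst lborel.nn_integral_fst[symmetric]) auto
    also have "\<dots> = (\<integral>\<^sup>+x. B x \<partial>lborel) * (\<integral>\<^sup>+y. A y \<partial>lborel)"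
      by (simp add: nn_integral_cmult nn_integral_multc)
    also have "(\<integral>\<^sup>+x. B x \<partial>lborel) = P 2 z"
      unfolding P_def B_def by (subst lborel.nn_integral_fst[symmetric]) auto
    also have "(\<integral>\<^sup>+y. A y \<partial>lborel) = P 1 z"
      unfolding P_def A_def by (subst lborel_pair.nn_integral_snd[symmetric]) (auto simp: split_beta')
    finally show ?thesis by (simp add: mult.commute)
  qed
  have "X = (\<integral>\<^sup>+z. \<integral>\<^sup>+p. ennreal (u (vec3 (fst p) (snd p) z) ^ 6) \<partial>?L2 \<partial>lborel)"
    unfolding X_def by (rule nn_integral_vec3) measurable
  also have "\<dots> \<le> (\<integral>\<^sup>+z. P 1 z * P 2 z \<partial>lborel)" by (intro nn_integral_mono slice)
  finally have "X\<^sup>2 \<le> (\<integral>\<^sup>+z. P 1 z * P 2 z \<partial>lborel)\<^sup>2" by (rule power_mono) simp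
  also have "\<dots> \<le> (\<integral>\<^sup>+z. (P 1 z)\<^sup>2 \<partial>lborel) * (\<integral>\<^sup>+z. (P 2 z)\<^sup>2 \<partial>lborel)"
    by (rule Cauchy_Schwarz_nn_integral) measurable
  also have "\<dots> \<le> (9 * K * N 1) * (9 * K * N 2)"
  proof (rule mult_mono)
    have "(\<integral>\<^sup>+z. (P i z)\<^sup>2 \<partial>lborel) \<le> 9 * K * N i" for i
    proof -
      have "(\<integral>\<^sup>+z. (P i z)\<^sup>2 \<partial>lborel) \<le> (\<integral>\<^sup>+z. 9 * K * D i z \<partial>lborel)" by (intro nn_integral_mono P2)
      also have "\<dots> = 9 * K * N i" unfolding N_eq by (rule nn_integral_cmult) measurable
      finally show ?thesis .
    qed
    then show "(\<integral>\<^sup>+z. (P 1 z)\<^sup>2 \<partial>lborel) \<le> 9 * K * N 1" "(\<integral>\<^sup>+z. (P 2 z)\<^sup>2 \<partial>lborel) \<le> 9 * K * N 2" by blast+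
  qed auto
  also have "\<dots> = 81 * K\<^sup>2 * (N 1 * N 2)"
  proof -
    have "(9::ennreal) * 9 = 81" by simp
    then show ?thesis by (simp only: power2_eq_square mult.assoc mult.left_commute mult.commute)
  qed
  also have "\<dots> \<le> 81 * (16 * X * N 3) * (N 1 * N 2)" by (intro mult_mono K2) auto
  finally have X2: "X\<^sup>2 \<le> 81 * (16 * X * N 3) * (N 1 * N 2)" .
  define G where "G = (\<integral>\<^sup>+x. ennreal ((norm (grad \<phi> x))\<^sup>2) \<partial>lborel)"
  have NG: "N i \<le> G" for i
    unfolding N_def G_def
  proof (intro nn_integral_mono ennreal_leI)
    fix x
    have "\<bar>grad \<phi> x $ i\<bar> \<le> norm (grad \<phi> x)" by (rule component_le_norm_cart)
    then show "(d i x)\<^sup>2 \<le> (norm (grad \<phi> x))\<^sup>2" by (intro power_mono) (auto simp: d_def)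
  qed
  \<comment> \<open>The constant is 81 times 16: two factors 9 from differentiating cubes and one
    factor 16 from differentiating the fourth power, each after squaring.\<close>
  have "X * X \<le> X * (1296 * G ^ 3)"
  proof -
    have "X * X \<le> 81 * (16 * X * N 3) * (N 1 * N 2)" using X2 by (simp add: power2_eq_square)
    also have "\<dots> \<le> 81 * (16 * X * G) * (G * G)" by (intro mult_mono NG) auto
    also have "\<dots> = X * (1296 * G ^ 3)"
    proof -
      have "(81::ennreal) * 16 = 1296" by simp
      then show ?thesis by (simp add: power3_eq_cube mult.assoc mult.left_commute mult.commute)
    qed
    finally show ?thesis .
  qed
  \<comment> \<open>Finiteness is needed to cancel one factor \<open>X\<close>; for a test function
    it comes from compact support.\<close>
  moreover have "X < top"
  proof -
    obtain C where C: "compact C" "\<And>x. x \<notin> C \<Longrightarrow> \<phi> x = 0" using test_functionsE[OF \<phi>] by metis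
    have "integrable lborel (\<lambda>x. \<bar>\<phi> x\<bar> ^ 6)"
    proof (rule integrable_compact_support[OF _ C(1)])
      show "continuous_on UNIV (\<lambda>x. \<bar>\<phi> x\<bar> ^ 6)"
        by (rule continuous_on_power[OF continuous_on_rabs[OF smooth_continuous_on[OF test_functions_smooth[OF \<phi>]]]])
    qed (simp add: C(2))
    then show ?thesis
      unfolding X_def u_def by (subst nn_integral_eq_integral) auto
  qed
  ultimately have "X \<le> 1296 * G ^ 3"
    by (cases "X = 0") (auto simp: ennreal_mult_le_mult_iff)
  then show ?thesis by (simp add: X_def G_def u_def)
qed

text \<open>Fatou's lemma along an almost everywhere convergent subsequence of approximating test
  functions.\<close>

lemma h0_pair_sobolev:
  fixes u :: "real^3 \<Rightarrow> real"
  assumes u: "h0_pair \<Omega> u V"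
  shows "(\<integral>\<^sup>+x. ennreal (\<bar>u x\<bar> ^ 6) \<partial>lborel) \<le> ennreal (1296 * (l2norm lborel V) ^ 6)"
proof -
  obtain \<phi> where \<phi>: "\<And>n. \<phi> n \<in> test_functions \<Omega>" "(\<lambda>n. l2norm lborel (\<lambda>x. \<phi> n x - u x)) \<longlonglongrightarrow> 0"
    "(\<lambda>n. l2norm lborel (\<lambda>x. grad (\<phi> n) x - V x)) \<longlonglongrightarrow> 0" by (rule h0_pair_sequence[OF u]) (rule that)
  note t = test_function_square_integrable
  note sq = h0_pairD(1,2)[OF u]
  obtain r where r: "strict_mono r" "AE x in lborel. (\<lambda>n. \<phi> (r n) x) \<longlonglongrightarrow> u x"
    by (rule l2_AE_subseq[OF t(1)[OF \<phi>(1)] sq(1) \<phi>(2)])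
  have [measurable]: "\<phi> n \<in> borel_measurable borel" for n by (rule test_function_measurable[OF \<phi>(1)])
  have "(\<integral>\<^sup>+x. ennreal (\<bar>u x\<bar> ^ 6) \<partial>lborel) = (\<integral>\<^sup>+x. liminf (\<lambda>n. ennreal (\<bar>\<phi> (r n) x\<bar> ^ 6)) \<partial>lborel)"
  proof (rule nn_integral_cong_AE)
    show "AE x in lborel. ennreal (\<bar>u x\<bar> ^ 6) = liminf (\<lambda>n. ennreal (\<bar>\<phi> (r n) x\<bar> ^ 6))"
      using r(2) by eventually_elim (auto intro!: lim_imp_Liminf[symmetric] tendsto_ennrealI tendsto_intros)
  qed
  also have "\<dots> \<le> liminf (\<lambda>n. \<integral>\<^sup>+x. ennreal (\<bar>\<phi> (r n) x\<bar> ^ 6) \<partial>lborel)"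
    by (rule nn_integral_liminf) measurable
  also have "\<dots> \<le> liminf (\<lambda>n. ennreal (1296 * (l2norm lborel (grad (\<phi> (r n)))) ^ 6))"
  proof (intro Liminf_mono always_eventually allI)
    fix n
    have "(\<integral>\<^sup>+x. ennreal (\<bar>\<phi> (r n) x\<bar> ^ 6) \<partial>lborel) \<le> 1296 * ennreal ((l2norm lborel (grad (\<phi> (r n))))\<^sup>2) ^ 3"
      using sobolev_test_function[OF \<phi>(1), of "r n"] by (simp add: nn_integral_l2norm[OF t(2)[OF \<phi>(1)]])
    also have "\<dots> = ennreal (1296 * (l2norm lborel (grad (\<phi> (r n)))) ^ 6)"
      by (simp add: ennreal_power ennreal_mult flip: power_mult)
    finally show "(\<integral>\<^sup>+x. ennreal (\<bar>\<phi> (r n) x\<bar> ^ 6) \<partial>lborel) \<le> ennreal (1296 * (l2norm lborel (grad (\<phi> (r n)))) ^ 6)" .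
  qed
  also have "\<dots> = ennreal (1296 * (l2norm lborel V) ^ 6)"
    by (intro lim_imp_Liminf tendsto_ennrealI tendsto_intros
        LIMSEQ_subseq_LIMSEQ[OF l2norm_tendsto[OF t(2)[OF \<phi>(1)] sq(2) \<phi>(3)] r(1), unfolded comp_def]) simp
  finally show ?thesis .
qed


section \<open>Compactness in the mean\<close>

lemma mollify_eq_lborel:
  fixes u :: "real^'n \<Rightarrow> real"
  assumes \<delta>: "\<delta> > 0" and [measurable]: "u \<in> borel_measurable borel"
  shows "mollify \<delta> u x = (\<integral>z. rho \<delta> z * u (z + x) \<partial>lborel)"
proof -
  have [measurable]: "(rho \<delta> :: real^'n \<Rightarrow> real) \<in> borel_measurable borel"
    by (rule test_function_measurable(1)[OF rho_test[OF \<delta>]])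
  have m: "rho \<delta> (- z) = rho \<delta> z" for z :: "real^'n" by (rule rho_norm_cong) simp
  show ?thesis
    using integral_lborel_translate[of "\<lambda>y. rho \<delta> (x - y) * u y" x]
    by (simp add: conv_def m)
qed

lemma h0_pair_integrable:
  assumes u: "h0_pair \<Omega> u V" and 0: "\<And>x. x \<notin> ball 0 1 \<Longrightarrow> u x = 0"
  shows "integrable lborel u"
proof -
  note sq = h0_pairD(1)[OF u]
  have e: "(norm (indicat_real (ball 0 1) x))\<^sup>2 = indicat_real (ball 0 1) x" for x :: "real^'a"
    by (simp add: indicator_def)
  have "integrable lborel (indicat_real (ball (0::real^'a) 1))"
    using emeasure_lborel_ball_finite[of "0::real^'a" 1] by simp
  then have "square_integrable lborel (indicat_real (ball (0::real^'a) 1))"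
    unfolding square_integrable_def e by simp
  from square_integrable_mult[OF this sq]
  have "integrable lborel (\<lambda>x. indicat_real (ball 0 1) x * u x)" .
  moreover have "indicat_real (ball 0 1) x * u x = u x" for x
    by (cases "x \<in> ball 0 1") (simp_all add: 0)
  ultimately show ?thesis by (simp only:)
qed

text \<open>Poincare inequality: a shift of length 3 moves the unit ball off itself, so at each
  point of the ball the increment of \<open>u\<close> has modulus \<open>\<bar>u x\<bar>\<close>.
  The constant is the length of the shift.\<close>

lemma h0_pair_l2norm_le:
  fixes u :: "real^'n \<Rightarrow> real"
  assumes u: "h0_pair \<Omega> u V" and 0: "\<And>x. x \<notin> ball 0 1 \<Longrightarrow> u x = 0"
  shows "l2norm lborel u \<le> 3 * l2norm lborel V"
proof -
  let ?z = "3 *\<^sub>R axis undefined 1 :: real^'n"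
  note sq = h0_pairD(1)[OF u]
  have "l2norm lborel u \<le> l2norm lborel (\<lambda>x. u (x + ?z) - u x)"
  proof (rule square_integrable_bound(2)[OF square_integrable_diff(1)[OF l2norm_translate(1)[OF sq] sq]])
    show "u \<in> borel_measurable lborel" using h0_pairD(3)[OF u] by simp
    show "AE x in lborel. norm (u x) \<le> norm (u (x + ?z) - u x)"
    proof (rule AE_I2)
      fix x
      show "norm (u x) \<le> norm (u (x + ?z) - u x)"
      proof (cases "x \<in> ball 0 1")
        case True
        have "norm ?z \<le> norm (x + ?z) + norm x" using norm_triangle_ineq4[of "x + ?z" x] by simp
        then have "x + ?z \<notin> ball 0 1" using True by (simp add: norm_axis_1)
        then show ?thesis by (simp add: 0)
      qed (simp add: 0)
    qed
  qed
  also have "\<dots> \<le> norm ?z * l2norm lborel V" by (rule h0_pair_translation[OF u])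
  finally show ?thesis by (simp add: norm_axis_1)
qed

text \<open>The rate depends on \<open>u\<close> only through the gradient norm, hence is uniform on
  bounded sets.\<close>

lemma mollify_h0_pair_close:
  assumes u: "h0_pair \<Omega> u V" and 0: "\<And>x. x \<notin> ball 0 1 \<Longrightarrow> u x = 0" and \<delta>: "\<delta> > 0"
  shows "square_integrable lborel (mollify \<delta> u)" "l2norm lborel (\<lambda>x. mollify \<delta> u x - u x) \<le> \<delta> * l2norm lborel V"
proof -
  note sq = h0_pairD(1)[OF u] and i = h0_pair_integrable[OF u 0]
  have [measurable]: "mollify \<delta> u \<in> borel_measurable borel" "u \<in> borel_measurable borel"
    using mollify_measurable[OF \<delta> i] h0_pairD(3)[OF u] by simp_all
  have "(\<integral>\<^sup>+x. ennreal ((mollify \<delta> u x - u x)\<^sup>2) \<partial>lborel) \<le> ennreal ((\<delta> * l2norm lborel V)\<^sup>2)"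
  proof (rule mollify_close[OF \<delta> i])
    fix z :: "real^'a" assume z: "norm z < \<delta>"
    have s: "square_integrable lborel (\<lambda>x. u (x + z) - u x)"
      by (rule square_integrable_diff(1)[OF l2norm_translate(1)[OF sq] sq])
    have "l2norm lborel (\<lambda>x. u (x + z) - u x) \<le> \<delta> * l2norm lborel V"
      using h0_pair_translation[OF u, of z] mult_right_mono[OF less_imp_le[OF z] l2norm_nonneg[of lborel V]] by (rule order_trans)
    then have "(l2norm lborel (\<lambda>x. u (x + z) - u x))\<^sup>2 \<le> (\<delta> * l2norm lborel V)\<^sup>2" by (rule power_mono) simp
    then show "(\<integral>\<^sup>+x. ennreal ((u (x + z) - u x)\<^sup>2) \<partial>lborel) \<le> ennreal ((\<delta> * l2norm lborel V)\<^sup>2)"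
      using nn_integral_l2norm[OF s] by (simp add: ennreal_leI)
  qed
  then have *: "(\<integral>\<^sup>+x. ennreal ((norm (mollify \<delta> u x - u x))\<^sup>2) \<partial>lborel) \<le> ennreal ((\<delta> * l2norm lborel V)\<^sup>2)" by simp
  have s: "square_integrable lborel (\<lambda>x. mollify \<delta> u x - u x)"
    by (rule square_integrableI_nn(1)[OF _ *]) auto
  show "square_integrable lborel (mollify \<delta> u)"
    using square_integrable_add(1)[OF s sq] by simp
  have "(l2norm lborel (\<lambda>x. mollify \<delta> u x - u x))\<^sup>2 \<le> (\<delta> * l2norm lborel V)\<^sup>2"
    by (rule square_integrableI_nn(2)[OF _ *]) auto
  then show "l2norm lborel (\<lambda>x. mollify \<delta> u x - u x) \<le> \<delta> * l2norm lborel V"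
    by (rule power2_le_imp_le) (use \<delta> in simp)
qed

text \<open>At a fixed scale \<open>\<delta>\<close>, Cauchy-Schwarz against the kernel turns
  \<open>L2\<close> control of increments and values into uniform pointwise control: the hypotheses
  of Arzela-Ascoli.\<close>

lemma mollify_h0_pair_lipschitz:
  assumes u: "h0_pair \<Omega> u V" and \<delta>: "\<delta> > 0"
  shows "\<bar>mollify \<delta> u x - mollify \<delta> u y\<bar> \<le> l2norm lborel (rho \<delta> :: real^'n \<Rightarrow> real) * (norm (x - y) * l2norm lborel V)"
    and "\<bar>mollify \<delta> u x\<bar> \<le> l2norm lborel (rho \<delta> :: real^'n \<Rightarrow> real) * l2norm lborel (u :: real^'n \<Rightarrow> real)"
proof -
  note sq = h0_pairD(1)[OF u] and r = test_function_square_integrable(1)[OF rho_test[OF \<delta>]]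
  note m = h0_pairD(3)[OF u]
  note int = square_integrable_mult[OF r l2norm_translate(1)[OF sq]]
  have s: "square_integrable lborel (\<lambda>z. u (z + x) - u (z + y))"
    by (rule square_integrable_diff(1)[OF l2norm_translate(1)[OF sq] l2norm_translate(1)[OF sq]])
  have "mollify \<delta> u x - mollify \<delta> u y = (\<integral>z. rho \<delta> z \<bullet> (u (z + x) - u (z + y)) \<partial>lborel)"
    unfolding mollify_eq_lborel[OF \<delta> m] using int by (simp add: right_diff_distrib)
  also have "\<bar>\<dots>\<bar> \<le> l2norm lborel (rho \<delta> :: real^'n \<Rightarrow> real) * l2norm lborel (\<lambda>z. u (z + x) - u (z + y))"
    by (rule l2norm_Cauchy_Schwarz[OF r s])
  also have "l2norm lborel (\<lambda>z. u (z + x) - u (z + y)) = l2norm lborel (\<lambda>z. u (z + (x - y)) - u z)"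
    using l2norm_translate(2)[OF square_integrable_diff(1)[OF l2norm_translate(1)[OF sq, of "x - y"] sq], of y]
    by (simp add: algebra_simps)
  also have "\<dots> \<le> norm (x - y) * l2norm lborel V" by (rule h0_pair_translation[OF u])
  finally show "\<bar>mollify \<delta> u x - mollify \<delta> u y\<bar> \<le> l2norm lborel (rho \<delta> :: real^'n \<Rightarrow> real) * (norm (x - y) * l2norm lborel V)"
    by (simp add: mult_left_mono)
  have "\<bar>mollify \<delta> u x\<bar> = \<bar>\<integral>z. rho \<delta> z \<bullet> u (z + x) \<partial>lborel\<bar>"
    unfolding mollify_eq_lborel[OF \<delta> m] by simp
  also have "\<dots> \<le> l2norm lborel (rho \<delta> :: real^'n \<Rightarrow> real) * l2norm lborel (\<lambda>z. u (z + x))"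
    by (rule l2norm_Cauchy_Schwarz[OF r l2norm_translate(1)[OF sq]])
  finally show "\<bar>mollify \<delta> u x\<bar> \<le> l2norm lborel (rho \<delta> :: real^'n \<Rightarrow> real) * l2norm lborel (u :: real^'n \<Rightarrow> real)"
    by (simp add: l2norm_translate(2)[OF sq])
qed

text \<open>Arzela-Ascoli on the ball of radius 2. Since \<open>\<delta> \<le> 1\<close>, all
  mollifications vanish outside it, so uniform convergence there gives convergence in
  \<open>L2\<close>.\<close>

lemma mollify_subsequence:
  fixes v :: "nat \<Rightarrow> real^'n \<Rightarrow> real"
  assumes v: "\<And>n. h0_pair \<Omega> (v n) (V n)" and v0: "\<And>n x. x \<notin> ball 0 1 \<Longrightarrow> v n x = 0"
    and A: "\<And>n. l2norm lborel (V n) \<le> A" and \<delta>: "0 < \<delta>" "\<delta> \<le> 1"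
  obtains r :: "nat \<Rightarrow> nat" where "strict_mono r"
    "\<And>e. e > 0 \<Longrightarrow> \<exists>N. \<forall>m\<ge>N. \<forall>n\<ge>N. l2norm lborel (\<lambda>x. mollify \<delta> (v (r m)) x - mollify \<delta> (v (r n)) x) < e"
proof -
  define S where "S = cball (0::real^'n) 2"
  define L where "L = l2norm lborel (rho \<delta> :: real^'n \<Rightarrow> real)"
  have L: "0 \<le> L" by (simp add: L_def)
  have A0: "0 \<le> A" using A[of 0] l2norm_nonneg order_trans by blast
  have bound: "norm (mollify \<delta> (v n) x) \<le> L * (3 * A)" for n x
  proof -
    have "\<bar>mollify \<delta> (v n) x\<bar> \<le> L * l2norm lborel (v n)" unfolding L_def by (rule mollify_h0_pair_lipschitz(2)[OF v \<delta>(1)])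
    also have "\<dots> \<le> L * (3 * A)"
      using h0_pair_l2norm_le[OF v v0] A by (intro mult_left_mono L) (meson mult_left_mono order_trans zero_le_numeral)
    finally show ?thesis by simp
  qed
  have equi: "norm (mollify \<delta> (v n) x - mollify \<delta> (v n) y) \<le> L * A * norm (x - y)" for n x y
  proof -
    have "\<bar>mollify \<delta> (v n) x - mollify \<delta> (v n) y\<bar> \<le> L * (norm (x - y) * l2norm lborel (V n))"
      unfolding L_def by (rule mollify_h0_pair_lipschitz(1)[OF v \<delta>(1)])
    also have "\<dots> \<le> L * (norm (x - y) * A)" by (intro mult_left_mono A L norm_ge_zero)
    finally show ?thesis by (simp add: mult_ac)
  qed
  have "compact S" by (simp add: S_def)
  moreover have "\<exists>d>0. \<forall>n y. y \<in> S \<and> norm (x - y) < d \<longrightarrow> norm (mollify \<delta> (v n) x - mollify \<delta> (v n) y) < e"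
    if "0 < e" for x e
  proof (intro exI[of _ "e / (L * A + 1)"] conjI allI impI)
    have p: "0 < L * A + 1" using L A0 by (simp add: add_nonneg_pos)
    then show "0 < e / (L * A + 1)" using that by simp
    fix n y assume y: "y \<in> S \<and> norm (x - y) < e / (L * A + 1)"
    have "L * A * norm (x - y) \<le> (L * A + 1) * norm (x - y)" by (intro mult_right_mono) auto
    also have "\<dots> < e" using y p by (simp add: field_simps)
    finally show "norm (mollify \<delta> (v n) x - mollify \<delta> (v n) y) < e" using equi[of n x y] by linarith
  qed
  ultimately obtain g r where r: "strict_mono (r :: nat \<Rightarrow> nat)"
    "\<And>e. 0 < e \<Longrightarrow> \<exists>N. \<forall>n x. n \<ge> N \<and> x \<in> S \<longrightarrow> norm (mollify \<delta> (v (r n)) x - g x) < e"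
    using Arzela_Ascoli[of S "\<lambda>n. mollify \<delta> (v n)" "L * (3 * A)"] bound by metis
  define M where "M = measure lborel S"
  have M: "0 \<le> M" by (simp add: M_def)
  have MS: "emeasure lborel S = ennreal M"
    using emeasure_lborel_cball_finite[of "0::real^'n" 2] by (simp add: M_def S_def emeasure_eq_ennreal_measure)
  show thesis
  proof (rule that[OF r(1)])
    fix e :: real assume e: "e > 0"
    define \<eta> where "\<eta> = e / (2 * (M + 1))"
    have \<eta>: "\<eta> > 0" using e M by (simp add: \<eta>_def)
    obtain N where N: "\<And>n x. n \<ge> N \<Longrightarrow> x \<in> S \<Longrightarrow> norm (mollify \<delta> (v (r n)) x - g x) < \<eta> / 2"
      using r(2)[of "\<eta> / 2"] \<eta> by auto
    show "\<exists>N. \<forall>m\<ge>N. \<forall>n\<ge>N. l2norm lborel (\<lambda>x. mollify \<delta> (v (r m)) x - mollify \<delta> (v (r n)) x) < e"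
    proof (intro exI[of _ N] allI impI)
      fix m n assume mn: "N \<le> m" "N \<le> n"
      let ?f = "\<lambda>x. mollify \<delta> (v (r m)) x - mollify \<delta> (v (r n)) x"
      have "(\<integral>\<^sup>+x. ennreal ((norm (?f x))\<^sup>2) \<partial>lborel) \<le> (\<integral>\<^sup>+x. ennreal (\<eta>\<^sup>2) * indicator S x \<partial>lborel)"
      proof (rule nn_integral_mono)
        fix x
        show "ennreal ((norm (?f x))\<^sup>2) \<le> ennreal (\<eta>\<^sup>2) * indicator S x"
        proof (cases "x \<in> S")
          case True
          have "norm (?f x) \<le> norm (mollify \<delta> (v (r m)) x - g x) + norm (mollify \<delta> (v (r n)) x - g x)"
            using norm_triangle_ineq4[of "mollify \<delta> (v (r m)) x - g x" "mollify \<delta> (v (r n)) x - g x"] by simp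
          also have "\<dots> \<le> \<eta>" using N[OF mn(1) True] N[OF mn(2) True] by simp
          finally have "(norm (?f x))\<^sup>2 \<le> \<eta>\<^sup>2" by (rule power_mono) simp
          then show ?thesis using True by (simp add: ennreal_leI)
        next
          case False
          then have x: "1 + \<delta> < norm x" using \<delta> by (simp add: S_def)
          have "mollify \<delta> (v k) x = 0" for k
            by (rule mollify_eq_0[OF \<delta>(1) _ x]) (simp add: v0)
          then show ?thesis by simp
        qed
      qed
      also have "\<dots> = ennreal (\<eta>\<^sup>2) * emeasure lborel S" by (rule nn_integral_cmult_indicator) (simp add: S_def)
      also have "\<dots> = ennreal (\<eta>\<^sup>2 * M)" using M by (simp add: MS ennreal_mult)
      finally have "(l2norm lborel ?f)\<^sup>2 \<le> \<eta>\<^sup>2 * M"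
        using mollify_measurable[OF \<delta>(1) h0_pair_integrable[OF v v0]] M by (intro square_integrableI_nn(2)) auto
      also have "\<dots> \<le> (\<eta> * (M + 1))\<^sup>2"
      proof -
        have "M \<le> (M + 1)\<^sup>2" using M by (simp add: power2_sum)
        then show ?thesis by (simp add: power_mult_distrib mult_left_mono)
      qed
      also have "\<eta> * (M + 1) = e / 2" using M by (simp add: \<eta>_def field_simps)
      finally have "l2norm lborel ?f \<le> e / 2" by (rule power2_le_imp_le) (use e in simp)
      then show "l2norm lborel ?f < e" using e by simp
    qed
  qed
qed

text \<open>Along a diagonal subsequence the mollifications are Cauchy in \<open>L2\<close> at every
  scale \<open>\<delta> k\<close>. The mollification error is at most \<open>\<delta> k * A\<close>
  for all members at once, so the functions themselves are Cauchy.\<close>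

theorem rellich:
  fixes v :: "nat \<Rightarrow> real^'n \<Rightarrow> real"
  assumes v: "\<And>n. h0_pair \<Omega> (v n) (V n)" and v0: "\<And>n x. x \<notin> ball 0 1 \<Longrightarrow> v n x = 0"
    and A: "\<And>n. l2norm lborel (V n) \<le> A"
  obtains r w where "strict_mono (r :: nat \<Rightarrow> nat)" "square_integrable lborel w" "(\<lambda>n. l2norm lborel (\<lambda>x. v (r n) x - w x)) \<longlonglongrightarrow> 0"
proof -
  define \<delta> where "\<delta> k = 1 / real (Suc k)" for k
  have \<delta>: "0 < \<delta> k" "\<delta> k \<le> 1" for k by (auto simp: \<delta>_def)
  define P where "P k s \<longleftrightarrow> (\<forall>e>0. \<exists>N. \<forall>m\<ge>N. \<forall>n\<ge>N.
      l2norm lborel (\<lambda>x. mollify (\<delta> k) (v (s m)) x - mollify (\<delta> k) (v (s n)) x) < e)" for k and s :: "nat \<Rightarrow> nat"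
  interpret subseqs P
  proof
    fix k and s :: "nat \<Rightarrow> nat" assume "strict_mono s"
    obtain r :: "nat \<Rightarrow> nat" where "strict_mono r"
      "\<And>e. e > 0 \<Longrightarrow> \<exists>N. \<forall>m\<ge>N. \<forall>n\<ge>N. l2norm lborel (\<lambda>x. mollify (\<delta> k) (v (s (r m))) x - mollify (\<delta> k) (v (s (r n))) x) < e"
      by (rule mollify_subsequence[of \<Omega> "\<lambda>n. v (s n)" "\<lambda>n. V (s n)" A "\<delta> k"]) (use v v0 A \<delta> in auto)
    then show "\<exists>r. strict_mono r \<and> P k (s \<circ> r)" by (auto simp: P_def)
  qed
  \<comment> \<open>The diagonal sequence is a subsequence of the \<open>k\<close>-th stage only
    from index \<open>Suc k\<close> on; passing to further subsequences preserves
    \<open>P k\<close>.\<close>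
  have hold: "P k (diagseq \<circ> (+) (Suc k))" for k
  proof (rule diagseq_holds)
    fix k and s r :: "nat \<Rightarrow> nat" assume r: "strict_mono r" and Ps: "P k s"
    have ge: "n \<le> r n" for n by (rule strict_mono_imp_increasing[OF r])
    show "P k (s \<circ> r)"
      unfolding P_def
    proof (intro allI impI)
      fix e :: real assume "e > 0"
      then obtain N where "\<forall>m\<ge>N. \<forall>n\<ge>N. l2norm lborel (\<lambda>x. mollify (\<delta> k) (v (s m)) x - mollify (\<delta> k) (v (s n)) x) < e"
        using Ps unfolding P_def by blast
      then show "\<exists>N. \<forall>m\<ge>N. \<forall>n\<ge>N. l2norm lborel (\<lambda>x. mollify (\<delta> k) (v ((s \<circ> r) m)) x - mollify (\<delta> k) (v ((s \<circ> r) n)) x) < e"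
        using ge by (intro exI[of _ N] allI impI) (simp, meson order_trans)
    qed
  qed
  have A0: "0 \<le> A" using A[of 0] l2norm_nonneg order_trans by blast
  obtain w where w: "square_integrable lborel w" "(\<lambda>n. l2norm lborel (\<lambda>x. v (diagseq n) x - w x)) \<longlonglongrightarrow> 0"
  proof (rule l2_complete[OF h0_pairD(1)[OF v], of diagseq])
    fix e :: real assume e: "e > 0"
    have "0 < e / (3 * (A + 1))" using e A0 by simp
    then obtain k where k: "\<delta> k < e / (3 * (A + 1))" unfolding \<delta>_def using nat_approx_posE by blast
    have \<delta>A: "\<delta> k * A \<le> e / 3"
    proof -
      have "\<delta> k * A \<le> e / (3 * (A + 1)) * A" using k A0 by (intro mult_right_mono) auto
      also have "\<dots> \<le> e / 3" using e A0 by (simp add: field_simps)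
      finally show ?thesis .
    qed
    obtain N where N: "\<And>m n. m \<ge> N \<Longrightarrow> n \<ge> N \<Longrightarrow>
        l2norm lborel (\<lambda>x. mollify (\<delta> k) (v (diagseq (Suc k + m))) x - mollify (\<delta> k) (v (diagseq (Suc k + n))) x) < e / 3"
      using hold[of k] e unfolding P_def comp_def by (meson divide_pos_pos zero_less_numeral)
    show "\<exists>N. \<forall>m\<ge>N. \<forall>n\<ge>N. l2norm lborel (\<lambda>x. v (diagseq m) x - v (diagseq n) x) < e"
    proof (intro exI[of _ "Suc k + N"] allI impI)
      fix m n assume mn: "Suc k + N \<le> m" "Suc k + N \<le> n"
      let ?a = "v (diagseq m)" and ?b = "v (diagseq n)"
      let ?Ma = "mollify (\<delta> k) ?a" and ?Mb = "mollify (\<delta> k) ?b"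
      note sm = mollify_h0_pair_close(1)[OF v v0 \<delta>(1)] and cm = mollify_h0_pair_close(2)[OF v v0 \<delta>(1)]
      note sv = h0_pairD(1)[OF v]
      have c: "l2norm lborel (\<lambda>x. mollify (\<delta> k) (v j) x - v j x) \<le> e / 3" for j
      proof -
        have "l2norm lborel (\<lambda>x. mollify (\<delta> k) (v j) x - v j x) \<le> \<delta> k * l2norm lborel (V j)" by (rule cm)
        also have "\<dots> \<le> \<delta> k * A" using \<delta>(1)[of k] by (intro mult_left_mono A) simp
        finally show ?thesis using \<delta>A by simp
      qed
      have "l2norm lborel (\<lambda>x. ?a x - ?b x) \<le> l2norm lborel (\<lambda>x. ?a x - ?Ma x) + l2norm lborel (\<lambda>x. ?Ma x - ?b x)"
        by (rule l2norm_triangle_diff[OF sv sm sv])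
      also have "l2norm lborel (\<lambda>x. ?Ma x - ?b x) \<le> l2norm lborel (\<lambda>x. ?Ma x - ?Mb x) + l2norm lborel (\<lambda>x. ?Mb x - ?b x)"
        by (rule l2norm_triangle_diff[OF sm sm sv])
      finally have "l2norm lborel (\<lambda>x. ?a x - ?b x) \<le> l2norm lborel (\<lambda>x. ?Ma x - ?a x) + (l2norm lborel (\<lambda>x. ?Ma x - ?Mb x) + l2norm lborel (\<lambda>x. ?Mb x - ?b x))"
        by (simp add: l2norm_minus_commute[of lborel ?a])
      moreover have "l2norm lborel (\<lambda>x. ?Ma x - ?Mb x) < e / 3"
        using N[of "m - Suc k" "n - Suc k"] mn by simp
      ultimately show "l2norm lborel (\<lambda>x. ?a x - ?b x) < e" using c[of "diagseq m"] c[of "diagseq n"] by linarith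
    qed
  qed (rule that)
  show thesis by (rule that[OF subseq_diagseq w])
qed

section \<open>The nonlinearity and its primitive\<close>

lemma integral_lborel_scale:
  fixes f :: "'a::euclidean_space \<Rightarrow> real"
  assumes [measurable]: "f \<in> borel_measurable borel" and c: "c > 0"
  shows "(\<integral>x. f x \<partial>lborel) = c ^ DIM('a) * (\<integral>x. f (c *\<^sub>R x) \<partial>lborel)"
proof -
  have "(\<integral>x. f x \<partial>lborel) = (\<integral>x. f x \<partial>density (distr lborel borel (\<lambda>x. 0 + c *\<^sub>R x)) (\<lambda>_. ennreal (\<bar>c\<bar> ^ DIM('a))))"
    using c by (subst lborel_affine[of c 0]) (simp_all add: ennreal_power)
  also have "\<dots> = (\<integral>x. \<bar>c\<bar> ^ DIM('a) * f x \<partial>distr lborel borel (\<lambda>x. 0 + c *\<^sub>R x))"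
    by (subst integral_density) auto
  also have "\<dots> = (\<integral>x. \<bar>c\<bar> ^ DIM('a) * f (0 + c *\<^sub>R x) \<partial>lborel)" by (rule integral_distr) auto
  finally show ?thesis using c by simp
qed

text \<open>The hypotheses of the theorem brought to the critical case \<open>p = 6\<close>, with
  integer powers and one constant; smaller exponents are absorbed by
  \<open>powr_le_1_plus_power\<close>.\<close>

locale nonlinearity =
  fixes g :: "real \<Rightarrow> real" and C :: real
  assumes cont: "continuous_on UNIV g"
    and growth: "\<bar>g s\<bar> \<le> C * (1 + \<bar>s\<bar> ^ 5)"
    and odd: "g (- s) = - g s"
    and one_sided: "(g s - g t) * (s - t) \<ge> - (C * (1 + \<bar>s\<bar> ^ 4 + \<bar>t\<bar> ^ 4)) * (s - t)\<^sup>2"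
begin

abbreviation G :: "real \<Rightarrow> real" where "G \<equiv> primitive g"

lemma C_nonneg: "0 \<le> C"
  using order_trans[OF abs_ge_zero growth[of 0]] by simp

lemma G_0 [simp]: "G 0 = 0"
  by (simp add: primitive_def)

lemma G_deriv: "(G has_real_derivative g s) (at s)"
proof -
  define a b where "a = - \<bar>s\<bar> - 1" and "b = \<bar>s\<bar> + 1"
  have ab: "a \<le> 0" "0 \<le> b" "a < s" "s < b" by (auto simp: a_def b_def)
  have "((\<lambda>u. interval_lebesgue_integral lborel (ereal 0) (ereal u) g) has_vector_derivative g s) (at s within {a..b})"
    by (rule interval_integral_FTC2) (use ab in \<open>auto intro: continuous_on_subset[OF cont]\<close>)
  then have "(G has_vector_derivative g s) (at s within {a..b})" by (simp add: primitive_def[abs_def])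
  moreover have "at s within {a..b} = at s"
    using ab by (intro at_within_interior) (simp add: interior_atLeastAtMost_real)
  ultimately show ?thesis by (simp add: has_real_derivative_iff_has_vector_derivative)
qed

lemma G_cont: "continuous_on A G"
  using G_deriv DERIV_isCont by (blast intro: continuous_at_imp_continuous_on)

lemma g_measurable [measurable]: "g \<in> borel_measurable borel"
  using cont by (rule borel_measurable_continuous_onI)

lemma G_measurable [measurable]: "G \<in> borel_measurable borel"
  using G_cont by (rule borel_measurable_continuous_onI)

lemma G_even: "G (- s) = G s"
proof -
  have "((\<lambda>s. G (- s) - G s) has_real_derivative 0) (at s)" for s
    by (rule derivative_eq_intros DERIV_chain2[OF G_deriv] G_deriv | simp add: odd)+
  then have "G (- s) - G s = G (- 0) - G 0" by (intro DERIV_isconst_all) blast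
  then show ?thesis by simp
qed

lemma G_abs: "G \<bar>s\<bar> = G s"
  using G_even by (cases "0 \<le> s") auto

lemma G_diff: "\<bar>G s - G t\<bar> \<le> C * (1 + \<bar>s\<bar> ^ 5 + \<bar>t\<bar> ^ 5) * \<bar>s - t\<bar>"
proof -
  have *: "\<bar>G s - G t\<bar> \<le> C * (1 + \<bar>s\<bar> ^ 5 + \<bar>t\<bar> ^ 5) * \<bar>s - t\<bar>" if ts: "t < s" for s t
  proof -
    obtain z where z: "t < z" "z < s" "G s - G t = (s - t) * g z"
      using MVT2[OF ts, of G g] G_deriv by blast
    have "\<bar>z\<bar> \<le> max \<bar>s\<bar> \<bar>t\<bar>" using z by linarith
    then have "\<bar>z\<bar> ^ 5 \<le> (max \<bar>s\<bar> \<bar>t\<bar>) ^ 5" by (rule power_mono) simp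
    also have "\<dots> \<le> \<bar>s\<bar> ^ 5 + \<bar>t\<bar> ^ 5" by (simp add: max_def)
    finally have "\<bar>g z\<bar> \<le> C * (1 + \<bar>s\<bar> ^ 5 + \<bar>t\<bar> ^ 5)"
      using growth[of z] mult_left_mono[OF _ C_nonneg, of "1 + \<bar>z\<bar> ^ 5" "1 + \<bar>s\<bar> ^ 5 + \<bar>t\<bar> ^ 5"] by linarith
    then have "\<bar>g z\<bar> * \<bar>s - t\<bar> \<le> C * (1 + \<bar>s\<bar> ^ 5 + \<bar>t\<bar> ^ 5) * \<bar>s - t\<bar>" by (rule mult_right_mono) simp
    then show ?thesis using z(3) by (simp add: abs_mult mult.commute)
  qed
  consider "t < s" | "s < t" | "s = t" by linarith
  then show ?thesis
  proof cases
    case 2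
    have "\<bar>G s - G t\<bar> = \<bar>G t - G s\<bar>" by simp
    also have "\<dots> \<le> C * (1 + \<bar>t\<bar> ^ 5 + \<bar>s\<bar> ^ 5) * \<bar>t - s\<bar>" by (rule *[OF 2])
    finally show ?thesis by (simp add: abs_minus_commute add_ac)
  qed (use * in auto)
qed

lemma G_bound: "\<bar>G s\<bar> \<le> C * (\<bar>s\<bar> + \<bar>s\<bar> ^ 6)"
  using G_diff[of s 0] by (simp add: algebra_simps eval_nat_numeral)

end

section \<open>Functions on the unit ball and their energy\<close>

definition \<Omega>1 :: "(real^3) set" where
  "\<Omega>1 = ball 0 1"

text \<open>Vanishing outside the ball is required everywhere, not just almost everywhere, so that
  pointwise arguments outside the ball need no exceptional set.\<close>

definition h0 :: "(real^3 \<Rightarrow> real) \<Rightarrow> (real^3 \<Rightarrow> real^3) \<Rightarrow> bool" where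
  "h0 u V \<longleftrightarrow> h0_pair \<Omega>1 u V \<and> (\<forall>x. x \<notin> \<Omega>1 \<longrightarrow> u x = 0)"

lemma h0D:
  assumes "h0 u V"
  shows "h0_pair \<Omega>1 u V" "h0_pair (ball 0 1) u V" "\<And>x. x \<notin> ball 0 1 \<Longrightarrow> u x = 0" "square_integrable lborel u" "square_integrable lborel V"
    "u \<in> borel_measurable borel" "V \<in> borel_measurable borel" "integrable lborel u"
  using assms h0_pairD[of \<Omega>1 u V] h0_pair_integrable[of \<Omega>1 u V] by (auto simp: h0_def \<Omega>1_def)

lemma h0_test_function: "\<phi> \<in> test_functions \<Omega>1 \<Longrightarrow> h0 \<phi> (grad \<phi>)"
  unfolding h0_def using h0_pair_test_function[of \<phi> \<Omega>1] test_functionsE[of \<phi> \<Omega>1] by (metis subsetD)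

lemma h0_linear_comb:
  "h0 u U \<Longrightarrow> h0 v V \<Longrightarrow> h0 (\<lambda>x. a * u x + b * v x) (\<lambda>x. a *\<^sub>R U x + b *\<^sub>R V x)"
  unfolding h0_def using h0_pair_linear_comb[of \<Omega>1 u U v V a b] by simp

lemma h0_power6:
  assumes "h0 u V"
  shows "integrable lborel (\<lambda>x. \<bar>u x\<bar> ^ 6)" "(\<integral>x. \<bar>u x\<bar> ^ 6 \<partial>lborel) \<le> 1296 * (l2norm lborel V) ^ 6"
proof -
  have [measurable]: "u \<in> borel_measurable borel" by (rule h0D[OF assms])
  note s = h0_pair_sobolev[OF h0D(1)[OF assms]]
  show i: "integrable lborel (\<lambda>x. \<bar>u x\<bar> ^ 6)"
    using s by (auto simp: integrable_iff_bounded intro: le_less_trans)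
  show "(\<integral>x. \<bar>u x\<bar> ^ 6 \<partial>lborel) \<le> 1296 * (l2norm lborel V) ^ 6"
    using s by (subst (asm) nn_integral_eq_integral[OF i]) auto
qed

context nonlinearity
begin

lemma G_integrable:
  assumes "h0 u V" shows "integrable lborel (\<lambda>x. G (u x))"
proof (rule Bochner_Integration.integrable_bound)
  have [measurable]: "u \<in> borel_measurable borel" by (rule h0D[OF assms])
  show "integrable lborel (\<lambda>x. C * (\<bar>u x\<bar> + \<bar>u x\<bar> ^ 6))"
    using h0_power6(1)[OF assms] h0D(8)[OF assms] by (intro integrable_mult_right Bochner_Integration.integrable_add integrable_abs)
  show "(\<lambda>x. G (u x)) \<in> borel_measurable lborel" by measurable
  have "norm (G (u x)) \<le> norm (C * (\<bar>u x\<bar> + \<bar>u x\<bar> ^ 6))" for x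
    using G_bound[of "u x"] C_nonneg by (simp add: abs_mult)
  then show "AE x in lborel. norm (G (u x)) \<le> norm (C * (\<bar>u x\<bar> + \<bar>u x\<bar> ^ 6))" by simp
qed

definition E :: "(real^3 \<Rightarrow> real) \<Rightarrow> (real^3 \<Rightarrow> real^3) \<Rightarrow> real" where
  "E u V = 1/2 * (l2norm lborel V)\<^sup>2 - (\<integral>x. G (u x) \<partial>lborel)"

text \<open>A far enough member of the sequence \<open>1 - (1 - \<psi>) ^ n\<close>, with
  \<open>\<psi>\<close> positive exactly on the ball. Closeness to 1 is only needed in the
  mean.\<close>

lemma plateau_exists:
  assumes "0 < \<eta>"
  obtains \<zeta> :: "real^3 \<Rightarrow> real" where "smooth \<zeta>" "\<And>x. 0 \<le> \<zeta> x" "\<And>x. \<zeta> x \<le> 1" "\<And>x. x \<notin> cball 0 1 \<Longrightarrow> \<zeta> x = 0"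
    "(\<integral>x. indicat_real (ball 0 1) x * (1 - \<zeta> x) \<partial>lborel) < \<eta>" "integrable lborel (\<lambda>x. indicat_real (ball 0 1) x * (1 - \<zeta> x))"
proof -
  define \<psi> where "\<psi> x = bump 0 (1 - (norm x)\<^sup>2)" for x :: "real^3"
  have \<psi>s: "\<psi> \<in> elem_smooth"
    unfolding \<psi>_def[abs_def] by (intro elem_smooth.bump elem_smooth_diff elem_smooth_norm2 elem_smooth.const)
  have \<psi>0: "\<psi> x = 0" if "x \<notin> cball 0 1" for x
    using that one_le_power[of "norm x" 2] by (simp add: \<psi>_def bump_def not_less)
  have \<psi>1: "0 \<le> \<psi> x" "\<psi> x < 1" for x by (simp_all add: \<psi>_def bump_nonneg bump_0_less_1)
  have \<psi>pos: "0 < \<psi> x" if "x \<in> ball 0 1" for x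
    using that power_strict_mono[of "norm x" 1 2] by (simp add: \<psi>_def bump_pos)
  have pl1: "(\<lambda>x. 1 - (1 - \<psi> x) ^ n) \<in> test_functions UNIV" for n
    by (rule plateau_test_functions(1)[OF \<psi>s \<psi>1 compact_cball subset_UNIV]) (rule \<psi>0)
  have pl4: "(\<lambda>n. 1 - (1 - \<psi> x) ^ n) \<longlonglongrightarrow> indicator {x. 0 < \<psi> x} x" for x
    by (rule plateau_test_functions(4)[OF \<psi>s \<psi>1 compact_cball subset_UNIV]) (rule \<psi>0)
  have p: "0 \<le> (1 - \<psi> x) ^ n" "(1 - \<psi> x) ^ n \<le> 1" for x n
    using \<psi>1[of x] by (auto simp: power_le_one)
  have [measurable]: "\<psi> \<in> borel_measurable borel"
    using smooth_continuous_on[OF elem_smooth_imp_smooth[OF \<psi>s]] by (rule borel_measurable_continuous_onI)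
  have bi: "integrable lborel (indicat_real (ball (0::real^3) 1))"
    using emeasure_lborel_ball_finite[of "0::real^3" 1] by simp
  have "(\<lambda>n. \<integral>x. indicat_real (ball 0 1) x * (1 - (1 - (1 - \<psi> x) ^ n)) \<partial>lborel) \<longlonglongrightarrow> (\<integral>x. indicat_real (ball 0 1) x * (1 - indicator {x. 0 < \<psi> x} x) \<partial>lborel)"
  proof (rule integral_dominated_convergence[OF _ _ bi])
    show "(\<lambda>x. indicat_real (ball 0 1) x * (1 - indicator {x. 0 < \<psi> x} x)) \<in> borel_measurable lborel"
      "(\<lambda>x. indicat_real (ball 0 1) x * (1 - (1 - (1 - \<psi> x) ^ n))) \<in> borel_measurable lborel" for n by measurable
    show "AE x in lborel. (\<lambda>n. indicat_real (ball 0 1) x * (1 - (1 - (1 - \<psi> x) ^ n))) \<longlonglongrightarrow> indicat_real (ball 0 1) x * (1 - indicator {x. 0 < \<psi> x} x)"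
      by (intro AE_I2 tendsto_intros pl4)
    show "AE x in lborel. norm (indicat_real (ball 0 1) x * (1 - (1 - (1 - \<psi> x) ^ n))) \<le> indicat_real (ball 0 1) x" for n
      using p[where n=n] by (intro AE_I2) (auto simp: indicator_def)
  qed
  also have "(\<lambda>x. indicat_real (ball 0 1) x * (1 - indicator {x. 0 < \<psi> x} x)) = (\<lambda>x. 0)"
    using \<psi>pos by (auto simp: indicator_def)
  finally have "\<forall>\<^sub>F n in sequentially. (\<integral>x. indicat_real (ball 0 1) x * (1 - (1 - (1 - \<psi> x) ^ n)) \<partial>lborel) < \<eta>"
    using assms by (intro order_tendstoD(2)) auto
  then obtain n where n: "(\<integral>x. indicat_real (ball 0 1) x * (1 - (1 - (1 - \<psi> x) ^ n)) \<partial>lborel) < \<eta>"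
    unfolding eventually_sequentially by blast
  show thesis
  proof (rule that[of "\<lambda>x. 1 - (1 - \<psi> x) ^ n"])
    show "smooth (\<lambda>x. 1 - (1 - \<psi> x) ^ n)" by (rule test_functions_smooth[OF pl1])
    show "integrable lborel (\<lambda>x. indicat_real (ball 0 1) x * (1 - (1 - (1 - \<psi> x) ^ n)))"
      by (rule Bochner_Integration.integrable_bound[OF bi]) (use p[where n=n] in \<open>auto simp: indicator_def\<close>)
  qed (use p n \<psi>0 in auto)
qed

text \<open>Test the energy with \<open>s \<zeta>(x / \<rho>)\<close>, where \<open>\<rho> = K / s\<^sup>2\<close>: the Dirichlet integral is of order \<open>K\<close>, whereas \<open>G s > \<epsilon> s\<^sup>6\<close>
  makes the potential term at least of order \<open>K\<^sup>3\<close>.\<close>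

lemma G_upper:
  assumes bdd: "\<And>u V. h0 u V \<Longrightarrow> m0 \<le> E u V" and \<epsilon>: "0 < \<epsilon>"
  obtains K where "0 \<le> K" "\<And>s. G s \<le> \<epsilon> * s ^ 6 + K"
proof (rule ccontr)
  note main = that
  assume "\<not> thesis"
  then have no: "\<exists>s. \<epsilon> * s ^ 6 + K < G s" if "0 \<le> K" for K
    using main[OF that] by (meson not_le)
  \<comment> \<open>If no constant works, the violating values of \<open>s\<close> are unbounded,
    because \<open>G\<close> is bounded on bounded sets; as \<open>G\<close> is even, they may be
    taken positive.\<close>
  have large: "\<exists>s>R. \<epsilon> * s ^ 6 < G s" if "0 \<le> R" for R
  proof -
    have "0 \<le> C * (R + R ^ 6)" using C_nonneg that by simp
    then obtain s where s: "\<epsilon> * s ^ 6 + C * (R + R ^ 6) < G s" using no by blast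
    have "R < \<bar>s\<bar>"
    proof (rule ccontr)
      assume "\<not> R < \<bar>s\<bar>"
      then have "\<bar>s\<bar> + \<bar>s\<bar> ^ 6 \<le> R + R ^ 6" by (intro add_mono power_mono) auto
      then have "C * (\<bar>s\<bar> + \<bar>s\<bar> ^ 6) \<le> C * (R + R ^ 6)" by (rule mult_left_mono[OF _ C_nonneg])
      moreover have "0 \<le> \<epsilon> * s ^ 6" using \<epsilon> by simp
      ultimately show False using s G_bound[of s] by linarith
    qed
    moreover have "\<epsilon> * \<bar>s\<bar> ^ 6 < G \<bar>s\<bar>"
      using s C_nonneg that by (simp add: G_abs) (smt (verit) mult_nonneg_nonneg zero_le_power)
    ultimately show ?thesis by blast
  qed
  define \<beta> where "\<beta> = measure lborel (ball (0::real^3) 1)"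
  have \<beta>: "0 < \<beta>" using unit_ball_vol_pos[of 3] by (simp add: \<beta>_def measure_def emeasure_ball)
  have bi: "integrable lborel (indicat_real (ball (0::real^3) 1))"
    using emeasure_lborel_ball_finite[of "0::real^3" 1] by simp
  \<comment> \<open>Chosen so that the loss \<open>3 * C * \<eta>\<close> caused by the transition
    region of \<open>\<zeta>\<close> is at most half of the gain
    \<open>\<epsilon> * \<beta>\<close>.\<close>
  define \<eta> where "\<eta> = \<epsilon> * \<beta> / (6 * (C + 1))"
  have \<eta>: "0 < \<eta>" using \<epsilon> \<beta> C_nonneg by (simp add: \<eta>_def)
  have C\<eta>: "3 * C * \<eta> \<le> \<epsilon> * \<beta> / 2" using \<epsilon> \<beta> C_nonneg by (simp add: \<eta>_def field_simps)
  obtain \<zeta> :: "real^3 \<Rightarrow> real" where \<zeta>: "smooth \<zeta>" "\<And>x. 0 \<le> \<zeta> x" "\<And>x. \<zeta> x \<le> 1" "\<And>x. x \<notin> cball 0 1 \<Longrightarrow> \<zeta> x = 0"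
    "(\<integral>x. indicat_real (ball 0 1) x * (1 - \<zeta> x) \<partial>lborel) < \<eta>" "integrable lborel (\<lambda>x. indicat_real (ball 0 1) x * (1 - \<zeta> x))"
    by (rule plateau_exists[OF \<eta>]) (rule that)
  have \<zeta>t: "\<zeta> \<in> test_functions UNIV" by (rule test_functionsI[OF \<zeta>(1) compact_cball subset_UNIV]) (rule \<zeta>(4))
  have [measurable]: "\<zeta> \<in> borel_measurable borel" "grad \<zeta> \<in> borel_measurable borel"
    by (rule test_function_measurable[OF \<zeta>t])+
  define D where "D = (l2norm lborel (grad \<zeta>))\<^sup>2"
  \<comment> \<open>Large enough that the cubic gain beats the linear Dirichlet term by more than
    \<open>\<bar>m0\<bar>\<close>, which contradicts the lower bound for the energy.\<close>
  define K where "K = max 1 ((D + 2 * (\<bar>m0\<bar> + 1)) / (\<epsilon> * \<beta>))"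
  have K1: "1 \<le> K" by (simp add: K_def)
  have "D + 2 * (\<bar>m0\<bar> + 1) \<le> K * (\<epsilon> * \<beta>)"
    using \<epsilon> \<beta> by (simp add: K_def pos_divide_le_eq[symmetric])
  also have "\<dots> \<le> K\<^sup>2 * (\<epsilon> * \<beta>)" using K1 \<epsilon> \<beta> by (intro mult_right_mono) (auto simp: power2_eq_square)
  finally have KD: "2 * (\<bar>m0\<bar> + 1) \<le> K\<^sup>2 * (\<epsilon> * \<beta>) - D" by simp
  \<comment> \<open>The first bound absorbs lower powers of \<open>s\<close> into the highest one;
    the second gives \<open>\<rho> \<le> 1 / 2\<close>, so the rescaled plateau fits into the unit
    ball.\<close>
  have "0 \<le> max 1 (2 * K)" by simp
  then obtain s where s: "max 1 (2 * K) < s" "\<epsilon> * s ^ 6 < G s" using large by blast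
  have s1: "1 < s" "2 * K < s" using s(1) by auto
  define \<rho> where "\<rho> = K / s\<^sup>2"
  have \<rho>0: "0 < \<rho>" using K1 s1 by (simp add: \<rho>_def)
  have "\<rho> \<le> 1 / 2"
  proof -
    have "2 * K \<le> s * s" using s1 mult_strict_mono[of 1 s "2 * K" s] K1 by simp
    then show ?thesis using s1 by (simp add: \<rho>_def power2_eq_square field_simps)
  qed
  define c where "c = 1 / \<rho>"
  have c: "0 < c" using \<rho>0 by (simp add: c_def)
  define u where "u x = s * \<zeta> (c *\<^sub>R x)" for x
  have \<zeta>c: "(\<lambda>x. \<zeta> (c *\<^sub>R x)) \<in> test_functions \<Omega>1"
  proof (rule test_functionsI[of _ "cball 0 \<rho>"])
    show "smooth (\<lambda>x. \<zeta> (c *\<^sub>R x))" by (rule smooth_scaleR(1)[OF \<zeta>(1)])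
    show "cball 0 \<rho> \<subseteq> \<Omega>1" using \<open>\<rho> \<le> 1 / 2\<close> by (auto simp: \<Omega>1_def)
    show "\<zeta> (c *\<^sub>R x) = 0" if "x \<notin> cball 0 \<rho>" for x
      using that \<rho>0 by (intro \<zeta>(4)) (simp add: c_def field_simps)
  qed simp
  have ut: "u \<in> test_functions \<Omega>1" and ug: "grad u x = s *\<^sub>R c *\<^sub>R grad \<zeta> (c *\<^sub>R x)" for x
    using test_functions_linear_comb[OF \<zeta>c \<zeta>c, of s 0] grad_linear_comb[OF \<zeta>c \<zeta>c, of s 0] smooth_scaleR(2)[OF \<zeta>(1), of c]
    by (simp_all add: u_def[abs_def])
  have "(l2norm lborel (grad u))\<^sup>2 = (\<integral>x. (s * c)\<^sup>2 * (norm (grad \<zeta> (c *\<^sub>R x)))\<^sup>2 \<partial>lborel)"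
    unfolding l2norm_power2 ug by (simp add: power_mult_distrib abs_mult)
  also have "\<dots> = (s * c)\<^sup>2 * (\<integral>x. (norm (grad \<zeta> (c *\<^sub>R x)))\<^sup>2 \<partial>lborel)" by simp
  also have "\<dots> = (s * c)\<^sup>2 * (D / c ^ 3)"
    using integral_lborel_scale[of "\<lambda>x. (norm (grad \<zeta> x))\<^sup>2", OF _ c] c by (simp add: D_def l2norm_power2)
  also have "\<dots> = K * D"
    using s1 K1 \<rho>0 by (simp add: c_def \<rho>_def power2_eq_square power3_eq_cube field_simps)
  finally have dir: "(l2norm lborel (grad u))\<^sup>2 = K * D" .
  have pot: "s ^ 6 * (\<epsilon> * \<beta> / 2) \<le> (\<integral>y. G (s * \<zeta> y) \<partial>lborel)"
  proof -
    \<comment> \<open>Where \<open>\<zeta>\<close> falls short of 1, \<open>G_diff\<close> bounds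
      the difference between \<open>G s\<close> and \<open>G (s * \<zeta> y)\<close> linearly in
      \<open>1 - \<zeta> y\<close>. The sphere is excluded because \<open>\<zeta>\<close> is only
      known to vanish off the closed ball.\<close>
    have low: "indicat_real (ball 0 1) y * (\<epsilon> * s ^ 6) - (3 * C * s ^ 6) * (indicat_real (ball 0 1) y * (1 - \<zeta> y)) \<le> G (s * \<zeta> y)"
      if "y \<notin> sphere 0 1" for y
    proof (cases "y \<in> ball 0 1")
      case True
      have "\<bar>G s - G (s * \<zeta> y)\<bar> \<le> C * (1 + \<bar>s\<bar> ^ 5 + \<bar>s * \<zeta> y\<bar> ^ 5) * \<bar>s - s * \<zeta> y\<bar>" by (rule G_diff)
      also have "\<dots> \<le> C * (3 * s ^ 5) * (s * (1 - \<zeta> y))"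
      proof (intro mult_mono mult_left_mono C_nonneg)
        have "\<bar>s * \<zeta> y\<bar> ^ 5 \<le> s ^ 5"
          using \<zeta>(2,3)[of y] s1 by (intro power_mono) (auto simp: abs_mult mult_left_le)
        moreover have "1 \<le> s ^ 5" using s1 by simp
        moreover have "\<bar>s\<bar> ^ 5 = s ^ 5" using s1 by simp
        ultimately show "1 + \<bar>s\<bar> ^ 5 + \<bar>s * \<zeta> y\<bar> ^ 5 \<le> 3 * s ^ 5" by linarith
        have "s - s * \<zeta> y = s * (1 - \<zeta> y)" by (simp add: algebra_simps)
        then show "\<bar>s - s * \<zeta> y\<bar> \<le> s * (1 - \<zeta> y)" using \<zeta>(3)[of y] s1 by (simp add: abs_mult)
      qed (use C_nonneg s1 in auto)
      also have "\<dots> = (3 * C * s ^ 6) * (1 - \<zeta> y)" by (simp add: eval_nat_numeral)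
      finally show ?thesis using s(2) True by simp
    next
      case False
      then have "\<zeta> y = 0" using that by (intro \<zeta>(4)) auto
      then show ?thesis using False by simp
    qed
    have ii: "integrable lborel (\<lambda>y. indicat_real (ball 0 1) y * (\<epsilon> * s ^ 6) - (3 * C * s ^ 6) * (indicat_real (ball 0 1) y * (1 - \<zeta> y)))"
      using bi \<zeta>(6) by (intro Bochner_Integration.integrable_diff integrable_mult_left integrable_mult_right)
    have beq: "\<beta> = (\<integral>y. indicat_real (ball (0::real^3) 1) y \<partial>lborel)" by (simp add: \<beta>_def)
    have "s ^ 6 * (\<epsilon> * \<beta> / 2) \<le> s ^ 6 * (\<epsilon> * \<beta> - 3 * C * \<eta>)"
    proof (rule mult_left_mono)
      show "\<epsilon> * \<beta> / 2 \<le> \<epsilon> * \<beta> - 3 * C * \<eta>" using C\<eta> by argo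
    qed simp
    also have "\<dots> \<le> s ^ 6 * (\<epsilon> * \<beta> - 3 * C * (\<integral>x. indicat_real (ball 0 1) x * (1 - \<zeta> x) \<partial>lborel))"
      using \<zeta>(5) C_nonneg by (intro mult_left_mono diff_left_mono) auto
    also have "\<dots> = \<beta> * (\<epsilon> * s ^ 6) - (3 * C * s ^ 6) * (\<integral>x. indicat_real (ball 0 1) x * (1 - \<zeta> x) \<partial>lborel)"
      by (simp only: right_diff_distrib mult_ac)
    also have "\<dots>
        = (\<integral>y. indicat_real (ball 0 1) y * (\<epsilon> * s ^ 6) - (3 * C * s ^ 6) * (indicat_real (ball 0 1) y * (1 - \<zeta> y)) \<partial>lborel)"
      by (simp only: beq Bochner_Integration.integral_diff[OF integrable_mult_left[OF bi] integrable_mult_right[OF \<zeta>(6)]]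
          integral_mult_left_zero integral_mult_right_zero)
    also have "\<dots> \<le> (\<integral>y. G (s * \<zeta> y) \<partial>lborel)"
    proof (rule integral_mono_AE[OF ii])
      have "continuous_on UNIV (\<lambda>y. G (s * \<zeta> y))"
        by (intro continuous_on_compose2[OF G_cont[of UNIV]] continuous_intros smooth_continuous_on[OF \<zeta>(1)]) auto
      then show "integrable lborel (\<lambda>y. G (s * \<zeta> y))"
        by (rule integrable_compact_support[OF _ compact_cball[of 0 1]]) (simp add: \<zeta>(4))
      have "sphere (0::real^3) 1 \<in> null_sets lborel"
        using negligible_sphere[of "0::real^3" 1] by (simp add: negligible_iff_null_sets null_sets_completion_iff)
      then have "AE y in lborel. y \<notin> sphere (0::real^3) 1" by (rule AE_not_in)
      then show "AE y in lborel. indicat_real (ball 0 1) y * (\<epsilon> * s ^ 6) - (3 * C * s ^ 6) * (indicat_real (ball 0 1) y * (1 - \<zeta> y)) \<le> G (s * \<zeta> y)"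
        by eventually_elim (rule low)
    qed
    finally show ?thesis .
  qed
  have "(\<integral>x. G (u x) \<partial>lborel) = \<rho> ^ 3 * (\<integral>y. G (s * \<zeta> y) \<partial>lborel)"
    using integral_lborel_scale[of "\<lambda>y. G (s * \<zeta> y)", OF _ c] \<rho>0 by (simp add: u_def c_def field_simps power3_eq_cube)
  also have "\<dots> \<ge> \<rho> ^ 3 * (s ^ 6 * (\<epsilon> * \<beta> / 2))" using \<rho>0 pot by (intro mult_left_mono) auto
  also have "\<rho> ^ 3 * (s ^ 6 * (\<epsilon> * \<beta> / 2)) = K ^ 3 * (\<epsilon> * \<beta> / 2)"
    using s1 by (simp add: \<rho>_def power_divide flip: power_mult)
  finally have "E u (grad u) \<le> 1/2 * (K * D) - K ^ 3 * (\<epsilon> * \<beta> / 2)" by (simp add: E_def dir)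
  also have "\<dots> = - (K / 2 * (K\<^sup>2 * (\<epsilon> * \<beta>) - D))" by (simp add: power2_eq_square power3_eq_cube algebra_simps)
  also have "\<dots> \<le> - (1 / 2 * (2 * (\<bar>m0\<bar> + 1)))" using K1 KD by (intro le_imp_neg_le mult_mono) auto
  also have "\<dots> < m0" using abs_ge_minus_self[of m0] by (simp add: field_simps)
  finally show False using bdd[OF h0_test_function[OF ut]] by simp
qed

end

section \<open>Existence of a minimizer\<close>

text \<open>Test functions close to a late \<open>v n\<close> are close to \<open>w\<close> and have
  almost the limiting Dirichlet norm, so \<open>h0_pair_lsc\<close> supplies a gradient for the
  limit; the gradients \<open>V n\<close> themselves need not converge.\<close>

lemma h0_limit:
  assumes v: "\<And>n. h0 (v n) (V n)" and w: "square_integrable lborel w"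
    and lim: "(\<lambda>n. l2norm lborel (\<lambda>x. v n x - w x)) \<longlonglongrightarrow> 0" "(\<lambda>n. (l2norm lborel (V n))\<^sup>2) \<longlonglongrightarrow> B"
  obtains w' W where "h0 w' W" "(l2norm lborel W)\<^sup>2 \<le> B" "(\<lambda>n. l2norm lborel (\<lambda>x. v n x - w' x)) \<longlonglongrightarrow> 0"
proof -
  have wm [measurable]: "w \<in> borel_measurable borel" using square_integrable_measurable[OF w] by simp
  have B: "0 \<le> B" by (rule LIMSEQ_le_const[OF lim(2)]) auto
  obtain W where W: "h0_pair \<Omega>1 w W" "(l2norm lborel W)\<^sup>2 \<le> B"
  proof (rule h0_pair_lsc[OF w B, of \<Omega>1])
    fix e :: real assume e: "0 < e"
    have "\<forall>\<^sub>F n in sequentially. l2norm lborel (\<lambda>x. v n x - w x) < e / 2"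
      using e by (intro order_tendstoD(2)[OF lim(1)]) simp
    moreover have "\<forall>\<^sub>F n in sequentially. (l2norm lborel (V n))\<^sup>2 < B + e"
      using e by (intro order_tendstoD(2)[OF lim(2)]) simp
    ultimately have "\<forall>\<^sub>F n in sequentially. l2norm lborel (\<lambda>x. v n x - w x) < e / 2 \<and> (l2norm lborel (V n))\<^sup>2 < B + e"
      by (rule eventually_conj)
    then obtain n where n: "l2norm lborel (\<lambda>x. v n x - w x) < e / 2" "(l2norm lborel (V n))\<^sup>2 < B + e"
      unfolding eventually_sequentially by blast
    obtain \<phi> where \<phi>: "\<And>k. \<phi> k \<in> test_functions \<Omega>1" "(\<lambda>k. l2norm lborel (\<lambda>x. \<phi> k x - v n x)) \<longlonglongrightarrow> 0"
      "(\<lambda>k. l2norm lborel (\<lambda>x. grad (\<phi> k) x - V n x)) \<longlonglongrightarrow> 0" by (rule h0_pair_sequence[OF h0D(1)[OF v]]) (rule that)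
    have "(\<lambda>k. (l2norm lborel (grad (\<phi> k)))\<^sup>2) \<longlonglongrightarrow> (l2norm lborel (V n))\<^sup>2"
      by (intro tendsto_power l2norm_tendsto[OF test_function_square_integrable(2)[OF \<phi>(1)] h0D(5)[OF v] \<phi>(3)])
    then have "\<forall>\<^sub>F k in sequentially. (l2norm lborel (grad (\<phi> k)))\<^sup>2 < B + e"
      using n(2) by (rule order_tendstoD(2))
    moreover have "\<forall>\<^sub>F k in sequentially. l2norm lborel (\<lambda>x. \<phi> k x - v n x) < e / 2"
      using e by (intro order_tendstoD(2)[OF \<phi>(2)]) simp
    ultimately have "\<forall>\<^sub>F k in sequentially. (l2norm lborel (grad (\<phi> k)))\<^sup>2 < B + e \<and> l2norm lborel (\<lambda>x. \<phi> k x - v n x) < e / 2"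
      by (rule eventually_conj)
    then obtain k where k: "(l2norm lborel (grad (\<phi> k)))\<^sup>2 < B + e" "l2norm lborel (\<lambda>x. \<phi> k x - v n x) < e / 2"
      unfolding eventually_sequentially by blast
    have "l2norm lborel (\<lambda>x. \<phi> k x - w x) \<le> l2norm lborel (\<lambda>x. \<phi> k x - v n x) + l2norm lborel (\<lambda>x. v n x - w x)"
      by (rule l2norm_triangle_diff[OF test_function_square_integrable(1)[OF \<phi>(1)] h0D(4)[OF v] w])
    then have "l2norm lborel (\<lambda>x. \<phi> k x - w x) < e" using n(1) k(2) by simp
    then show "\<exists>\<phi>\<in>test_functions \<Omega>1. l2norm lborel (\<lambda>x. \<phi> x - w x) < e \<and> (l2norm lborel (grad \<phi>))\<^sup>2 < B + e"
      using k(1) \<phi>(1) by blast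
  qed (rule that)
  \<comment> \<open>The \<open>L2\<close> limit vanishes outside the ball almost everywhere only;
    cutting it off gives the exact condition in \<open>h0\<close>.\<close>
  define w' where "w' x = indicat_real \<Omega>1 x * w x" for x
  have [measurable]: "\<Omega>1 \<in> sets borel" by (simp add: \<Omega>1_def)
  have w'm [measurable]: "w' \<in> borel_measurable borel" unfolding w'_def[abs_def] by measurable
  have ae: "AE x in lborel. w x = w' x"
    using h0_pair_AE_outside[OF W(1)] by eventually_elim (auto simp: w'_def indicator_def)
  have "h0_pair \<Omega>1 w' W" by (rule h0_pair_cong_AE[OF W(1) w'm h0_pairD(4)[OF W(1)] ae]) simp
  then have "h0 w' W" by (simp add: h0_def w'_def)
  moreover have "l2norm lborel (\<lambda>x. v n x - w' x) = l2norm lborel (\<lambda>x. v n x - w x)" for n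
  proof (rule square_integrable_cong_AE(2)[OF square_integrable_diff(1)[OF h0D(4)[OF v] w]])
    show "(\<lambda>x. v n x - w' x) \<in> borel_measurable lborel" using h0D(6)[OF v] by measurable
    show "AE x in lborel. v n x - w x = v n x - w' x" using ae by eventually_elim simp
  qed
  ultimately show thesis using that W(2) lim(1) by simp
qed

context nonlinearity
begin

text \<open>Fatou's lemma for the nonnegative function
  \<open>H = \<epsilon> \<bar>u\<bar>^6 + K - G u\<close> on the ball. By the Sobolev inequality the
  sixth powers contribute at most \<open>\<epsilon> * M\<close> along the sequence, and
  \<open>\<epsilon>\<close> is arbitrary; the unknown \<open>K\<close> cancels because the ball has
  finite measure.\<close>

lemma E_lsc:
  assumes bdd: "\<And>u V. h0 u V \<Longrightarrow> m0 \<le> E u V"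
    and v: "\<And>n. h0 (v n) (V n)" and w: "h0 w W" and A: "\<And>n. l2norm lborel (V n) \<le> A"
    and lim: "(\<lambda>n. l2norm lborel (\<lambda>x. v n x - w x)) \<longlonglongrightarrow> 0" "(\<lambda>n. \<integral>x. G (v n x) \<partial>lborel) \<longlonglongrightarrow> \<gamma>"
  shows "\<gamma> \<le> (\<integral>x. G (w x) \<partial>lborel)"
proof -
  have A0: "0 \<le> A" using A[of 0] l2norm_nonneg order_trans by blast
  define M where "M = 1296 * A ^ 6"
  have M: "0 \<le> M" using A0 by (simp add: M_def)
  obtain r where r: "strict_mono r" "AE x in lborel. (\<lambda>n. v (r n) x) \<longlonglongrightarrow> w x"
    by (rule l2_AE_subseq[OF h0D(4)[OF v] h0D(4)[OF w] lim(1)])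
  have [measurable]: "v n \<in> borel_measurable borel" "w \<in> borel_measurable borel" "\<Omega>1 \<in> sets borel" for n
    by (rule h0D[OF v] h0D[OF w] | simp add: \<Omega>1_def)+
  have bi: "integrable lborel (indicat_real \<Omega>1)"
    using emeasure_lborel_ball_finite[of "0::real^3" 1] by (simp add: \<Omega>1_def)
  have "\<gamma> \<le> (\<integral>x. G (w x) \<partial>lborel) + \<epsilon> * M" if \<epsilon>: "0 < \<epsilon>" for \<epsilon>
  proof -
    obtain K where K: "0 \<le> K" "\<And>s. G s \<le> \<epsilon> * s ^ 6 + K" using G_upper[OF bdd \<epsilon>] by blast
    define H where "H u x = \<epsilon> * \<bar>u x\<bar> ^ 6 + K * indicat_real \<Omega>1 x - G (u x)" for u and x :: "real^3"
    define \<beta> where "\<beta> = (\<integral>x. indicat_real \<Omega>1 x \<partial>lborel)"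
    have Hnn: "0 \<le> H u x" if "h0 u U" for u U x
    proof (cases "x \<in> \<Omega>1")
      case True then show ?thesis using K(2)[of "u x"] by (simp add: H_def power_even_abs)
    next
      case False then show ?thesis using that by (simp add: H_def h0_def)
    qed
    have Hint: "integrable lborel (H u)" "(\<integral>x. H u x \<partial>lborel) = \<epsilon> * (\<integral>x. \<bar>u x\<bar> ^ 6 \<partial>lborel) + K * \<beta> - (\<integral>x. G (u x) \<partial>lborel)"
      if "h0 u U" for u U
      using h0_power6(1)[OF that] G_integrable[OF that] bi unfolding H_def[abs_def] \<beta>_def by simp_all
    have Hnn_int: "(\<integral>\<^sup>+x. ennreal (H u x) \<partial>lborel) = ennreal (\<integral>x. H u x \<partial>lborel)" if "h0 u U" for u U
      by (rule nn_integral_eq_integral[OF Hint(1)[OF that]]) (use Hnn[OF that] in simp)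
    have "ennreal (\<integral>x. H w x \<partial>lborel) = (\<integral>\<^sup>+x. liminf (\<lambda>n. ennreal (H (v (r n)) x)) \<partial>lborel)"
      unfolding Hnn_int[OF w, symmetric]
    proof (rule nn_integral_cong_AE)
      show "AE x in lborel. ennreal (H w x) = liminf (\<lambda>n. ennreal (H (v (r n)) x))"
        using r(2)
      proof eventually_elim
        case (elim x)
        have "(\<lambda>n. G (v (r n) x)) \<longlonglongrightarrow> G (w x)"
          by (rule continuous_on_tendsto_compose[OF G_cont[of UNIV] elim]) auto
        then show ?case unfolding H_def
          by (intro lim_imp_Liminf[symmetric] tendsto_ennrealI tendsto_intros elim) simp
      qed
    qed
    also have "\<dots> \<le> liminf (\<lambda>n. \<integral>\<^sup>+x. ennreal (H (v (r n)) x) \<partial>lborel)"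
      unfolding H_def by (rule nn_integral_liminf) measurable
    also have "\<dots> \<le> liminf (\<lambda>n. ennreal (\<epsilon> * M + K * \<beta> - (\<integral>x. G (v (r n) x) \<partial>lborel)))"
    proof (intro Liminf_mono always_eventually allI)
      fix n
      have "(\<integral>x. \<bar>v (r n) x\<bar> ^ 6 \<partial>lborel) \<le> 1296 * (l2norm lborel (V (r n))) ^ 6" by (rule h0_power6(2)[OF v])
      also have "\<dots> \<le> M" unfolding M_def by (intro mult_left_mono power_mono A) auto
      finally have "\<epsilon> * (\<integral>x. \<bar>v (r n) x\<bar> ^ 6 \<partial>lborel) \<le> \<epsilon> * M" using \<epsilon> by (intro mult_left_mono) auto
      then show "(\<integral>\<^sup>+x. ennreal (H (v (r n)) x) \<partial>lborel) \<le> ennreal (\<epsilon> * M + K * \<beta> - (\<integral>x. G (v (r n) x) \<partial>lborel))"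
        unfolding Hnn_int[OF v] Hint(2)[OF v] by (intro ennreal_leI) simp
    qed
    also have "\<dots> = ennreal (\<epsilon> * M + K * \<beta> - \<gamma>)"
      by (intro lim_imp_Liminf tendsto_ennrealI tendsto_intros LIMSEQ_subseq_LIMSEQ[OF lim(2) r(1), unfolded comp_def]) simp
    finally have le: "ennreal (\<integral>x. H w x \<partial>lborel) \<le> ennreal (\<epsilon> * M + K * \<beta> - \<gamma>)" .
    \<comment> \<open>Needed to return to real numbers, since \<open>ennreal\<close> truncates
      negative arguments to 0.\<close>
    have "0 \<le> \<epsilon> * M + K * \<beta> - \<gamma>"
    proof (rule LIMSEQ_le_const)
      show "(\<lambda>n. \<epsilon> * M + K * \<beta> - (\<integral>x. G (v n x) \<partial>lborel)) \<longlonglongrightarrow> \<epsilon> * M + K * \<beta> - \<gamma>" by (intro tendsto_intros lim(2))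
      have "0 \<le> \<epsilon> * M + K * \<beta> - (\<integral>x. G (v n x) \<partial>lborel)" for n
      proof -
        have "0 \<le> (\<integral>x. H (v n) x \<partial>lborel)" using Hnn[OF v] by simp
        moreover have "(\<integral>x. \<bar>v n x\<bar> ^ 6 \<partial>lborel) \<le> M"
          using h0_power6(2)[OF v, of n] power_mono[OF A[of n] l2norm_nonneg, of 6] by (simp add: M_def)
        then have "\<epsilon> * (\<integral>x. \<bar>v n x\<bar> ^ 6 \<partial>lborel) \<le> \<epsilon> * M" using \<epsilon> by (intro mult_left_mono) auto
        ultimately show ?thesis unfolding Hint(2)[OF v] by simp
      qed
      then show "\<exists>N. \<forall>n\<ge>N. 0 \<le> \<epsilon> * M + K * \<beta> - (\<integral>x. G (v n x) \<partial>lborel)" by blast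
    qed
    with le have "(\<integral>x. H w x \<partial>lborel) \<le> \<epsilon> * M + K * \<beta> - \<gamma>" by (simp add: ennreal_le_iff)
    moreover have "0 \<le> \<epsilon> * (\<integral>x. \<bar>w x\<bar> ^ 6 \<partial>lborel)" using \<epsilon> by simp
    ultimately show ?thesis unfolding Hint(2)[OF w] by simp
  qed
  note * = this
  show ?thesis
  proof (rule field_le_epsilon)
    fix e :: real assume e: "0 < e"
    have "e / (M + 1) * M \<le> e" using e M by (simp add: field_simps)
    moreover have "0 < e / (M + 1)" using e M by simp
    ultimately show "\<gamma> \<le> (\<integral>x. G (w x) \<partial>lborel) + e" using *[of "e / (M + 1)"] by simp
  qed
qed

text \<open>The limit obeys the same gradient bound \<open>A\<close>. This is used twice: for the
  minimizing sequence, and for a sequence of minimizers whose moments approach their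
  supremum.\<close>

lemma E_compact:
  assumes bdd: "\<And>u V. h0 u V \<Longrightarrow> m0 \<le> E u V"
    and v: "\<And>n. h0 (v n) (V n)" and A: "\<And>n. l2norm lborel (V n) \<le> A"
    and Elim: "(\<lambda>n. E (v n) (V n)) \<longlonglongrightarrow> m"
  obtains r w W where "strict_mono (r :: nat \<Rightarrow> nat)" "h0 w W" "l2norm lborel W \<le> A" "E w W \<le> m"
    "(\<lambda>n. l2norm lborel (\<lambda>x. v (r n) x - w x)) \<longlonglongrightarrow> 0"
proof -
  have A0: "0 \<le> A" using A[of 0] l2norm_nonneg order_trans by blast
  obtain r1 :: "nat \<Rightarrow> nat" and w0 where r1: "strict_mono r1" "square_integrable lborel w0"
    "(\<lambda>n. l2norm lborel (\<lambda>x. v (r1 n) x - w0 x)) \<longlonglongrightarrow> 0"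
    by (rule rellich[of \<Omega>1 v V A, OF h0D(1)[OF v] h0D(3)[OF v] A]) (assumption | rule that)+
  have bd: "(l2norm lborel (V n))\<^sup>2 \<le> A\<^sup>2" for n by (intro power_mono A) simp
  have "bounded (range (\<lambda>n. (l2norm lborel (V (r1 n)))\<^sup>2))"
    unfolding bounded_iff using bd by (intro exI[of _ "A\<^sup>2"]) auto
  then obtain B r2 where r2: "strict_mono (r2 :: nat \<Rightarrow> nat)" "((\<lambda>n. (l2norm lborel (V (r1 n)))\<^sup>2) \<circ> r2) \<longlonglongrightarrow> B"
    using bounded_imp_convergent_subsequence by blast
  define r where "r = r1 \<circ> r2"
  have r: "strict_mono r" unfolding r_def by (rule strict_mono_o[OF r1(1) r2(1)])
  have limB: "(\<lambda>n. (l2norm lborel (V (r n)))\<^sup>2) \<longlonglongrightarrow> B" using r2(2) by (simp add: r_def comp_def)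
  have limw: "(\<lambda>n. l2norm lborel (\<lambda>x. v (r n) x - w0 x)) \<longlonglongrightarrow> 0"
    using LIMSEQ_subseq_LIMSEQ[OF r1(3) r2(1)] by (simp add: r_def comp_def)
  obtain w W where w: "h0 w W" "(l2norm lborel W)\<^sup>2 \<le> B" "(\<lambda>n. l2norm lborel (\<lambda>x. v (r n) x - w x)) \<longlonglongrightarrow> 0"
    by (rule h0_limit[of "\<lambda>n. v (r n)" "\<lambda>n. V (r n)", OF v r1(2) limw limB]) (rule that)
  have BA: "B \<le> A\<^sup>2" by (rule LIMSEQ_le_const2[OF limB]) (use bd in blast)
  have "(l2norm lborel W)\<^sup>2 \<le> A\<^sup>2" using w(2) BA by simp
  then have WA: "l2norm lborel W \<le> A" using A0 by (rule power2_le_imp_le)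
  have "(\<lambda>n. 1/2 * (l2norm lborel (V (r n)))\<^sup>2 - E (v (r n)) (V (r n))) \<longlonglongrightarrow> 1/2 * B - m"
    by (intro tendsto_intros limB LIMSEQ_subseq_LIMSEQ[OF Elim r, unfolded comp_def])
  then have gl: "(\<lambda>n. \<integral>x. G (v (r n) x) \<partial>lborel) \<longlonglongrightarrow> 1/2 * B - m" by (simp add: E_def)
  have "1/2 * B - m \<le> (\<integral>x. G (w x) \<partial>lborel)"
    by (rule E_lsc[of m0 "\<lambda>n. v (r n)" "\<lambda>n. V (r n)" w W A, OF bdd v w(1) A w(3) gl])
  then have "E w W \<le> m" using w(2) by (simp add: E_def)
  then show thesis using that r w(1) WA w(3) by blast
qed

section \<open>A symmetric minimizer\<close>

text \<open>Polarizing \<open>\<bar>u\<bar>\<close> at most exchanges the values at a point and its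
  mirror image, so the sum of \<open>G\<close> over each mirror pair is unchanged; evenness of
  \<open>G\<close> disposes of the modulus.\<close>

lemma polar_h0:
  assumes u: "h0 u V" and n: "norm n = 1" and c: "0 \<le> c"
  obtains V' where "h0 (polar n c (\<lambda>x. \<bar>u x\<bar>)) V'" "l2norm lborel V' \<le> l2norm lborel V" "E (polar n c (\<lambda>x. \<bar>u x\<bar>)) V' \<le> E u V"
proof -
  let ?T = "polar n c (\<lambda>x. \<bar>u x\<bar>)"
  obtain V' where V': "h0_pair (ball 0 1) ?T V'" "(l2norm lborel V')\<^sup>2 \<le> (l2norm lborel V)\<^sup>2"
    by (rule polar_h0_pair[OF h0D(2)[OF u] n c]) (rule that)
  have "?T x = 0" if x: "x \<notin> \<Omega>1" for x
  proof (cases "n \<bullet> x \<le> c")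
    case True
    then have "(norm x)\<^sup>2 \<le> (norm (reflect n c x))\<^sup>2"
      using norm_reflect[OF n, of c x] c by (simp add: mult_nonneg_nonpos)
    then have "norm x \<le> norm (reflect n c x)" by (rule power2_le_imp_le) simp
    then have "reflect n c x \<notin> \<Omega>1" using x by (simp add: \<Omega>1_def)
    then show ?thesis using x u by (simp add: polar_def h0_def)
  next
    case False then show ?thesis using x u by (simp add: polar_def h0_def)
  qed
  then have h: "h0 ?T V'" using V'(1) by (simp add: h0_def \<Omega>1_def)
  have [measurable]: "u \<in> borel_measurable borel" "?T \<in> borel_measurable borel" using h0D(6)[OF u] h0D(6)[OF h] by auto
  have Gi: "integrable lborel (\<lambda>x. G (?T x))" "integrable lborel (\<lambda>x. G (u x))" by (rule G_integrable[OF h] G_integrable[OF u])+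
  have dbl: "(\<integral>x. f x + f (reflect n c x) \<partial>lborel) = 2 * (\<integral>x. f x \<partial>lborel)" if "integrable lborel f" for f :: "real^3 \<Rightarrow> real"
  proof -
    have [measurable]: "f \<in> borel_measurable borel" using borel_measurable_integrable[OF that] by simp
    have "integrable lborel (\<lambda>x. f (reflect n c x))" using that integrable_reflect[OF n, of f c] by simp
    then show ?thesis using that by (simp add: integral_reflect[OF n])
  qed
  have "(\<lambda>x. G (?T x) + G (?T (reflect n c x))) = (\<lambda>x. G (u x) + G (u (reflect n c x)))"
  proof
    fix x
    show "G (?T x) + G (?T (reflect n c x)) = G (u x) + G (u (reflect n c x))"
      using polar_swap[OF n, where u="\<lambda>x. \<bar>u x\<bar>" and c=c and x=x]
      by (elim disjE conjE) (simp_all only: G_abs add.commute)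
  qed
  then have "2 * (\<integral>x. G (?T x) \<partial>lborel) = 2 * (\<integral>x. G (u x) \<partial>lborel)"
    using dbl[OF Gi(1)] dbl[OF Gi(2)] by simp
  then have "E ?T V' \<le> E u V" using V'(2) by (simp add: E_def)
  moreover have "l2norm lborel V' \<le> l2norm lborel V" using V'(2) by (rule power2_le_imp_le) simp
  ultimately show thesis using that h by blast
qed

text \<open>The moment with the strictly radially decreasing weight \<open>4 - |x|\<^sup>2\<close> increases under polarization,
  strictly unless the function is already polarized.\<close>

definition moment :: "(real^3 \<Rightarrow> real) \<Rightarrow> real" where
  "moment u = (\<integral>x. u x * (4 - (norm x)\<^sup>2) \<partial>lborel)"

lemma moment_integrable:
  assumes "h0 u V" shows "integrable lborel (\<lambda>x. u x * (4 - (norm x)\<^sup>2))"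
proof (rule Bochner_Integration.integrable_bound)
  have [measurable]: "u \<in> borel_measurable borel" by (rule h0D[OF assms])
  show "integrable lborel (\<lambda>x. 4 * u x)" using h0D(8)[OF assms] by simp
  show "(\<lambda>x. u x * (4 - (norm x)\<^sup>2)) \<in> borel_measurable lborel" by measurable
  have "norm (u x * (4 - (norm x)\<^sup>2)) \<le> norm (4 * u x)" for x
  proof (cases "x \<in> ball 0 1")
    case True
    then have "(norm x)\<^sup>2 \<le> 1" by (simp add: abs_square_le_1)
    moreover have "0 \<le> (norm x)\<^sup>2" by simp
    ultimately have "\<bar>4 - (norm x)\<^sup>2\<bar> \<le> 4" by linarith
    then have "\<bar>u x\<bar> * \<bar>4 - (norm x)\<^sup>2\<bar> \<le> \<bar>u x\<bar> * 4" by (rule mult_left_mono) simp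
    then show ?thesis by (simp add: abs_mult mult.commute)
  next
    case False then show ?thesis using h0D(3)[OF assms] by simp
  qed
  then show "AE x in lborel. norm (u x * (4 - (norm x)\<^sup>2)) \<le> norm (4 * u x)" by simp
qed

lemma weight_pos: "x \<in> \<Omega>1 \<Longrightarrow> 0 < 4 - (norm x)\<^sup>2"
proof -
  assume "x \<in> \<Omega>1"
  then have "(norm x)\<^sup>2 \<le> 1" by (simp add: \<Omega>1_def abs_square_le_1)
  then show ?thesis by simp
qed

lemma moment_abs:
  assumes u: "h0 u V" and ia: "h0 (\<lambda>x. \<bar>u x\<bar>) V'" and le: "moment (\<lambda>x. \<bar>u x\<bar>) \<le> moment u"
  shows "AE x in lborel. \<bar>u x\<bar> = u x"
proof -
  let ?d = "\<lambda>x. \<bar>u x\<bar> * (4 - (norm x)\<^sup>2) - u x * (4 - (norm x)\<^sup>2)"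
  have i: "integrable lborel ?d" by (intro Bochner_Integration.integrable_diff moment_integrable[OF u] moment_integrable[OF ia])
  have nn: "0 \<le> ?d x" for x
  proof (cases "x \<in> \<Omega>1")
    case True
    have "u x * (4 - (norm x)\<^sup>2) \<le> \<bar>u x\<bar> * (4 - (norm x)\<^sup>2)" using weight_pos[OF True] by (intro mult_right_mono) auto
    then show ?thesis by simp
  next
    case False then show ?thesis using u by (simp add: h0_def)
  qed
  have "(\<integral>x. ?d x \<partial>lborel) = moment (\<lambda>x. \<bar>u x\<bar>) - moment u"
    unfolding moment_def by (rule Bochner_Integration.integral_diff[OF moment_integrable[OF ia] moment_integrable[OF u]])
  then have "(\<integral>x. ?d x \<partial>lborel) = 0" using le Bochner_Integration.integral_nonneg[where M=lborel and f="?d"] nn by simp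
  then have "AE x in lborel. ?d x = 0" using integral_nonneg_eq_0_iff_AE[OF i] nn by simp
  then show ?thesis
  proof eventually_elim
    case (elim x)
    show ?case
    proof (cases "x \<in> \<Omega>1")
      case True
      have "(\<bar>u x\<bar> - u x) * (4 - (norm x)\<^sup>2) = 0" using elim by (simp add: left_diff_distrib)
      then show ?thesis using weight_pos[OF True] by simp
    next
      case False then show ?thesis using u by (simp add: h0_def)
    qed
  qed
qed

text \<open>The gain \<open>d\<close> is odd under the reflection, and the weights at two mirror
  points differ by \<open>4 * c * (c - n \<bullet> x)\<close>, which has the sign of
  \<open>d\<close>. Adding the contributions of a mirror pair gives a nonnegative integrand; as
  \<open>c > 0\<close>, it vanishes only where \<open>d\<close> does or on the hyperplane, whose
  points are fixed.\<close>

lemma moment_polar: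
  assumes u: "h0 u V" and p: "h0 (polar n c u) V'" and n: "norm n = 1" and c: "0 < c"
  shows "moment u \<le> moment (polar n c u)"
    and "moment (polar n c u) \<le> moment u \<Longrightarrow> AE x in lborel. polar n c u x = u x"
proof -
  let ?r = "reflect n c"
  define d where "d x = polar n c u x - u x" for x
  define k where "k x = d x * (4 * c * (c - n \<bullet> x))" for x
  have dr: "d (?r x) = - d x" for x using polar_swap[OF n, where u=u and x=x and c=c] by (auto simp: d_def)
  have [measurable]: "d \<in> borel_measurable borel" using h0D(6)[OF u] h0D(6)[OF p] unfolding d_def[abs_def] by measurable
  have i: "integrable lborel (\<lambda>x. d x * (4 - (norm x)\<^sup>2))"
    unfolding d_def left_diff_distrib by (intro Bochner_Integration.integrable_diff moment_integrable[OF u] moment_integrable[OF p])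
  have ir: "integrable lborel (\<lambda>x. d (?r x) * (4 - (norm (?r x))\<^sup>2))"
    using i integrable_reflect[OF n, of "\<lambda>x. d x * (4 - (norm x)\<^sup>2)" c] by simp
  have M: "(\<integral>x. d x * (4 - (norm x)\<^sup>2) \<partial>lborel) = moment (polar n c u) - moment u"
    unfolding moment_def d_def left_diff_distrib by (rule Bochner_Integration.integral_diff[OF moment_integrable[OF p] moment_integrable[OF u]])
  have keq: "d x * (4 - (norm x)\<^sup>2) + d (?r x) * (4 - (norm (?r x))\<^sup>2) = k x" for x
    unfolding dr norm_reflect[OF n] k_def by (simp add: algebra_simps)
  have ki: "integrable lborel k"
    using Bochner_Integration.integrable_add[OF i ir] unfolding keq by (simp add: k_def[abs_def])
  have "(\<integral>x. k x \<partial>lborel) = (\<integral>x. d x * (4 - (norm x)\<^sup>2) \<partial>lborel) + (\<integral>x. d (?r x) * (4 - (norm (?r x))\<^sup>2) \<partial>lborel)"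
    unfolding keq[symmetric] by (rule Bochner_Integration.integral_add[OF i ir])
  also have "(\<integral>x. d (?r x) * (4 - (norm (?r x))\<^sup>2) \<partial>lborel) = (\<integral>x. d x * (4 - (norm x)\<^sup>2) \<partial>lborel)"
    by (rule integral_reflect[OF n]) measurable
  finally have kM: "(\<integral>x. k x \<partial>lborel) = 2 * (moment (polar n c u) - moment u)" using M by simp
  have knn: "0 \<le> k x" for x
  proof (cases "n \<bullet> x \<le> c")
    case True
    then have "0 \<le> d x" using polar_cases(1)[OF n True, of u] by (simp add: d_def)
    then show ?thesis using True c by (simp add: k_def)
  next
    case False
    then have "d x \<le> 0" using polar_cases(2)[OF n, where u=u and x=x and c=c] by (simp add: d_def)
    moreover have "4 * c * (c - n \<bullet> x) \<le> 0" using False c by (simp add: mult_nonneg_nonpos)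
    ultimately show ?thesis unfolding k_def by (rule mult_nonpos_nonpos)
  qed
  show "moment u \<le> moment (polar n c u)" using kM Bochner_Integration.integral_nonneg[where M=lborel and f=k] knn by simp
  assume "moment (polar n c u) \<le> moment u"
  then have "(\<integral>x. k x \<partial>lborel) = 0" using kM Bochner_Integration.integral_nonneg[where M=lborel and f=k] knn by simp
  then have "AE x in lborel. k x = 0" using integral_nonneg_eq_0_iff_AE[OF ki] knn by simp
  then show "AE x in lborel. polar n c u x = u x"
  proof eventually_elim
    case (elim x)
    then have "d x = 0 \<or> n \<bullet> x = c" using c by (auto simp: k_def)
    then show ?case using reflect_fixed[OF n, of x c] by (auto simp: d_def polar_def)
  qed
qed

text \<open>On the set \<open>S\<close> of minimizers with gradient norm at most \<open>A\<close>
  the moment is bounded, and it attains its supremum by \<open>E_compact\<close>. Polarizing the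
  modulus maps \<open>S\<close> to itself, so at a nonnegative maximizer no polarization can
  increase the moment.\<close>

lemma symmetric_minimizer:
  assumes bdd: "\<And>u V. h0 u V \<Longrightarrow> m \<le> E u V"
    and v: "\<And>n. h0 (v n) (V n)" and A: "\<And>n. l2norm lborel (V n) \<le> A" and Elim: "(\<lambda>n. E (v n) (V n)) \<longlonglongrightarrow> m"
  obtains u U where "h0 u U" "E u U = m" "\<And>x. 0 \<le> u x"
    "\<And>n c. norm n = 1 \<Longrightarrow> 0 < c \<Longrightarrow> AE x in lborel. polar n c u x = u x"
proof -
  define S where "S = {(u, U). h0 u U \<and> l2norm lborel U \<le> A \<and> E u U \<le> m}"
  obtain w0 W0 where w0: "(w0, W0) \<in> S"
    using E_compact[OF bdd v A Elim] unfolding S_def by (metis (mono_tags, lifting) case_prodI mem_Collect_eq)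
  have A0: "0 \<le> A" using A[of 0] l2norm_nonneg order_trans by blast
  define wt where "wt x = indicat_real \<Omega>1 x * (4 - (norm x)\<^sup>2)" for x
  have [measurable]: "\<Omega>1 \<in> sets borel" by (simp add: \<Omega>1_def)
  have wtsq: "square_integrable lborel wt"
  proof -
    have "integrable lborel (indicat_real \<Omega>1)"
      using emeasure_lborel_ball_finite[of "0::real^3" 1] by (simp add: \<Omega>1_def)
    then have "integrable lborel (\<lambda>x. 16 * indicat_real \<Omega>1 x)" by simp
    then have "integrable lborel (\<lambda>x. (norm (wt x))\<^sup>2)"
    proof (rule Bochner_Integration.integrable_bound)
      show "(\<lambda>x. (norm (wt x))\<^sup>2) \<in> borel_measurable lborel" unfolding wt_def by measurable
      have "(wt x)\<^sup>2 \<le> 16 * indicat_real \<Omega>1 x" for x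
      proof (cases "x \<in> \<Omega>1")
        case True
        have "(4 - (norm x)\<^sup>2)\<^sup>2 \<le> 4\<^sup>2" using weight_pos[OF True] by (intro power_mono) auto
        then show ?thesis using True by (simp add: wt_def)
      qed (simp add: wt_def)
      then show "AE x in lborel. norm ((norm (wt x))\<^sup>2) \<le> norm (16 * indicat_real \<Omega>1 x)" by simp
    qed
    then show ?thesis unfolding square_integrable_def wt_def[abs_def] by simp
  qed
  have mom: "moment u = (\<integral>x. u x \<bullet> wt x \<partial>lborel)" if "h0 u U" for u U
    unfolding moment_def using that by (intro Bochner_Integration.integral_cong) (auto simp: wt_def h0_def indicator_def)
  have momle: "moment u \<le> 3 * A * l2norm lborel wt" if "(u, U) \<in> S" for u U
  proof -
    have h: "h0 u U" and UA: "l2norm lborel U \<le> A" using that by (auto simp: S_def)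
    have "l2norm lborel u \<le> 3 * A" using h0_pair_l2norm_le[OF h0D(1)[OF h] h0D(3)[OF h]] UA by simp
    then have "l2norm lborel u * l2norm lborel wt \<le> 3 * A * l2norm lborel wt" by (rule mult_right_mono) simp
    then show ?thesis using l2norm_Cauchy_Schwarz[OF h0D(4)[OF h] wtsq] unfolding mom[OF h] by linarith
  qed
  define J where "J = (SUP p\<in>S. moment (fst p))"
  have bddJ: "bdd_above ((\<lambda>p. moment (fst p)) ` S)" using momle by (auto intro!: bdd_aboveI)
  have Jup: "moment u \<le> J" if "(u, U) \<in> S" for u U
    unfolding J_def using cSUP_upper[OF that bddJ] by simp
  have "\<exists>p\<in>S. J - 1 / real (Suc k) < moment (fst p)" for k
  proof -
    have "J - 1 / real (Suc k) < (SUP p\<in>S. moment (fst p))" by (simp add: J_def)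
    then show ?thesis using w0 by (subst (asm) less_cSUP_iff[OF _ bddJ]) auto
  qed
  then obtain p where p: "\<And>k. p k \<in> S" "\<And>k. J - 1 / real (Suc k) < moment (fst (p k))" by metis
  define w W where "w k = fst (p k)" and "W k = snd (p k)" for k
  have wS: "(w k, W k) \<in> S" for k using p(1) by (simp add: w_def W_def)
  have wh: "h0 (w k) (W k)" and WA: "l2norm lborel (W k) \<le> A" and "E (w k) (W k) \<le> m" for k using wS[of k] by (auto simp: S_def)
  then have "E (w k) (W k) = m" for k using bdd[OF wh[of k]] by (simp add: order_antisym)
  then have Em: "(\<lambda>k. E (w k) (W k)) \<longlonglongrightarrow> m" by simp
  obtain r :: "nat \<Rightarrow> nat" and u0 U0 where u0: "strict_mono r" "h0 u0 U0" "l2norm lborel U0 \<le> A" "E u0 U0 \<le> m"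
    "(\<lambda>k. l2norm lborel (\<lambda>x. w (r k) x - u0 x)) \<longlonglongrightarrow> 0"
    by (rule E_compact[of m w W A m, OF bdd wh WA Em]) (assumption | rule that)+
  have u0S: "(u0, U0) \<in> S" using u0 by (simp add: S_def)
  have "(\<lambda>k. \<integral>x. w (r k) x \<bullet> wt x \<partial>lborel) \<longlonglongrightarrow> (\<integral>x. u0 x \<bullet> wt x \<partial>lborel)"
    by (rule integral_inner_tendsto[OF h0D(4)[OF wh] h0D(4)[OF u0(2)] wtsq wtsq u0(5)]) simp
  then have ml: "(\<lambda>k. moment (w (r k))) \<longlonglongrightarrow> moment u0" by (simp only: mom[OF wh] mom[OF u0(2)])
  have "J \<le> moment u0"
  proof (rule LIMSEQ_le[OF _ ml])
    show "(\<lambda>k. J - 1 / real (Suc (r k))) \<longlonglongrightarrow> J"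
      using tendsto_diff[OF tendsto_const[of J] LIMSEQ_subseq_LIMSEQ[OF LIMSEQ_inverse_real_of_nat u0(1)]]
      by (simp add: comp_def inverse_eq_divide)
    show "\<exists>N. \<forall>k\<ge>N. J - 1 / real (Suc (r k)) \<le> moment (w (r k))" using p(2) by (auto simp: w_def intro: less_imp_le)
  qed
  then have Jeq: "moment u0 = J" using Jup[OF u0S] by simp
  define u where "u x = \<bar>u0 x\<bar>" for x
  have TS: "\<exists>U'. (polar n c u, U') \<in> S" if nc: "norm n = 1" "0 \<le> c" for n c
  proof -
    obtain V' where "h0 (polar n c (\<lambda>x. \<bar>u0 x\<bar>)) V'" "l2norm lborel V' \<le> l2norm lborel U0" "E (polar n c (\<lambda>x. \<bar>u0 x\<bar>)) V' \<le> E u0 U0"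
      by (rule polar_h0[OF u0(2) nc])
    then show ?thesis using u0 unfolding S_def u_def[abs_def] by (intro exI[of _ V']) auto
  qed
  \<comment> \<open>The hyperplane at distance 2 from the origin mirrors the unit ball to a disjoint
    set, so this polarization fixes nonnegative functions vanishing off the ball. Hence
    \<open>\<bar>u0\<bar>\<close> itself belongs to \<open>S\<close>, as the special case of a
    polarization of the modulus.\<close>
  have far: "polar (axis 1 1) 2 u = u"
  proof
    fix x :: "real^3"
    have n1: "norm (axis 1 1 :: real^3) = 1" by (rule norm_axis_1)
    have out: "u y = 0" if "1 \<le> norm y" for y using u0(2) that by (auto simp: u_def h0_def \<Omega>1_def)
    show "polar (axis 1 1) 2 u x = u x"
    proof (cases "axis 1 1 \<bullet> x \<le> 2")
      case True
      have "1 \<le> \<bar>axis 1 1 \<bullet> x\<bar> \<or> 1 \<le> \<bar>axis 1 1 \<bullet> reflect (axis 1 1) 2 x\<bar>" using True by (simp add: inner_reflect[OF n1])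
      then consider "1 \<le> norm x" | "1 \<le> norm (reflect (axis 1 1) 2 x)"
        using Cauchy_Schwarz_ineq2[of "axis 1 1" x] Cauchy_Schwarz_ineq2[of "axis 1 1" "reflect (axis 1 1) 2 x"] by (fastforce simp: n1)
      then show ?thesis
      proof cases
        case 1
        then have "1 \<le> norm (reflect (axis 1 1) 2 x)"
        proof -
          have "(norm x)\<^sup>2 \<le> (norm (reflect (axis 1 1) 2 x))\<^sup>2" using norm_reflect[OF n1, of 2 x] True by simp
          then have "norm x \<le> norm (reflect (axis 1 1) 2 x)" by (rule power2_le_imp_le) simp
          then show ?thesis using 1 by simp
        qed
        then show ?thesis using 1 by (simp add: polar_def out)
      next
        case 2
        have "0 \<le> u x" by (simp add: u_def)
        then show ?thesis using True out[OF 2] by (simp add: polar_def max_def)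
      qed
    next
      case False
      have "1 \<le> norm x" using False Cauchy_Schwarz_ineq2[of "axis 1 1" x] by (simp add: n1)
      moreover have "0 \<le> u (reflect (axis 1 1) 2 x)" by (simp add: u_def)
      ultimately show ?thesis using False out[of x] by (simp add: polar_def min_def)
    qed
  qed
  obtain U where uS: "(u, U) \<in> S" using TS[of "axis 1 1" 2] far by (auto simp: norm_axis_1)
  have uh: "h0 u U" and uE: "E u U \<le> m" using uS by (auto simp: S_def)
  \<comment> \<open>Passing to the modulus cannot push the moment above its supremum
    \<open>J\<close>, and the weight is positive on the ball, so \<open>u0\<close> is nonnegative
    almost everywhere and \<open>u\<close> still has moment \<open>J\<close>.\<close>
  have pos: "AE x in lborel. \<bar>u0 x\<bar> = u0 x"
    using moment_abs[OF u0(2) uh[unfolded u_def[abs_def]]] Jup[OF uS] Jeq by (simp add: u_def[abs_def])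
  have "moment u = moment u0"
    unfolding moment_def
  proof (rule integral_cong_AE)
    show "AE x in lborel. u x * (4 - (norm x)\<^sup>2) = u0 x * (4 - (norm x)\<^sup>2)" using pos by eventually_elim (simp add: u_def)
  qed (use h0D(6)[OF uh] h0D(6)[OF u0(2)] in measurable)
  then have uJ: "moment u = J" using Jeq by simp
  show thesis
  proof (rule that[OF uh])
    show "E u U = m" using uE bdd[OF uh] by simp
    show "0 \<le> u x" for x by (simp add: u_def)
    fix n :: "real^3" and c :: real assume n: "norm n = 1" and c: "0 < c"
    obtain U' where U': "(polar n c u, U') \<in> S" using TS[OF n less_imp_le[OF c]] by blast
    have "h0 (polar n c u) U'" using U' by (simp add: S_def)
    then show "AE x in lborel. polar n c u x = u x"
      using moment_polar(2)[OF uh _ n c] Jup[OF U'] uJ by simp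
  qed
qed

end

text \<open>Take the hyperplane bisecting the segment from \<open>x\<close> to \<open>y\<close>;
  then \<open>c > 0\<close> because \<open>x\<close> is nearer to the origin, and the reflection
  exchanges \<open>x\<close> and \<open>y\<close>. Since \<open>\<delta>\<close> is at most half the
  distance, the kernel around \<open>x\<close> is supported on the side of \<open>x\<close>, where
  invariance under polarization says that \<open>u\<close> is at least its reflection.\<close>

lemma mollify_radial_mono:
  assumes u: "h0 u U" and xy: "norm x < norm y" and \<delta>: "0 < \<delta>" "\<delta> \<le> norm (y - x) / 2"
    and pol: "\<And>n c. norm n = 1 \<Longrightarrow> 0 < c \<Longrightarrow> AE z in lborel. polar n c u z = u z"
  shows "mollify \<delta> u y \<le> mollify \<delta> u x"
proof -
  define D where "D = norm (y - x)"
  have D: "0 < D" using xy by (auto simp: D_def)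
  define n where "n = (1 / D) *\<^sub>R (y - x)"
  define c where "c = ((norm y)\<^sup>2 - (norm x)\<^sup>2) / (2 * D)"
  have n: "norm n = 1" using D by (simp add: n_def flip: D_def)
  have c: "0 < c" using xy D by (simp add: c_def power_strict_mono)
  have D2: "D * D = y \<bullet> y - 2 * (y \<bullet> x) + x \<bullet> x"
    unfolding D_def power2_eq_square[symmetric] power2_norm_eq_inner by (simp add: inner_diff_left inner_diff_right inner_commute)
  have nx: "n \<bullet> x = c - D / 2"
  proof -
    have "n \<bullet> x = (y \<bullet> x - x \<bullet> x) / D" by (simp add: n_def inner_diff_left)
    moreover have "c - D / 2 = ((y \<bullet> y - x \<bullet> x) - D * D) / (2 * D)"
      using D by (simp add: c_def power2_norm_eq_inner field_simps)
    moreover have q: "(y \<bullet> y - x \<bullet> x) - D * D = 2 * (y \<bullet> x - x \<bullet> x)" unfolding D2 by simp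
    moreover have "((y \<bullet> y - x \<bullet> x) - D * D) / (2 * D) = (y \<bullet> x - x \<bullet> x) / D" unfolding q by (rule mult_divide_mult_cancel_left) simp
    ultimately show ?thesis by argo
  qed
  have rx: "reflect n c x = y"
    using D by (simp add: reflect_def nx) (simp add: n_def)
  have [measurable]: "u \<in> borel_measurable borel" by (rule h0D[OF u])
  have [measurable]: "(rho \<delta> :: real^3 \<Rightarrow> real) \<in> borel_measurable borel"
    by (rule test_function_measurable(1)[OF rho_test[OF \<delta>(1)]])
  have eq: "rho \<delta> (y - reflect n c z) = rho \<delta> (x - z)" for z
    by (rule rho_norm_cong) (use norm_reflect_diff[OF n, of c x z] in \<open>simp add: rx\<close>)
  have i: "integrable lborel (\<lambda>z. rho \<delta> (x - z) * u z)" "integrable lborel (\<lambda>z. rho \<delta> (y - z) * u z)"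
    by (rule integrable_conv[OF rho_test[OF \<delta>(1)] h0D(8)[OF u]])+
  have ir: "integrable lborel (\<lambda>z. rho \<delta> (x - z) * u (reflect n c z))"
    using i(2) integrable_reflect[OF n, of "\<lambda>z. rho \<delta> (y - z) * u z" c] by (simp add: eq)
  have "mollify \<delta> u y = (\<integral>z. rho \<delta> (x - z) * u (reflect n c z) \<partial>lborel)"
    unfolding conv_def using integral_reflect[OF n, of "\<lambda>z. rho \<delta> (y - z) * u z" c] by (simp add: eq)
  also have "\<dots> \<le> mollify \<delta> u x"
    unfolding conv_def
  proof (rule integral_mono_AE[OF ir i(1)])
    show "AE z in lborel. rho \<delta> (x - z) * u (reflect n c z) \<le> rho \<delta> (x - z) * u z"
      using pol[OF n c]
    proof eventually_elim
      case (elim z)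
      show ?case
      proof (cases "\<delta> \<le> norm (x - z)")
        case True then show ?thesis by (simp add: rho_eq_0[OF \<delta>(1)])
      next
        case False
        have "n \<bullet> z = n \<bullet> x + n \<bullet> (z - x)" by (simp add: inner_diff_right)
        also have "n \<bullet> (z - x) \<le> norm (z - x)" using Cauchy_Schwarz_ineq2[of n "z - x"] n by simp
        finally have "n \<bullet> z \<le> c" using False \<delta>(2) by (simp add: nx D_def norm_minus_commute)
        then have "max (u z) (u (reflect n c z)) = u z" using elim by (simp add: polar_def)
        then have "u (reflect n c z) \<le> u z" by (simp add: max_def split: if_splits)
        then show ?thesis by (rule mult_left_mono) (rule rho_nonneg[OF \<delta>(1)])
      qed
    qed
  qed
  finally show ?thesis .
qed

text \<open>The null set in the hypothesis depends on the half-space. For mollified functions the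
  comparison holds at every pair of points, so a single null set remains: where the mollifications
  fail to converge along a subsequence.\<close>

lemma radially_decreasing_AE:
  assumes u: "h0 u U"
    and pol: "\<And>n c. norm n = 1 \<Longrightarrow> 0 < c \<Longrightarrow> AE z in lborel. polar n c u z = u z"
  obtains N where "N \<in> null_sets lborel" "\<And>x y. x \<notin> N \<Longrightarrow> y \<notin> N \<Longrightarrow> norm x < norm y \<Longrightarrow> u y \<le> u x"
proof -
  define \<delta> where "\<delta> k = 1 / real (Suc k)" for k
  have \<delta>: "0 < \<delta> k" for k by (simp add: \<delta>_def)
  have \<delta>0: "\<delta> \<longlonglongrightarrow> 0" using LIMSEQ_inverse_real_of_nat unfolding \<delta>_def[abs_def] inverse_eq_divide .
  note close = mollify_h0_pair_close[OF h0D(1)[OF u] h0D(3)[OF u] \<delta>]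
  have "(\<lambda>k. l2norm lborel (\<lambda>x. mollify (\<delta> k) u x - u x)) \<longlonglongrightarrow> 0"
  proof (rule Lim_null_comparison)
    show "(\<lambda>k. \<delta> k * l2norm lborel U) \<longlonglongrightarrow> 0" using tendsto_mult_right[OF \<delta>0, of "l2norm lborel U"] by simp
  qed (use close(2) in simp)
  then obtain r where r: "strict_mono r" "AE x in lborel. (\<lambda>k. mollify (\<delta> (r k)) u x) \<longlonglongrightarrow> u x"
    by (rule l2_AE_subseq[OF close(1) h0D(4)[OF u], rotated])
  obtain N where N: "{x \<in> space lborel. \<not> (\<lambda>k. mollify (\<delta> (r k)) u x) \<longlonglongrightarrow> u x} \<subseteq> N" "emeasure lborel N = 0" "N \<in> sets lborel"
    by (rule AE_E[OF r(2)])
  have lim: "(\<lambda>k. mollify (\<delta> (r k)) u x) \<longlonglongrightarrow> u x" if "x \<notin> N" for x using N(1) that by auto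
  show thesis
  proof (rule that[OF null_setsI[OF N(2,3)]])
    fix x y assume x: "x \<notin> N" and y: "y \<notin> N" and xy: "norm x < norm y"
    have "(\<lambda>k. \<delta> (r k)) \<longlonglongrightarrow> 0" using LIMSEQ_subseq_LIMSEQ[OF \<delta>0 r(1)] by (simp add: comp_def)
    moreover have "0 < norm (y - x) / 2" using xy by auto
    ultimately have ev: "\<forall>\<^sub>F k in sequentially. \<delta> (r k) < norm (y - x) / 2" by (rule order_tendstoD(2))
    show "u y \<le> u x"
    proof (rule tendsto_le[OF _ lim[OF x] lim[OF y]])
      show "\<forall>\<^sub>F k in sequentially. mollify (\<delta> (r k)) u y \<le> mollify (\<delta> (r k)) u x"
        using ev
      proof eventually_elim
        case (elim k)
        show ?case by (rule mollify_radial_mono[OF u xy \<delta> less_imp_le[OF elim] pol])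
      qed
    qed simp
  qed
qed

text \<open>Up to a null set, a superlevel set of a radially decreasing function is the centered
  ball with radius the supremum of the norms of its points. The ball in the symmetrization has the
  same measure and hence the same radius.\<close>

lemma schwarz_symm_eq_AE:
  fixes u :: "real^3 \<Rightarrow> real"
  assumes um [measurable]: "u \<in> borel_measurable borel" and u0: "\<And>x. 0 \<le> u x" and out: "\<And>x. x \<notin> \<Omega>1 \<Longrightarrow> u x = 0"
    and N: "N \<in> null_sets lborel" "\<And>x y. x \<notin> N \<Longrightarrow> y \<notin> N \<Longrightarrow> norm x < norm y \<Longrightarrow> u y \<le> u x"
  shows "AE x in lborel. x \<in> \<Omega>1 \<longrightarrow> schwarz_symm \<Omega>1 u x = u x"
proof -
  define v where "v = (THE v. is_schwarz_symm \<Omega>1 u v)"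
  have "u \<in> borel_measurable (lebesgue_on (ball 0 1))"
    by (intro measurable_restrict_space1 measurable_completion) simp
  then have v: "is_schwarz_symm \<Omega>1 u v"
    unfolding v_def \<Omega>1_def by (intro is_schwarz_symm_The) simp_all
  have lev: "AE x in lborel. x \<in> \<Omega>1 \<longrightarrow> (ennreal t < v x \<longleftrightarrow> t < u x)" if t: "0 \<le> t" for t
  proof -
    have "\<exists>r\<ge>0. {x\<in>\<Omega>1. v x > ennreal t} = ball 0 r \<and>
        emeasure lebesgue (ball 0 r :: (real^3) set) = emeasure lebesgue {x\<in>\<Omega>1. \<bar>u x\<bar> > t}"
      using v t unfolding is_schwarz_symm_def by blast
    then obtain r where r: "0 \<le> r" "{x\<in>\<Omega>1. v x > ennreal t} = ball 0 r"
      "emeasure lebesgue (ball 0 r :: (real^3) set) = emeasure lebesgue {x\<in>\<Omega>1. \<bar>u x\<bar> > t}" by blast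
    define L where "L = {x. t < u x}"
    have L\<Omega>: "{x\<in>\<Omega>1. \<bar>u x\<bar> > t} = L" using u0 out t by (auto simp: L_def) (metis not_less)
    have Lm: "L \<in> sets borel" unfolding L_def by measurable
    \<comment> \<open>Inserting 0 keeps the supremum meaningful and nonnegative when the superlevel
      set is negligible.\<close>
    define R where "R = insert 0 (norm ` (L - N))"
    have RU: "x \<le> 1" if "x \<in> R" for x
    proof -
      have "norm y \<le> 1" if "y \<in> L" for y
        using that out[of y] t by (cases "y \<in> \<Omega>1") (auto simp: L_def \<Omega>1_def)
      then show ?thesis using that by (auto simp: R_def)
    qed
    have Rb: "bdd_above R" unfolding bdd_above_def using RU by blast
    define s where "s = Sup R"
    have s0: "0 \<le> s" unfolding s_def by (rule cSup_upper[OF _ Rb]) (simp add: R_def)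
    have in1: "x \<in> L" if "x \<in> ball 0 s" "x \<notin> N" for x
    proof -
      have "norm x < Sup R" using that(1) by (simp add: s_def)
      then obtain z where z: "z \<in> R" "norm x < z" using less_cSup_iff[OF _ Rb] by (auto simp: R_def)
      then have "z \<noteq> 0" using norm_ge_zero[of x] by linarith
      then obtain y where y: "y \<in> L" "y \<notin> N" "z = norm y" using z(1) by (auto simp: R_def)
      then have "u y \<le> u x" using N(2)[OF that(2) y(2)] z(2) by simp
      then show ?thesis using y(1) by (simp add: L_def)
    qed
    have in2: "norm x \<le> s" if "x \<in> L" "x \<notin> N" for x
      unfolding s_def by (rule cSup_upper[OF _ Rb]) (use that in \<open>auto simp: R_def\<close>)
    have sph: "AE x in lborel. x \<notin> sphere (0::real^3) s"
      using negligible_sphere[of "0::real^3" s] by (intro AE_not_in) (simp add: negligible_iff_null_sets null_sets_completion_iff)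
    have ae: "AE x in lborel. x \<in> L \<longleftrightarrow> x \<in> ball 0 s"
      using sph AE_not_in[OF N(1)]
    proof eventually_elim
      case (elim x)
      then show ?case using in1[of x] in2[of x] by (auto simp: less_le)
    qed
    have "emeasure lborel L = emeasure lborel (ball (0::real^3) s)"
      by (rule emeasure_eq_AE) (use ae Lm in auto)
    then have "emeasure lebesgue (ball 0 r :: (real^3) set) = emeasure lebesgue (ball 0 s :: (real^3) set)"
      using r(3) Lm unfolding L\<Omega> by simp
    then have rs: "r = s" by (rule ball_0_eq_of_emeasure_eq[OF r(1) s0])
    show ?thesis using ae
    proof eventually_elim
      case (elim x)
      have "x \<in> \<Omega>1 \<and> ennreal t < v x \<longleftrightarrow> x \<in> ball 0 s" using r(2) unfolding rs by blast
      then have "x \<in> \<Omega>1 \<and> ennreal t < v x \<longleftrightarrow> t < u x" using elim by (simp only: L_def mem_Collect_eq)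
      then show ?case by blast
    qed
  qed
  \<comment> \<open>Each level has its own null set; countably many rational levels suffice to
    determine a value.\<close>
  have "AE x in lborel. \<forall>q\<in>{q\<in>\<rat>. 0 \<le> q}. x \<in> \<Omega>1 \<longrightarrow> (ennreal q < v x \<longleftrightarrow> q < u x)"
  proof (subst AE_ball_countable)
    show "countable {q\<in>\<rat>. 0 \<le> (q::real)}" by (rule countable_subset[OF _ countable_rat]) auto
    show "\<forall>q\<in>{q\<in>\<rat>. 0 \<le> q}. AE x in lborel. x \<in> \<Omega>1 \<longrightarrow> (ennreal q < v x \<longleftrightarrow> q < u x)" using lev by blast
  qed
  then show ?thesis
  proof eventually_elim
    case (elim x)
    show ?case
    proof
      assume x: "x \<in> \<Omega>1"
      have q: "ennreal q < v x \<longleftrightarrow> q < u x" if "q \<in> \<rat>" "0 \<le> q" for q using elim that x by auto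
      have "v x = ennreal (u x)"
      proof (rule ccontr)
        assume "v x \<noteq> ennreal (u x)"
        then consider "v x < ennreal (u x)" | "ennreal (u x) < v x" by (metis neqE)
        then show False
        proof cases
          case 1
          then obtain a where a: "v x = ennreal a" "0 \<le> a" by (cases "v x") auto
          then have "a < u x" using 1 by (simp add: ennreal_less_iff)
          then obtain p where p: "p \<in> \<rat>" "a < p" "p < u x" using Rats_dense_in_real by blast
          then have "ennreal p < ennreal a" using q[of p] a by simp
          then show False using p a by (simp add: ennreal_less_iff)
        next
          case 2
          then obtain z where z: "ennreal (u x) < z" "z < v x" using dense by blast
          then obtain a where a: "z = ennreal a" "0 \<le> a" by (cases z) auto
          then have "u x < a" using z(1) u0[of x] by (simp add: ennreal_less_iff)
          then obtain p where p: "p \<in> \<rat>" "u x < p" "p < a" using Rats_dense_in_real by blast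
          have "ennreal p \<le> z" unfolding a(1) using p by (intro ennreal_leI) simp
          then have "ennreal p < v x" by (rule le_less_trans[OF _ z(2)])
          then show False using q[of p] p u0[of x] by simp
        qed
      qed
      then show "schwarz_symm \<Omega>1 u x = u x" using u0[of x] by (simp add: schwarz_symm_def v_def)
    qed
  qed
qed

section \<open>First and second variation at a minimizer\<close>

lemma power6_add_le: "(\<bar>a\<bar> + \<bar>b\<bar>) ^ 6 \<le> 64 * (\<bar>a\<bar> ^ 6 + \<bar>b\<bar> ^ 6)" for a b :: real
proof -
  have "(\<bar>a\<bar> + \<bar>b\<bar>) ^ 6 \<le> (2 * max \<bar>a\<bar> \<bar>b\<bar>) ^ 6" by (rule power_mono) auto
  also have "\<dots> = 64 * (max \<bar>a\<bar> \<bar>b\<bar>) ^ 6" by (simp add: power_mult_distrib)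
  also have "(max \<bar>a\<bar> \<bar>b\<bar>) ^ 6 \<le> \<bar>a\<bar> ^ 6 + \<bar>b\<bar> ^ 6" by (simp add: max_def)
  finally show ?thesis by simp
qed

context nonlinearity
begin

text \<open>Minimality against \<open>u + t \<phi>\<close> with the quadratic part expanded. It is
  divided by \<open>t\<close> for the first variation and, after adding the cases \<open>t\<close>
  and \<open>- t\<close>, by the square of \<open>t\<close> for the second.\<close>

lemma E_perturb:
  assumes u: "h0 u U" and \<phi>: "h0 \<phi> \<Phi>" and min: "\<And>w W. h0 w W \<Longrightarrow> E u U \<le> E w W"
  shows "(\<integral>x. G (u x + t * \<phi> x) \<partial>lborel) - (\<integral>x. G (u x) \<partial>lborel) \<le> t * (\<integral>x. U x \<bullet> \<Phi> x \<partial>lborel) + t\<^sup>2 / 2 * (l2norm lborel \<Phi>)\<^sup>2"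
    and "integrable lborel (\<lambda>x. G (u x + t * \<phi> x))"
proof -
  have h: "h0 (\<lambda>x. u x + t * \<phi> x) (\<lambda>x. U x + t *\<^sub>R \<Phi> x)"
    using h0_linear_comb[OF u \<phi>, of 1 t] by simp
  show "integrable lborel (\<lambda>x. G (u x + t * \<phi> x))" by (rule G_integrable[OF h])
  have "(l2norm lborel (\<lambda>x. U x + t *\<^sub>R \<Phi> x))\<^sup>2 = (l2norm lborel U)\<^sup>2 + 2 * t * (\<integral>x. U x \<bullet> \<Phi> x \<partial>lborel) + t\<^sup>2 * (l2norm lborel \<Phi>)\<^sup>2"
    using l2norm_add_power2[OF h0D(5)[OF u] square_integrable_scaleR(1)[OF h0D(5)[OF \<phi>]], of t]
      square_integrable_scaleR(2)[OF h0D(5)[OF \<phi>], of t]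
    by (simp add: power_mult_distrib)
  then show "(\<integral>x. G (u x + t * \<phi> x) \<partial>lborel) - (\<integral>x. G (u x) \<partial>lborel) \<le> t * (\<integral>x. U x \<bullet> \<Phi> x \<partial>lborel) + t\<^sup>2 / 2 * (l2norm lborel \<Phi>)\<^sup>2"
    using min[OF h] unfolding E_def by (simp add: field_simps)
qed

lemma first_variation_le:
  assumes u: "h0 u U" and \<phi>: "h0 \<phi> \<Phi>" and min: "\<And>w W. h0 w W \<Longrightarrow> E u U \<le> E w W"
  shows "(\<integral>x. g (u x) * \<phi> x \<partial>lborel) \<le> (\<integral>x. U x \<bullet> \<Phi> x \<partial>lborel)"
proof -
  define t where "t k = 1 / real (Suc k)" for k
  have t: "0 < t k" "t k \<le> 1" for k by (auto simp: t_def)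
  have t0: "t \<longlonglongrightarrow> 0" using LIMSEQ_inverse_real_of_nat unfolding t_def[abs_def] inverse_eq_divide .
  define D where "D k x = (G (u x + t k * \<phi> x) - G (u x)) / t k" for k x
  have [measurable]: "u \<in> borel_measurable borel" "\<phi> \<in> borel_measurable borel" by (rule h0D[OF u] h0D[OF \<phi>])+
  have lim: "(\<lambda>k. \<integral>x. D k x \<partial>lborel) \<longlonglongrightarrow> (\<integral>x. g (u x) * \<phi> x \<partial>lborel)"
  \<comment> \<open>The constant 128 is 2 times 64: two fifth powers in \<open>G_diff\<close>, and
    the factor in \<open>power6_add_le\<close> for the sixth power of
    \<open>\<bar>u x\<bar> + \<bar>\<phi> x\<bar>\<close>.\<close>
  proof (rule integral_dominated_convergence[where w="\<lambda>x. C * (\<bar>\<phi> x\<bar> + 128 * (\<bar>u x\<bar> ^ 6 + \<bar>\<phi> x\<bar> ^ 6))"])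
    show "integrable lborel (\<lambda>x. C * (\<bar>\<phi> x\<bar> + 128 * (\<bar>u x\<bar> ^ 6 + \<bar>\<phi> x\<bar> ^ 6)))"
      using h0D(8)[OF \<phi>] h0_power6(1)[OF u] h0_power6(1)[OF \<phi>] by simp
    show "(\<lambda>x. g (u x) * \<phi> x) \<in> borel_measurable lborel" "D k \<in> borel_measurable lborel" for k
      unfolding D_def[abs_def] by measurable
    show "AE x in lborel. (\<lambda>k. D k x) \<longlonglongrightarrow> g (u x) * \<phi> x"
    proof (rule AE_I2)
      fix x
      have "((\<lambda>s. G (u x + s * \<phi> x)) has_real_derivative g (u x + 0 * \<phi> x) * \<phi> x) (at 0)"
        by (rule DERIV_chain2[OF G_deriv]) (auto intro!: derivative_eq_intros)
      then have "((\<lambda>s. (G (u x + s * \<phi> x) - G (u x)) / s) \<longlongrightarrow> g (u x) * \<phi> x) (at 0)"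
        by (simp add: DERIV_def)
      moreover have "filterlim t (at 0) sequentially"
        unfolding filterlim_at using less_imp_neq[OF t(1)] t0 by auto
      ultimately show "(\<lambda>k. D k x) \<longlonglongrightarrow> g (u x) * \<phi> x" unfolding D_def by (rule filterlim_compose)
    qed
    show "AE x in lborel. norm (D k x) \<le> C * (\<bar>\<phi> x\<bar> + 128 * (\<bar>u x\<bar> ^ 6 + \<bar>\<phi> x\<bar> ^ 6))" for k
    proof (rule AE_I2)
      fix x
      define m where "m = \<bar>u x\<bar> + \<bar>\<phi> x\<bar>"
      have m: "0 \<le> m" "\<bar>\<phi> x\<bar> \<le> m" "\<bar>u x\<bar> \<le> m" by (auto simp: m_def)
      have "\<bar>t k * \<phi> x\<bar> \<le> 1 * \<bar>\<phi> x\<bar>" unfolding abs_mult using t[of k] by (intro mult_right_mono) auto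
      then have um: "\<bar>u x + t k * \<phi> x\<bar> \<le> m" unfolding m_def using abs_triangle_ineq[of "u x" "t k * \<phi> x"] by linarith
      have "\<bar>G (u x + t k * \<phi> x) - G (u x)\<bar> \<le> C * (1 + \<bar>u x + t k * \<phi> x\<bar> ^ 5 + \<bar>u x\<bar> ^ 5) * \<bar>(u x + t k * \<phi> x) - u x\<bar>" by (rule G_diff)
      also have "\<dots> \<le> C * (1 + m ^ 5 + m ^ 5) * (t k * \<bar>\<phi> x\<bar>)"
        using C_nonneg m um t[of k] by (intro mult_mono mult_left_mono add_mono power_mono) (auto simp: abs_mult)
      finally have "\<bar>D k x\<bar> \<le> C * (1 + m ^ 5 + m ^ 5) * \<bar>\<phi> x\<bar>"
        using t[of k] by (simp add: D_def abs_divide field_simps)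
      also have "\<dots> = C * (\<bar>\<phi> x\<bar> + 2 * (m ^ 5 * \<bar>\<phi> x\<bar>))" by (simp add: algebra_simps)
      also have "\<dots> \<le> C * (\<bar>\<phi> x\<bar> + 2 * (m ^ 5 * m))"
        using m C_nonneg by (intro mult_left_mono add_left_mono) auto
      also have "m ^ 5 * m = m ^ 6" by (simp add: eval_nat_numeral)
      also have "C * (\<bar>\<phi> x\<bar> + 2 * m ^ 6) \<le> C * (\<bar>\<phi> x\<bar> + 2 * (64 * (\<bar>u x\<bar> ^ 6 + \<bar>\<phi> x\<bar> ^ 6)))"
        unfolding m_def by (intro mult_left_mono add_left_mono power6_add_le C_nonneg) simp
      finally show "norm (D k x) \<le> C * (\<bar>\<phi> x\<bar> + 128 * (\<bar>u x\<bar> ^ 6 + \<bar>\<phi> x\<bar> ^ 6))" by simp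
    qed
  qed
  have bound: "(\<integral>x. D k x \<partial>lborel) \<le> (\<integral>x. U x \<bullet> \<Phi> x \<partial>lborel) + t k / 2 * (l2norm lborel \<Phi>)\<^sup>2" for k
  proof -
    have "(\<integral>x. D k x \<partial>lborel) = ((\<integral>x. G (u x + t k * \<phi> x) \<partial>lborel) - (\<integral>x. G (u x) \<partial>lborel)) / t k"
      unfolding D_def using E_perturb(2)[OF u \<phi> min] G_integrable[OF u] by simp
    also have "\<dots> \<le> (t k * (\<integral>x. U x \<bullet> \<Phi> x \<partial>lborel) + (t k)\<^sup>2 / 2 * (l2norm lborel \<Phi>)\<^sup>2) / t k"
      using E_perturb(1)[OF u \<phi> min] t[of k] by (intro divide_right_mono) auto
    also have "\<dots> = (\<integral>x. U x \<bullet> \<Phi> x \<partial>lborel) + t k / 2 * (l2norm lborel \<Phi>)\<^sup>2"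
      using t[of k] by (simp add: add_divide_distrib power2_eq_square)
    finally show ?thesis .
  qed
  have "(\<lambda>k. (\<integral>x. U x \<bullet> \<Phi> x \<partial>lborel) + t k / 2 * (l2norm lborel \<Phi>)\<^sup>2) \<longlonglongrightarrow> (\<integral>x. U x \<bullet> \<Phi> x \<partial>lborel) + 0 / 2 * (l2norm lborel \<Phi>)\<^sup>2"
    by (intro tendsto_intros t0) simp
  then show ?thesis using LIMSEQ_le[OF lim] bound by fastforce
qed

lemma euler_lagrange:
  assumes u: "h0 u U" and \<phi>: "h0 \<phi> \<Phi>" and min: "\<And>w W. h0 w W \<Longrightarrow> E u U \<le> E w W"
  shows "(\<integral>x. U x \<bullet> \<Phi> x \<partial>lborel) = (\<integral>x. g (u x) * \<phi> x \<partial>lborel)"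
proof (rule antisym)
  show "(\<integral>x. g (u x) * \<phi> x \<partial>lborel) \<le> (\<integral>x. U x \<bullet> \<Phi> x \<partial>lborel)" by (rule first_variation_le[OF u \<phi> min])
  have "h0 (\<lambda>x. - \<phi> x) (\<lambda>x. - \<Phi> x)" using h0_linear_comb[OF \<phi> \<phi>, of "-1" 0] by simp
  from first_variation_le[OF u this min] show "(\<integral>x. U x \<bullet> \<Phi> x \<partial>lborel) \<le> (\<integral>x. g (u x) * \<phi> x \<partial>lborel)" by simp
qed

text \<open>In \<open>\<tau>\<close>, the symmetric second difference minus \<open>L\<close> times
  the square of \<open>\<tau>\<close> vanishes at 0 up to the constant \<open>2 * G s\<close>, and
  the assumption says that its derivative is nonnegative. No second derivative of \<open>G\<close>
  is involved.\<close>

lemma second_difference_ge: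
  assumes "\<And>\<tau>. 0 \<le> \<tau> \<Longrightarrow> \<tau> \<le> \<bar>h\<bar> \<Longrightarrow> 2 * L * \<tau> \<le> g (s + \<tau>) - g (s - \<tau>)"
  shows "L * h\<^sup>2 \<le> G (s + h) + G (s - h) - 2 * G s"
proof -
  define k where "k \<tau> = G (s + \<tau>) + G (s - \<tau>) - L * \<tau>\<^sup>2" for \<tau>
  have "k 0 \<le> k \<bar>h\<bar>"
  proof (rule DERIV_nonneg_imp_nondecreasing[where f=k])
    show "\<exists>y. (k has_real_derivative y) (at \<tau>) \<and> 0 \<le> y" if "0 \<le> \<tau>" "\<tau> \<le> \<bar>h\<bar>" for \<tau>
    proof (intro exI conjI)
      have 1: "((\<lambda>\<tau>. G (s + \<tau>)) has_real_derivative g (s + \<tau>) * 1) (at \<tau>)"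
        by (rule DERIV_chain2[OF G_deriv]) (auto intro!: derivative_eq_intros)
      have 2: "((\<lambda>\<tau>. G (s - \<tau>)) has_real_derivative g (s - \<tau>) * - 1) (at \<tau>)"
        by (rule DERIV_chain2[OF G_deriv]) (auto intro!: derivative_eq_intros)
      have 3: "((\<lambda>\<tau>. L * \<tau>\<^sup>2) has_real_derivative L * (2 * \<tau>)) (at \<tau>)" by (auto intro!: derivative_eq_intros)
      show "(k has_real_derivative g (s + \<tau>) * 1 + g (s - \<tau>) * - 1 - L * (2 * \<tau>)) (at \<tau>)"
        unfolding k_def[abs_def] by (intro DERIV_diff DERIV_add 1 2 3)
      show "0 \<le> g (s + \<tau>) * 1 + g (s - \<tau>) * - 1 - L * (2 * \<tau>)" using assms[OF that] by (simp add: algebra_simps)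
    qed
  qed simp
  moreover have "k \<bar>h\<bar> = G (s + h) + G (s - h) - L * h\<^sup>2" by (cases "0 \<le> h") (simp_all add: k_def)
  ultimately show ?thesis by (simp add: k_def)
qed

lemma second_difference_bound: "- (C * (1 + 2 * (\<bar>s\<bar> + \<bar>h\<bar>) ^ 4)) * h\<^sup>2 \<le> G (s + h) + G (s - h) - 2 * G s"
proof (rule second_difference_ge)
  fix \<tau> :: real assume \<tau>: "0 \<le> \<tau>" "\<tau> \<le> \<bar>h\<bar>"
  define M where "M = C * (1 + 2 * (\<bar>s\<bar> + \<bar>h\<bar>) ^ 4)"
  show "2 * - M * \<tau> \<le> g (s + \<tau>) - g (s - \<tau>)"
  proof (cases "\<tau> = 0")
    case False
    then have t: "0 < \<tau>" using \<tau> by simp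
    have "C * (1 + \<bar>s + \<tau>\<bar> ^ 4 + \<bar>s - \<tau>\<bar> ^ 4) \<le> C * (1 + (\<bar>s\<bar> + \<bar>h\<bar>) ^ 4 + (\<bar>s\<bar> + \<bar>h\<bar>) ^ 4)"
      using \<tau> by (intro mult_left_mono C_nonneg add_mono power_mono) auto
    then have "C * (1 + \<bar>s + \<tau>\<bar> ^ 4 + \<bar>s - \<tau>\<bar> ^ 4) \<le> M" unfolding M_def mult_2 add.assoc .
    then have "C * (1 + \<bar>s + \<tau>\<bar> ^ 4 + \<bar>s - \<tau>\<bar> ^ 4) * (2 * \<tau>)\<^sup>2 \<le> M * (2 * \<tau>)\<^sup>2" by (rule mult_right_mono) simp
    moreover have "- (C * (1 + \<bar>s + \<tau>\<bar> ^ 4 + \<bar>s - \<tau>\<bar> ^ 4)) * (2 * \<tau>)\<^sup>2 \<le> (g (s + \<tau>) - g (s - \<tau>)) * (2 * \<tau>)"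
    proof -
      have "s + \<tau> - (s - \<tau>) = 2 * \<tau>" by simp
      then show ?thesis using one_sided[of "s + \<tau>" "s - \<tau>"] by (simp only:)
    qed
    ultimately have "(2 * - M * \<tau>) * (2 * \<tau>) \<le> (g (s + \<tau>) - g (s - \<tau>)) * (2 * \<tau>)" by (simp add: power2_eq_square algebra_simps)
    then show ?thesis by (rule mult_right_le_imp_le) (use t in simp)
  qed simp
qed

text \<open>The lower limit controls difference quotients at rational increments only; continuity of
  \<open>g\<close> extends the inequality to real ones. Halving the radius accounts for the distance
  in the plane, which is at most \<open>\<bar>a\<bar> + \<bar>b\<bar>\<close>.\<close>

lemma lower_deriv_local:
  assumes L: "ereal L < lower_deriv g s"
  obtains d where "0 < d" "\<And>a b. \<bar>a\<bar> < d \<Longrightarrow> \<bar>b\<bar> < d \<Longrightarrow> b < a \<Longrightarrow> L * (a - b) \<le> g (s + a) - g (s + b)"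
proof -
  let ?S = "{(t, \<tau>). t \<in> \<rat> \<and> \<tau> \<in> \<rat> \<and> t \<noteq> \<tau>} :: (real \<times> real) set"
  have "\<forall>\<^sub>F p in at (0, 0) within ?S. ereal L < (\<lambda>(t, \<tau>). ereal ((g (s + t) - g (s + \<tau>)) / (t - \<tau>))) p"
    using L unfolding lower_deriv_def by (rule less_LiminfD)
  then obtain d where d: "0 < d" "\<And>p. p \<in> ?S \<Longrightarrow> p \<noteq> (0, 0) \<Longrightarrow> dist p (0, 0) < d \<Longrightarrow> ereal L < (\<lambda>(t, \<tau>). ereal ((g (s + t) - g (s + \<tau>)) / (t - \<tau>))) p"
    unfolding eventually_at by blast
  have rat: "L * (a - b) \<le> g (s + a) - g (s + b)" if "a \<in> \<rat>" "b \<in> \<rat>" "\<bar>a\<bar> < d / 2" "\<bar>b\<bar> < d / 2" "b < a" for a b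
  proof -
    have "dist (a, b) (0, 0) \<le> \<bar>a\<bar> + \<bar>b\<bar>" using sqrt_sum_squares_le_sum_abs[of a b] by (simp add: dist_Pair_Pair)
    then have "dist (a, b) (0, 0) < d" using that by linarith
    then have "L < (g (s + a) - g (s + b)) / (a - b)" using d(2)[of "(a, b)"] that by auto
    then show ?thesis using that by (simp add: pos_less_divide_eq less_imp_le)
  qed
  have approx: "\<exists>q. (\<forall>k. q k \<in> \<rat> \<and> a < q k) \<and> q \<longlonglongrightarrow> a" for a :: real
  proof -
    have "\<exists>q. q \<in> \<rat> \<and> a < q \<and> q < a + 1 / real (Suc k)" for k using Rats_dense_in_real[of a "a + 1 / real (Suc k)"] by auto
    then obtain q where q: "\<And>k. q k \<in> \<rat> \<and> a < q k \<and> q k < a + 1 / real (Suc k)" by metis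
    have "(\<lambda>k. a + 1 / real (Suc k)) \<longlonglongrightarrow> a"
      using tendsto_add[OF tendsto_const[of a] LIMSEQ_inverse_real_of_nat] by (simp add: inverse_eq_divide)
    then have "q \<longlonglongrightarrow> a"
      by (rule tendsto_sandwich[OF _ _ tendsto_const, rotated 2]) (use q in \<open>auto intro!: always_eventually less_imp_le\<close>)
    then show ?thesis using q by blast
  qed
  show thesis
  proof (rule that[of "d / 2"])
    fix a b :: real assume ab: "\<bar>a\<bar> < d / 2" "\<bar>b\<bar> < d / 2" "b < a"
    obtain q where q: "\<And>k. q k \<in> \<rat>" "q \<longlonglongrightarrow> a" using approx[of a] by blast
    obtain p where p: "\<And>k. p k \<in> \<rat>" "p \<longlonglongrightarrow> b" using approx[of b] by blast
    have cg: "(\<lambda>k. g (s + f k)) \<longlonglongrightarrow> g (s + x)" if "f \<longlonglongrightarrow> x" for f x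
      by (rule continuous_on_tendsto_compose[OF cont]) (auto intro: tendsto_intros that)
    have "\<forall>\<^sub>F k in sequentially. \<bar>q k\<bar> < d / 2" "\<forall>\<^sub>F k in sequentially. \<bar>p k\<bar> < d / 2" "\<forall>\<^sub>F k in sequentially. 0 < q k - p k"
      using order_tendstoD(2)[OF tendsto_rabs[OF q(2)] ab(1)] order_tendstoD(2)[OF tendsto_rabs[OF p(2)] ab(2)]
        order_tendstoD(1)[OF tendsto_diff[OF q(2) p(2)], of 0] ab(3) by auto
    then have "\<forall>\<^sub>F k in sequentially. L * (q k - p k) \<le> g (s + q k) - g (s + p k)"
      by eventually_elim (intro rat q p; simp)
    then show "L * (a - b) \<le> g (s + a) - g (s + b)"
      by (intro tendsto_le[OF _ tendsto_diff[OF cg[OF q(2)] cg[OF p(2)]] tendsto_mult_left[OF tendsto_diff[OF q(2) p(2)]]]) auto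
  qed (use d in simp)
qed

text \<open>\<open>one_sided\<close> divided by the squared increment, for increments below 1. It
  excludes the value minus infinity and makes the negative part integrable in the second
  variation.\<close>

lemma lower_deriv_ge: "ereal (- (C * (1 + 2 * (\<bar>s\<bar> + 1) ^ 4))) \<le> lower_deriv g s"
  unfolding lower_deriv_def
proof (rule Liminf_bounded)
  let ?S = "{(t, \<tau>). t \<in> \<rat> \<and> \<tau> \<in> \<rat> \<and> t \<noteq> \<tau>} :: (real \<times> real) set"
  show "\<forall>\<^sub>F p in at (0, 0) within ?S. ereal (- (C * (1 + 2 * (\<bar>s\<bar> + 1) ^ 4))) \<le> (\<lambda>(t, \<tau>). ereal ((g (s + t) - g (s + \<tau>)) / (t - \<tau>))) p"
    unfolding eventually_at
  proof (intro exI[of _ 1] conjI ballI impI)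
    fix p assume p: "p \<in> ?S" "p \<noteq> (0, 0) \<and> dist p (0, 0) < 1"
    obtain a b where ab: "p = (a, b)" "a \<noteq> b" using p(1) by auto
    have "\<bar>a\<bar> \<le> dist p (0, 0)" "\<bar>b\<bar> \<le> dist p (0, 0)"
      using dist_fst_le[of p "(0, 0)"] dist_snd_le[of p "(0, 0)"] by (simp_all add: ab)
    then have a1: "\<bar>a\<bar> < 1" "\<bar>b\<bar> < 1" using p(2) by linarith+
    define M where "M = C * (1 + 2 * (\<bar>s\<bar> + 1) ^ 4)"
    have "C * (1 + \<bar>s + a\<bar> ^ 4 + \<bar>s + b\<bar> ^ 4) \<le> C * (1 + (\<bar>s\<bar> + 1) ^ 4 + (\<bar>s\<bar> + 1) ^ 4)"
      using a1 by (intro mult_left_mono C_nonneg add_mono power_mono) auto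
    then have "C * (1 + \<bar>s + a\<bar> ^ 4 + \<bar>s + b\<bar> ^ 4) \<le> M" unfolding M_def mult_2 add.assoc .
    then have "C * (1 + \<bar>s + a\<bar> ^ 4 + \<bar>s + b\<bar> ^ 4) * (a - b)\<^sup>2 \<le> M * (a - b)\<^sup>2" by (rule mult_right_mono) simp
    moreover have "- (C * (1 + \<bar>s + a\<bar> ^ 4 + \<bar>s + b\<bar> ^ 4)) * (a - b)\<^sup>2 \<le> (g (s + a) - g (s + b)) * (a - b)"
      using one_sided[of "s + a" "s + b"] by simp
    ultimately have "- M * (a - b)\<^sup>2 \<le> (g (s + a) - g (s + b)) * (a - b)" by simp
    also have "(g (s + a) - g (s + b)) * (a - b) = (g (s + a) - g (s + b)) / (a - b) * (a - b)\<^sup>2"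
      using ab(2) by (simp add: power2_eq_square)
    finally have "- M \<le> (g (s + a) - g (s + b)) / (a - b)"
      by (rule mult_right_le_imp_le) (use ab(2) in simp)
    then show "ereal (- (C * (1 + 2 * (\<bar>s\<bar> + 1) ^ 4))) \<le> (\<lambda>(t, \<tau>). ereal ((g (s + t) - g (s + \<tau>)) / (t - \<tau>))) p"
      by (simp add: ab M_def)
  qed simp
qed

text \<open>Restricting the increments to rationals turns the lower limit into a countable supremum
  of countable infima of continuous functions of \<open>s\<close>.\<close>

lemma lower_deriv_measurable [measurable]: "lower_deriv g \<in> borel_measurable borel"
proof -
  let ?S = "{(t, \<tau>). t \<in> \<rat> \<and> \<tau> \<in> \<rat> \<and> t \<noteq> \<tau>} :: (real \<times> real) set"
  define S where "S k = {p\<in>?S. p \<noteq> (0, 0) \<and> dist p (0, 0) < 1 / real (Suc k)}" for k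
  define q where "q s p = ereal ((g (s + fst p) - g (s + snd p)) / (fst p - snd p))" for s p
  have qe: "(\<lambda>(t, \<tau>). ereal ((g (s + t) - g (s + \<tau>)) / (t - \<tau>))) = q s" for s by (auto simp: q_def)
  have eq: "lower_deriv g s = (SUP k. INF p\<in>S k. q s p)" for s
  proof (rule antisym)
    show "(SUP k. INF p\<in>S k. q s p) \<le> lower_deriv g s"
      unfolding lower_deriv_def qe
    proof (intro SUP_least Liminf_bounded)
      fix k
      show "\<forall>\<^sub>F p in at (0, 0) within ?S. (INF p\<in>S k. q s p) \<le> q s p"
        unfolding eventually_at by (intro exI[of _ "1 / real (Suc k)"]) (auto simp: S_def intro!: INF_lower)
    qed
    show "lower_deriv g s \<le> (SUP k. INF p\<in>S k. q s p)"
    proof (rule dense_le)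
      fix y assume "y < lower_deriv g s"
      then have "\<forall>\<^sub>F p in at (0, 0) within ?S. y < q s p" unfolding lower_deriv_def qe by (rule less_LiminfD)
      then obtain d where d: "0 < d" "\<And>p. p \<in> ?S \<Longrightarrow> p \<noteq> (0, 0) \<Longrightarrow> dist p (0, 0) < d \<Longrightarrow> y < q s p"
        unfolding eventually_at by blast
      obtain k where k: "1 / real (Suc k) < d" using nat_approx_posE[OF d(1)] by auto
      have "y \<le> (INF p\<in>S k. q s p)" by (rule INF_greatest) (use d(2) k in \<open>auto simp: S_def intro!: less_imp_le\<close>)
      also have "\<dots> \<le> (SUP k. INF p\<in>S k. q s p)" by (rule SUP_upper) simp
      finally show "y \<le> (SUP k. INF p\<in>S k. q s p)" .
    qed
  qed
  have "countable (S k)" for k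
  proof (rule countable_subset)
    show "S k \<subseteq> \<rat> \<times> \<rat>" by (auto simp: S_def)
  qed (intro countable_SIGMA countable_rat)
  then have "(\<lambda>s. SUP k. INF p\<in>S k. q s p) \<in> borel_measurable borel"
    by (intro borel_measurable_SUP borel_measurable_INF) (auto simp: q_def)
  moreover have "lower_deriv g = (\<lambda>s. SUP k. INF p\<in>S k. q s p)" by (rule ext) (rule eq)
  ultimately show ?thesis by simp
qed

end

context nonlinearity
begin

text \<open>One minorant \<open>- H\<close>, integrable when \<open>s\<close> and \<open>h\<close>
  are values of functions in \<open>h0\<close>, serves for the limit and for all difference
  quotients. Here 33 is 1 plus 2 times 16, and 2048 is 2 times 16 times 64, from expanding
  \<open>(\<bar>s\<bar> + 1) ^ 4\<close> and from \<open>power6_add_le\<close>.\<close>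

lemma second_variation_pointwise:
  fixes s h :: real
  defines "H \<equiv> C * (33 * h\<^sup>2 + 2048 * (\<bar>s\<bar> ^ 6 + \<bar>h\<bar> ^ 6))"
  shows "ereal (- H) \<le> lower_deriv g s * ereal (h\<^sup>2)"
    and "0 < t \<Longrightarrow> t \<le> 1 \<Longrightarrow> - H \<le> (G (s + t * h) + G (s - t * h) - 2 * G s) / t\<^sup>2"
proof -
  define m where "m = \<bar>s\<bar> + \<bar>h\<bar>"
  have m: "0 \<le> m" "\<bar>h\<bar> \<le> m" "\<bar>s\<bar> \<le> m" by (auto simp: m_def)
  have m6: "m ^ 6 \<le> 64 * (\<bar>s\<bar> ^ 6 + \<bar>h\<bar> ^ 6)" unfolding m_def by (rule power6_add_le)
  have "m ^ 4 * h\<^sup>2 \<le> m ^ 4 * m\<^sup>2" using m by (intro mult_left_mono) (auto simp: abs_le_square_iff[symmetric])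
  also have "m ^ 4 * m\<^sup>2 = m ^ 6" by (simp flip: power_add)
  finally have m4: "m ^ 4 * h\<^sup>2 \<le> m ^ 6" .
  have h0: "0 \<le> h\<^sup>2" by simp
  have s0: "0 \<le> \<bar>s\<bar> ^ 6 + \<bar>h\<bar> ^ 6" by simp
  have "(\<bar>s\<bar> + 1) ^ 4 \<le> (2 * max \<bar>s\<bar> 1) ^ 4" by (rule power_mono) auto
  also have "\<dots> = 16 * (max \<bar>s\<bar> 1) ^ 4" by (simp add: power_mult_distrib)
  also have "(max \<bar>s\<bar> 1) ^ 4 \<le> \<bar>s\<bar> ^ 4 + 1" by (simp add: max_def)
  also have "\<bar>s\<bar> ^ 4 \<le> m ^ 4" using m by (intro power_mono) auto
  finally have "(\<bar>s\<bar> + 1) ^ 4 \<le> 16 * (m ^ 4 + 1)" by simp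
  then have "(\<bar>s\<bar> + 1) ^ 4 * h\<^sup>2 \<le> 16 * (m ^ 4 + 1) * h\<^sup>2" by (rule mult_right_mono) simp
  also have "\<dots> = 16 * (m ^ 4 * h\<^sup>2) + 16 * h\<^sup>2" by (simp add: algebra_simps)
  finally have s4: "(\<bar>s\<bar> + 1) ^ 4 * h\<^sup>2 \<le> 16 * (m ^ 4 * h\<^sup>2) + 16 * h\<^sup>2" .
  have "(1 + 2 * (\<bar>s\<bar> + 1) ^ 4) * h\<^sup>2 = h\<^sup>2 + 2 * ((\<bar>s\<bar> + 1) ^ 4 * h\<^sup>2)" by (simp add: algebra_simps)
  also have "\<dots> \<le> 33 * h\<^sup>2 + 2048 * (\<bar>s\<bar> ^ 6 + \<bar>h\<bar> ^ 6)" using s4 m4 m6 by argo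
  finally have "C * ((1 + 2 * (\<bar>s\<bar> + 1) ^ 4) * h\<^sup>2) \<le> H" unfolding H_def by (rule mult_left_mono[OF _ C_nonneg])
  then have "ereal (- H) \<le> ereal (- (C * (1 + 2 * (\<bar>s\<bar> + 1) ^ 4))) * ereal (h\<^sup>2)" by (simp add: mult.assoc)
  also have "\<dots> \<le> lower_deriv g s * ereal (h\<^sup>2)" by (rule ereal_mult_right_mono[OF lower_deriv_ge]) simp
  finally show "ereal (- H) \<le> lower_deriv g s * ereal (h\<^sup>2)" .
  have "(1 + 2 * m ^ 4) * h\<^sup>2 = h\<^sup>2 + 2 * (m ^ 4 * h\<^sup>2)" by (simp add: algebra_simps)
  also have "\<dots> \<le> 33 * h\<^sup>2 + 2048 * (\<bar>s\<bar> ^ 6 + \<bar>h\<bar> ^ 6)" using m4 m6 h0 s0 by argo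
  finally have mH: "C * ((1 + 2 * m ^ 4) * h\<^sup>2) \<le> H" unfolding H_def by (rule mult_left_mono[OF _ C_nonneg])
  show "- H \<le> (G (s + t * h) + G (s - t * h) - 2 * G s) / t\<^sup>2" if t: "0 < t" "t \<le> 1"
  proof -
    have "t * \<bar>h\<bar> \<le> 1 * \<bar>h\<bar>" using t by (intro mult_right_mono) auto
    then have "\<bar>s\<bar> + \<bar>t * h\<bar> \<le> m" using t by (simp add: m_def abs_mult)
    then have "C * (1 + 2 * (\<bar>s\<bar> + \<bar>t * h\<bar>) ^ 4) * (t * h)\<^sup>2 \<le> C * (1 + 2 * m ^ 4) * (t * h)\<^sup>2"
      by (intro mult_right_mono mult_left_mono add_left_mono power_mono C_nonneg) auto
    also have "\<dots> = C * ((1 + 2 * m ^ 4) * h\<^sup>2) * t\<^sup>2" by (simp add: power_mult_distrib mult_ac)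
    also have "\<dots> \<le> H * t\<^sup>2" by (rule mult_right_mono[OF mH]) simp
    finally have "- H * t\<^sup>2 \<le> - (C * (1 + 2 * (\<bar>s\<bar> + \<bar>t * h\<bar>) ^ 4)) * (t * h)\<^sup>2" by simp
    also have "\<dots> \<le> G (s + t * h) + G (s - t * h) - 2 * G s" by (rule second_difference_bound)
    finally show ?thesis using t by (subst pos_le_divide_eq) simp_all
  qed
qed

text \<open>The pointwise inequality behind Fatou's lemma, stated with strict lower bounds
  \<open>r\<close> so that an infinite lower derivative is covered as well. A number
  \<open>L\<close> between \<open>r / h\<^sup>2\<close> and the lower derivative bounds
  \<open>g\<close> near \<open>s\<close> as in \<open>second_difference_ge\<close>.\<close>

lemma second_difference_liminf:
  assumes r: "ereal r < lower_deriv g s * ereal (h\<^sup>2)" and t0: "t \<longlonglongrightarrow> 0" and t: "\<And>n. 0 < t n"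
  shows "\<forall>\<^sub>F n in sequentially. r < (G (s + t n * h) + G (s - t n * h) - 2 * G s) / (t n)\<^sup>2"
proof (cases "h = 0")
  case True
  \<comment> \<open>In \<open>ereal\<close> the product of infinity and 0 is 0, so
    \<open>r < 0\<close>, while all second differences vanish.\<close>
  then show ?thesis using r by (simp flip: zero_ereal_def)
next
  case False
  then have h: "0 < h\<^sup>2" by simp
  have "ereal (r / h\<^sup>2) < lower_deriv g s"
  proof (cases "lower_deriv g s")
    case (real l)
    then show ?thesis using r h by (simp add: pos_divide_less_eq)
  qed (use r h in auto)
  then obtain L where L: "r / h\<^sup>2 < L" "ereal L < lower_deriv g s" using ereal_dense2[of "ereal (r / h\<^sup>2)" "lower_deriv g s"] by auto
  obtain d where d: "0 < d" "\<And>a b. \<bar>a\<bar> < d \<Longrightarrow> \<bar>b\<bar> < d \<Longrightarrow> b < a \<Longrightarrow> L * (a - b) \<le> g (s + a) - g (s + b)"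
    by (rule lower_deriv_local[OF L(2)]) (rule that)
  have "(\<lambda>n. t n * \<bar>h\<bar>) \<longlonglongrightarrow> 0 * \<bar>h\<bar>" by (intro tendsto_intros t0)
  then have "\<forall>\<^sub>F n in sequentially. t n * \<bar>h\<bar> < d" using d(1) by (intro order_tendstoD(2)) auto
  then show ?thesis
  proof eventually_elim
    case (elim n)
    have "L * (t n * h)\<^sup>2 \<le> G (s + t n * h) + G (s - t n * h) - 2 * G s"
    proof (rule second_difference_ge)
      fix \<tau> :: real assume \<tau>: "0 \<le> \<tau>" "\<tau> \<le> \<bar>t n * h\<bar>"
      then have "\<tau> < d" using elim t[of n] by (simp add: abs_mult)
      then show "2 * L * \<tau> \<le> g (s + \<tau>) - g (s - \<tau>)"
        using d(2)[of \<tau> "- \<tau>"] \<tau>(1) by (cases "\<tau> = 0") (auto simp: algebra_simps)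
    qed
    then have "L * h\<^sup>2 \<le> (G (s + t n * h) + G (s - t n * h) - 2 * G s) / (t n)\<^sup>2"
      using t[of n] by (subst pos_le_divide_eq) (simp_all add: power_mult_distrib mult_ac)
    moreover have "r < L * h\<^sup>2" using L(1) h by (simp add: pos_divide_less_eq)
    ultimately show ?case by simp
  qed
qed

text \<open>Minimality at \<open>t\<close> and \<open>- t\<close> bounds the integrals of the second
  difference quotients \<open>Q n\<close> by \<open>k\<close>, the first-order terms cancelling.
  Fatou's lemma for the nonnegative functions \<open>Q n + H\<close> transfers the bound to
  \<open>F + H\<close>, and the integral of \<open>H\<close> is removed again at the end.\<close>

lemma second_variation:
  assumes u: "h0 u U" and \<phi>: "h0 \<phi> \<Phi>" and min: "\<And>w W. h0 w W \<Longrightarrow> E u U \<le> E w W"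
  shows "0 \<le> ereal ((l2norm lborel \<Phi>)\<^sup>2) - ext_integral lborel (\<lambda>x. lower_deriv g (u x) * ereal ((\<phi> x)\<^sup>2))"
proof -
  define t where "t k = 1 / real (Suc k)" for k
  have t: "0 < t k" "t k \<le> 1" for k by (auto simp: t_def)
  have t0: "t \<longlonglongrightarrow> 0" using LIMSEQ_inverse_real_of_nat unfolding t_def[abs_def] inverse_eq_divide .
  have [measurable]: "u \<in> borel_measurable borel" "\<phi> \<in> borel_measurable borel" by (rule h0D[OF u] h0D[OF \<phi>])+
  define F where "F x = lower_deriv g (u x) * ereal ((\<phi> x)\<^sup>2)" for x
  define H where "H x = C * (33 * (\<phi> x)\<^sup>2 + 2048 * (\<bar>u x\<bar> ^ 6 + \<bar>\<phi> x\<bar> ^ 6))" for x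
  define Q where "Q n x = (G (u x + t n * \<phi> x) + G (u x - t n * \<phi> x) - 2 * G (u x)) / (t n)\<^sup>2" for n x
  define k where "k = (l2norm lborel \<Phi>)\<^sup>2"
  define a where "a = (\<integral>x. H x \<partial>lborel)"
  have [measurable]: "F \<in> borel_measurable borel" "H \<in> borel_measurable borel" "Q n \<in> borel_measurable borel" for n
    unfolding F_def[abs_def] H_def[abs_def] Q_def[abs_def] by measurable
  have FH: "ereal (- H x) \<le> F x" for x unfolding F_def H_def by (rule second_variation_pointwise(1))
  have QH: "- H x \<le> Q n x" for n x unfolding Q_def H_def by (rule second_variation_pointwise(2)[OF t])
  have H0: "0 \<le> H x" for x unfolding H_def by (simp add: C_nonneg)
  have Hi: "integrable lborel H"
    unfolding H_def[abs_def] using square_integrable_norm2[OF h0D(4)[OF \<phi>]] h0_power6(1)[OF u] h0_power6(1)[OF \<phi>] by simp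
  have a0: "0 \<le> a" unfolding a_def by (rule Bochner_Integration.integral_nonneg) (rule H0)
  have HN: "(\<integral>\<^sup>+x. ennreal (H x) \<partial>lborel) = ennreal a"
    unfolding a_def by (rule nn_integral_eq_integral[OF Hi]) (simp add: H0)
  have Gi: "integrable lborel (\<lambda>x. G (u x + t n * \<phi> x))" "integrable lborel (\<lambda>x. G (u x - t n * \<phi> x))" for n
    using E_perturb(2)[OF u \<phi> min, of "t n"] E_perturb(2)[OF u \<phi> min, of "- t n"] by simp_all
  have Qi: "integrable lborel (Q n)" for n
    unfolding Q_def[abs_def] using Gi[of n] G_integrable[OF u] by simp
  have "(\<integral>x. Q n x \<partial>lborel) \<le> k" for n
  proof -
    have "(\<integral>x. Q n x \<partial>lborel) = ((\<integral>x. G (u x + t n * \<phi> x) \<partial>lborel) + (\<integral>x. G (u x - t n * \<phi> x) \<partial>lborel) - 2 * (\<integral>x. G (u x) \<partial>lborel)) / (t n)\<^sup>2"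
      unfolding Q_def using Gi[of n] G_integrable[OF u] by simp
    also have "\<dots> \<le> k"
      using E_perturb(1)[OF u \<phi> min, of "t n"] E_perturb(1)[OF u \<phi> min, of "- t n"] t[of n]
      by (subst pos_divide_le_eq) (simp_all add: k_def mult.commute)
    finally show ?thesis .
  qed
  then have QN: "(\<integral>\<^sup>+x. ennreal (Q n x + H x) \<partial>lborel) \<le> ennreal (k + a)" for n
  proof (subst nn_integral_eq_integral)
    show "AE x in lborel. 0 \<le> Q n x + H x" using QH by (auto intro!: AE_I2 simp: diff_le_eq[of 0, simplified])
  qed (use Qi[of n] Hi \<open>\<And>n. (\<integral>x. Q n x \<partial>lborel) \<le> k\<close> in \<open>auto simp: a_def intro!: ennreal_leI\<close>)
  \<comment> \<open>Tested with numbers \<open>y\<close> strictly below the left-hand side; such a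
    \<open>y\<close> is finite even where \<open>F x\<close> is infinite.\<close>
  have lim: "e2ennreal (F x + ereal (H x)) \<le> liminf (\<lambda>n. ennreal (Q n x + H x))" for x
    unfolding le_Liminf_iff
  proof (intro allI impI)
    fix y assume y: "y < e2ennreal (F x + ereal (H x))"
    then have "y \<noteq> top" by auto
    then obtain r where r: "y = ennreal r" "0 \<le> r" by (cases y) auto
    have "ereal r < F x + ereal (H x)"
    proof (rule ccontr)
      assume "\<not> ereal r < F x + ereal (H x)"
      then have "e2ennreal (F x + ereal (H x)) \<le> e2ennreal (ereal r)" by (intro e2ennreal_mono) simp
      then show False using y r by simp
    qed
    then have "ereal (r - H x) < F x" by (cases "F x") auto
    from second_difference_liminf[OF this[unfolded F_def] t0 t(1)]
    show "\<forall>\<^sub>F n in sequentially. y < ennreal (Q n x + H x)"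
      by eventually_elim (use r in \<open>auto simp: Q_def ennreal_less_iff\<close>)
  qed
  have "(\<integral>\<^sup>+x. e2ennreal (F x + ereal (H x)) \<partial>lborel) \<le> (\<integral>\<^sup>+x. liminf (\<lambda>n. ennreal (Q n x + H x)) \<partial>lborel)"
    by (rule nn_integral_mono) (rule lim)
  also have "\<dots> \<le> liminf (\<lambda>n. \<integral>\<^sup>+x. ennreal (Q n x + H x) \<partial>lborel)" by (rule nn_integral_liminf) measurable
  also have "\<dots> \<le> ennreal (k + a)" by (rule Liminf_le) (simp_all add: QN)
  finally have FA: "(\<integral>\<^sup>+x. e2ennreal (F x + ereal (H x)) \<partial>lborel) \<le> ennreal (k + a)" .
  \<comment> \<open>Positive part plus \<open>H\<close> equals \<open>F + H\<close> plus negative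
    part. In this additive form nothing infinite is subtracted; only the negative part, dominated by
    \<open>H\<close>, has to be finite a priori.\<close>
  have split: "e2ennreal (F x) + ennreal (H x) = e2ennreal (F x + ereal (H x)) + e2ennreal (- F x)" for x
  proof (cases "F x")
    case (real f)
    then have "- H x \<le> f" using FH[of x] by simp
    then show ?thesis using real H0[of x]
      by (cases "0 \<le> f") (auto simp: ennreal_neg simp flip: ennreal_plus)
  next
    case PInf then show ?thesis by simp
  next
    case MInf then show ?thesis using FH[of x] by simp
  qed
  have e2m: "(\<lambda>x. e2ennreal (f x)) \<in> borel_measurable lborel" if "f \<in> borel_measurable borel" for f :: "real^3 \<Rightarrow> ereal"
    using that by measurable
  have "(\<integral>\<^sup>+x. e2ennreal (F x) \<partial>lborel) + ennreal a = (\<integral>\<^sup>+x. e2ennreal (F x) + ennreal (H x) \<partial>lborel)"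
    by (subst nn_integral_add) (simp_all add: HN e2m)
  also have "\<dots> = (\<integral>\<^sup>+x. e2ennreal (F x + ereal (H x)) \<partial>lborel) + (\<integral>\<^sup>+x. e2ennreal (- F x) \<partial>lborel)"
    unfolding split by (rule nn_integral_add) (simp_all add: e2m)
  finally have sum: "(\<integral>\<^sup>+x. e2ennreal (F x) \<partial>lborel) + ennreal a \<le> ennreal (k + a) + (\<integral>\<^sup>+x. e2ennreal (- F x) \<partial>lborel)"
    using FA by (simp add: add_right_mono)
  have "(\<integral>\<^sup>+x. e2ennreal (- F x) \<partial>lborel) \<le> (\<integral>\<^sup>+x. ennreal (H x) \<partial>lborel)"
  proof (rule nn_integral_mono)
    fix x
    have "- F x \<le> ereal (H x)" using FH[of x] by (cases "F x") auto
    then show "e2ennreal (- F x) \<le> ennreal (H x)" using e2ennreal_mono by fastforce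
  qed
  then have "(\<integral>\<^sup>+x. e2ennreal (- F x) \<partial>lborel) \<noteq> top" unfolding HN by (metis ennreal_neq_top neq_top_trans)
  then obtain n where n: "(\<integral>\<^sup>+x. e2ennreal (- F x) \<partial>lborel) = ennreal n" "0 \<le> n" by (cases "\<integral>\<^sup>+x. e2ennreal (- F x) \<partial>lborel") auto
  have k0: "0 \<le> k" by (simp add: k_def)
  have "(\<integral>\<^sup>+x. e2ennreal (F x) \<partial>lborel) + ennreal a \<le> ennreal (k + a + n)" using sum n k0 a0 by (simp add: ennreal_plus)
  moreover then obtain p where p: "(\<integral>\<^sup>+x. e2ennreal (F x) \<partial>lborel) = ennreal p" "0 \<le> p"
    by (cases "\<integral>\<^sup>+x. e2ennreal (F x) \<partial>lborel") (auto simp: top_unique)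
  ultimately have "p + a \<le> k + a + n" using a0 k0 n by (simp add: ennreal_plus[symmetric] del: ennreal_plus)
  then show ?thesis
    unfolding ext_integral_def F_def[symmetric] k_def[symmetric] using n p by simp
qed

end

section \<open>Borel representatives of functions on the unit ball\<close>

text \<open>\<open>u'\<close> is a Borel representative on the whole space of the extension of \<open>u\<close> by zero.\<close>

definition represents :: "(real^3 \<Rightarrow> 'b::euclidean_space) \<Rightarrow> (real^3 \<Rightarrow> 'b) \<Rightarrow> bool" where
  "represents u' u \<longleftrightarrow> u' \<in> borel_measurable borel \<and> (AE x in lborel. (if x \<in> \<Omega>1 then u x else 0) = u' x)"

lemma \<Omega>1_borel [measurable]: "\<Omega>1 \<in> sets borel"
  by (simp add: \<Omega>1_def)

lemma \<Omega>1_lebesgue: "\<Omega>1 \<in> sets lebesgue" "\<Omega>1 \<inter> space lebesgue \<in> sets lebesgue"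
  using \<Omega>1_borel by auto

lemma representsD:
  assumes "represents u' u"
  shows "u' \<in> borel_measurable borel" "u \<in> borel_measurable (lebesgue_on \<Omega>1)"
    and "AE x in lborel. (if x \<in> \<Omega>1 then u x else 0) = u' x" "AE x in lborel. x \<in> \<Omega>1 \<longrightarrow> u x = u' x" "AE x in lborel. x \<notin> \<Omega>1 \<longrightarrow> u' x = 0"
proof -
  show m: "u' \<in> borel_measurable borel" and ae: "AE x in lborel. (if x \<in> \<Omega>1 then u x else 0) = u' x"
    using assms by (auto simp: represents_def)
  show "AE x in lborel. x \<in> \<Omega>1 \<longrightarrow> u x = u' x" "AE x in lborel. x \<notin> \<Omega>1 \<longrightarrow> u' x = 0"
    using ae by (auto elim!: AE_mp)
  have "(\<lambda>x. if x \<in> \<Omega>1 then u x else 0) \<in> borel_measurable lebesgue"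
  proof (rule borel_measurable_AE)
    show "u' \<in> borel_measurable lebesgue" using m by (intro measurable_completion) simp
    have "AE x in lborel. u' x = (if x \<in> \<Omega>1 then u x else 0)" using ae by eventually_elim (rule sym)
    then show "AE x in lebesgue. u' x = (if x \<in> \<Omega>1 then u x else 0)" by (rule AE_completion)
  qed
  then show "u \<in> borel_measurable (lebesgue_on \<Omega>1)" by (rule borel_measurable_if_D)
qed

lemma represents_exists:
  fixes u :: "real^3 \<Rightarrow> 'b::euclidean_space"
  assumes "u \<in> borel_measurable (lebesgue_on \<Omega>1)"
  obtains u' where "represents u' u"
proof -
  define f where "f x = (if x \<in> \<Omega>1 then u x else 0)" for x
  have f: "f \<in> borel_measurable lebesgue"
    unfolding f_def[abs_def] by (rule borel_measurable_if_I[OF assms \<Omega>1_lebesgue(1)])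
  have "\<exists>v\<in>borel_measurable lborel. AE x in lborel. f x \<bullet> b = v x" for b
    by (rule completion_ex_borel_measurable_real) (use f in measurable)
  then obtain v where v: "\<And>b. v b \<in> borel_measurable lborel" "\<And>b. AE x in lborel. f x \<bullet> b = v b x" by metis
  show thesis
  proof (rule that)
    show "represents (\<lambda>x. \<Sum>b\<in>Basis. v b x *\<^sub>R b) u"
      unfolding represents_def f_def[symmetric]
    proof
      show "(\<lambda>x. \<Sum>b\<in>Basis. v b x *\<^sub>R b) \<in> borel_measurable borel" using v(1) by simp
      have "AE x in lborel. \<forall>b\<in>Basis. f x \<bullet> b = v b x" using v(2) by (subst AE_finite_all) auto
      then show "AE x in lborel. f x = (\<Sum>b\<in>Basis. v b x *\<^sub>R b)"
      proof eventually_elim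
        case (elim x)
        have "(\<Sum>b\<in>Basis. v b x *\<^sub>R b) = (\<Sum>b\<in>Basis. (f x \<bullet> b) *\<^sub>R b)" by (rule sum.cong) (use elim in auto)
        then show ?case by (simp add: euclidean_representation)
      qed
    qed
  qed
qed

lemma represents_self:
  "u \<in> borel_measurable borel \<Longrightarrow> AE x in lborel. x \<notin> \<Omega>1 \<longrightarrow> u x = 0 \<Longrightarrow> represents u u"
  unfolding represents_def by (auto elim: AE_mp)

lemma represents_cong_AE:
  assumes "represents u' u" "AE x in lborel. u' x = w x" "w \<in> borel_measurable borel"
  shows "represents w u"
proof -
  have "AE x in lborel. (if x \<in> \<Omega>1 then u x else 0) = w x"
    using representsD(3)[OF assms(1)] assms(2) by eventually_elim simp
  then show ?thesis using assms(3) by (simp add: represents_def)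
qed

text \<open>The condition \<open>k 0 0 = 0\<close> keeps the composition equal to the extension by
  zero.\<close>

lemma represents_compose2:
  assumes "represents u' u" "represents v' v" "(\<lambda>x. k (u' x) (v' x)) \<in> borel_measurable borel" "k 0 0 = 0"
  shows "represents (\<lambda>x. k (u' x) (v' x)) (\<lambda>x. k (u x) (v x))"
proof -
  have "AE x in lborel. (if x \<in> \<Omega>1 then k (u x) (v x) else 0) = k (u' x) (v' x)"
    using representsD(3)[OF assms(1)] representsD(3)[OF assms(2)]
  proof eventually_elim
    case (elim x)
    then show ?case using assms(4) by (cases "x \<in> \<Omega>1") auto
  qed
  then show ?thesis using assms(3) by (simp add: represents_def)
qed

lemma represents_compose:
  assumes "represents u' u" "k \<in> borel_measurable borel" "k 0 = 0"
  shows "represents (\<lambda>x. k (u' x)) (\<lambda>x. k (u x))"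
  by (rule represents_compose2[OF assms(1) assms(1), of "\<lambda>a b. k a"])
     (use assms(2,3) representsD(1)[OF assms(1)] in measurable)

lemma represents_mult:
  fixes u' h :: "real^3 \<Rightarrow> real"
  assumes "represents u' u" "h \<in> borel_measurable borel"
  shows "represents (\<lambda>x. u' x * h x) (\<lambda>x. u x * h x)"
proof -
  have "AE x in lborel. (if x \<in> \<Omega>1 then u x * h x else 0) = u' x * h x"
    using representsD(3)[OF assms(1)] by eventually_elim (auto split: if_splits)
  then show ?thesis using assms(2) representsD(1)[OF assms(1)] by (simp add: represents_def)
qed

lemma represents_integral:
  assumes "represents f' f"
  shows "(\<integral>x. f x \<partial>lebesgue_on \<Omega>1) = (\<integral>x. f' x \<partial>lborel)"
    and "integrable (lebesgue_on \<Omega>1) f \<longleftrightarrow> integrable lborel f'"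
proof -
  have [measurable]: "f' \<in> borel_measurable lborel" "f' \<in> borel_measurable lebesgue" "(\<lambda>x. indicator \<Omega>1 x *\<^sub>R f x) \<in> borel_measurable lebesgue"
  proof -
    show m: "f' \<in> borel_measurable lborel" using representsD(1)[OF assms] by simp
    then show "f' \<in> borel_measurable lebesgue" by (rule measurable_completion)
    show "(\<lambda>x. indicator \<Omega>1 x *\<^sub>R f x) \<in> borel_measurable lebesgue"
      using borel_measurable_if_I[OF representsD(2)[OF assms] \<Omega>1_lebesgue(1)]
      by (simp add: indicator_def if_distrib[of "\<lambda>c. c *\<^sub>R _"] of_bool_def cong: if_cong)
  qed
  have "AE x in lborel. indicator \<Omega>1 x *\<^sub>R f x = f' x"
    using representsD(3)[OF assms] by eventually_elim (auto simp: indicator_def)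
  then have ae: "AE x in lebesgue. indicator \<Omega>1 x *\<^sub>R f x = f' x" by (rule AE_completion)
  have "(\<integral>x. f x \<partial>lebesgue_on \<Omega>1) = (\<integral>x. indicator \<Omega>1 x *\<^sub>R f x \<partial>lebesgue)"
    by (rule integral_restrict_space[OF \<Omega>1_lebesgue(2)])
  also have "\<dots> = (\<integral>x. f' x \<partial>lebesgue)" by (rule integral_cong_AE) (use ae in measurable)
  also have "\<dots> = (\<integral>x. f' x \<partial>lborel)" by (rule integral_completion) measurable
  finally show "(\<integral>x. f x \<partial>lebesgue_on \<Omega>1) = (\<integral>x. f' x \<partial>lborel)" .
  have "integrable (lebesgue_on \<Omega>1) f \<longleftrightarrow> integrable lebesgue (\<lambda>x. indicator \<Omega>1 x *\<^sub>R f x)"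
    by (rule integrable_restrict_space[OF \<Omega>1_lebesgue(2)])
  also have "\<dots> \<longleftrightarrow> integrable lebesgue f'" by (rule integrable_cong_AE) (use ae in measurable)
  also have "\<dots> \<longleftrightarrow> integrable lborel f'" by (rule integrable_completion) measurable
  finally show "integrable (lebesgue_on \<Omega>1) f \<longleftrightarrow> integrable lborel f'" .
qed

lemma represents_L2:
  assumes "represents u' u"
  shows "u \<in> Lp 2 \<Omega>1 \<longleftrightarrow> square_integrable lborel u'" "Lp_norm 2 \<Omega>1 u = l2norm lborel u'"
proof -
  have r: "represents (\<lambda>x. (norm (u' x))\<^sup>2) (\<lambda>x. (norm (u x))\<^sup>2)"
    by (rule represents_compose[OF assms, of "\<lambda>v. (norm v)\<^sup>2"]) simp_all
  show "u \<in> Lp 2 \<Omega>1 \<longleftrightarrow> square_integrable lborel u'"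
    using representsD(1,2)[OF assms] represents_integral(2)[OF r] by (simp add: Lp_def square_integrable_def)
  show "Lp_norm 2 \<Omega>1 u = l2norm lborel u'"
    using represents_integral(1)[OF r] by (simp add: Lp_norm_def l2norm_def powr_half_sqrt)
qed

section \<open>Weak gradients and the closure of the test functions\<close>

lemma is_weak_gradient_iff:
  assumes "represents u' u" "represents V' V"
  shows "is_weak_gradient \<Omega>1 u V \<longleftrightarrow> (\<forall>\<phi>\<in>test_functions \<Omega>1. \<forall>i.
    (\<integral>x. u' x * partial_deriv i \<phi> x \<partial>lborel) = - (\<integral>x. V' x $ i * \<phi> x \<partial>lborel))"
proof -
  have 1: "(\<integral>x. u x * partial_deriv i \<phi> x \<partial>lebesgue_on \<Omega>1) = (\<integral>x. u' x * partial_deriv i \<phi> x \<partial>lborel)"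
    if "\<phi> \<in> test_functions \<Omega>1" for \<phi> i
    by (rule represents_integral(1)[OF represents_mult[OF assms(1)]])
       (rule test_function_measurable(1)[OF test_functions_partial_deriv[OF that]])
  have 2: "(\<integral>x. V x $ i * \<phi> x \<partial>lebesgue_on \<Omega>1) = (\<integral>x. V' x $ i * \<phi> x \<partial>lborel)"
    if "\<phi> \<in> test_functions \<Omega>1" for \<phi> i
    by (rule represents_integral(1)[OF represents_mult[OF represents_compose[OF assms(2), of "\<lambda>v. v $ i"]]])
       (simp_all add: test_function_measurable(1)[OF that])
  show ?thesis unfolding is_weak_gradient_def by (simp add: 1 2)
qed

lemma square_integrable_nth:
  fixes V :: "'a \<Rightarrow> real^'n"
  assumes "square_integrable M V" shows "square_integrable M (\<lambda>x. V x $ i)"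
proof (rule square_integrable_bound(1)[OF assms])
  have "(\<lambda>v::real^'n. v $ i) \<in> borel_measurable borel" by simp
  from measurable_compose[OF square_integrable_measurable[OF assms] this] show "(\<lambda>x. V x $ i) \<in> borel_measurable M" .
qed (simp add: component_le_norm_cart)

lemma weak_gradient_unique:
  assumes u: "represents u' u" and V: "represents V' V" and W: "represents W' W"
    and sq: "square_integrable lborel V'" "square_integrable lborel W'"
    and wg: "is_weak_gradient \<Omega>1 u V" "is_weak_gradient \<Omega>1 u W"
  shows "AE x in lborel. V' x = W' x"
proof -
  have comp: "AE x in lborel. x \<in> \<Omega>1 \<longrightarrow> V' x $ i - W' x $ i = 0" for i
  proof (rule fundamental_lemma)
    note sqi = square_integrable_diff(1)[OF square_integrable_nth[OF sq(1), of i] square_integrable_nth[OF sq(2), of i]]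
    show "open \<Omega>1" by (simp add: \<Omega>1_def)
    show "(\<lambda>x. V' x $ i - W' x $ i) \<in> borel_measurable borel" using square_integrable_measurable[OF sqi] by simp
    have "square_integrable lborel (indicator \<Omega>1 :: real^3 \<Rightarrow> real)"
    proof -
      have "integrable lborel (indicator \<Omega>1 :: real^3 \<Rightarrow> real)"
        using emeasure_lborel_ball_finite[of "0::real^3" 1] by (intro integrable_real_indicator) (simp_all add: \<Omega>1_def)
      moreover have "(indicator \<Omega>1 x :: real)\<^sup>2 = indicator \<Omega>1 x" for x by (simp add: indicator_def)
      ultimately show ?thesis by (simp add: square_integrable_def)
    qed
    from square_integrable_mult[OF this sqi] show "integrable lborel (\<lambda>x. indicator \<Omega>1 x * (V' x $ i - W' x $ i))" .
    fix \<phi> assume \<phi>: "\<phi> \<in> test_functions \<Omega>1"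
    have "(\<integral>x. V' x $ i * \<phi> x \<partial>lborel) = (\<integral>x. W' x $ i * \<phi> x \<partial>lborel)"
      using wg \<phi> unfolding is_weak_gradient_iff[OF u V] is_weak_gradient_iff[OF u W] by force
    then show "(\<integral>x. (V' x $ i - W' x $ i) * \<phi> x \<partial>lborel) = 0"
      using square_integrable_mult[OF square_integrable_nth[OF sq(1), of i] test_function_square_integrable(1)[OF \<phi>]]
        square_integrable_mult[OF square_integrable_nth[OF sq(2), of i] test_function_square_integrable(1)[OF \<phi>]]
      by (simp add: left_diff_distrib)
  qed
  have "AE x in lborel. \<forall>i\<in>UNIV. x \<in> \<Omega>1 \<longrightarrow> V' x $ i - W' x $ i = 0"
    using comp by (subst AE_finite_all) auto
  then show ?thesis using representsD(5)[OF V] representsD(5)[OF W]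
    by eventually_elim (auto simp: vec_eq_iff)
qed

text \<open>\<open>weak_gradient\<close> is some weak gradient chosen by \<open>SOME\<close>;
  uniqueness almost everywhere lets any known one represent it.\<close>

lemma represents_weak_gradient:
  assumes u: "represents u' u" and V: "represents V' V" and sq: "square_integrable lborel V'"
    and wg: "is_weak_gradient \<Omega>1 u V"
  shows "represents V' (weak_gradient \<Omega>1 u)"
proof -
  have "V \<in> Lp 2 \<Omega>1" using sq represents_L2(1)[OF V] by simp
  then have W: "weak_gradient \<Omega>1 u \<in> Lp 2 \<Omega>1" "is_weak_gradient \<Omega>1 u (weak_gradient \<Omega>1 u)"
    using someI[of "\<lambda>V. V \<in> Lp 2 \<Omega>1 \<and> is_weak_gradient \<Omega>1 u V" V] wg by (auto simp: weak_gradient_def)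
  obtain W' where W': "represents W' (weak_gradient \<Omega>1 u)"
    by (rule represents_exists[of "weak_gradient \<Omega>1 u"]) (use W(1) in \<open>auto simp: Lp_def\<close>)
  have "square_integrable lborel W'" using W(1) represents_L2(1)[OF W'] by simp
  from weak_gradient_unique[OF u W' V this sq W(2) wg]
  show ?thesis by (rule represents_cong_AE[OF W']) (rule representsD(1)[OF V])
qed

lemma h0_represents:
  assumes "h0 u V" shows "represents u u" "represents V V"
proof -
  show "represents u u" by (rule represents_self) (use h0D(3,6)[OF assms] in \<open>auto simp: \<Omega>1_def\<close>)
  show "represents V V"
  proof (rule represents_self)
    show "AE x in lborel. x \<notin> \<Omega>1 \<longrightarrow> V x = 0" using h0_pair_AE_outside[OF h0D(1)[OF assms]] by eventually_elim simp
  qed (rule h0D(7)[OF assms])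
qed

lemma h0_weak_gradient:
  assumes h: "h0 u' V'" and u: "represents u' u"
  shows "represents V' (weak_gradient \<Omega>1 u)" "u \<in> H1 \<Omega>1"
proof -
  note V = h0_represents(2)[OF h]
  have wg: "is_weak_gradient \<Omega>1 u V'"
    unfolding is_weak_gradient_iff[OF u V] using h0_pair_by_parts[OF h0D(1)[OF h]] by blast
  show "represents V' (weak_gradient \<Omega>1 u)" by (rule represents_weak_gradient[OF u V h0D(5)[OF h] wg])
  show "u \<in> H1 \<Omega>1"
    using wg h0D(4,5)[OF h] represents_L2(1)[OF u] represents_L2(1)[OF V] by (auto simp: H1_def)
qed

lemma H1_norm_eq:
  assumes "represents u' u" "represents V' (weak_gradient \<Omega>1 u)"
  shows "H1_norm \<Omega>1 u = sqrt ((l2norm lborel u')\<^sup>2 + (l2norm lborel V')\<^sup>2)"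
  by (simp add: H1_norm_def represents_L2(2)[OF assms(1)] represents_L2(2)[OF assms(2)])

lemma represents_diff:
  assumes "represents u' u" "represents v' v"
  shows "represents (\<lambda>x. u' x - v' x) (\<lambda>x. u x - v x)"
  by (rule represents_compose2[OF assms, of "(-)"]) (use representsD(1)[OF assms(1)] representsD(1)[OF assms(2)] in measurable)

text \<open>With \<open>H10_represents\<close> this identifies \<open>H10\<close> with the pairs in
  \<open>h0\<close> up to representatives, so the theorem can be proved for pairs.\<close>

lemma h0_in_H10:
  assumes h: "h0 u' V'" and u: "represents u' u"
  shows "u \<in> H10 \<Omega>1"
  unfolding H10_def
proof (intro CollectI conjI allI impI h0_weak_gradient(2)[OF h u])
  fix \<epsilon> :: real assume "0 < \<epsilon>"
  then have "0 < \<epsilon> / 2" by simp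
  then obtain \<phi> where \<phi>: "\<phi> \<in> test_functions \<Omega>1" "l2norm lborel (\<lambda>x. \<phi> x - u' x) < \<epsilon> / 2" "l2norm lborel (\<lambda>x. grad \<phi> x - V' x) < \<epsilon> / 2"
    using h0D(1)[OF h] unfolding h0_pair_def by blast
  note \<phi>h = h0_test_function[OF \<phi>(1)]
  have r: "represents (\<lambda>x. u' x - \<phi> x) (\<lambda>x. u x - \<phi> x)" by (rule represents_diff[OF u h0_represents(1)[OF \<phi>h]])
  have "h0 (\<lambda>x. u' x - \<phi> x) (\<lambda>x. V' x - grad \<phi> x)" using h0_linear_comb[OF h \<phi>h, of 1 "-1"] by simp
  note h0_weak_gradient(1)[OF this r]
  then have "H1_norm \<Omega>1 (\<lambda>x. u x - \<phi> x) \<le> l2norm lborel (\<lambda>x. u' x - \<phi> x) + l2norm lborel (\<lambda>x. V' x - grad \<phi> x)"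
    by (simp add: H1_norm_eq[OF r] sqrt_sum_squares_le_sum)
  also have "\<dots> < \<epsilon>" using \<phi>(2,3) by (simp add: l2norm_minus_commute[of lborel u' \<phi>] l2norm_minus_commute[of lborel V' "grad \<phi>"])
  finally show "\<exists>\<phi>\<in>test_functions \<Omega>1. H1_norm \<Omega>1 (\<lambda>x. u x - \<phi> x) < \<epsilon>" using \<phi>(1) by blast
qed

text \<open>Density in \<open>H10\<close> is measured with the weak gradient of
  \<open>u - \<phi>\<close>; by linearity of the weak formulation and uniqueness this is represented
  by \<open>V' - grad \<phi>\<close>, which gives the simultaneous approximation demanded by
  \<open>h0_pair\<close>.\<close>

lemma H10_represents:
  assumes "u \<in> H10 \<Omega>1"
  obtains u' V' where "h0 u' V'" "represents u' u" "represents V' (weak_gradient \<Omega>1 u)"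
proof -
  let ?W = "weak_gradient \<Omega>1 u"
  have uL: "u \<in> Lp 2 \<Omega>1" and ex: "\<exists>V\<in>Lp 2 \<Omega>1. is_weak_gradient \<Omega>1 u V"
    and dense: "\<And>\<epsilon>. 0 < \<epsilon> \<Longrightarrow> \<exists>\<phi>\<in>test_functions \<Omega>1. H1_norm \<Omega>1 (\<lambda>x. u x - \<phi> x) < \<epsilon>"
    using assms by (auto simp: H10_def H1_def)
  have W: "?W \<in> Lp 2 \<Omega>1" "is_weak_gradient \<Omega>1 u ?W"
    using someI_ex[of "\<lambda>V. V \<in> Lp 2 \<Omega>1 \<and> is_weak_gradient \<Omega>1 u V"] ex by (auto simp: weak_gradient_def)
  obtain w where w: "represents w u" by (rule represents_exists[of u]) (use uL in \<open>auto simp: Lp_def\<close>)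
  obtain V' where V': "represents V' ?W" by (rule represents_exists[of ?W]) (use W(1) in \<open>auto simp: Lp_def\<close>)
  define u' where "u' x = indicator \<Omega>1 x * w x" for x
  have [measurable]: "w \<in> borel_measurable borel" by (rule representsD(1)[OF w])
  have u': "represents u' u"
  proof (rule represents_cong_AE[OF w])
    show "AE x in lborel. w x = u' x" using representsD(5)[OF w] by eventually_elim (auto simp: u'_def indicator_def)
    show "u' \<in> borel_measurable borel" unfolding u'_def[abs_def] by measurable
  qed
  have sq: "square_integrable lborel u'" "square_integrable lborel V'"
    using uL W(1) represents_L2(1)[OF u'] represents_L2(1)[OF V'] by auto
  have "h0_pair \<Omega>1 u' V'"
    unfolding h0_pair_def
  proof (intro conjI sq allI impI)
    fix e :: real assume "0 < e"
    then obtain \<phi> where \<phi>: "\<phi> \<in> test_functions \<Omega>1" "H1_norm \<Omega>1 (\<lambda>x. u x - \<phi> x) < e" using dense by blast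
    note \<phi>h = h0_test_function[OF \<phi>(1)]
    note r = represents_diff[OF u' h0_represents(1)[OF \<phi>h]] and R = represents_diff[OF V' h0_represents(2)[OF \<phi>h]]
    have "is_weak_gradient \<Omega>1 (\<lambda>x. u x - \<phi> x) (\<lambda>x. ?W x - grad \<phi> x)"
      unfolding is_weak_gradient_iff[OF r R]
    proof (intro ballI allI)
      fix \<psi> i assume \<psi>: "\<psi> \<in> test_functions \<Omega>1"
      note sqp = test_function_square_integrable(1)[OF \<psi>] test_function_square_integrable(1)[OF test_functions_partial_deriv[OF \<psi>, of i]]
      have "(\<integral>x. u' x * partial_deriv i \<psi> x \<partial>lborel) = - (\<integral>x. V' x $ i * \<psi> x \<partial>lborel)"
        using W(2) \<psi> unfolding is_weak_gradient_iff[OF u' V'] by blast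
      moreover have "(\<integral>x. \<phi> x * partial_deriv i \<psi> x \<partial>lborel) = - (\<integral>x. grad \<phi> x $ i * \<psi> x \<partial>lborel)"
        by (rule h0_pair_by_parts[OF h0D(1)[OF \<phi>h] \<psi>])
      ultimately show "(\<integral>x. (u' x - \<phi> x) * partial_deriv i \<psi> x \<partial>lborel) = - (\<integral>x. (V' x - grad \<phi> x) $ i * \<psi> x \<partial>lborel)"
        using square_integrable_mult[OF sq(1) sqp(2)] square_integrable_mult[OF h0D(4)[OF \<phi>h] sqp(2)]
          square_integrable_mult[OF square_integrable_nth[OF sq(2), of i] sqp(1)]
          square_integrable_mult[OF square_integrable_nth[OF h0D(5)[OF \<phi>h], of i] sqp(1)]
        by (simp add: left_diff_distrib del: grad_nth)
    qed
    from represents_weak_gradient[OF r R square_integrable_diff(1)[OF sq(2) h0D(5)[OF \<phi>h]] this]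
    have "sqrt ((l2norm lborel (\<lambda>x. u' x - \<phi> x))\<^sup>2 + (l2norm lborel (\<lambda>x. V' x - grad \<phi> x))\<^sup>2) < e"
      using \<phi>(2) by (simp add: H1_norm_eq[OF r])
    then have "l2norm lborel (\<lambda>x. u' x - \<phi> x) < e" "l2norm lborel (\<lambda>x. V' x - grad \<phi> x) < e"
      using real_sqrt_sum_squares_ge1 real_sqrt_sum_squares_ge2 by (blast intro: le_less_trans)+
    then show "\<exists>\<phi>\<in>test_functions \<Omega>1. l2norm lborel (\<lambda>x. \<phi> x - u' x) < e \<and> l2norm lborel (\<lambda>x. grad \<phi> x - V' x) < e"
      using \<phi>(1) by (auto simp: l2norm_minus_commute[of lborel u'] l2norm_minus_commute[of lborel V'])
  qed
  then have "h0 u' V'" by (simp add: h0_def u'_def)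
  then show thesis by (rule that[OF _ u' V'])
qed

section \<open>Translation of the energy, the extended integral and the norms; conclusion\<close>

lemma powr_le_1_plus_power:
  fixes x q :: real
  assumes "0 \<le> x" "0 \<le> q" "q \<le> real n"
  shows "x powr q \<le> 1 + x ^ n"
proof (cases "x \<le> 1")
  case True
  then have "x powr q \<le> 1" using assms by (intro powr_le1) auto
  then show ?thesis using zero_le_power[OF assms(1), of n] by linarith
next
  case False
  then have "x powr q \<le> x powr real n" using assms by (intro powr_mono) auto
  also have "\<dots> = x ^ n" using False by (intro powr_realpow) simp
  finally show ?thesis by simp
qed

lemma represents_energy:
  assumes "nonlinearity g C" "represents u' u" "represents V' (weak_gradient \<Omega>1 u)"
  shows "energy \<Omega>1 g u = nonlinearity.E g u' V'"
proof -
  interpret nonlinearity g C by (rule assms(1))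
  have "(\<integral>x. (norm (weak_gradient \<Omega>1 u x))\<^sup>2 \<partial>lebesgue_on \<Omega>1) = (l2norm lborel V')\<^sup>2"
    unfolding l2norm_power2 by (rule represents_integral(1)[OF represents_compose[OF assms(3), of "\<lambda>v. (norm v)\<^sup>2"]]) simp_all
  moreover have "(\<integral>x. G (u x) \<partial>lebesgue_on \<Omega>1) = (\<integral>x. G (u' x) \<partial>lborel)"
    by (rule represents_integral(1)[OF represents_compose[OF assms(2), of G]]) simp_all
  ultimately show ?thesis by (simp add: energy_def E_def)
qed

lemma nn_integral_lebesgue_on_\<Omega>1:
  assumes "AE x in lborel. (if x \<in> \<Omega>1 then f x else 0) = f' x"
  shows "(\<integral>\<^sup>+x. f x \<partial>lebesgue_on \<Omega>1) = (\<integral>\<^sup>+x. f' x \<partial>lborel)"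
proof -
  have "(\<integral>\<^sup>+x. f x \<partial>lebesgue_on \<Omega>1) = (\<integral>\<^sup>+x. f x * indicator \<Omega>1 x \<partial>lborel)"
    by (simp add: nn_integral_restrict_space[OF \<Omega>1_lebesgue(2)] nn_integral_completion)
  also have "\<dots> = (\<integral>\<^sup>+x. f' x \<partial>lborel)"
  proof (rule nn_integral_cong_AE)
    show "AE x in lborel. f x * indicator \<Omega>1 x = f' x" using assms by eventually_elim (auto simp: indicator_def)
  qed
  finally show ?thesis .
qed

text \<open>Outside the ball \<open>w'\<close> vanishes almost everywhere, and the integrand is 0
  there even if \<open>k\<close> is infinite, since infinity times 0 is 0 in
  \<open>ereal\<close>.\<close>

lemma ext_integral_lebesgue_on_\<Omega>1:
  assumes "h0 u U" "represents w' w"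
  shows "ext_integral (lebesgue_on \<Omega>1) (\<lambda>x. k (u x) * ereal ((w x)\<^sup>2)) = ext_integral lborel (\<lambda>x. k (u x) * ereal ((w' x)\<^sup>2))"
proof -
  have "AE x in lborel. (if x \<in> \<Omega>1 then e2ennreal (k (u x) * ereal ((w x)\<^sup>2)) else 0) = e2ennreal (k (u x) * ereal ((w' x)\<^sup>2))"
    "AE x in lborel. (if x \<in> \<Omega>1 then e2ennreal (- (k (u x) * ereal ((w x)\<^sup>2))) else 0) = e2ennreal (- (k (u x) * ereal ((w' x)\<^sup>2)))"
    using representsD(3)[OF assms(2)] by (eventually_elim; auto simp: e2ennreal_neg simp flip: zero_ereal_def split: if_splits; fail)+
  then show ?thesis by (simp add: ext_integral_def nn_integral_lebesgue_on_\<Omega>1)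
qed

lemma represents_zero_Lp:
  assumes "represents (\<lambda>x. 0) f" shows "f \<in> Lp p \<Omega>1" "Lp_norm p \<Omega>1 f = 0"
proof -
  have "represents (\<lambda>x. norm (0 :: 'a) powr p) (\<lambda>x. norm (f x) powr p)"
    by (rule represents_compose[OF assms, of "\<lambda>v. norm v powr p"]) simp_all
  from represents_integral[OF this] representsD(2)[OF assms]
  show "f \<in> Lp p \<Omega>1" "Lp_norm p \<Omega>1 f = 0" by (simp_all add: Lp_def Lp_norm_def)
qed

lemma zero_functional: "(\<lambda>_. 0) \<in> H_minus1 \<Omega>1" "H_minus1_norm \<Omega>1 (\<lambda>_. 0) = 0"
proof -
  show "(\<lambda>_. 0) \<in> H_minus1 \<Omega>1" by (auto simp: H_minus1_def intro!: exI[of _ 0])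
  have h: "h0 (\<lambda>x. 0) (\<lambda>x. 0)" by (simp add: h0_def h0_pair_zero)
  note r = h0_represents(1)[OF h]
  have "H1_norm \<Omega>1 (\<lambda>x. 0) = 0" by (simp add: H1_norm_eq[OF r h0_weak_gradient(1)[OF h r]])
  then have "(\<lambda>x. 0) \<in> {u \<in> H10 \<Omega>1. H1_norm \<Omega>1 u \<le> 1}" using h0_in_H10[OF h r] by simp
  \<comment> \<open>The supremum of an empty set of reals is unspecified, so the unit ball of
    \<open>H10\<close> must be seen to be nonempty.\<close>
  then have "{u \<in> H10 \<Omega>1. H1_norm \<Omega>1 u \<le> 1} \<noteq> {}" by blast
  then show "H_minus1_norm \<Omega>1 (\<lambda>_. 0) = 0" unfolding H_minus1_norm_def by simp
qed

theorem theorem3p3: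
  fixes \<Omega> :: "(real^3) set"
    and g :: "real \<Rightarrow> real"
    and a1 a2 b p :: real
  assumes \<Omega>: "\<Omega> = ball 0 1"
    and cont: "continuous_on UNIV g"
    and p: "2 < p" "p \<le> 6"
    and growth: "\<And>s. \<bar>g s\<bar> \<le> a1 + b * \<bar>s\<bar> powr (p - 1)"
    and odd: "\<And>s. g (- s) = - g s"
    and one_sided: "\<And>s t. (g s - g t) * (s - t)
      \<ge> - (a2 + b * \<bar>s\<bar> powr (p - 2) + b * \<bar>t\<bar> powr (p - 2)) * (s - t)\<^sup>2"
    and bounded_below: "bdd_below (energy \<Omega> g ` H10 \<Omega>)"
    and bounded_minimizing: "\<exists>v. minimizing_sequence (energy \<Omega> g) (H10 \<Omega>) v \<and>
      (\<exists>C. \<forall>h. H1_norm \<Omega> (v h) \<le> C)"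
  shows "\<exists>(u :: nat \<Rightarrow> real^3 \<Rightarrow> real) (\<psi> :: nat \<Rightarrow> (real^3 \<Rightarrow> real) \<Rightarrow> real).
    minimizing_sequence (energy \<Omega> g) (H10 \<Omega>) u \<and>
    (\<forall>h. \<psi> h \<in> H_minus1 \<Omega>) \<and>
    (\<forall>h. (\<lambda>x. u h x - schwarz_symm \<Omega> (u h) x) \<in> Lp 2 \<Omega> \<inter> Lp 6 \<Omega>) \<and>
    (\<lambda>h. Lp_norm 2 \<Omega> (\<lambda>x. u h x - schwarz_symm \<Omega> (u h) x)
       + Lp_norm 6 \<Omega> (\<lambda>x. u h x - schwarz_symm \<Omega> (u h) x)) \<longlonglongrightarrow> 0 \<and>
    (\<forall>h. \<forall>\<phi>\<in>H10 \<Omega>.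
       (\<integral>x. weak_gradient \<Omega> (u h) x \<bullet> weak_gradient \<Omega> \<phi> x \<partial>lebesgue_on \<Omega>)
       = (\<integral>x. g (u h x) * \<phi> x \<partial>lebesgue_on \<Omega>) + \<psi> h \<phi>) \<and>
    (\<lambda>h. H_minus1_norm \<Omega> (\<psi> h)) \<longlonglongrightarrow> 0 \<and>
    (\<forall>w\<in>H10 \<Omega>.
       liminf (\<lambda>h. ereal (\<integral>x. (norm (weak_gradient \<Omega> w x))\<^sup>2 \<partial>lebesgue_on \<Omega>)
         - ext_integral (lebesgue_on \<Omega>) (\<lambda>x. lower_deriv g (u h x) * ereal ((w x)\<^sup>2))) \<ge> 0)"
proof -
  \<comment> \<open>The coefficient 2 of \<open>\<bar>b\<bar>\<close> is needed because
    \<open>b\<close> occurs twice in the one-sided condition and each power is bounded by 1 plus a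
    higher one.\<close>
  define C where "C = \<bar>a1\<bar> + \<bar>a2\<bar> + 2 * \<bar>b\<bar>"
  have pw: "c * \<bar>s\<bar> powr q \<le> \<bar>c\<bar> * (1 + \<bar>s\<bar> ^ n)" if "0 \<le> q" "q \<le> real n" for c s q :: real and n
  proof -
    have "c * \<bar>s\<bar> powr q \<le> \<bar>c\<bar> * \<bar>s\<bar> powr q" by (rule mult_right_mono) auto
    also have "\<dots> \<le> \<bar>c\<bar> * (1 + \<bar>s\<bar> ^ n)" by (rule mult_left_mono) (use that in \<open>auto intro: powr_le_1_plus_power\<close>)
    finally show ?thesis .
  qed
  have nl: "nonlinearity g C"
  proof
    fix s t :: real
    have ineq: "\<bar>a1\<bar> * 1 + \<bar>b\<bar> * (1 + X) \<le> C * (1 + X)" "\<bar>a2\<bar> * 1 + \<bar>b\<bar> * (1 + X) + \<bar>b\<bar> * (1 + Y) \<le> C * (1 + X + Y)"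
      if "0 \<le> X" "0 \<le> Y" for X Y :: real
      using that unfolding C_def by (simp_all add: distrib_left distrib_right)
    have "\<bar>g s\<bar> \<le> \<bar>a1\<bar> * 1 + \<bar>b\<bar> * (1 + \<bar>s\<bar> ^ 5)" using growth[of s] pw[of "p - 1" 5 b s] p by simp
    also have "\<dots> \<le> C * (1 + \<bar>s\<bar> ^ 5)" by (rule ineq(1)[of _ 0]) simp_all
    finally show "\<bar>g s\<bar> \<le> C * (1 + \<bar>s\<bar> ^ 5)" .
    have "a2 + b * \<bar>s\<bar> powr (p - 2) + b * \<bar>t\<bar> powr (p - 2) \<le> \<bar>a2\<bar> * 1 + \<bar>b\<bar> * (1 + \<bar>s\<bar> ^ 4) + \<bar>b\<bar> * (1 + \<bar>t\<bar> ^ 4)"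
      using pw[of "p - 2" 4 b s] pw[of "p - 2" 4 b t] p abs_ge_self[of a2] by simp
    also have "\<dots> \<le> C * (1 + \<bar>s\<bar> ^ 4 + \<bar>t\<bar> ^ 4)" by (rule ineq(2)) simp_all
    finally have "(a2 + b * \<bar>s\<bar> powr (p - 2) + b * \<bar>t\<bar> powr (p - 2)) * (s - t)\<^sup>2 \<le> (C * (1 + \<bar>s\<bar> ^ 4 + \<bar>t\<bar> ^ 4)) * (s - t)\<^sup>2"
      by (rule mult_right_mono) simp
    then show "(g s - g t) * (s - t) \<ge> - (C * (1 + \<bar>s\<bar> ^ 4 + \<bar>t\<bar> ^ 4)) * (s - t)\<^sup>2"
      using one_sided[of s t] by (simp only: mult_minus_left)
  qed (rule cont odd)+
  interpret nonlinearity g C by (rule nl)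
  have \<Omega>1: "\<Omega> = \<Omega>1" by (simp add: \<Omega> \<Omega>1_def)
  define m where "m = (INF v\<in>H10 \<Omega>1. energy \<Omega>1 g v)"
  have en: "energy \<Omega>1 g u = E u' V'" if "represents u' u" "represents V' (weak_gradient \<Omega>1 u)" for u u' V'
    by (rule represents_energy[OF nl that])
  have enh: "energy \<Omega>1 g u = E u V" "u \<in> H10 \<Omega>1" if "h0 u V" for u V
    using en[OF h0_represents(1)[OF that] h0_weak_gradient(1)[OF that h0_represents(1)[OF that]]]
      h0_in_H10[OF that h0_represents(1)[OF that]] by auto
  \<comment> \<open>The infimum over \<open>H10\<close> also bounds the energy of every pair in
    \<open>h0\<close>, by the identification of the two spaces.\<close>
  have bdd: "m \<le> E u V" if "h0 u V" for u V
    unfolding m_def enh(1)[OF that, symmetric] by (rule cINF_lower) (use bounded_below enh(2)[OF that] \<Omega>1 in auto)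
  obtain v A where v: "\<And>h. v h \<in> H10 \<Omega>1" "(\<lambda>h. energy \<Omega>1 g (v h)) \<longlonglongrightarrow> m" "\<And>h. H1_norm \<Omega>1 (v h) \<le> A"
    using bounded_minimizing unfolding minimizing_sequence_def \<Omega>1 m_def by blast
  have "\<exists>v' V'. h0 v' V' \<and> represents v' (v h) \<and> represents V' (weak_gradient \<Omega>1 (v h))" for h
    using H10_represents[OF v(1)[of h]] by blast
  then obtain v' V' where v': "\<And>h. h0 (v' h) (V' h)" "\<And>h. represents (v' h) (v h)" "\<And>h. represents (V' h) (weak_gradient \<Omega>1 (v h))"
    by metis
  have A: "l2norm lborel (V' h) \<le> A" for h
    using v(3)[of h] unfolding H1_norm_eq[OF v'(2,3)] by (rule order_trans[OF real_sqrt_sum_squares_ge2])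
  have lim: "(\<lambda>h. E (v' h) (V' h)) \<longlonglongrightarrow> m" using v(2) by (simp add: en[OF v'(2,3)])
  obtain u U where u: "h0 u U" "E u U = m" "\<And>x. 0 \<le> u x"
    "\<And>n c. norm n = 1 \<Longrightarrow> 0 < c \<Longrightarrow> AE x in lborel. polar n c u x = u x"
    by (rule symmetric_minimizer[OF bdd v'(1) A lim]) (assumption | rule that)+
  have min: "E u U \<le> E w W" if "h0 w W" for w W using bdd[OF that] u(2) by simp
  obtain N where "N \<in> null_sets lborel" "\<And>x y. x \<notin> N \<Longrightarrow> y \<notin> N \<Longrightarrow> norm x < norm y \<Longrightarrow> u y \<le> u x"
    by (rule radially_decreasing_AE[OF u(1,4)]) (assumption | rule that)+
  then have "AE x in lborel. x \<in> \<Omega>1 \<longrightarrow> schwarz_symm \<Omega>1 u x = u x"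
    by (intro schwarz_symm_eq_AE[OF h0D(6)[OF u(1)] u(3)]) (use h0D(3)[OF u(1)] \<Omega>1_def in auto)
  then have sym: "represents (\<lambda>x. 0) (\<lambda>x. u x - schwarz_symm \<Omega>1 u x)"
    unfolding represents_def by (auto elim: AE_mp)
  note ru = h0_represents(1)[OF u(1)] and rU = h0_weak_gradient(1)[OF u(1) h0_represents(1)[OF u(1)]]
  have el: "(\<integral>x. weak_gradient \<Omega>1 u x \<bullet> weak_gradient \<Omega>1 \<phi> x \<partial>lebesgue_on \<Omega>1) = (\<integral>x. g (u x) * \<phi> x \<partial>lebesgue_on \<Omega>1)"
    if \<phi>H: "\<phi> \<in> H10 \<Omega>1" for \<phi>
  proof -
    obtain \<phi>' \<Phi> where \<phi>: "h0 \<phi>' \<Phi>" "represents \<phi>' \<phi>" "represents \<Phi> (weak_gradient \<Omega>1 \<phi>)"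
      by (rule H10_represents[OF \<phi>H])
    have [measurable]: "u \<in> borel_measurable borel" "U \<in> borel_measurable borel" "\<phi>' \<in> borel_measurable borel" "\<Phi> \<in> borel_measurable borel"
      by (rule h0D[OF u(1)] h0D[OF \<phi>(1)])+
    have r1: "represents (\<lambda>x. U x \<bullet> \<Phi> x) (\<lambda>x. weak_gradient \<Omega>1 u x \<bullet> weak_gradient \<Omega>1 \<phi> x)"
      by (rule represents_compose2[OF rU \<phi>(3), of "(\<bullet>)"]) simp_all
    have r2: "represents (\<lambda>x. g (u x) * \<phi>' x) (\<lambda>x. g (u x) * \<phi> x)"
      by (rule represents_compose2[OF ru \<phi>(2), of "\<lambda>a b. g a * b"]) simp_all
    from represents_integral(1)[OF r1] represents_integral(1)[OF r2]
    show ?thesis using euler_lagrange[OF u(1) \<phi>(1) min] by simp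
  qed
  have so: "0 \<le> ereal (\<integral>x. (norm (weak_gradient \<Omega>1 w x))\<^sup>2 \<partial>lebesgue_on \<Omega>1)
      - ext_integral (lebesgue_on \<Omega>1) (\<lambda>x. lower_deriv g (u x) * ereal ((w x)\<^sup>2))" if wH: "w \<in> H10 \<Omega>1" for w
  proof -
    obtain w' W where w: "h0 w' W" "represents w' w" "represents W (weak_gradient \<Omega>1 w)"
      by (rule H10_represents[OF wH])
    have "(\<integral>x. (norm (weak_gradient \<Omega>1 w x))\<^sup>2 \<partial>lebesgue_on \<Omega>1) = (l2norm lborel W)\<^sup>2"
      unfolding l2norm_power2 by (rule represents_integral(1)[OF represents_compose[OF w(3), of "\<lambda>v. (norm v)\<^sup>2"]]) simp_all
    then show ?thesis using second_variation[OF u(1) w(1) min]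
      by (simp only: ext_integral_lebesgue_on_\<Omega>1[OF u(1) w(2)])
  qed
  show ?thesis
    unfolding \<Omega>1
  proof (rule exI[of _ "\<lambda>_. u"], rule exI[of _ "\<lambda>_ _. 0"], intro conjI allI ballI)
    show "minimizing_sequence (energy \<Omega>1 g) (H10 \<Omega>1) (\<lambda>_. u)"
      unfolding minimizing_sequence_def m_def[symmetric] using enh[OF u(1)] u(2) by simp
  qed (simp_all add: zero_functional represents_zero_Lp[OF sym] el so Liminf_const)
qed

end
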